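(* Let $\mathcal P^0$ be a Markov semigroup on $\mathsf A$ with weak*-generator $\tau$, and suppose that $\mathcal P^0$ is realised as the (vacuum) expectation semigroup of a QS flow $j$ on $\mathsf A$, that is, $\mathcal P^0_t=\mathbb E\circ j_t$ for all $t\in\mathbb R_+$. Let $\theta=\begin{bmatrix}\mathcal L&\delta^\dagger\\ \delta&\pi-\iota\end{bmatrix}$ be the ultraweak stochastic derivative of $j$ (so that $\mathcal L\subset\tau$), where $\iota(x)=I_{\mathsf k}\otimes x$. Let $l_1,l_2\in|\mathsf k\rangle\,\overline\otimes\,\mathsf A$ and $k_1,k_2\in\mathsf A$. Then there is an ultraweakly continuous normal completely quasicontractive semigroup $\mathcal P$ on $\mathsf A$ whose weak*-generator is an extension of the operator with domain $\operatorname{Dom}\theta$ given by $$x\mapsto \mathcal L(x)+l_1^*\delta(x)+l_1^*\pi(x)l_2+\delta^\dagger(x)l_2+k_1^*x+xk_2 .$$ Moreover, $\mathcal P$ is (a) contractive if $k_1^*+k_1+l_1^*l_1\le 0$ and $k_2^*+k_2+l_2^*l_2\le 0$; (b) unital if $k_1^*+l_1^*l_2+k_2=0$; (c) completely positive if $l_1=l_2$ and $k_1=k_2$.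
   Context: All Hilbert spaces are complex, with inner products linear in the second argument. $\mathsf A$ is a von Neumann algebra acting faithfully on a Hilbert space $\mathfrak h$; $\mathsf k$ is a Hilbert space and $\widehat{\mathsf k}:=\mathbb C\oplus\mathsf k$. $\underline\otimes$ and $\overline\otimes$ denote algebraic and ultraweak tensor products; $|\mathsf k\rangle:=B(\mathbb C;\mathsf k)$, $\langle\mathsf k|:=B(\mathsf k;\mathbb C)$. Via $\widehat{\mathsf k}\otimes\mathfrak h=\mathfrak h\oplus(\mathsf k\otimes\mathfrak h)$, elements of $B(\widehat{\mathsf k})\,\overline\otimes\,\mathsf A$ are block matrices $\begin{bmatrix}k&m\\ l&n\end{bmatrix}$ with $k\in\mathsf A$, $l\in|\mathsf k\rangle\overline\otimes\mathsf A$, $m\in\langle\mathsf k|\overline\otimes\mathsf A$, $n\in B(\mathsf k)\overline\otimes\mathsf A$. Fock space: for a subinterval $J$ of $\mathbb R_+$, $\mathcal F_J$ is the symmetric Fock space over $L^2(J;\mathsf k)$, $\mathsf N_J:=B(\mathcal F_J)$, $I_J$ is the identity on $\mathcal F_J$; subscripts are omitted for $J=\mathbb R_+$; $\mathcal F=\mathcal F_{[0,t[}\otimes\mathcal F_{[t,\infty[}$. $\mathbb S$ is the space of right-continuous step functions in $L^2(\mathbb R_+;\mathsf k)$; $f_J$ equals $f$ on $J$ and $0$ elsewhere (similarly $c_J$ for a constant $c$); $\varpi(f):=e^{-\|f\|^2/2}\big((n!)^{-1/2}f^{\otimes n}\big)_{n\ge0}$; $\mathcal E$ is the linear span of $\{\varpi(f):f\in\mathbb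 S\}$. $E_u$ denotes $|u\rangle$ tensored with identity operators (e.g. $E_{\varpi(f)}:\mathfrak h\to\mathfrak h\otimes\mathcal F$, $v\mapsto v\otimes\varpi(f)$) and $E^u:=(E_u)^*$. Vacuum expectation: $\mathbb E(T):=E^{\varpi(0)}TE_{\varpi(0)}$ for $T\in\mathsf A\overline\otimes\mathsf N$. Processes: an (operator) process is a family $X=(X_t)_{t\ge0}$ of operators on $\mathfrak h\otimes\mathcal F$ with domain $\mathfrak h\underline\otimes\mathcal E$ that is weakly measurable in $t$ and adapted: $E^{\varpi(f)}X_tE_{\varpi(g)}=\langle\varpi(f_{[t,\infty[}),\varpi(g_{[t,\infty[})\rangle E^{\varpi(f_{[0,t[})}X_tE_{\varpi(g_{[0,t[})}$ for $f,g\in\mathbb S$; it is a process in $\mathsf A$ if $E^{\varpi(f)}X_tE_{\varpi(g)}\in\mathsf A$ for all $f,g,t$. A process on $\mathsf A$ is a family $k=(k_t)_{t\ge0}$ of linear maps on $\mathsf A$ with $(k_t(a))_{t\ge0}$ a process in $\mathsf A$ for each $a$. If $k$ is normal and completely bounded (i.e. each $k_t$ is), then $k_r(a)=k_{r)}(a)\otimes I_{[r,\infty[}$ with $k_{r)}:\mathsf A\to\mathsf A\overline\otimes\mathsf N_{[0,r[}$; put $\widehat k_r:=k_{r)}\overline\otimes\operatorname{id}_{\mathsf N_{[r,\infty[}}$. Let $T_r:\mathcal F\to\mathcal F_{[r,\infty[}$ be the unitary with $\varpi(f)\mapsto\varpi(f_r)$, $f_r(s)=f(s-r)$, and $\sigma_r:\mathsf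 A\overline\otimes\mathsf N\to\mathsf A\overline\otimes\mathsf N_{[r,\infty[}$ the normal *-isomorphism with $a\otimes z\mapsto a\otimes T_rzT_r^*$. $k$ is a QS cocycle if $k_0(a)=a\otimes I_{\mathcal F}$ and $k_{r+t}=\widehat k_r\circ\sigma_r\circ k_t$ for all $r,t\ge0$; it is a QS flow if moreover it is pointwise ultraweakly continuous in $t$, *-homomorphic and unital. Semigroups: a Markov semigroup on $\mathsf A$ is a pointwise ultraweakly continuous semigroup of normal positive unital maps on $\mathsf A$. A semigroup $\mathcal P$ is completely quasicontractive if there is $\beta\in\mathbb R$ with $\|e^{-\beta t}\mathcal P_t\|_{\rm cb}\le1$ for all $t\ge0$. Ultraweak stochastic derivative: for $t>0$ let $V_t:\mathsf k\otimes\mathfrak h\to\mathfrak h\otimes\mathcal F$ be the isometry determined by $c\otimes u\mapsto u\otimes(0,t^{-1/2}c_{[0,t[},0,0,\dots)$ and let $$\theta_t(a):=\begin{bmatrix}t^{-1/2}E^{\varpi(0)}\\ V_t^*\end{bmatrix}\big(j_t(a)-a\otimes I_{\mathcal F}\big)\begin{bmatrix}t^{-1/2}E_{\varpi(0)}&V_t\end{bmatrix}\in B(\widehat{\mathsf k})\overline\otimes\mathsf A .$$ Then $\theta(x):=\lim_{t\to0^+}\theta_t(x)$ (ultraweak limit), with $\operatorname{Dom}\theta$ the set of $x\in\mathsf A$ for which the limit exists. It is a *-invariant subspace; the maps $\mathcal L,\delta,\pi$ on $\operatorname{Dom}\theta$ are defined by the block form in the claim, with $\delta^\dagger(x)=\delta(x^*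 )^*$. *)

theory Defs
  imports "HOL-Analysis.Analysis"
begin

section \<open>Complex Hilbert spaces\<close>

class chilbert = real_inner + complete_space +
  fixes scaleC :: "complex \<Rightarrow> 'a \<Rightarrow> 'a" (infixr "*\<^sub>C" 75)
    and cinner :: "'a \<Rightarrow> 'a \<Rightarrow> complex" ("\<langle>_, _\<rangle>")
  assumes scaleC_add_right: "c *\<^sub>C (x + y) = c *\<^sub>C x + c *\<^sub>C y"
    and scaleC_add_left: "(c + d) *\<^sub>C x = c *\<^sub>C x + d *\<^sub>C x"
    and scaleC_scaleC: "c *\<^sub>C d *\<^sub>C x = (c * d) *\<^sub>C x"
    and scaleC_of_real: "complex_of_real r *\<^sub>C x = r *\<^sub>R x"
    and cinner_add_right: "\<langle>x, y + z\<rangle> = \<langle>x, y\<rangle> + \<langle>x, z\<rangle>"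
    and cinner_scaleC_right: "\<langle>x, c *\<^sub>C y\<rangle> = c * \<langle>x, y\<rangle>"
    and cnj_cinner: "cnj \<langle>x, y\<rangle> = \<langle>y, x\<rangle>"
    and Re_cinner: "Re \<langle>x, y\<rangle> = inner x y"

lemma cinner_add_left: "\<langle>x + y, z\<rangle> = \<langle>x, z\<rangle> + \<langle>y, z\<rangle>"
  by (metis cinner_add_right cnj_cinner complex_cnj_add)

lemma cinner_scaleC_left: "\<langle>c *\<^sub>C x, y\<rangle> = cnj c * \<langle>x, y\<rangle>"
  by (metis cinner_scaleC_right cnj_cinner complex_cnj_mult)

lemma cinner_zero_right [simp]: "\<langle>x, 0\<rangle> = 0"
  using cinner_add_right[of x 0 0] by simp

lemma cinner_zero_left [simp]: "\<langle>0, x\<rangle> = 0"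
  using cinner_add_left[of 0 0 x] by simp

lemma cinner_minus_right: "\<langle>x, - y\<rangle> = - \<langle>x, y\<rangle>"
  using cinner_add_right[of x y "- y"] by (simp add: eq_neg_iff_add_eq_0 add.commute)

lemma cinner_diff_right: "\<langle>x, y - z\<rangle> = \<langle>x, y\<rangle> - \<langle>x, z\<rangle>"
  using cinner_add_right[of x y "- z"] by (simp add: cinner_minus_right)

lemma cinner_sum_right: "\<langle>x, \<Sum>i\<in>I. f i\<rangle> = (\<Sum>i\<in>I. \<langle>x, f i\<rangle>)"
  by (induction I rule: infinite_finite_induct) (auto simp: cinner_add_right)

lemma cinner_sum_left: "\<langle>\<Sum>i\<in>I. f i, x\<rangle> = (\<Sum>i\<in>I. \<langle>f i, x\<rangle>)"
  by (induction I rule: infinite_finite_induct) (auto simp: cinner_add_left)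

lemma cinner_self: "\<langle>x, x\<rangle> = complex_of_real ((norm x)\<^sup>2)"
  using Re_cinner[of x x] cnj_cinner[of x x]
  by (auto simp: complex_eq_iff power2_norm_eq_inner)

instantiation complex :: chilbert
begin
definition scaleC_complex :: "complex \<Rightarrow> complex \<Rightarrow> complex" where "scaleC_complex c x = c * x"
definition cinner_complex :: "complex \<Rightarrow> complex \<Rightarrow> complex" where "cinner_complex x y = cnj x * y"
instance
  by standard (auto simp: scaleC_complex_def cinner_complex_def algebra_simps scaleR_conv_of_real
      inner_complex_def)
end

instantiation prod :: (chilbert, chilbert) chilbert
begin
definition scaleC_prod :: "complex \<Rightarrow> 'a \<times> 'b \<Rightarrow> 'a \<times> 'b"
  where "scaleC_prod c x = (c *\<^sub>C fst x, c *\<^sub>C snd x)"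
definition cinner_prod :: "'a \<times> 'b \<Rightarrow> 'a \<times> 'b \<Rightarrow> complex"
  where "cinner_prod x y = \<langle>fst x, fst y\<rangle> + \<langle>snd x, snd y\<rangle>"
instance
  by standard (auto simp: scaleC_prod_def cinner_prod_def scaleC_add_right scaleC_add_left
      scaleC_scaleC scaleC_of_real cinner_add_right cinner_scaleC_right cnj_cinner Re_cinner
      inner_prod_def algebra_simps prod_eq_iff)
end

definition cspan :: "'a::chilbert set \<Rightarrow> 'a set" where
  "cspan S = {\<Sum>i<n. c i *\<^sub>C x i | (n::nat) c x. \<forall>i<n. x i \<in> S}"


section \<open>The Hilbert space generated by a positive definite kernel\<close>

text \<open>Tensor products, Fock spaces and vector-valued L2 spaces are obtained below as the Hilbert
  completion of the complex vector space with generators \<^term>\<open>x\<close> and inner product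
  \<open>kern x y\<close> (modulo null vectors).\<close>

class psd_kernel =
  fixes kern :: "'a \<Rightarrow> 'a \<Rightarrow> complex"
  assumes cnj_kern: "cnj (kern x y) = kern y x"
    and kern_psd: "0 \<le> Re (\<Sum>i<(n::nat). \<Sum>j<n. cnj (\<alpha> i) * \<alpha> j * kern (z i) (z j))"

definition lform :: "(complex \<times> 'x::psd_kernel) list \<Rightarrow> (complex \<times> 'x) list \<Rightarrow> complex" where
  "lform xs ys = (\<Sum>(c, x)\<leftarrow>xs. \<Sum>(d, y)\<leftarrow>ys. cnj c * d * kern x y)"

definition lscale :: "complex \<Rightarrow> (complex \<times> 'x) list \<Rightarrow> (complex \<times> 'x) list" where
  "lscale a xs = map (\<lambda>(c, x). (a * c, x)) xs"

abbreviation lnorm2 :: "(complex \<times> 'x::psd_kernel) list \<Rightarrow> real" where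
  "lnorm2 xs \<equiv> Re (lform xs xs)"

lemma lform_Nil [simp]: "lform [] ys = 0" "lform xs [] = 0"
  by (simp_all add: lform_def case_prod_unfold)

lemma lform_append_left: "lform (xs @ xs') ys = lform xs ys + lform xs' ys"
  by (simp add: lform_def)

lemma lform_append_right: "lform xs (ys @ ys') = lform xs ys + lform xs ys'"
  by (simp add: lform_def case_prod_unfold sum_list_addf)

lemma lform_scale_left: "lform (lscale a xs) ys = cnj a * lform xs ys"
  by (simp add: lform_def lscale_def case_prod_unfold o_def sum_list_const_mult[symmetric]
      mult.assoc)

lemma lform_scale_right: "lform xs (lscale a ys) = a * lform xs ys"
  by (simp add: lform_def lscale_def case_prod_unfold o_def sum_list_const_mult[symmetric]
      algebra_simps)

lemma cnj_sum_list: "cnj (\<Sum>x\<leftarrow>xs. f x) = (\<Sum>x\<leftarrow>xs. cnj (f x))"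
  by (induction xs) auto

lemma sum_list_swap: "(\<Sum>x\<leftarrow>xs. \<Sum>y\<leftarrow>ys. f x y) = (\<Sum>y\<leftarrow>ys. \<Sum>x\<leftarrow>xs. f x y :: complex)"
  by (induction xs) (auto simp: sum_list_addf)

lemma cnj_lform: "cnj (lform xs ys) = lform ys xs"
proof -
  have "cnj (lform xs ys) = (\<Sum>p\<leftarrow>xs. \<Sum>q\<leftarrow>ys. fst p * cnj (fst q) * kern (snd q) (snd p))"
    by (simp add: lform_def cnj_sum_list case_prod_unfold cnj_kern)
  also have "\<dots> = (\<Sum>q\<leftarrow>ys. \<Sum>p\<leftarrow>xs. fst p * cnj (fst q) * kern (snd q) (snd p))"
    by (rule sum_list_swap)
  also have "\<dots> = lform ys xs"
    by (simp add: lform_def case_prod_unfold algebra_simps)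
  finally show ?thesis .
qed

lemma lnorm2_nonneg: "0 \<le> lnorm2 xs"
proof -
  have "lform xs xs = (\<Sum>i<length xs. \<Sum>j<length xs.
      cnj (fst (xs ! i)) * fst (xs ! j) * kern (snd (xs ! i)) (snd (xs ! j)))"
    by (simp add: lform_def case_prod_unfold sum_list_sum_nth atLeast0LessThan)
  then show ?thesis
    using kern_psd[of "\<lambda>i. fst (xs ! i)" "\<lambda>i. snd (xs ! i)" "length xs"] by simp
qed

lemma lform_self: "lform xs xs = complex_of_real (lnorm2 xs)"
  using cnj_lform[of xs xs] by (auto simp: complex_eq_iff)

lemma lform_CS: "(cmod (lform xs ys))\<^sup>2 \<le> lnorm2 xs * lnorm2 ys"
proof -
  let ?l = "lform xs ys"
  have exp: "0 \<le> t\<^sup>2 * (cmod ?l)\<^sup>2 * lnorm2 xs - 2 * t * (cmod ?l)\<^sup>2 + lnorm2 ys" for t :: real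
  proof -
    let ?z = "- (complex_of_real t * ?l)"
    have "lform (lscale ?z xs @ ys) (lscale ?z xs @ ys) =
        cnj ?z * ?z * lform xs xs + cnj ?z * ?l + ?z * cnj ?l + lform ys ys"
      by (simp only: lform_append_left lform_append_right lform_scale_left lform_scale_right
          cnj_lform) (simp add: algebra_simps)
    also have "\<dots> = complex_of_real (t\<^sup>2 * (cmod ?l)\<^sup>2 * a - 2 * t * (cmod ?l)\<^sup>2 + b)"
      if "lform xs xs = complex_of_real a" "lform ys ys = complex_of_real b" for a b
      unfolding that using complex_norm_square[of ?l]
      by (simp add: power2_eq_square algebra_simps)
    note this[OF lform_self lform_self]
    finally show ?thesis
      using lnorm2_nonneg[of "lscale ?z xs @ ys"] by simp
  qed
  show ?thesis
  proof (cases "lnorm2 xs = 0")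
    case True
    have "cmod ?l = 0"
    proof (rule ccontr)
      assume "cmod ?l \<noteq> 0"
      then have p: "(cmod ?l)\<^sup>2 > 0" by simp
      define t where "t = (lnorm2 ys + 1) / (cmod ?l)\<^sup>2"
      have "0 \<le> - 2 * (t * (cmod ?l)\<^sup>2) + lnorm2 ys"
        using exp[of t] unfolding True by (simp only: mult_zero_right)
      moreover have "t * (cmod ?l)\<^sup>2 = lnorm2 ys + 1"
        using p unfolding t_def by simp
      ultimately show False using lnorm2_nonneg[of ys] by linarith
    qed
    then show ?thesis using True by simp
  next
    case False
    then have p: "lnorm2 xs > 0" using lnorm2_nonneg[of xs] by simp
    have "0 \<le> (1 / lnorm2 xs)\<^sup>2 * (cmod ?l)\<^sup>2 * lnorm2 xs - 2 * (1 / lnorm2 xs) * (cmod ?l)\<^sup>2 + lnorm2 ys"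
      by (rule exp)
    also have "\<dots> = lnorm2 ys - (cmod ?l)\<^sup>2 / lnorm2 xs"
      using p by (simp add: field_simps power2_eq_square)
    finally show ?thesis using p by (simp add: field_simps)
  qed
qed

text \<open>The pre-Hilbert space of formal linear combinations embeds isometrically in the Banach space of
  bounded functions on itself by \<open>ys \<mapsto> (xs \<mapsto> \<langle>xs, ys\<rangle> / \<parallel>xs\<parallel>)\<close>; its completion is the
  closure of the image. The index set carries the discrete metric only in order to use the
  library type of bounded continuous functions.\<close>

datatype 'x comb = Comb "(complex \<times> 'x) list"

instantiation comb :: (type) metric_space
begin
definition dist_comb :: "'a comb \<Rightarrow> 'a comb \<Rightarrow> real" where "dist_comb x y = (if x = y then 0 else 1)"
definition uniformity_comb :: "('a comb \<times> 'a comb) filter"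
  where "uniformity_comb = (INF e\<in>{0 <..}. principal {(x, y). dist x y < e})"
definition open_comb :: "'a comb set \<Rightarrow> bool"
  where "open_comb S = (\<forall>x\<in>S. \<forall>\<^sub>F (x', y) in uniformity. x' = x \<longrightarrow> y \<in> S)"
instance
  by standard (auto simp: dist_comb_def uniformity_comb_def open_comb_def)
end

lemma open_comb_all: "open (S :: 'x comb set)"
  unfolding open_dist by (auto simp: dist_comb_def intro!: exI[of _ "1/2"] split: if_splits)

lemma continuous_on_comb: "continuous_on S (f :: 'x comb \<Rightarrow> 'b::topological_space)"
  unfolding continuous_on_open_invariant
  by (intro allI impI exI[of _ "f -` _ \<inter> S"]) (auto simp: open_comb_all)

definition embv :: "(complex \<times> 'x::psd_kernel) list \<Rightarrow> 'x comb \<Rightarrow>\<^sub>C complex" where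
  "embv ys = Bcontfun (\<lambda>v. case v of Comb xs \<Rightarrow> lform xs ys / sqrt (lnorm2 xs))"

lemma lform_quot_le: "cmod (lform xs ys / sqrt (lnorm2 xs)) \<le> sqrt (lnorm2 ys)"
proof (cases "lnorm2 xs = 0")
  case False
  then have p: "lnorm2 xs > 0" using lnorm2_nonneg[of xs] by simp
  have "cmod (lform xs ys) \<le> sqrt (lnorm2 xs * lnorm2 ys)"
    using lform_CS[of xs ys] by (simp add: real_le_rsqrt)
  then show ?thesis
    using p by (simp add: norm_divide real_sqrt_mult field_simps)
qed (simp add: lnorm2_nonneg)

lemma apply_embv: "apply_bcontfun (embv ys) (Comb xs) = lform xs ys / sqrt (lnorm2 xs)"
proof -
  have "(\<lambda>v. case v of Comb xs \<Rightarrow> lform xs ys / sqrt (lnorm2 xs)) \<in> bcontfun"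
    by (rule bcontfun_normI[of _ "sqrt (lnorm2 ys)"])
       (auto simp: continuous_on_comb lform_quot_le split: comb.split)
  then show ?thesis by (simp add: embv_def Bcontfun_inverse)
qed

lemma norm_embv: "norm (embv ys) = sqrt (lnorm2 ys)"
proof (rule antisym)
  show "norm (embv ys) \<le> sqrt (lnorm2 ys)"
    proof (rule norm_bound)
    fix v show "cmod (apply_bcontfun (embv ys) v) \<le> sqrt (lnorm2 ys)"
      using lform_quot_le by (cases v) (simp only: apply_embv)
  qed
  have "sqrt (lnorm2 ys) = cmod (apply_bcontfun (embv ys) (Comb ys))"
    by (subst apply_embv, subst lform_self) (simp add: norm_divide lnorm2_nonneg real_div_sqrt)
  also have "\<dots> \<le> norm (embv ys)" by (rule norm_bounded)
  finally show "sqrt (lnorm2 ys) \<le> norm (embv ys)" .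
qed

definition cmulb :: "complex \<Rightarrow> ('x comb \<Rightarrow>\<^sub>C complex) \<Rightarrow> 'x comb \<Rightarrow>\<^sub>C complex" where
  "cmulb c f = Bcontfun (\<lambda>v. c * apply_bcontfun f v)"

lemma apply_cmulb: "apply_bcontfun (cmulb c f) v = c * apply_bcontfun f v"
proof -
  have "(\<lambda>v. c * apply_bcontfun f v) \<in> bcontfun"
    by (rule bcontfun_normI[of _ "cmod c * norm f"])
       (auto simp: continuous_on_comb norm_mult intro!: mult_left_mono norm_bounded)
  then show ?thesis by (simp add: cmulb_def Bcontfun_inverse)
qed

lemma norm_cmulb: "norm (cmulb c f) = cmod c * norm f"
proof (rule antisym)
  show *: "norm (cmulb c f) \<le> cmod c * norm f" for c and f :: "'x comb \<Rightarrow>\<^sub>C complex"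
    by (rule norm_bound) (auto simp: apply_cmulb norm_mult intro!: mult_left_mono norm_bounded)
  show "cmod c * norm f \<le> norm (cmulb c f)"
  proof (cases "c = 0")
    case False
    have "cmulb (inverse c) (cmulb c f) = f"
      using False by (intro bcontfun_eqI) (simp add: apply_cmulb)
    then have "norm f \<le> cmod (inverse c) * norm (cmulb c f)" using * by metis
    then have "cmod c * norm f \<le> cmod c * (cmod (inverse c) * norm (cmulb c f))"
      by (rule mult_left_mono) simp
    also have "\<dots> = norm (cmulb c f)"
      unfolding mult.assoc[symmetric] norm_mult[symmetric] using False by simp
    finally show ?thesis .
  qed simp
qed

lemma cmulb_diff: "cmulb c (f - g) = cmulb c f - cmulb c g"
  by (intro bcontfun_eqI) (simp add: apply_cmulb algebra_simps)

lemma cmulb_add: "cmulb c (f + g) = cmulb c f + cmulb c g"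
  by (intro bcontfun_eqI) (simp add: apply_cmulb algebra_simps)

lemma cmulb_of_real: "cmulb (complex_of_real r) f = r *\<^sub>R f"
  by (intro bcontfun_eqI) (simp add: apply_cmulb scaleR_conv_of_real)

lemma embv_append: "embv (xs @ ys) = embv xs + embv ys"
proof (rule bcontfun_eqI)
  fix v :: "'a comb"
  obtain zs where "v = Comb zs" by (cases v)
  then show "apply_bcontfun (embv (xs @ ys)) v = apply_bcontfun (embv xs + embv ys) v"
    by (simp add: apply_embv lform_append_right add_divide_distrib)
qed

lemma embv_scale: "embv (lscale c ys) = cmulb c (embv ys)"
proof (rule bcontfun_eqI)
  fix v :: "'a comb"
  obtain xs where "v = Comb xs" by (cases v)
  then show "apply_bcontfun (embv (lscale c ys)) v = apply_bcontfun (cmulb c (embv ys)) v"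
    by (simp add: apply_cmulb apply_embv lform_scale_right)
qed

definition hcar :: "('x::psd_kernel comb \<Rightarrow>\<^sub>C complex) set" where
  "hcar = closure (range embv)"

lemma hcar_seq: "f \<in> hcar \<Longrightarrow> \<exists>X. (\<lambda>n. embv (X n)) \<longlonglongrightarrow> f"
proof -
  assume "f \<in> hcar"
  then obtain u where u: "\<forall>n. u n \<in> range embv" "u \<longlonglongrightarrow> f"
    unfolding hcar_def closure_sequential by blast
  then have "\<forall>n. \<exists>xs. u n = embv xs" by blast
  then obtain X where "\<And>n. u n = embv (X n)" by metis
  then have "u = (\<lambda>n. embv (X n))" by auto
  then show ?thesis using u(2) by blast
qed

lemma hcar_lim: "u \<longlonglongrightarrow> f \<Longrightarrow> (\<And>n. u n = embv (X n)) \<Longrightarrow> f \<in> hcar"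
  unfolding hcar_def closure_sequential by (intro exI[of _ u]) auto

lemma hcar_add: "f \<in> hcar \<Longrightarrow> g \<in> hcar \<Longrightarrow> f + g \<in> hcar"
proof -
  assume "f \<in> hcar" "g \<in> hcar"
  obtain X where X: "(\<lambda>n. embv (X n)) \<longlonglongrightarrow> f" using hcar_seq[OF \<open>f \<in> hcar\<close>] by blast
  obtain Y where Y: "(\<lambda>n. embv (Y n)) \<longlonglongrightarrow> g" using hcar_seq[OF \<open>g \<in> hcar\<close>] by blast
  have lim: "(\<lambda>n. embv (X n) + embv (Y n)) \<longlonglongrightarrow> f + g"
    by (rule tendsto_add[OF X Y])
  have eq: "embv (X n) + embv (Y n) = embv (X n @ Y n)" for n
    by (rule embv_append[symmetric])
  show ?thesis
    by (rule hcar_lim[OF lim eq])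
qed

lemma tendsto_cmulb: "u \<longlonglongrightarrow> f \<Longrightarrow> (\<lambda>n. cmulb c (u n)) \<longlonglongrightarrow> cmulb c f"
proof -
  assume "u \<longlonglongrightarrow> f"
  then have "(\<lambda>n. norm (u n - f)) \<longlonglongrightarrow> 0" by (intro tendsto_norm_zero LIM_zero)
  then have "(\<lambda>n. cmod c * norm (u n - f)) \<longlonglongrightarrow> 0" by (rule tendsto_mult_right_zero)
  then have "(\<lambda>n. norm (cmulb c (u n) - cmulb c f)) \<longlonglongrightarrow> 0"
    by (simp add: cmulb_diff[symmetric] norm_cmulb)
  then show ?thesis by (rule LIM_zero_cancel[OF tendsto_norm_zero_cancel])
qed

lemma hcar_cmulb: "f \<in> hcar \<Longrightarrow> cmulb c f \<in> hcar"
proof -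
  assume "f \<in> hcar"
  then obtain X where X: "(\<lambda>n. embv (X n)) \<longlonglongrightarrow> f" using hcar_seq by blast
  show ?thesis
    by (rule hcar_lim[OF tendsto_cmulb[OF X], where X = "\<lambda>n. lscale c (X n)"]) (simp add: embv_scale)
qed

lemma hcar_scaleR: "f \<in> hcar \<Longrightarrow> r *\<^sub>R f \<in> hcar"
  using hcar_cmulb[of f "complex_of_real r"] by (simp add: cmulb_of_real)

lemma hcar_minus: "f \<in> hcar \<Longrightarrow> - f \<in> hcar"
  using hcar_scaleR[of f "-1"] by simp

lemma hcar_diff: "f \<in> hcar \<Longrightarrow> g \<in> hcar \<Longrightarrow> f - g \<in> hcar"
  using hcar_add[OF _ hcar_minus, of f g] by simp

lemma embv_hcar: "embv xs \<in> hcar"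
  using closure_subset[of "range embv"] by (auto simp: hcar_def)

lemma embv_Nil: "embv [] = 0"
  using norm_embv[of "[]"] by simp

lemma hcar_zero: "0 \<in> hcar"
  using embv_hcar[of "[]"] by (simp add: embv_Nil)

definition binner :: "('x comb \<Rightarrow>\<^sub>C complex) \<Rightarrow> ('x comb \<Rightarrow>\<^sub>C complex) \<Rightarrow> real" where
  "binner f g = ((norm (f + g))\<^sup>2 - (norm (f - g))\<^sup>2) / 4"

lemma embv_diff: "embv xs - embv ys = embv (xs @ lscale (-1) ys)"
  using cmulb_of_real[of "-1" "embv ys"] by (simp add: embv_append embv_scale)

lemma binner_embv: "binner (embv xs) (embv ys) = Re (lform xs ys)"
proof -
  have "Re (lform ys xs) = Re (lform xs ys)" unfolding cnj_lform[of xs ys, symmetric] by simp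
  then show ?thesis
    by (simp add: binner_def embv_append[symmetric] embv_diff norm_embv lnorm2_nonneg)
       (simp add: lform_append_left lform_append_right lform_scale_left lform_scale_right)
qed

lemma tendsto_binner: "u \<longlonglongrightarrow> f \<Longrightarrow> v \<longlonglongrightarrow> g \<Longrightarrow> (\<lambda>n. binner (u n) (v n)) \<longlonglongrightarrow> binner f g"
  unfolding binner_def by (intro tendsto_intros) auto

lemma binner_add_left:
  assumes "f \<in> hcar" "g \<in> hcar" "h \<in> hcar"
  shows "binner (f + g) h = binner f h + binner g h"
proof -
  obtain X Y Z where *: "(\<lambda>n. embv (X n)) \<longlonglongrightarrow> f" "(\<lambda>n. embv (Y n)) \<longlonglongrightarrow> g" "(\<lambda>n. embv (Z n)) \<longlonglongrightarrow> h"
    using assms[THEN hcar_seq] by blast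
  have "(\<lambda>n. binner (embv (X n) + embv (Y n)) (embv (Z n))) \<longlonglongrightarrow> binner (f + g) h"
    by (intro tendsto_binner tendsto_add *)
  moreover have "binner (embv (X n) + embv (Y n)) (embv (Z n)) =
      binner (embv (X n)) (embv (Z n)) + binner (embv (Y n)) (embv (Z n))" for n
    by (simp add: embv_append[symmetric] binner_embv lform_append_left)
  ultimately have "(\<lambda>n. binner (embv (X n)) (embv (Z n)) + binner (embv (Y n)) (embv (Z n)))
      \<longlonglongrightarrow> binner (f + g) h" by simp
  moreover have "(\<lambda>n. binner (embv (X n)) (embv (Z n)) + binner (embv (Y n)) (embv (Z n)))
      \<longlonglongrightarrow> binner f h + binner g h"
    by (intro tendsto_binner tendsto_add *)
  ultimately show ?thesis by (rule LIMSEQ_unique)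
qed

lemma binner_scaleR_left:
  assumes "f \<in> hcar" "g \<in> hcar"
  shows "binner (r *\<^sub>R f) g = r * binner f g"
proof -
  obtain X Y where *: "(\<lambda>n. embv (X n)) \<longlonglongrightarrow> f" "(\<lambda>n. embv (Y n)) \<longlonglongrightarrow> g"
    using assms[THEN hcar_seq] by blast
  have "(\<lambda>n. binner (r *\<^sub>R embv (X n)) (embv (Y n))) \<longlonglongrightarrow> binner (r *\<^sub>R f) g"
    by (intro tendsto_binner tendsto_scaleR tendsto_const *)
  moreover have "binner (r *\<^sub>R embv (X n)) (embv (Y n)) = r * binner (embv (X n)) (embv (Y n))" for n
    by (simp add: cmulb_of_real[symmetric] embv_scale[symmetric] binner_embv lform_scale_left)
  ultimately have "(\<lambda>n. r * binner (embv (X n)) (embv (Y n))) \<longlonglongrightarrow> binner (r *\<^sub>R f) g" by simp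
  moreover have "(\<lambda>n. r * binner (embv (X n)) (embv (Y n))) \<longlonglongrightarrow> r * binner f g"
    by (intro tendsto_binner tendsto_mult tendsto_const *)
  ultimately show ?thesis by (rule LIMSEQ_unique)
qed

lemma binner_commute: "binner f g = binner g f"
  by (simp add: binner_def add.commute norm_minus_commute)

lemma binner_self: "binner f f = (norm f)\<^sup>2"
  by (simp add: binner_def power_mult_distrib flip: scaleR_2)

lemma binner_cmulb: "binner (cmulb c f) (cmulb c g) = (cmod c)\<^sup>2 * binner f g"
  by (simp add: binner_def cmulb_add[symmetric] cmulb_diff[symmetric] norm_cmulb
      power_mult_distrib algebra_simps)

typedef (overloaded) 'x khilb = "hcar :: ('x::psd_kernel comb \<Rightarrow>\<^sub>C complex) set"
  using hcar_zero by blast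

setup_lifting type_definition_khilb

instantiation khilb :: (psd_kernel) real_inner
begin

lift_definition zero_khilb :: "'a khilb" is 0 by (rule hcar_zero)
lift_definition plus_khilb :: "'a khilb \<Rightarrow> 'a khilb \<Rightarrow> 'a khilb" is "(+)" by (rule hcar_add)
lift_definition minus_khilb :: "'a khilb \<Rightarrow> 'a khilb \<Rightarrow> 'a khilb" is "(-)" by (rule hcar_diff)
lift_definition uminus_khilb :: "'a khilb \<Rightarrow> 'a khilb" is uminus by (rule hcar_minus)
lift_definition scaleR_khilb :: "real \<Rightarrow> 'a khilb \<Rightarrow> 'a khilb" is scaleR by (rule hcar_scaleR)
lift_definition norm_khilb :: "'a khilb \<Rightarrow> real" is norm .
lift_definition inner_khilb :: "'a khilb \<Rightarrow> 'a khilb \<Rightarrow> real" is binner .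
definition sgn_khilb :: "'a khilb \<Rightarrow> 'a khilb" where "sgn_khilb x = scaleR (inverse (norm x)) x"
definition dist_khilb :: "'a khilb \<Rightarrow> 'a khilb \<Rightarrow> real" where "dist_khilb x y = norm (x - y)"
definition uniformity_khilb :: "('a khilb \<times> 'a khilb) filter"
  where "uniformity_khilb = (INF e\<in>{0 <..}. principal {(x, y). dist x y < e})"
definition open_khilb :: "'a khilb set \<Rightarrow> bool"
  where "open_khilb S = (\<forall>x\<in>S. \<forall>\<^sub>F (x', y) in uniformity. x' = x \<longrightarrow> y \<in> S)"

instance
proof
  fix x y z :: "'a khilb" and r s :: real
  show "x + y + z = x + (y + z)" by transfer simp
  show "x + y = y + x" by transfer simp
  show "0 + x = x" by transfer simp
  show "- x + x = 0" by transfer simp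
  show "x - y = x + - y" by transfer simp
  show "r *\<^sub>R (x + y) = r *\<^sub>R x + r *\<^sub>R y" by transfer (simp add: scaleR_add_right)
  show "(r + s) *\<^sub>R x = r *\<^sub>R x + s *\<^sub>R x" by transfer (simp add: scaleR_add_left)
  show "r *\<^sub>R s *\<^sub>R x = (r * s) *\<^sub>R x" by transfer simp
  show "1 *\<^sub>R x = x" by transfer simp
  show "sgn x = scaleR (inverse (norm x)) x" by (rule sgn_khilb_def)
  show "dist x y = norm (x - y)" by (rule dist_khilb_def)
  show "uniformity = (INF e\<in>{0 <..}. principal {(x::'a khilb, y). dist x y < e})"
    by (rule uniformity_khilb_def)
  show "open S = (\<forall>x\<in>S. \<forall>\<^sub>F (x', y) in uniformity. x' = x \<longrightarrow> y \<in> S)" for S :: "'a khilb set"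
    by (rule open_khilb_def)
  show "inner x y = inner y x" by transfer (rule binner_commute)
  show "inner (x + y) z = inner x z + inner y z" by transfer (rule binner_add_left)
  show "inner (r *\<^sub>R x) y = r * inner x y" by transfer (rule binner_scaleR_left)
  show "0 \<le> inner x x" by transfer (simp add: binner_self)
  show "inner x x = 0 \<longleftrightarrow> x = 0" by transfer (simp add: binner_self)
  show "norm x = sqrt (inner x x)" by transfer (simp add: binner_self)
qed

end

instance khilb :: (psd_kernel) complete_space
proof
  fix X :: "nat \<Rightarrow> 'a khilb" assume "Cauchy X"
  have d: "dist (Rep_khilb x) (Rep_khilb y) = dist x y" for x y :: "'a khilb"
    by (simp add: dist_norm) (transfer, simp)
  have "Cauchy (\<lambda>n. Rep_khilb (X n))"
    using \<open>Cauchy X\<close> by (simp add: Cauchy_def d)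
  then obtain f where f: "(\<lambda>n. Rep_khilb (X n)) \<longlonglongrightarrow> f"
    using Cauchy_convergent unfolding convergent_def by blast
  have "closed (hcar :: ('a comb \<Rightarrow>\<^sub>C complex) set)" by (simp add: hcar_def)
  then have "f \<in> hcar"
    by (rule closed_sequentially[OF _ _ f]) (simp add: Rep_khilb)
  then obtain g where g: "f = Rep_khilb g" by (rule Rep_khilb_cases)
  have "X \<longlonglongrightarrow> g"
    using f unfolding g tendsto_iff d .
  then show "convergent X" by (rule convergentI)
qed

instantiation khilb :: (psd_kernel) chilbert
begin

lift_definition scaleC_khilb :: "complex \<Rightarrow> 'a khilb \<Rightarrow> 'a khilb" is cmulb by (rule hcar_cmulb)
definition cinner_khilb :: "'a khilb \<Rightarrow> 'a khilb \<Rightarrow> complex"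
  where "cinner_khilb x y = Complex (inner x y) (inner (\<i> *\<^sub>C x) y)"

instance
proof
  fix x y z :: "'a khilb" and r s :: real and c d :: complex
  show "c *\<^sub>C (x + y) = c *\<^sub>C x + c *\<^sub>C y" by transfer (rule cmulb_add)
  show add: "(c + d) *\<^sub>C x = c *\<^sub>C x + d *\<^sub>C x" for c d and x :: "'a khilb"
    by transfer (auto intro!: bcontfun_eqI simp: apply_cmulb algebra_simps)
  show mult: "c *\<^sub>C d *\<^sub>C x = (c * d) *\<^sub>C x" for c d and x :: "'a khilb"
    by transfer (auto intro!: bcontfun_eqI simp: apply_cmulb algebra_simps)
  show real: "complex_of_real r *\<^sub>C x = r *\<^sub>R x" for r and x :: "'a khilb"
    by transfer (rule cmulb_of_real)
  have i: "inner (\<i> *\<^sub>C x) (\<i> *\<^sub>C y) = inner x y" for x y :: "'a khilb"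
    by transfer (simp add: binner_cmulb)
  have ii: "\<i> *\<^sub>C \<i> *\<^sub>C x = - x" for x :: "'a khilb"
    using real[of "-1" x] by (simp add: mult)
  have i': "inner x (\<i> *\<^sub>C y) = - inner (\<i> *\<^sub>C x) y" for x y :: "'a khilb"
    using i[of x "\<i> *\<^sub>C y"] by (simp add: ii)
  show "\<langle>x, y + z\<rangle> = \<langle>x, y\<rangle> + \<langle>x, z\<rangle>"
    by (simp add: cinner_khilb_def inner_add_right complex_eq_iff)
  show "cnj \<langle>x, y\<rangle> = \<langle>y, x\<rangle>"
    using i'[of y x] by (simp add: cinner_khilb_def inner_commute complex_eq_iff)
  have "c *\<^sub>C y = Re c *\<^sub>R y + Im c *\<^sub>R (\<i> *\<^sub>C y)"
    unfolding real[symmetric] mult add[symmetric]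
    by (subst complex_eq[of c]) (simp only: mult.commute)
  then show "\<langle>x, c *\<^sub>C y\<rangle> = c * \<langle>x, y\<rangle>"
    by (simp add: cinner_khilb_def inner_add_right i i' ii complex_eq_iff)
  show "Re \<langle>x, y\<rangle> = inner x y" by (simp add: cinner_khilb_def)
qed

end

definition kvec :: "'x::psd_kernel \<Rightarrow> 'x khilb" where
  "kvec x = Abs_khilb (embv [(1, x)])"

lemma Rep_kvec: "Rep_khilb (kvec x) = embv [(1, x)]"
  by (simp add: kvec_def Abs_khilb_inverse embv_hcar)

lemma cinner_kvec: "\<langle>kvec x, kvec y\<rangle> = kern x y"
proof -
  have 1: "Re (kern x y) = inner (kvec x) (kvec y)"
    by (simp add: inner_khilb.rep_eq Rep_kvec binner_embv) (simp add: lform_def)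
  have "Rep_khilb (\<i> *\<^sub>C kvec x) = embv (lscale \<i> [(1, x)])"
    by (simp add: scaleC_khilb.rep_eq Rep_kvec embv_scale)
  then have "inner (\<i> *\<^sub>C kvec x) (kvec y) = Im (kern x y)"
    by (simp add: inner_khilb.rep_eq Rep_kvec binner_embv) (simp add: lform_def lscale_def)
  with 1 show ?thesis by (simp add: cinner_khilb_def complex_eq_iff)
qed

lemma cspan_zero: "0 \<in> cspan S"
  unfolding cspan_def by (rule CollectI, rule exI[of _ 0]) auto

lemma cspanE:
  assumes "v \<in> cspan S"
  obtains n :: nat and c x where "v = (\<Sum>i<n. c i *\<^sub>C x i)" "\<forall>i<n. x i \<in> S"
  using assms unfolding cspan_def by blast

lemma cspan_insert:
  assumes "v \<in> cspan S" "y \<in> S" shows "a *\<^sub>C y + v \<in> cspan S"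
proof -
  obtain n :: nat and c x where v: "v = (\<Sum>i<n. c i *\<^sub>C x i)" "\<forall>i<n. x i \<in> S"
    using assms(1) unfolding cspan_def by blast
  have "a *\<^sub>C y + v = (\<Sum>i<Suc n. (c(n := a)) i *\<^sub>C (x(n := y)) i)"
    unfolding v(1) by (simp add: add.commute)
  moreover have "\<forall>i<Suc n. (x(n := y)) i \<in> S"
    using v(2) assms(2) by auto
  ultimately show ?thesis unfolding cspan_def by blast
qed

lemma kvec_total: "closure (cspan (range (kvec :: 'x::psd_kernel \<Rightarrow> _))) = UNIV"
proof -
  have span: "Abs_khilb (embv xs) \<in> cspan (range kvec)" for xs :: "(complex \<times> 'x) list"
  proof (induction xs)
    case Nil
    have "Abs_khilb (embv []) = (0 :: 'x khilb)"
      by (simp add: embv_Nil zero_khilb_def)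
    then show ?case by (simp add: cspan_zero)
  next
    case (Cons p xs)
    obtain a x where p: "p = (a, x)" by (cases p)
    have "embv (p # xs) = cmulb a (embv [(1, x)]) + embv xs"
      using embv_append[of "[p]" xs] embv_scale[of a "[(1, x)]"] by (simp add: p lscale_def)
    then have "Abs_khilb (embv (p # xs)) = a *\<^sub>C kvec x + Abs_khilb (embv xs)"
      unfolding Rep_khilb_inject[symmetric] plus_khilb.rep_eq scaleC_khilb.rep_eq Rep_kvec
        Abs_khilb_inverse[OF embv_hcar] .
    then show ?case using cspan_insert[OF Cons.IH, of "kvec x" a] by simp
  qed
  have "f \<in> closure (cspan (range kvec))" for f :: "'x khilb"
  proof -
    obtain X where X: "(\<lambda>n. embv (X n)) \<longlonglongrightarrow> Rep_khilb f"
      using Rep_khilb hcar_seq by blast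
    have "dist (Abs_khilb (embv (X n))) f = dist (embv (X n)) (Rep_khilb f)" for n
      by (simp add: dist_norm norm_khilb.rep_eq minus_khilb.rep_eq Abs_khilb_inverse embv_hcar)
    then have "(\<lambda>n. Abs_khilb (embv (X n))) \<longlonglongrightarrow> f"
      using X by (simp add: tendsto_iff)
    then show ?thesis unfolding closure_sequential
      using span by (intro exI[of _ "\<lambda>n. Abs_khilb (embv (X n))"]) simp
  qed
  then show ?thesis by blast
qed

lemma khilb_eqI:
  assumes "\<And>z. \<langle>kvec z, f\<rangle> = \<langle>kvec z, g\<rangle>" shows "f = (g :: 'x::psd_kernel khilb)"
proof -
  let ?h = "f - g"
  have v: "inner v ?h = 0" if vc: "v \<in> cspan (range kvec)" for v
  proof -
    obtain n :: nat and c x where v: "v = (\<Sum>i<n. c i *\<^sub>C x i)" "\<forall>i<n. x i \<in> range kvec"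
      using vc by (rule cspanE)
    have "\<langle>v, f\<rangle> = \<langle>v, g\<rangle>"
      unfolding v(1) cinner_sum_left cinner_scaleC_left
      by (rule sum.cong) (use v(2) assms in auto)
    then show ?thesis unfolding Re_cinner[symmetric] cinner_diff_right by simp
  qed
  have "?h \<in> closure (cspan (range kvec))" unfolding kvec_total by simp
  then obtain u where u: "\<And>n. u n \<in> cspan (range kvec)" "u \<longlonglongrightarrow> ?h"
    unfolding closure_sequential by blast
  have "(\<lambda>n. inner (u n) ?h) \<longlonglongrightarrow> inner ?h ?h"
    by (intro tendsto_inner u tendsto_const)
  then have "inner ?h ?h = 0" by (simp add: v u LIMSEQ_const_iff)
  then show ?thesis by simp
qed


section \<open>Products of positive definite kernels\<close>

definition psd_on :: "'i set \<Rightarrow> ('i \<Rightarrow> 'i \<Rightarrow> complex) \<Rightarrow> bool" where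
  "psd_on S K \<longleftrightarrow> (\<forall>i j. cnj (K i j) = K j i) \<and>
     (\<forall>c. 0 \<le> Re (\<Sum>i\<in>S. \<Sum>j\<in>S. cnj (c i) * c j * K i j))"

lemma psd_on_herm: "psd_on S K \<Longrightarrow> cnj (K i j) = K j i"
  by (simp add: psd_on_def)

lemma psd_on_ge0: "psd_on S K \<Longrightarrow> 0 \<le> Re (\<Sum>i\<in>S. \<Sum>j\<in>S. cnj (c i) * c j * K i j)"
  by (simp add: psd_on_def)

lemma psd_onI:
  assumes "\<And>i j. cnj (K i j) = K j i"
    "\<And>c. 0 \<le> Re (\<Sum>i\<in>S. \<Sum>j\<in>S. cnj (c i) * c j * K i j)"
  shows "psd_on S K"
  using assms by (simp add: psd_on_def)

lemma psd_on_subset: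
  assumes "finite S" "T \<subseteq> S" "psd_on S K" shows "psd_on T K"
proof (rule psd_onI)
  fix c :: "'a \<Rightarrow> complex"
  define d where "d i = (if i \<in> T then c i else 0)" for i
  have "(\<Sum>i\<in>S. \<Sum>j\<in>S. cnj (d i) * d j * K i j) = (\<Sum>i\<in>T. \<Sum>j\<in>S. cnj (d i) * d j * K i j)"
    by (rule sum.mono_neutral_right[OF assms(1,2)]) (auto simp: d_def)
  also have "\<dots> = (\<Sum>i\<in>T. \<Sum>j\<in>T. cnj (d i) * d j * K i j)"
    by (intro sum.cong refl sum.mono_neutral_right[OF assms(1,2)]) (auto simp: d_def)
  also have "\<dots> = (\<Sum>i\<in>T. \<Sum>j\<in>T. cnj (c i) * c j * K i j)"
    by (intro sum.cong refl) (auto simp: d_def)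
  finally show "0 \<le> Re (\<Sum>i\<in>T. \<Sum>j\<in>T. cnj (c i) * c j * K i j)"
    using psd_on_ge0[OF assms(3), of d] by simp
qed (rule psd_on_herm[OF assms(3)])

lemma psd_on_diag: "finite S \<Longrightarrow> psd_on S K \<Longrightarrow> x \<in> S \<Longrightarrow> 0 \<le> Re (K x x)"
  using psd_on_ge0[OF psd_on_subset[of S "{x}" K], of "\<lambda>_. 1"] by simp

lemma psd_on_cong: "(\<And>i j. K i j = L i j) \<Longrightarrow> psd_on S K \<Longrightarrow> psd_on S L"
  by (simp add: psd_on_def)

lemma psd_on_rank_one:
  assumes "psd_on S L" shows "psd_on S (\<lambda>i j. cnj (a i) * a j * L i j)"
proof (rule psd_onI)
  fix c
  have "(\<Sum>i\<in>S. \<Sum>j\<in>S. cnj (c i) * c j * (cnj (a i) * a j * L i j)) =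
      (\<Sum>i\<in>S. \<Sum>j\<in>S. cnj (c i * a i) * (c j * a j) * L i j)"
    by (intro sum.cong refl) simp
  then show "0 \<le> Re (\<Sum>i\<in>S. \<Sum>j\<in>S. cnj (c i) * c j * (cnj (a i) * a j * L i j))"
    using psd_on_ge0[OF assms, of "\<lambda>i. c i * a i"] by simp
qed (simp add: psd_on_herm[OF assms])

lemma psd_on_add:
  assumes "psd_on S K" "psd_on S L" shows "psd_on S (\<lambda>i j. K i j + L i j)"
proof (rule psd_onI)
  fix c
  show "0 \<le> Re (\<Sum>i\<in>S. \<Sum>j\<in>S. cnj (c i) * c j * (K i j + L i j))"
    using psd_on_ge0[OF assms(1), of c] psd_on_ge0[OF assms(2), of c]
    by (simp add: distrib_left sum.distrib)
qed (simp add: psd_on_herm[OF assms(1)] psd_on_herm[OF assms(2)])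

lemma psd_on_quadratic:
  assumes "finite S" "x \<notin> S" "psd_on (insert x S) K"
  shows "0 \<le> Re (cnj z * z * K x x) + 2 * Re (cnj z * (\<Sum>j\<in>S. c j * K x j)) +
    Re (\<Sum>i\<in>S. \<Sum>j\<in>S. cnj (c i) * c j * K i j)"
proof -
  define d where "d = c(x := z)"
  have d: "d x = z" "\<And>j. j \<in> S \<Longrightarrow> d j = c j" using assms(2) by (auto simp: d_def)
  have r: "(\<Sum>j\<in>S. cnj z * c j * K x j) = cnj z * (\<Sum>j\<in>S. c j * K x j)"
    by (simp add: sum_distrib_left mult.assoc)
  have "(\<Sum>i\<in>S. cnj (c i) * z * K i x) = cnj (cnj z * (\<Sum>j\<in>S. c j * K x j))"
    by (simp add: sum_distrib_left psd_on_herm[OF assms(3)] algebra_simps)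
  moreover have "(\<Sum>i\<in>insert x S. \<Sum>j\<in>insert x S. cnj (d i) * d j * K i j) =
      (cnj z * z * K x x + (\<Sum>j\<in>S. cnj z * c j * K x j)) +
      ((\<Sum>i\<in>S. cnj (c i) * z * K i x) + (\<Sum>i\<in>S. \<Sum>j\<in>S. cnj (c i) * c j * K i j))"
    using assms(1,2) by (simp add: d sum.distrib cong: sum.cong)
  ultimately show ?thesis
    using psd_on_ge0[OF assms(3), of d] by (simp add: r del: complex_cnj_mult complex_cnj_cnj)
qed

lemma psd_on_zero_row:
  assumes S: "finite S" "psd_on S K" and x: "x \<in> S" "K x x = 0" and j: "j \<in> S"
  shows "K x j = 0"
proof (cases "j = x")
  case False
  have "psd_on {x, j} K"
    by (rule psd_on_subset[OF S(1) _ S(2)]) (use x j in auto)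
  then have q: "0 \<le> 2 * Re (cnj z * K x j) + Re (K j j)" for z
    using psd_on_quadratic[of "{j}" x K z "\<lambda>_. 1"] False x by simp
  define t where "t = (Re (K j j) + 1) / (cmod (K x j))\<^sup>2"
  have "0 \<le> - 2 * (t * (cmod (K x j))\<^sup>2) + Re (K j j)"
  proof -
    have "cnj (- (complex_of_real t * K x j)) * K x j = - complex_of_real (t * (cmod (K x j))\<^sup>2)"
      using complex_norm_square[of "K x j"] by (simp add: mult.commute)
    then show ?thesis
      using q[of "- (complex_of_real t * K x j)"] by (simp only: uminus_complex.sel Re_complex_of_real)
  qed
  moreover have "t * (cmod (K x j))\<^sup>2 = Re (K j j) + 1" if "K x j \<noteq> 0"
    using that unfolding t_def by simp
  moreover have "0 \<le> Re (K j j)" by (rule psd_on_diag[OF S j])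
  ultimately show ?thesis by force
qed (use x in simp)

lemma psd_on_schur_complement:
  assumes "finite S" "x \<notin> S" "psd_on (insert x S) K" "K x x \<noteq> 0"
  shows "psd_on S (\<lambda>i j. K i j - K i x * K x j / K x x)"
proof (rule psd_onI)
  have herm: "\<And>i j. cnj (K i j) = K j i" by (rule psd_on_herm[OF assms(3)])
  show "cnj (K i j - K i x * K x j / K x x) = K j i - K j x * K x i / K x x" for i j
    by (simp add: herm)
  fix c
  obtain a where a: "K x x = complex_of_real a"
    using herm[of x x] by (metis Reals_cnj_iff Reals_cases)
  have a0: "a \<noteq> 0" using assms(4) by (auto simp: a)
  define l where "l = (\<Sum>j\<in>S. c j * K x j)"
  have l: "(\<Sum>i\<in>S. cnj (c i) * K i x) = cnj l"
    by (simp add: l_def herm)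
  have "(\<Sum>i\<in>S. \<Sum>j\<in>S. cnj (c i) * c j * (K i x * K x j / K x x)) = cnj l * l / K x x"
    unfolding l[symmetric] unfolding l_def sum_product sum_divide_distrib
    by (intro sum.cong refl) (simp add: algebra_simps)
  also have "\<dots> = complex_of_real ((cmod l)\<^sup>2 / a)"
    using complex_norm_square[of l] by (simp add: a mult.commute)
  finally have "Re (\<Sum>i\<in>S. \<Sum>j\<in>S. cnj (c i) * c j * (K i j - K i x * K x j / K x x)) =
      Re (\<Sum>i\<in>S. \<Sum>j\<in>S. cnj (c i) * c j * K i j) - (cmod l)\<^sup>2 / a"
    unfolding right_diff_distrib sum_subtractf minus_complex.sel
    by (simp only: Re_complex_of_real)
  moreover have "0 \<le> Re (\<Sum>i\<in>S. \<Sum>j\<in>S. cnj (c i) * c j * K i j) - (cmod l)\<^sup>2 / a"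
  proof -
    define z where "z = - l / complex_of_real a"
    have "cnj z * z * K x x = complex_of_real ((cmod l)\<^sup>2 / a)"
      unfolding z_def a using complex_norm_square[of l] a0
      by (simp add: field_simps power2_eq_square)
    then have 1: "Re (cnj z * z * K x x) = (cmod l)\<^sup>2 / a" by (simp only: Re_complex_of_real)
    have "cnj z * l = - complex_of_real ((cmod l)\<^sup>2 / a)"
      unfolding z_def using complex_norm_square[of l] by (simp add: mult.commute)
    then have 2: "Re (cnj z * l) = - ((cmod l)\<^sup>2 / a)"
      by (simp only: uminus_complex.sel Re_complex_of_real)
    show ?thesis
      using psd_on_quadratic[OF assms(1-3), of z c, folded l_def] unfolding 1 2 by linarith
  qed
  ultimately show "0 \<le> Re (\<Sum>i\<in>S. \<Sum>j\<in>S. cnj (c i) * c j * (K i j - K i x * K x j / K x x))"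
    by simp
qed

lemma psd_on_extend_zero:
  assumes "finite S" "x \<notin> S" "psd_on S K" "\<And>j. j \<in> insert x S \<Longrightarrow> K x j = 0"
    "\<And>j. j \<in> insert x S \<Longrightarrow> K j x = 0"
  shows "psd_on (insert x S) K"
proof (rule psd_onI)
  fix c
  have "(\<Sum>i\<in>insert x S. \<Sum>j\<in>insert x S. cnj (c i) * c j * K i j) =
      (\<Sum>i\<in>S. \<Sum>j\<in>S. cnj (c i) * c j * K i j)"
    using assms by (simp cong: sum.cong)
  then show "0 \<le> Re (\<Sum>i\<in>insert x S. \<Sum>j\<in>insert x S. cnj (c i) * c j * K i j)"
    using psd_on_ge0[OF assms(3), of c] by simp
qed (rule psd_on_herm[OF assms(3)])

lemma psd_on_mult:
  assumes "finite S" "psd_on S K" "psd_on S L"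
  shows "psd_on S (\<lambda>i j. K i j * L i j)"
  using assms
proof (induction S arbitrary: K rule: finite_induct)
  case empty
  then show ?case by (auto simp: psd_on_def)
next
  case (insert x S)
  note K = insert.prems(1) and L = insert.prems(2)
  have LS: "psd_on S L" and KS: "psd_on S K"
    by (rule psd_on_subset[OF _ _ L] psd_on_subset[OF _ _ K]; use insert.hyps in auto)+
  have herm: "\<And>i j. cnj (K i j) = K j i" by (rule psd_on_herm[OF K])
  show ?case
  proof (cases "K x x = 0")
    case True
    have z: "K x j = 0" if "j \<in> insert x S" for j
      by (rule psd_on_zero_row[OF _ K _ True that]) (use insert.hyps in auto)
    have z': "K j x = 0" if "j \<in> insert x S" for j
      using z[OF that] herm[of x j] by simp
    show ?thesis
      by (rule psd_on_extend_zero[OF insert.hyps(1,2) insert.IH[OF KS LS]]) (auto simp: z z')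
  next
    case False
    obtain a where a: "K x x = complex_of_real a"
      using herm[of x x] by (metis Reals_cnj_iff Reals_cases)
    have apos: "a > 0"
      using psd_on_diag[OF _ K, of x] insert.hyps(1) False unfolding a by auto
    define M where "M i j = K i j - K i x * K x j / K x x" for i j
    have "psd_on S M"
      unfolding M_def by (rule psd_on_schur_complement[OF insert.hyps(1,2) K False])
    then have "psd_on S (\<lambda>i j. M i j * L i j)" by (rule insert.IH[OF _ LS])
    then have 1: "psd_on (insert x S) (\<lambda>i j. M i j * L i j)"
      by (rule psd_on_extend_zero[OF insert.hyps(1,2)]) (auto simp: M_def False)
    have 2: "psd_on (insert x S) (\<lambda>i j. cnj (K x i / sqrt a) * (K x j / sqrt a) * L i j)"
      by (rule psd_on_rank_one[OF L])
    have "cnj (K x i / sqrt a) * (K x j / sqrt a) = K i x * K x j / K x x" for i j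
      using apos by (simp add: herm a flip: of_real_mult)
    then show ?thesis
      by (intro psd_on_cong[OF _ psd_on_add[OF 1 2]]) (simp add: M_def algebra_simps)
  qed
qed

lemma psd_on_power:
  assumes "finite S" "psd_on S K" shows "psd_on S (\<lambda>i j. K i j ^ n)"
proof (induction n)
  case 0
  have "(\<Sum>i\<in>S. \<Sum>j\<in>S. cnj (c i) * c j) = cnj (\<Sum>i\<in>S. c i) * (\<Sum>i\<in>S. c i)" for c
    by (simp add: sum_product)
  moreover have "0 \<le> Re (cnj z * z)" for z by simp
  ultimately have "0 \<le> Re (\<Sum>i\<in>S. \<Sum>j\<in>S. cnj (c i) * c j)" for c by metis
  then show ?case by (simp add: psd_on_def del: Re_sum)
next
  case (Suc n)
  then show ?case using psd_on_mult[OF assms(1,2) Suc] by simp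
qed

lemma psd_on_cinner: "psd_on S (\<lambda>i j. \<langle>x i, x j\<rangle>)"
proof (rule psd_onI)
  fix c
  have "(\<Sum>i\<in>S. \<Sum>j\<in>S. cnj (c i) * c j * \<langle>x i, x j\<rangle>) = \<langle>\<Sum>i\<in>S. c i *\<^sub>C x i, \<Sum>i\<in>S. c i *\<^sub>C x i\<rangle>"
    unfolding cinner_sum_left unfolding cinner_sum_right cinner_scaleC_left cinner_scaleC_right
    by (simp add: mult.assoc sum_distrib_left mult.left_commute)
  then show "0 \<le> Re (\<Sum>i\<in>S. \<Sum>j\<in>S. cnj (c i) * c j * \<langle>x i, x j\<rangle>)"
    by (simp add: Re_cinner del: Re_sum)
qed (rule cnj_cinner)

section \<open>Tensor products, vector-valued L2 and symmetric Fock space\<close>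

datatype ('a, 'b) tensor_gen = TensorGen 'a 'b

instantiation tensor_gen :: (chilbert, chilbert) psd_kernel
begin
fun kern_tensor_gen :: "('a, 'b) tensor_gen \<Rightarrow> ('a, 'b) tensor_gen \<Rightarrow> complex" where
  "kern_tensor_gen (TensorGen u v) (TensorGen u' v') = \<langle>u, u'\<rangle> * \<langle>v, v'\<rangle>"
instance
proof
  fix n :: nat and \<alpha> :: "nat \<Rightarrow> complex" and x y :: "('a, 'b) tensor_gen"
    and z :: "nat \<Rightarrow> ('a, 'b) tensor_gen"
  show "cnj (kern x y) = kern y x"
    by (cases x; cases y) (simp add: cnj_cinner)
  have "psd_on {..<n} (\<lambda>i j. kern (z i) (z j))"
  proof (rule psd_on_cong)
    let ?u = "\<lambda>i. case z i of TensorGen u v \<Rightarrow> u" and ?v = "\<lambda>i. case z i of TensorGen u v \<Rightarrow> v"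
    show "psd_on {..<n} (\<lambda>i j. \<langle>?u i, ?u j\<rangle> * \<langle>?v i, ?v j\<rangle>)"
      by (intro psd_on_mult psd_on_cinner finite_lessThan)
    show "\<langle>?u i, ?u j\<rangle> * \<langle>?v i, ?v j\<rangle> = kern (z i) (z j)" for i j
      by (cases "z i"; cases "z j") simp
  qed
  then show "0 \<le> Re (\<Sum>i<n. \<Sum>j<n. cnj (\<alpha> i) * \<alpha> j * kern (z i) (z j))"
    by (rule psd_on_ge0)
qed
end

type_synonym ('a, 'b) tensor = "('a, 'b) tensor_gen khilb"

definition tensor :: "'a::chilbert \<Rightarrow> 'b::chilbert \<Rightarrow> ('a, 'b) tensor" (infixr "\<otimes>" 75) where
  "u \<otimes> v = kvec (TensorGen u v)"

lemma cinner_tensor: "\<langle>u \<otimes> v, u' \<otimes> v'\<rangle> = \<langle>u, u'\<rangle> * \<langle>v, v'\<rangle>"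
  by (simp add: tensor_def cinner_kvec)

lemma tensor_total: "closure (cspan {u \<otimes> v | u v. True}) = (UNIV :: ('a::chilbert, 'b::chilbert) tensor set)"
proof -
  have "{u \<otimes> v | u v. True} = range (kvec :: ('a, 'b) tensor_gen \<Rightarrow> _)"
    unfolding tensor_def by (auto, metis tensor_gen.exhaust)
  then show ?thesis by (simp only: kvec_total)
qed

lemma tensor_eqI:
  assumes "\<And>u v. \<langle>u \<otimes> v, f\<rangle> = \<langle>u \<otimes> v, g\<rangle>" shows "f = (g :: ('a::chilbert, 'b::chilbert) tensor)"
proof (rule khilb_eqI)
  fix z :: "('a, 'b) tensor_gen"
  show "\<langle>kvec z, f\<rangle> = \<langle>kvec z, g\<rangle>"
    using assms by (cases z) (simp add: tensor_def)
qed

lemma tensor_add_left: "(u + u') \<otimes> v = u \<otimes> v + u' \<otimes> v"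
  by (rule tensor_eqI) (simp add: cinner_tensor cinner_add_right algebra_simps)

lemma tensor_add_right: "u \<otimes> (v + v') = u \<otimes> v + u \<otimes> v'"
  by (rule tensor_eqI) (simp add: cinner_tensor cinner_add_right algebra_simps)

lemma tensor_scaleC_left: "(c *\<^sub>C u) \<otimes> v = c *\<^sub>C (u \<otimes> v)"
  by (rule tensor_eqI) (simp add: cinner_tensor cinner_scaleC_right)

lemma tensor_scaleC_right: "u \<otimes> (c *\<^sub>C v) = c *\<^sub>C (u \<otimes> v)"
  by (rule tensor_eqI) (simp add: cinner_tensor cinner_scaleC_right)

text \<open>Right-continuous step functions on the half-line (with values in \<open>'k\<close>), extended by 0 to
  negative arguments. Square integrability forces finitely many steps and bounded support.\<close>

definition step_functions :: "(real \<Rightarrow> 'k::chilbert) set" where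
  "step_functions = {f. \<exists>(n::nat) a b c. (\<forall>i<n. 0 \<le> a i) \<and>
     f = (\<lambda>s. \<Sum>i<n. if s \<in> {a i..<b i} then c i else 0)}"

typedef (overloaded) 'k step = "step_functions :: (real \<Rightarrow> 'k::chilbert) set"
  by (rule exI[of _ "\<lambda>_. 0"]) (auto simp: step_functions_def intro!: exI[of _ 0])

lemma integrable_step_cinner:
  assumes "f \<in> step_functions" "g \<in> step_functions"
  shows "integrable lborel (\<lambda>s. \<langle>f s, g s\<rangle>)"
proof -
  obtain n :: nat and a b c where f: "f = (\<lambda>s. \<Sum>i<n. if s \<in> {a i..<b i} then c i else 0)"
    using assms(1) unfolding step_functions_def by blast
  obtain m :: nat and a' b' c' where g: "g = (\<lambda>s. \<Sum>i<m. if s \<in> {a' i..<b' i} then c' i else 0)"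
    using assms(2) unfolding step_functions_def by blast
  have "(\<lambda>s. \<langle>f s, g s\<rangle>) =
      (\<lambda>s. \<Sum>i<m. \<Sum>j<n. indicator ({max (a j) (a' i)..<min (b j) (b' i)}) s *\<^sub>R \<langle>c j, c' i\<rangle>)"
    unfolding f g cinner_sum_left cinner_sum_right
    by (intro ext sum.cong refl) (auto simp: indicator_def)
  moreover have "emeasure lborel {l..<u} < \<infinity>" for l u :: real
    by (cases "l \<le> u") auto
  then have "integrable lborel
      (\<lambda>s. \<Sum>i<m. \<Sum>j<n. indicator ({max (a j) (a' i)..<min (b j) (b' i)}) s *\<^sub>R \<langle>c j, c' i\<rangle>)"
    by (intro Bochner_Integration.integrable_sum integrable_scaleR_left integrable_real_indicator)
       auto
  ultimately show ?thesis by simp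
qed

instantiation step :: (chilbert) psd_kernel
begin
definition kern_step :: "'a step \<Rightarrow> 'a step \<Rightarrow> complex" where
  "kern_step f g = (\<integral>s. \<langle>Rep_step f s, Rep_step g s\<rangle> \<partial>lborel)"
instance
proof
  fix n :: nat and \<alpha> :: "nat \<Rightarrow> complex" and x y :: "'a step" and z :: "nat \<Rightarrow> 'a step"
  show "cnj (kern x y) = kern y x"
    by (simp add: kern_step_def Bochner_Integration.integral_cnj[symmetric] cnj_cinner
        del: Bochner_Integration.integral_cnj)
  have int: "integrable lborel (\<lambda>s. \<langle>Rep_step f s, Rep_step g s\<rangle>)" for f g :: "'a step"
    by (intro integrable_step_cinner Rep_step)
  let ?v = "\<lambda>s. \<Sum>i<n. \<alpha> i *\<^sub>C Rep_step (z i) s"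
  have eq: "\<langle>?v s, ?v s\<rangle> = (\<Sum>i<n. \<Sum>j<n. cnj (\<alpha> i) * \<alpha> j * \<langle>Rep_step (z i) s, Rep_step (z j) s\<rangle>)" for s
    unfolding cinner_sum_left unfolding cinner_sum_right cinner_scaleC_left cinner_scaleC_right
    by (simp add: mult.assoc sum_distrib_left mult.left_commute)
  have "(\<Sum>i<n. \<Sum>j<n. cnj (\<alpha> i) * \<alpha> j * kern (z i) (z j)) = (\<integral>s. \<langle>?v s, ?v s\<rangle> \<partial>lborel)"
    unfolding eq kern_step_def by (simp add: int)
  also have "\<dots> = (\<integral>s. complex_of_real ((norm (?v s))\<^sup>2) \<partial>lborel)"
    unfolding cinner_self ..
  also have "\<dots> = complex_of_real (\<integral>s. (norm (?v s))\<^sup>2 \<partial>lborel)"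
    by (rule integral_complex_of_real)
  finally show "0 \<le> Re (\<Sum>i<n. \<Sum>j<n. cnj (\<alpha> i) * \<alpha> j * kern (z i) (z j))"
    by (simp del: Re_sum)
qed
end

text \<open>The space of square-integrable functions from the half-line to \<open>'k\<close>, as the completion of
  the step functions; no separability of \<open>'k\<close> is needed.\<close>

type_synonym 'k L2 = "'k step khilb"

definition L2_of :: "(real \<Rightarrow> 'k::chilbert) \<Rightarrow> 'k L2" where
  "L2_of f = kvec (Abs_step f)"

lemma cinner_L2_of:
  "f \<in> step_functions \<Longrightarrow> g \<in> step_functions \<Longrightarrow> \<langle>L2_of f, L2_of g\<rangle> = (\<integral>s. \<langle>f s, g s\<rangle> \<partial>lborel)"
  by (simp add: L2_of_def cinner_kvec kern_step_def Abs_step_inverse)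

lemma L2_of_total: "closure (cspan (L2_of ` step_functions)) = (UNIV :: 'k::chilbert L2 set)"
proof -
  have "L2_of ` step_functions = range (kvec :: 'k step \<Rightarrow> _)"
    unfolding L2_of_def by (auto simp: image_iff) (metis Rep_step Rep_step_inverse)
  then show ?thesis by (simp only: kvec_total)
qed

text \<open>The symmetric Fock space over \<open>'a\<close> is spanned by the vectors \<open>(0, \<dots>, 0, f\<^sup>\<otimes>\<^sup>n, 0, \<dots>)\<close>,
  by polarisation.\<close>

datatype 'a fock_gen = FockGen nat 'a

instantiation fock_gen :: (chilbert) psd_kernel
begin
fun kern_fock_gen :: "'a fock_gen \<Rightarrow> 'a fock_gen \<Rightarrow> complex" where
  "kern_fock_gen (FockGen n f) (FockGen m g) = (if n = m then \<langle>f, g\<rangle> ^ n else 0)"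
instance
proof
  fix n :: nat and \<alpha> :: "nat \<Rightarrow> complex" and x y :: "'a fock_gen" and z :: "nat \<Rightarrow> 'a fock_gen"
  show "cnj (kern x y) = kern y x"
    by (cases x; cases y) (simp add: cnj_cinner)
  define N where "N i = (case z i of FockGen n f \<Rightarrow> n)" for i
  define f where "f i = (case z i of FockGen n f \<Rightarrow> f)" for i
  have z: "z i = FockGen (N i) (f i)" for i
    by (cases "z i") (simp add: N_def f_def)
  define d where "d m i = (if N i = m then \<alpha> i else 0)" for m i
  have "cnj (\<alpha> i) * \<alpha> j * kern (z i) (z j) =
      (\<Sum>m\<in>N ` {..<n}. cnj (d m i) * d m j * \<langle>f i, f j\<rangle> ^ m)" if "i < n" for i j
  proof -
    have "(\<Sum>m\<in>N ` {..<n}. cnj (d m i) * d m j * \<langle>f i, f j\<rangle> ^ m) =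
        (\<Sum>m\<in>N ` {..<n}. if m = N i then cnj (\<alpha> i) * \<alpha> j * kern (z i) (z j) else 0)"
      by (intro sum.cong refl) (auto simp: d_def z)
    then show ?thesis using that by simp
  qed
  then have "(\<Sum>i<n. \<Sum>j<n. cnj (\<alpha> i) * \<alpha> j * kern (z i) (z j)) =
      (\<Sum>i<n. \<Sum>j<n. \<Sum>m\<in>N ` {..<n}. cnj (d m i) * d m j * \<langle>f i, f j\<rangle> ^ m)"
    by (intro sum.cong refl) auto
  also have "\<dots> = (\<Sum>i<n. \<Sum>m\<in>N ` {..<n}. \<Sum>j<n. cnj (d m i) * d m j * \<langle>f i, f j\<rangle> ^ m)"
    by (intro sum.cong refl sum.swap)
  also have "\<dots> = (\<Sum>m\<in>N ` {..<n}. \<Sum>i<n. \<Sum>j<n. cnj (d m i) * d m j * \<langle>f i, f j\<rangle> ^ m)"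
    by (rule sum.swap)
  finally have eq: "(\<Sum>i<n. \<Sum>j<n. cnj (\<alpha> i) * \<alpha> j * kern (z i) (z j)) =
      (\<Sum>m\<in>N ` {..<n}. \<Sum>i<n. \<Sum>j<n. cnj (d m i) * d m j * \<langle>f i, f j\<rangle> ^ m)" .
  have "0 \<le> Re (\<Sum>i<n. \<Sum>j<n. cnj (d m i) * d m j * \<langle>f i, f j\<rangle> ^ m)" for m
    by (rule psd_on_ge0, rule psd_on_power[OF finite_lessThan psd_on_cinner])
  then show "0 \<le> Re (\<Sum>i<n. \<Sum>j<n. cnj (\<alpha> i) * \<alpha> j * kern (z i) (z j))"
    unfolding eq Re_sum[of _ "N ` {..<n}"] by (rule sum_nonneg)
qed
end

type_synonym 'a fock = "'a fock_gen khilb"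

definition npart :: "nat \<Rightarrow> 'a::chilbert \<Rightarrow> 'a fock" where
  "npart n f = kvec (FockGen n f)"

lemma cinner_npart: "\<langle>npart n f, npart m g\<rangle> = (if n = m then \<langle>f, g\<rangle> ^ n else 0)"
  by (simp add: npart_def cinner_kvec)

lemma npart_total: "closure (cspan {npart n f | n f. True}) = (UNIV :: 'a::chilbert fock set)"
proof -
  have "{npart n f | n f. True} = range (kvec :: 'a fock_gen \<Rightarrow> _)"
    unfolding npart_def by (auto, metis fock_gen.exhaust)
  then show ?thesis by (simp only: kvec_total)
qed

text \<open>Normalised exponential vector of a step function.\<close>

definition coh :: "(real \<Rightarrow> 'k::chilbert) \<Rightarrow> 'k L2 fock" where
  "coh f = exp (- (norm (L2_of f))\<^sup>2 / 2) *\<^sub>R (\<Sum>n. (1 / sqrt (fact n)) *\<^sub>R npart n (L2_of f))"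

definition restr :: "real set \<Rightarrow> (real \<Rightarrow> 'k::chilbert) \<Rightarrow> real \<Rightarrow> 'k" where
  "restr J f = (\<lambda>s. if s \<in> J then f s else 0)"


section \<open>Bounded operators and the ultraweak topology\<close>

definition bounded_clinear :: "('a::chilbert \<Rightarrow> 'b::chilbert) \<Rightarrow> bool" where
  "bounded_clinear T \<longleftrightarrow> bounded_linear T \<and> (\<forall>c x. T (c *\<^sub>C x) = c *\<^sub>C T x)"

definition bops :: "('a::chilbert \<Rightarrow> 'b::chilbert) set" where
  "bops = {T. bounded_clinear T}"

definition adj :: "('a::chilbert \<Rightarrow> 'b::chilbert) \<Rightarrow> 'b \<Rightarrow> 'a" where
  "adj T = (THE S. \<forall>x y. \<langle>S y, x\<rangle> = \<langle>y, T x\<rangle>)"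

definition positive_op :: "('a::chilbert \<Rightarrow> 'a) \<Rightarrow> bool" where
  "positive_op T \<longleftrightarrow> T \<in> bops \<and> (\<forall>x. \<langle>x, T x\<rangle> \<in> \<real>\<^sub>\<ge>\<^sub>0)"

definition square_summable :: "(nat \<Rightarrow> 'a::chilbert) \<Rightarrow> bool" where
  "square_summable \<xi> \<longleftrightarrow> summable (\<lambda>n. (norm (\<xi> n))\<^sup>2)"

definition uw_topology :: "('a::chilbert \<Rightarrow> 'b::chilbert) topology" where
  "uw_topology = topology_generated_by
     {{T \<in> bops. (\<Sum>n. \<langle>\<xi> n, T (\<eta> n)\<rangle>) \<in> U} | \<xi> \<eta> U.
        square_summable \<xi> \<and> square_summable \<eta> \<and> open U}"

definition op_span :: "('a::chilbert \<Rightarrow> 'b::chilbert) set \<Rightarrow> ('a \<Rightarrow> 'b) set" where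
  "op_span S = {\<lambda>x. \<Sum>i<n. c i *\<^sub>C T i x | (n::nat) c T. \<forall>i<n. T i \<in> S}"

definition op_tensor :: "('a::chilbert \<Rightarrow> 'c::chilbert) \<Rightarrow> ('b::chilbert \<Rightarrow> 'd::chilbert) \<Rightarrow>
    ('a, 'b) tensor \<Rightarrow> ('c, 'd) tensor" where
  "op_tensor S T = (THE R. bounded_clinear R \<and> (\<forall>u v. R (u \<otimes> v) = S u \<otimes> T v))"

definition uw_tensor :: "('a::chilbert \<Rightarrow> 'a) set \<Rightarrow> ('b::chilbert \<Rightarrow> 'b) set \<Rightarrow>
    (('a, 'b) tensor \<Rightarrow> ('a, 'b) tensor) set" where
  "uw_tensor A M = uw_topology closure_of op_span {op_tensor a z | a z. a \<in> A \<and> z \<in> M}"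

text \<open>\<open>|k\<rangle> \<otimes> A\<close> (ultraweak tensor product), where \<open>|c\<rangle> \<otimes> a\<close> is the operator \<open>u \<mapsto> c \<otimes> a u\<close>
  from \<open>h\<close> to \<open>k \<otimes> h\<close>.\<close>

definition ket_uw_tensor :: "('h::chilbert \<Rightarrow> 'h) set \<Rightarrow> ('h \<Rightarrow> ('k::chilbert, 'h) tensor) set" where
  "ket_uw_tensor A = uw_topology closure_of op_span {\<lambda>u. c \<otimes> a u | c a. a \<in> A}"

definition commutant :: "('h::chilbert \<Rightarrow> 'h) set \<Rightarrow> ('h \<Rightarrow> 'h) set" where
  "commutant A = {T \<in> bops. \<forall>S\<in>A. S \<circ> T = T \<circ> S}"

definition von_neumann_algebra :: "('h::chilbert \<Rightarrow> 'h) set \<Rightarrow> bool" where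
  "von_neumann_algebra A \<longleftrightarrow>
     A \<subseteq> bops \<and> (\<forall>a\<in>A. adj a \<in> A) \<and> commutant (commutant A) = A"


section \<open>Normal and completely bounded maps\<close>

text \<open>Maps between operator algebras are total functions; only their values on the algebra matter.\<close>

definition clinear_on ::
  "('a::chilbert \<Rightarrow> 'a) set \<Rightarrow> (('a \<Rightarrow> 'a) \<Rightarrow> ('b::chilbert \<Rightarrow> 'b)) \<Rightarrow> bool" where
  "clinear_on A \<phi> \<longleftrightarrow>
     (\<forall>a\<in>A. \<forall>b\<in>A. \<forall>c. \<phi> (\<lambda>u. c *\<^sub>C a u + b u) = (\<lambda>v. c *\<^sub>C \<phi> a v + \<phi> b v))"

definition normal_map ::
  "('a::chilbert \<Rightarrow> 'a) set \<Rightarrow> ('b::chilbert \<Rightarrow> 'b) set \<Rightarrow> (('a \<Rightarrow> 'a) \<Rightarrow> ('b \<Rightarrow> 'b)) \<Rightarrow> bool" where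
  "normal_map A B \<phi> \<longleftrightarrow> clinear_on A \<phi> \<and>
     continuous_map (subtopology uw_topology A) (subtopology uw_topology B) \<phi>"

text \<open>An \<open>n \<times> n\<close> matrix of operators on \<open>h\<close> acts on \<open>h\<^sup>n\<close>; only entries with indices below \<open>n\<close>
  are used.\<close>

definition mat_norm :: "nat \<Rightarrow> (nat \<Rightarrow> nat \<Rightarrow> 'a::chilbert \<Rightarrow> 'a) \<Rightarrow> real" where
  "mat_norm n a = Sup {L2_set (\<lambda>i. norm (\<Sum>j<n. a i j (\<xi> j))) {..<n} | \<xi>.
     L2_set (\<lambda>j. norm (\<xi> j)) {..<n} \<le> 1}"

definition mat_positive :: "nat \<Rightarrow> (nat \<Rightarrow> nat \<Rightarrow> 'a::chilbert \<Rightarrow> 'a) \<Rightarrow> bool" where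
  "mat_positive n a \<longleftrightarrow> (\<forall>\<xi>. (\<Sum>i<n. \<Sum>j<n. \<langle>\<xi> i, a i j (\<xi> j)\<rangle>) \<in> \<real>\<^sub>\<ge>\<^sub>0)"

definition mats :: "nat \<Rightarrow> ('a \<Rightarrow> 'a) set \<Rightarrow> (nat \<Rightarrow> nat \<Rightarrow> 'a \<Rightarrow> 'a) set" where
  "mats n A = {a. \<forall>i<n. \<forall>j<n. a i j \<in> A}"

definition cb_norm ::
  "('a::chilbert \<Rightarrow> 'a) set \<Rightarrow> (('a \<Rightarrow> 'a) \<Rightarrow> ('b::chilbert \<Rightarrow> 'b)) \<Rightarrow> ereal" where
  "cb_norm A \<phi> = Sup {ereal (mat_norm n (\<lambda>i j. \<phi> (a i j))) | n a. a \<in> mats n A \<and> mat_norm n a \<le> 1}"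

definition completely_positive ::
  "('a::chilbert \<Rightarrow> 'a) set \<Rightarrow> (('a \<Rightarrow> 'a) \<Rightarrow> ('b::chilbert \<Rightarrow> 'b)) \<Rightarrow> bool" where
  "completely_positive A \<phi> \<longleftrightarrow>
     (\<forall>n. \<forall>a\<in>mats n A. mat_positive n a \<longrightarrow> mat_positive n (\<lambda>i j. \<phi> (a i j)))"


section \<open>Semigroups on a von Neumann algebra\<close>

definition pointwise_uw_continuous :: "('a::chilbert \<Rightarrow> 'a) set \<Rightarrow>
    (real \<Rightarrow> ('a \<Rightarrow> 'a) \<Rightarrow> ('b::chilbert \<Rightarrow> 'b)) \<Rightarrow> bool" where
  "pointwise_uw_continuous A k \<longleftrightarrow>
     (\<forall>a\<in>A. continuous_map (top_of_set {0..}) uw_topology (\<lambda>t. k t a))"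

definition normal_semigroup ::
  "('h::chilbert \<Rightarrow> 'h) set \<Rightarrow> (real \<Rightarrow> ('h \<Rightarrow> 'h) \<Rightarrow> ('h \<Rightarrow> 'h)) \<Rightarrow> bool" where
  "normal_semigroup A P \<longleftrightarrow> (\<forall>t\<ge>0. normal_map A A (P t)) \<and> (\<forall>a\<in>A. P 0 a = a) \<and>
     (\<forall>s\<ge>0. \<forall>t\<ge>0. \<forall>a\<in>A. P (s + t) a = P s (P t a)) \<and> pointwise_uw_continuous A P"

definition unital_semigroup :: "(real \<Rightarrow> ('h \<Rightarrow> 'h) \<Rightarrow> ('h \<Rightarrow> 'h::chilbert)) \<Rightarrow> bool" where
  "unital_semigroup P \<longleftrightarrow> (\<forall>t\<ge>0. P t (\<lambda>u. u) = (\<lambda>u. u))"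

definition contractive_semigroup ::
  "('h::chilbert \<Rightarrow> 'h) set \<Rightarrow> (real \<Rightarrow> ('h \<Rightarrow> 'h) \<Rightarrow> ('h \<Rightarrow> 'h)) \<Rightarrow> bool" where
  "contractive_semigroup A P \<longleftrightarrow> (\<forall>t\<ge>0. \<forall>a\<in>A. onorm (P t a) \<le> onorm a)"

definition cp_semigroup ::
  "('h::chilbert \<Rightarrow> 'h) set \<Rightarrow> (real \<Rightarrow> ('h \<Rightarrow> 'h) \<Rightarrow> ('h \<Rightarrow> 'h)) \<Rightarrow> bool" where
  "cp_semigroup A P \<longleftrightarrow> (\<forall>t\<ge>0. completely_positive A (P t))"

definition completely_quasicontractive ::
  "('h::chilbert \<Rightarrow> 'h) set \<Rightarrow> (real \<Rightarrow> ('h \<Rightarrow> 'h) \<Rightarrow> ('h \<Rightarrow> 'h)) \<Rightarrow> bool" where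
  "completely_quasicontractive A P \<longleftrightarrow>
     (\<exists>\<beta>::real. \<forall>t\<ge>0. cb_norm A (\<lambda>a u. exp (- \<beta> * t) *\<^sub>R P t a u) \<le> 1)"

definition markov_semigroup ::
  "('h::chilbert \<Rightarrow> 'h) set \<Rightarrow> (real \<Rightarrow> ('h \<Rightarrow> 'h) \<Rightarrow> ('h \<Rightarrow> 'h)) \<Rightarrow> bool" where
  "markov_semigroup A P \<longleftrightarrow> normal_semigroup A P \<and> unital_semigroup P \<and>
     (\<forall>t\<ge>0. \<forall>a\<in>A. positive_op a \<longrightarrow> positive_op (P t a))"

text \<open>\<open>weak_generator A P a b\<close>: \<open>a\<close> is in the domain of the weak*-generator, and is mapped to \<open>b\<close>.\<close>

definition weak_generator :: "('h::chilbert \<Rightarrow> 'h) set \<Rightarrow> (real \<Rightarrow> ('h \<Rightarrow> 'h) \<Rightarrow> ('h \<Rightarrow> 'h)) \<Rightarrow>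
    ('h \<Rightarrow> 'h) \<Rightarrow> ('h \<Rightarrow> 'h) \<Rightarrow> bool" where
  "weak_generator A P a b \<longleftrightarrow> a \<in> A \<and> b \<in> A \<and>
     limitin uw_topology (\<lambda>t u. (1 / t) *\<^sub>R (P t a u - a u)) b (at_right 0)"


section \<open>Quantum stochastic processes, cocycles and flows\<close>

text \<open>\<open>E_ket \<psi> = E\<^sub>\<psi>\<close> and \<open>adj (E_ket \<psi>) = E\<^sup>\<psi>\<close>, so that \<open>slice \<psi> T \<phi> = E\<^sup>\<psi> T E\<^sub>\<phi>\<close>.\<close>

definition E_ket :: "'f::chilbert \<Rightarrow> 'h::chilbert \<Rightarrow> ('h, 'f) tensor" where
  "E_ket \<psi> = (\<lambda>u. u \<otimes> \<psi>)"

definition slice :: "'f::chilbert \<Rightarrow> (('h::chilbert, 'f) tensor \<Rightarrow> ('h, 'f) tensor) \<Rightarrow> 'f \<Rightarrow> 'h \<Rightarrow> 'h" where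
  "slice \<psi> T \<phi> = adj (E_ket \<psi>) \<circ> T \<circ> E_ket \<phi>"

abbreviation vacuum :: "'k::chilbert L2 fock" where
  "vacuum \<equiv> coh (\<lambda>_. 0)"

definition vacuum_expectation ::
  "(('h::chilbert, 'k::chilbert L2 fock) tensor \<Rightarrow> ('h, 'k L2 fock) tensor) \<Rightarrow> 'h \<Rightarrow> 'h" where
  "vacuum_expectation T = slice vacuum T vacuum"

definition exp_domain :: "('h::chilbert, 'k::chilbert L2 fock) tensor set" where
  "exp_domain = cspan {u \<otimes> coh f | u f. f \<in> step_functions}"

type_synonym ('h, 'k) process = "real \<Rightarrow> ('h, 'k L2 fock) tensor \<Rightarrow> ('h, 'k L2 fock) tensor"

definition op_process :: "('h::chilbert, 'k::chilbert) process \<Rightarrow> bool" where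
  "op_process X \<longleftrightarrow>
     (\<forall>t\<ge>0. \<forall>\<zeta>\<in>exp_domain. \<forall>\<zeta>'\<in>exp_domain. \<forall>c. X t (c *\<^sub>C \<zeta> + \<zeta>') = c *\<^sub>C X t \<zeta> + X t \<zeta>') \<and>
     (\<forall>\<zeta>\<in>exp_domain. \<forall>\<xi>. (\<lambda>t. \<langle>\<xi>, X t \<zeta>\<rangle>) \<in> borel_measurable (restrict_space borel {0..})) \<and>
     (\<forall>t\<ge>0. \<forall>f\<in>step_functions. \<forall>g\<in>step_functions.
        slice (coh f) (X t) (coh g) =
          (\<lambda>u. \<langle>coh (restr {t..} f), coh (restr {t..} g)\<rangle> *\<^sub>C
            slice (coh (restr {0..<t} f)) (X t) (coh (restr {0..<t} g)) u))"

definition process_in :: "('h::chilbert \<Rightarrow> 'h) set \<Rightarrow> ('h, 'k::chilbert) process \<Rightarrow> bool" where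
  "process_in A X \<longleftrightarrow> op_process X \<and>
     (\<forall>t\<ge>0. \<forall>f\<in>step_functions. \<forall>g\<in>step_functions. slice (coh f) (X t) (coh g) \<in> A)"

type_synonym ('h, 'k) map_process =
  "real \<Rightarrow> ('h \<Rightarrow> 'h) \<Rightarrow> ('h, 'k L2 fock) tensor \<Rightarrow> ('h, 'k L2 fock) tensor"

definition process_on :: "('h::chilbert \<Rightarrow> 'h) set \<Rightarrow> ('h, 'k::chilbert) map_process \<Rightarrow> bool" where
  "process_on A k \<longleftrightarrow> (\<forall>a\<in>A. process_in A (\<lambda>t. k t a)) \<and>
     (\<forall>t\<ge>0. \<forall>a\<in>A. \<forall>b\<in>A. \<forall>c. \<forall>\<zeta>\<in>exp_domain.
        k t (\<lambda>u. c *\<^sub>C a u + b u) \<zeta> = c *\<^sub>C k t a \<zeta> + k t b \<zeta>)"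

text \<open>The operators \<open>k\<^sub>t(a)\<close> of a completely bounded process are bounded, and are identified with
  their continuous extensions to the whole Hilbert space.\<close>

definition normal_cb_process ::
  "('h::chilbert \<Rightarrow> 'h) set \<Rightarrow> ('h, 'k::chilbert) map_process \<Rightarrow> bool" where
  "normal_cb_process A k \<longleftrightarrow> process_on A k \<and>
     (\<forall>t\<ge>0. normal_map A (uw_tensor A bops) (k t) \<and> cb_norm A (k t) < \<infinity>)"

text \<open>For a subinterval \<open>J\<close> of the half-line, the Fock space over \<open>L2(J; k)\<close> is realised as a closed
  subspace of the full Fock space, and its bounded operators as the corner of the operators that
  live on that subspace; \<open>fock_id J\<close> is the identity of the corner. The factorisation of the Fock
  space at \<open>r\<close> identifies \<open>coh f\<close> with \<open>coh (restr {0..<r} f) \<otimes> coh (restr {r..} f)\<close>, and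
  \<open>split_tensor r X z\<close> is the operator on \<open>h \<otimes> \<F>\<close> which corresponds to \<open>X \<otimes> z\<close>.\<close>

definition fock_sub :: "real set \<Rightarrow> 'k::chilbert L2 fock set" where
  "fock_sub J = closure (cspan {npart n (L2_of f) | n f. f \<in> step_functions \<and> (\<forall>s. s \<notin> J \<longrightarrow> f s = 0)})"

definition fock_ops :: "real set \<Rightarrow> ('k::chilbert L2 fock \<Rightarrow> 'k L2 fock) set" where
  "fock_ops J = {z \<in> bops. range z \<subseteq> fock_sub J \<and>
     (\<forall>\<psi>. (\<forall>\<phi>\<in>fock_sub J. \<langle>\<phi>, \<psi>\<rangle> = 0) \<longrightarrow> z \<psi> = 0)}"

definition fock_id :: "real set \<Rightarrow> 'k::chilbert L2 fock \<Rightarrow> 'k L2 fock" where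
  "fock_id J = (THE p. p \<in> fock_ops J \<and> (\<forall>\<psi>\<in>fock_sub J. p \<psi> = \<psi>))"

definition split_tensor ::
  "real \<Rightarrow> (('h::chilbert, 'k::chilbert L2 fock) tensor \<Rightarrow> ('h, 'k L2 fock) tensor) \<Rightarrow>
    ('k L2 fock \<Rightarrow> 'k L2 fock) \<Rightarrow> ('h, 'k L2 fock) tensor \<Rightarrow> ('h, 'k L2 fock) tensor" where
  "split_tensor r X z = (THE Y. Y \<in> bops \<and> (\<forall>u v. \<forall>f\<in>step_functions. \<forall>g\<in>step_functions.
     \<langle>u \<otimes> coh f, Y (v \<otimes> coh g)\<rangle> =
       \<langle>u \<otimes> coh (restr {0..<r} f), X (v \<otimes> coh (restr {0..<r} g))\<rangle> *
       \<langle>coh (restr {r..} f), z (coh (restr {r..} g))\<rangle>))"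

text \<open>The map with \<open>k\<^sub>r(a) = k_low A k r a \<otimes> I\<close>, and its ampliation.\<close>

definition k_low :: "('h::chilbert \<Rightarrow> 'h) set \<Rightarrow> ('h, 'k::chilbert) map_process \<Rightarrow> ('h, 'k) map_process" where
  "k_low A k r a = (THE X. X \<in> uw_tensor A (fock_ops {0..<r}) \<and>
     split_tensor r X (fock_id {r..}) = k r a)"

definition k_hat :: "('h::chilbert \<Rightarrow> 'h) set \<Rightarrow> ('h, 'k::chilbert) map_process \<Rightarrow> real \<Rightarrow>
    (('h, 'k L2 fock) tensor \<Rightarrow> ('h, 'k L2 fock) tensor) \<Rightarrow>
    ('h, 'k L2 fock) tensor \<Rightarrow> ('h, 'k L2 fock) tensor" where
  "k_hat A k r = (SOME K. normal_map (uw_tensor A (fock_ops {r..})) (uw_tensor A bops) K \<and>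
     (\<forall>a\<in>A. \<forall>z\<in>fock_ops {r..}. K (op_tensor a z) = split_tensor r (k_low A k r a) z))"

text \<open>\<open>T\<^sub>r\<close>, regarded as an isometry of the full Fock space with range \<open>fock_sub {r..}\<close>; then
  \<open>a \<otimes> T\<^sub>r z T\<^sub>r\<^sup>* = (I \<otimes> T\<^sub>r) (a \<otimes> z) (I \<otimes> T\<^sub>r)\<^sup>*\<close>.\<close>

definition fock_shift :: "real \<Rightarrow> 'k::chilbert L2 fock \<Rightarrow> 'k L2 fock" where
  "fock_shift r = (THE V. V \<in> bops \<and>
     (\<forall>f\<in>step_functions. V (coh f) = coh (\<lambda>s. if r \<le> s then f (s - r) else 0)))"

definition shift_endo :: "real \<Rightarrow> (('h::chilbert, 'k::chilbert L2 fock) tensor \<Rightarrow> ('h, 'k L2 fock) tensor) \<Rightarrow>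
    ('h, 'k L2 fock) tensor \<Rightarrow> ('h, 'k L2 fock) tensor" where
  "shift_endo r T =
     op_tensor (\<lambda>u. u) (fock_shift r) \<circ> T \<circ> adj (op_tensor (\<lambda>u. u) (fock_shift r))"

definition qs_cocycle :: "('h::chilbert \<Rightarrow> 'h) set \<Rightarrow> ('h, 'k::chilbert) map_process \<Rightarrow> bool" where
  "qs_cocycle A k \<longleftrightarrow> normal_cb_process A k \<and> (\<forall>a\<in>A. k 0 a = op_tensor a (\<lambda>\<psi>. \<psi>)) \<and>
     (\<forall>r\<ge>0. \<forall>t\<ge>0. \<forall>a\<in>A. k (r + t) a = k_hat A k r (shift_endo r (k t a)))"

definition qs_flow :: "('h::chilbert \<Rightarrow> 'h) set \<Rightarrow> ('h, 'k::chilbert) map_process \<Rightarrow> bool" where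
  "qs_flow A j \<longleftrightarrow> qs_cocycle A j \<and> pointwise_uw_continuous A j \<and>
     (\<forall>t\<ge>0. \<forall>a\<in>A. \<forall>b\<in>A. j t (a \<circ> b) = j t a \<circ> j t b) \<and>
     (\<forall>t\<ge>0. \<forall>a\<in>A. j t (adj a) = adj (j t a)) \<and>
     (\<forall>t\<ge>0. j t (\<lambda>u. u) = (\<lambda>\<xi>. \<xi>))"


section \<open>The ultraweak stochastic derivative\<close>

definition one_particle_iso :: "real \<Rightarrow> ('k::chilbert, 'h::chilbert) tensor \<Rightarrow> ('h, 'k L2 fock) tensor" where
  "one_particle_iso t = (THE V. V \<in> bops \<and>
     (\<forall>c u. V (c \<otimes> u) = u \<otimes> npart 1 (t powr (-1/2) *\<^sub>R L2_of (restr {0..<t} (\<lambda>_. c)))))"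

text \<open>Operators on \<open>(\<complex> \<oplus> k) \<otimes> h\<close> act on the identified space \<open>h \<oplus> (k \<otimes> h)\<close>.\<close>

definition theta_t :: "('h::chilbert, 'k::chilbert) map_process \<Rightarrow> real \<Rightarrow> ('h \<Rightarrow> 'h) \<Rightarrow>
    'h \<times> ('k, 'h) tensor \<Rightarrow> 'h \<times> ('k, 'h) tensor" where
  "theta_t j t a =
     (\<lambda>\<xi>. (t powr (-1/2) *\<^sub>R adj (E_ket vacuum) \<xi>, adj (one_particle_iso t) \<xi>)) \<circ>
     (\<lambda>\<xi>. j t a \<xi> - op_tensor a (\<lambda>\<psi>. \<psi>) \<xi>) \<circ>
     (\<lambda>(u, \<zeta>). t powr (-1/2) *\<^sub>R E_ket vacuum u + one_particle_iso t \<zeta>)"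

definition theta_dom :: "('h::chilbert \<Rightarrow> 'h) set \<Rightarrow> ('h, 'k::chilbert) map_process \<Rightarrow> ('h \<Rightarrow> 'h) set" where
  "theta_dom A j = {x \<in> A. \<exists>L. limitin uw_topology (\<lambda>t. theta_t j t x) L (at_right 0)}"

definition theta :: "('h::chilbert, 'k::chilbert) map_process \<Rightarrow> ('h \<Rightarrow> 'h) \<Rightarrow>
    'h \<times> ('k, 'h) tensor \<Rightarrow> 'h \<times> ('k, 'h) tensor" where
  "theta j x = (THE L. limitin uw_topology (\<lambda>t. theta_t j t x) L (at_right 0))"

definition theta_L :: "('h::chilbert, 'k::chilbert) map_process \<Rightarrow> ('h \<Rightarrow> 'h) \<Rightarrow> 'h \<Rightarrow> 'h" where
  "theta_L j x = (\<lambda>u. fst (theta j x (u, 0)))"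

definition theta_delta :: "('h::chilbert, 'k::chilbert) map_process \<Rightarrow> ('h \<Rightarrow> 'h) \<Rightarrow> 'h \<Rightarrow> ('k, 'h) tensor" where
  "theta_delta j x = (\<lambda>u. snd (theta j x (u, 0)))"

definition theta_delta_dag :: "('h::chilbert, 'k::chilbert) map_process \<Rightarrow> ('h \<Rightarrow> 'h) \<Rightarrow> ('k, 'h) tensor \<Rightarrow> 'h" where
  "theta_delta_dag j x = adj (theta_delta j (adj x))"

text \<open>The lower right block of \<open>\<theta>(x)\<close> is \<open>\<pi>(x) - I \<otimes> x\<close>.\<close>

definition theta_pi :: "('h::chilbert, 'k::chilbert) map_process \<Rightarrow> ('h \<Rightarrow> 'h) \<Rightarrow>
    ('k, 'h) tensor \<Rightarrow> ('k, 'h) tensor" where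
  "theta_pi j x = (\<lambda>\<zeta>. snd (theta j x (0, \<zeta>)) + op_tensor (\<lambda>c. c) x \<zeta>)"

end

theory Submission
  imports Defs
begin

text \<open>For \<open>h > 0\<close> let \<open>W\<^sub>i(h) = E\<^bsub>vacuum\<^esub> (1 + h k\<^sub>i) + l\<^sub>i \<otimes> 1\<^sub>[\<^sub>0\<^sub>,\<^sub>h\<^sub>)\<close>, where the second summand has values in
  the one-particle space. The map \<open>S\<^sub>h(a) = W\<^sub>1(h)\<^sup>* j\<^sub>h(a) W\<^sub>2(h)\<close> leaves \<open>A\<close> invariant, and \<open>(S\<^sub>h(x) - x) / h\<close> tends to
  the perturbed generator at \<open>x\<close> by the very definition of the stochastic derivative. By the cocycle
  identity the power \<open>S\<^sub>h\<^sup>n(a)\<close> is the compression of \<open>j\<^bsub>nh\<^esub>(a)\<close> by the \<open>n\<close>-th points of the Euler polygons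
  of the equations \<open>dX\<^sub>i = j(k\<^sub>i) X\<^sub>i dt + dA\<^sup>*(j(l\<^sub>i) X\<^sub>i)\<close>, which start in the vacuum. The polygons
  converge along dyadic step sizes, so \<open>P\<^sub>t(a) = X\<^sub>1(t)\<^sup>* j\<^sub>t(a) X\<^sub>2(t)\<close> is a semigroup; bounds on
  \<open>W\<^sub>i(h)\<^sup>* W\<^sub>i(h)\<close> give its contractivity and complete quasicontractivity, and complete positivity is
  clear if \<open>X\<^sub>1 = X\<^sub>2\<close>. For the generator, \<open>P\<^sub>t(x) - x\<close> is a limit of Riemann sums of \<open>P\<^sub>s((S\<^sub>h(x) - x) / h)\<close>.
  The ampliations of \<open>j\<^sub>t\<close> come from the structure of normal representations: \<open>j\<^sub>t\<close> is a
  subrepresentation of \<open>a \<mapsto> a \<otimes> 1\<close>.\<close>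

section \<open>Bounded operators between Hilbert spaces\<close>

text \<open>What shapes the argument is that composition is not jointly continuous for the ultraweak
  topology, so the powers of \<open>S\<close> cannot be controlled factor by factor. Every limit is
  arranged as a bounded, weakly convergent operator between two norm convergent vectors; this is why
  the vectors \<open>X\<close> are constructed at all. The columns \<open>W\<close> have their
  values exactly among the vectors by which \<open>theta_t\<close> compresses, up to the factor
  \<open>sqrt h\<close>. Hence \<open>x \<in> theta_dom A j\<close> gives the convergence of the
  difference quotients of \<open>S\<close>, but only weakly. The space \<open>k\<close> may be
  nonseparable and \<open>j\<close> is merely continuous in time, so the stochastic integral is
  built from Riemann sums, with the orthogonality of future one-particle increments to the past as
  its only probabilistic input. The ampliation in the cocycle identity is specified by normality and
  by its values on elementary tensors, so it must be shown to exist and to be determined by these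
  data before the identity can be used. Statements at arbitrary times are reached from dyadic ones
  by continuity.\<close>

lemma cinner_diff_left: "\<langle>x - y, z\<rangle> = \<langle>x, z\<rangle> - \<langle>y, z\<rangle>"
 by (metis cinner_diff_right cnj_cinner complex_cnj_diff)

lemma cinner_scaleR_right: "\<langle>x, r *\<^sub>R y\<rangle> = complex_of_real r * \<langle>x, y\<rangle>"
 by (metis scaleC_of_real cinner_scaleC_right)

lemma cinner_scaleR_left: "\<langle>r *\<^sub>R x, y\<rangle> = complex_of_real r * \<langle>x, y\<rangle>"
 by (metis scaleC_of_real cinner_scaleC_left complex_cnj_complex_of_real)

lemma scaleC_zero_right [simp]: "c *\<^sub>C (0::'a::chilbert) = 0"
 using scaleC_add_right[of c "0::'a" 0] by simp

lemma scaleC_zero_left [simp]: "0 *\<^sub>C (x::'a::chilbert) = 0"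
 using scaleC_of_real[of 0 x] by simp

lemma scaleC_one [simp]: "1 *\<^sub>C (x::'a::chilbert) = x"
 using scaleC_of_real[of 1 x] by simp

lemma scaleC_minus_one [simp]: "(-1) *\<^sub>C (x::'a::chilbert) = - x"
 using scaleC_of_real[of "-1" x] by simp

lemma scaleC_minus_right: "c *\<^sub>C (- x::'a::chilbert) = - (c *\<^sub>C x)"
 by (metis scaleC_minus_one scaleC_scaleC mult.commute)

lemma scaleC_diff_right: "c *\<^sub>C (x - y::'a::chilbert) = c *\<^sub>C x - c *\<^sub>C y"
 using scaleC_add_right[of c x "- y"] by (simp add: scaleC_minus_right)

lemma scaleC_scaleR: "c *\<^sub>C (r *\<^sub>R (x::'a::chilbert)) = r *\<^sub>R (c *\<^sub>C x)"
 unfolding scaleC_of_real[symmetric] scaleC_scaleC by (simp add: mult.commute)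

lemma scaleC_sum_right: "c *\<^sub>C (\<Sum>i\<in>I. f i) = (\<Sum>i\<in>I. c *\<^sub>C (f i::'a::chilbert))"
 by (induction I rule: infinite_finite_induct) (auto simp: scaleC_add_right)

lemma Re_cinner_self: "Re \<langle>x, x\<rangle> = (norm x)\<^sup>2"
 by (simp add: cinner_self)

lemma norm_scaleC: "norm (c *\<^sub>C (x::'a::chilbert)) = cmod c * norm x"
proof -
 have "complex_of_real ((norm (c *\<^sub>C x))\<^sup>2) = complex_of_real ((cmod c * norm x)\<^sup>2)"
  unfolding cinner_self[symmetric] cinner_scaleC_left cinner_scaleC_right
  unfolding cinner_self power_mult_distrib of_real_mult complex_norm_square by simp
 then have "(norm (c *\<^sub>C x))\<^sup>2 = (cmod c * norm x)\<^sup>2" by (simp only: of_real_eq_iff)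
 then show ?thesis by (rule power2_eq_imp_eq) auto
qed

text \<open>Rotating \<open>y\<close> by the phase of the inner product makes the product real and
  nonnegative, and the real Cauchy-Schwarz inequality applies.\<close>

lemma cinner_CS: "cmod \<langle>x, y\<rangle> <= norm x * norm (y::'a::chilbert)"
proof (cases "\<langle>x, y\<rangle> = 0")
 case False
 define c where "c = cnj \<langle>x, y\<rangle> / cmod \<langle>x, y\<rangle>"
 have "c * \<langle>x, y\<rangle> = complex_of_real ((cmod \<langle>x, y\<rangle>)\<^sup>2) / cmod \<langle>x, y\<rangle>"
  unfolding complex_norm_square c_def by (simp add: mult.commute)
 also have "\<dots> = complex_of_real (cmod \<langle>x, y\<rangle>)"
  using False by (simp add: power2_eq_square)
 finally have "c * \<langle>x, y\<rangle> = complex_of_real (cmod \<langle>x, y\<rangle>)" .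
 then have "cmod \<langle>x, y\<rangle> = Re \<langle>x, c *\<^sub>C y\<rangle>"
  by (simp add: cinner_scaleC_right)
 also have "\<dots> <= norm x * norm (c *\<^sub>C y)"
  unfolding Re_cinner by (rule norm_cauchy_schwarz)
 also have "norm (c *\<^sub>C y) = norm y"
  using False by (simp add: norm_scaleC c_def norm_divide)
 finally show ?thesis .
qed simp

lemma cinner_ext:
 assumes "!!x. \<langle>x, y\<rangle> = \<langle>x, z\<rangle>" shows "y = (z::'a::chilbert)"
proof -
 have "\<langle>y - z, y - z\<rangle> = 0"
  by (simp add: cinner_diff_right assms)
 then show ?thesis by (simp add: cinner_self)
qed

lemma cinner_ext_left:
 assumes "!!x. \<langle>y, x\<rangle> = \<langle>z, x\<rangle>" shows "y = (z::'a::chilbert)"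
 by (rule cinner_ext) (metis assms cnj_cinner)

lemma bounded_bilinear_cinner: "bounded_bilinear (cinner :: 'a::chilbert => 'a => complex)"
proof
 show "\<exists>K. \<forall>a b. cmod \<langle>a, b::'a\<rangle> <= norm a * norm b * K"
  by (rule exI[of _ 1]) (simp add: cinner_CS)
qed (auto simp: cinner_add_left cinner_add_right cinner_scaleR_left cinner_scaleR_right
   scaleR_conv_of_real)

lemmas tendsto_cinner [tendsto_intros] = bounded_bilinear.tendsto[OF bounded_bilinear_cinner]
lemmas continuous_on_cinner [continuous_intros] =
 bounded_bilinear.continuous_on[OF bounded_bilinear_cinner]

lemma norm_power2_add: "(norm (x + y))\<^sup>2 = (norm x)\<^sup>2 + (norm y)\<^sup>2 + 2 * Re \<langle>x, y::'a::chilbert\<rangle>"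
 by (simp add: Re_cinner power2_norm_eq_inner inner_add_left inner_add_right inner_commute)

lemma norm_power2_diff: "(norm (x - y))\<^sup>2 = (norm x)\<^sup>2 + (norm y)\<^sup>2 - 2 * Re \<langle>x, y::'a::chilbert\<rangle>"
 by (simp add: Re_cinner power2_norm_eq_inner inner_diff_left inner_diff_right inner_commute)

lemma bopsI:
 assumes "!!x y. T (x + y) = T x + T y" "!!c x. T (c *\<^sub>C x) = c *\<^sub>C T x"
  "!!x. norm (T x) <= K * norm x"
 shows "T \<in> bops"
proof -
 have "bounded_linear T"
  by (rule bounded_linear_intro[of _ K])
    (auto simp: assms(1) assms(2)[of "complex_of_real _", unfolded scaleC_of_real]
     assms(3)[unfolded mult.commute[of K]])
 then show ?thesis using assms(2) by (auto simp: bops_def bounded_clinear_def)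
qed

lemma bops_bounded_linear: "T \<in> bops ==> bounded_linear T"
 by (simp add: bops_def bounded_clinear_def)

lemma bops_add: "T \<in> bops ==> T (x + y) = T x + T y"
 by (simp add: bops_bounded_linear linear_simps)

lemma bops_scaleC: "T \<in> bops ==> T (c *\<^sub>C x) = c *\<^sub>C T x"
 by (simp add: bops_def bounded_clinear_def)

lemma bops_scaleR: "T \<in> bops ==> T (r *\<^sub>R x) = r *\<^sub>R T x"
 using bops_scaleC[of T "complex_of_real r"] by (simp add: scaleC_of_real)

lemma bops_0: "T \<in> bops ==> T 0 = 0"
 using bops_scaleR[of T 0 0] by simp

lemma bops_minus: "T \<in> bops ==> T (- x) = - T x"
 using bops_scaleR[of T "-1" x] by simp

lemma bops_diff: "T \<in> bops ==> T (x - y) = T x - T y"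
 using bops_add[of T x "- y"] by (simp add: bops_minus)

lemma bops_sum: "T \<in> bops ==> T (\<Sum>i\<in>I. f i) = (\<Sum>i\<in>I. T (f i))"
 by (induction I rule: infinite_finite_induct) (auto simp: bops_0 bops_add)

lemma bops_onorm: "T \<in> bops ==> norm (T x) <= onorm T * norm x"
 by (rule onorm) (rule bops_bounded_linear)

lemma onorm_ge0: "T \<in> bops ==> 0 <= onorm T"
 by (rule onorm_pos_le) (rule bops_bounded_linear)

lemma bops_tendsto: "T \<in> bops ==> (f \<longlongrightarrow> l) F ==> ((%x. T (f x)) \<longlongrightarrow> T l) F"
 by (rule bounded_linear.tendsto[OF bops_bounded_linear])

lemma bops_continuous_on: "T \<in> bops ==> continuous_on S f ==> continuous_on S (%x. T (f x))"
 by (rule bounded_linear.continuous_on[OF bops_bounded_linear])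

lemma bops_id [simp]: "(%x. x) \<in> bops"
 by (rule bopsI[of _ 1]) auto

lemma bops_zero_op [simp]: "(%x. 0) \<in> bops"
 by (rule bopsI[of _ 0]) auto

lemma bops_comp:
 assumes "S \<in> bops" "T \<in> bops" shows "(%x. S (T x)) \<in> bops"
proof (rule bopsI)
 show "norm (S (T x)) <= (onorm S * onorm T) * norm x" for x
  using bops_onorm[OF assms(1), of "T x"] bops_onorm[OF assms(2), of x] onorm_ge0[OF assms(1)]
  by (metis mult.assoc mult_left_mono order_trans)
qed (use assms in \<open>auto simp: bops_add bops_scaleC\<close>)

lemma bops_plus:
 assumes "S \<in> bops" "T \<in> bops" shows "(%x. S x + T x) \<in> bops"
proof (rule bopsI)
 show "norm (S x + T x) <= (onorm S + onorm T) * norm x" for x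
  using bops_onorm[OF assms(1), of x] bops_onorm[OF assms(2), of x] norm_triangle_ineq[of "S x" "T x"]
  by (simp add: distrib_right)
qed (use assms in \<open>auto simp: bops_add bops_scaleC scaleC_add_right\<close>)

lemma bops_cscale:
 assumes "T \<in> bops" shows "(%x. c *\<^sub>C T x) \<in> bops"
proof (rule bopsI)
 show "norm (c *\<^sub>C T x) <= (cmod c * onorm T) * norm x" for x
  using bops_onorm[OF assms(1), of x] by (simp add: norm_scaleC mult.assoc mult_left_mono)
qed (use assms in \<open>auto simp: bops_add bops_scaleC scaleC_add_right scaleC_scaleC mult.commute\<close>)

lemma bops_rscale: "T \<in> bops ==> (%x. r *\<^sub>R T x) \<in> bops"
 using bops_cscale[of T "complex_of_real r"] by (simp add: scaleC_of_real)

lemma bops_uminus: "T \<in> bops ==> (%x. - T x) \<in> bops"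
 using bops_rscale[of T "-1"] by simp

lemma bops_minus_op: "S \<in> bops ==> T \<in> bops ==> (%x. S x - T x) \<in> bops"
 using bops_plus[OF _ bops_uminus, of S T] by simp

lemma bops_sum_op: "(!!i. i \<in> I ==> T i \<in> bops) ==> (%x. \<Sum>i\<in>I. T i x) \<in> bops"
 by (induction I rule: infinite_finite_induct) (auto intro: bops_plus)

lemma bops_cinner_bound: "T \<in> bops ==> cmod \<langle>x, T y\<rangle> <= onorm T * norm x * norm y"
 using order_trans[OF cinner_CS mult_left_mono[OF bops_onorm norm_ge_zero]]
 by (simp add: mult_ac)

section \<open>Riesz representation and adjoints\<close>

text \<open>The functional \<open>F x = (norm x)\<^sup>2 - 2 * g x\<close> is minimised on
  \<open>M\<close>: the parallelogram law makes a minimising sequence Cauchy, and the first-order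
  condition at the minimiser is the representation. Taking \<open>M = UNIV\<close> yields the Riesz
  theorem, taking \<open>g = inner x\<close> yields the orthogonal projection of \<open>x\<close> to
  \<open>M\<close>.\<close>

lemma riesz_subspace:
 fixes M :: "'a::{real_inner, complete_space} set" and g :: "'a => real"
 assumes M: "0 \<in> M" "!!x y. x \<in> M ==> y \<in> M ==> x + y \<in> M" "!!r x. x \<in> M ==> r *\<^sub>R x \<in> M" "closed M"
  and g: "bounded_linear g"
 shows "\<exists>z\<in>M. \<forall>x\<in>M. g x = inner z x"
proof -
 interpret g: bounded_linear g by fact
 define F where "F x = (norm x)\<^sup>2 - 2 * g x" for x
 obtain K where K: "!!x. \<bar>g x\<bar> <= norm x * K" using g.bounded by (auto simp: real_norm_def)
 have lower: "- K\<^sup>2 <= F x" for x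
 proof -
  have "0 <= (norm x - K)\<^sup>2" by simp
  then show ?thesis using K[of x] unfolding F_def by (simp add: power2_diff)
 qed
 define m where "m = Inf (F ` M)"
 have bdd: "bdd_below (F ` M)" using lower by (intro bdd_belowI2)
 have mle: "m <= F x" if "x \<in> M" for x
  unfolding m_def by (rule cInf_lower[OF _ bdd]) (use that in auto)
 have "\<exists>x\<in>M. F x < m + 1 / (Suc n)" for n
 proof -
  have "Inf (F ` M) < m + 1 / (Suc n)" by (simp add: m_def)
  then show ?thesis using cInf_lessD[of "F ` M"] M(1) by blast
 qed
 then obtain X where X: "!!n. X n \<in> M" "!!n. F (X n) < m + 1 / (Suc n)" by metis
 have par: "(norm (x - y))\<^sup>2 = 2 * F x + 2 * F y - 4 * F ((1/2) *\<^sub>R (x + y))" for x y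
  unfolding F_def g.scaleR g.add power2_norm_eq_inner
  by (simp add: inner_add_left inner_add_right inner_diff_left inner_diff_right inner_commute field_simps)
 have est: "(norm (X i - X j))\<^sup>2 <= 2 * (1 / Suc i) + 2 * (1 / Suc j)" for i j
  using X(2)[of i] X(2)[of j] mle[OF M(3)[OF M(2)[OF X(1)[of i] X(1)[of j]]], of "1/2"]
  unfolding par by linarith
 have "Cauchy X"
 proof (rule CauchyI)
  fix e :: real assume "e > 0"
  then obtain N where N: "4 / e\<^sup>2 < real N" using reals_Archimedean2 by blast
  have "norm (X i - X j) < e" if "i \<ge> N" "j \<ge> N" for i j
  proof -
   have "N > 0"
   proof (rule ccontr)
    assume "\<not> N > 0"
    then have "4 / e\<^sup>2 < 0" using N by simp
    then show False using \<open>e > 0\<close> by (simp add: divide_less_0_iff power2_less_0)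
   qed
   have "1 / Suc i <= 1 / real N" "1 / Suc j <= 1 / real N"
    using that \<open>N > 0\<close> by (auto intro!: divide_left_mono)
   then have "(norm (X i - X j))\<^sup>2 <= 4 * (1 / real N)" using est[of i j] by linarith
   then have "(norm (X i - X j))\<^sup>2 <= 4 / real N" by simp
   also have "\<dots> < e\<^sup>2" using N \<open>e > 0\<close> \<open>N > 0\<close> by (simp add: field_simps)
   finally show ?thesis by (rule power2_less_imp_less) (use \<open>e > 0\<close> in auto)
  qed
  then show "\<exists>N. \<forall>i\<ge>N. \<forall>j\<ge>N. norm (X i - X j) < e" by blast
 qed
 then obtain z where z: "X \<longlonglongrightarrow> z" using Cauchy_convergent convergent_def by blast
 have zM: "z \<in> M" by (rule closed_sequentially[OF M(4) _ z]) (use X in auto)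
 have "(%n. F (X n)) \<longlonglongrightarrow> F z" unfolding F_def by (intro tendsto_intros g.tendsto z)
 moreover have "(%n. m + 1 / (Suc n)) \<longlonglongrightarrow> m + 0"
  by (intro tendsto_intros LIMSEQ_Suc[OF lim_1_over_n])
 ultimately have "F z <= m + 0"
  by (rule LIMSEQ_le) (use X(2) in \<open>auto intro: less_imp_le\<close>)
 then have Fz: "F z <= F x" if "x \<in> M" for x using mle[OF that] by simp
 have "g x = inner z x" if x: "x \<in> M" for x
 proof -
  define d where "d = inner z x - g x"
  have q: "0 <= 2 * t * d + t\<^sup>2 * (norm x)\<^sup>2" for t
  proof -
   have "F z <= F (z + t *\<^sub>R x)" by (intro Fz M zM x)
   then show ?thesis unfolding F_def d_def power2_norm_eq_inner g.add g.scaleR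
    by (simp add: inner_add_left inner_add_right inner_commute algebra_simps power2_eq_square)
  qed
  have "d = 0"
  proof (rule ccontr)
   assume "d \<noteq> 0"
   \<comment> \<open>A displacement by \<open>- s * d\<close> lowers the linear term by
     \<open>2 * s * d\<^sup>2\<close>, while this \<open>s\<close> keeps the quadratic term below
     \<open>s * d\<^sup>2\<close>.\<close>
   define s where "s = 1 / ((norm x)\<^sup>2 + 1)"
   have p: "(norm x)\<^sup>2 + 1 > 0" by (intro add_nonneg_pos) auto
   then have s: "s > 0" "s * (norm x)\<^sup>2 <= 1" by (simp_all add: s_def)
   have "0 <= 2 * (- s * d) * d + (- s * d)\<^sup>2 * (norm x)\<^sup>2" by (rule q)
   also have "\<dots> = s * d\<^sup>2 * (s * (norm x)\<^sup>2 - 2)" by (simp add: power2_eq_square algebra_simps)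
   also have "\<dots> < 0" using s \<open>d \<noteq> 0\<close> by (intro mult_pos_neg mult_pos_pos) auto
   finally show False by simp
  qed
  then show ?thesis by (simp add: d_def)
 qed
 then show ?thesis using zM by blast
qed

text \<open>The real part is represented by the real version; evaluating it at
  \<open>\<i> *\<^sub>C x\<close> recovers the imaginary part.\<close>

lemma riesz:
 fixes f :: "'a::chilbert => complex"
 assumes "!!x y. f (x + y) = f x + f y" "!!c x. f (c *\<^sub>C x) = c * f x" "!!x. cmod (f x) <= K * norm x"
 shows "\<exists>z. \<forall>x. f x = \<langle>z, x\<rangle>"
proof -
 have "bounded_linear (%x. Re (f x))"
 proof (rule bounded_linear_intro[of _ K])
  show "Re (f (r *\<^sub>R x)) = r *\<^sub>R Re (f x)" for r x
   using assms(2)[of "complex_of_real r" x] by (simp add: scaleC_of_real)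
  show "norm (Re (f x)) <= norm x * K" for x
   using assms(3)[of x] abs_Re_le_cmod[of "f x"] by (simp add: mult.commute)
 qed (simp add: assms(1))
 then obtain z where z: "!!x. Re (f x) = inner z x"
  using riesz_subspace[of UNIV "%x. Re (f x)"] by auto
 have "f x = \<langle>z, x\<rangle>" for x
 proof (rule complex_eqI)
  show "Re (f x) = Re \<langle>z, x\<rangle>" by (simp add: z Re_cinner)
  have "Re (f (\<i> *\<^sub>C x)) = Re \<langle>z, \<i> *\<^sub>C x\<rangle>" by (simp add: z Re_cinner)
  then show "Im (f x) = Im \<langle>z, x\<rangle>" by (simp add: assms(2) cinner_scaleC_right)
 qed
 then show ?thesis by blast
qed

lemma adj_eqI:
 assumes "!!x y. \<langle>S y, x\<rangle> = \<langle>y, T x\<rangle>" shows "adj T = S"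
 unfolding adj_def
proof (rule the_equality)
 fix S' assume "\<forall>x y. \<langle>S' y, x\<rangle> = \<langle>y, T x\<rangle>"
 then show "S' = S" using assms by (intro ext) (rule cinner_ext_left, simp)
qed (use assms in simp)

lemma adj_cinner:
 assumes "T \<in> bops" shows "\<langle>adj T y, x\<rangle> = \<langle>y, T x\<rangle>"
proof -
 have "\<exists>z. \<forall>x. \<langle>y, T x\<rangle> = \<langle>z, x\<rangle>" for y
 proof (rule riesz)
  show "cmod \<langle>y, T x\<rangle> <= (onorm T * norm y) * norm x" for x
   using bops_cinner_bound[OF assms, of y x] by (simp add: mult_ac)
 qed (use assms in \<open>auto simp: bops_add bops_scaleC cinner_add_right cinner_scaleC_right\<close>)
 then obtain S where S: "!!y x. \<langle>y, T x\<rangle> = \<langle>S y, x\<rangle>" by metis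
 then have "adj T = S" by (intro adj_eqI) simp
 then show ?thesis by (simp add: S)
qed

lemma adj_cinner': "T \<in> bops ==> \<langle>x, adj T y\<rangle> = \<langle>T x, y\<rangle>"
 by (metis adj_cinner cnj_cinner)

lemma norm_adj_le:
 assumes "T \<in> bops" "!!x. norm (T x) <= K * norm x" "0 <= K"
 shows "norm (adj T y) <= K * norm y"
proof (cases "adj T y = 0")
 case False
 have "(norm (adj T y))\<^sup>2 = Re \<langle>y, T (adj T y)\<rangle>"
  by (simp add: Re_cinner_self[symmetric] adj_cinner[OF assms(1)])
 also have "\<dots> <= norm y * norm (T (adj T y))" unfolding Re_cinner by (rule norm_cauchy_schwarz)
 also have "\<dots> <= norm y * (K * norm (adj T y))" by (intro mult_left_mono assms) auto
 finally show ?thesis using False by (simp add: power2_eq_square mult_ac)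
qed (use assms in simp)

lemma adj_bops: assumes "T \<in> bops" shows "adj T \<in> bops"
proof (rule bopsI)
 show "norm (adj T y) <= onorm T * norm y" for y
  by (intro norm_adj_le assms bops_onorm onorm_ge0)
 show "adj T (x + y) = adj T x + adj T y" for x y
  by (rule cinner_ext_left) (simp add: adj_cinner assms cinner_add_left)
 show "adj T (c *\<^sub>C x) = c *\<^sub>C adj T x" for c x
  by (rule cinner_ext_left) (simp add: adj_cinner assms cinner_scaleC_left)
qed

lemma adj_adj: "T \<in> bops ==> adj (adj T) = T"
 by (rule adj_eqI) (simp add: adj_cinner')

lemma adj_comp: "S \<in> bops ==> T \<in> bops ==> adj (%x. S (T x)) = (%x. adj T (adj S x))"
 by (rule adj_eqI) (simp add: adj_cinner)

lemma adj_id [simp]: "adj (%x. x) = (%x. x)"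
 by (rule adj_eqI) simp

lemma bops_ext:
 assumes "!!x y. \<langle>x, S y\<rangle> = \<langle>x, T y\<rangle>" shows "S = T"
 by (rule ext, rule cinner_ext) (rule assms)

section \<open>Subspaces, total sets and projections\<close>

definition csubspace :: "'a::chilbert set => bool" where
 "csubspace M \<longleftrightarrow> 0 \<in> M \<and> (\<forall>x\<in>M. \<forall>y\<in>M. x + y \<in> M) \<and> (\<forall>c. \<forall>x\<in>M. c *\<^sub>C x \<in> M)"

lemma csubspaceD:
 assumes "csubspace M"
 shows "0 \<in> M" "x \<in> M ==> y \<in> M ==> x + y \<in> M" "x \<in> M ==> c *\<^sub>C x \<in> M" "x \<in> M ==> r *\<^sub>R x \<in> M"
proof -
 show "0 \<in> M" "x \<in> M ==> y \<in> M ==> x + y \<in> M" and *: "x \<in> M ==> c *\<^sub>C x \<in> M" for c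
  using assms unfolding csubspace_def by auto
 show "x \<in> M ==> r *\<^sub>R x \<in> M"
  using *[of "complex_of_real r"] by (simp add: scaleC_of_real)
qed

lemma csubspace_diff: "csubspace M ==> x \<in> M ==> y \<in> M ==> x - y \<in> M"
 using csubspaceD(2)[of M x "- y"] csubspaceD(3)[of M y "-1"] by simp

lemma csubspace_sum: "csubspace M ==> (!!i. i \<in> I ==> f i \<in> M) ==> (\<Sum>i\<in>I. f i) \<in> M"
 by (induction I rule: infinite_finite_induct) (auto simp: csubspaceD)

text \<open>Totality is phrased by the orthogonal complement, which is easy to verify for tensor
  products; \<open>total_closed_UNIV\<close> turns it back into density by means of the
  projection.\<close>

definition ctotal :: "'a::chilbert set => bool" where
 "ctotal S \<longleftrightarrow> (\<forall>w. (\<forall>s\<in>S. \<langle>s, w\<rangle> = 0) \<longrightarrow> w = 0)"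

lemma projection_exists:
 fixes M :: "'a::chilbert set"
 assumes "csubspace M" "closed M"
 shows "\<exists>p\<in>M. \<forall>m\<in>M. \<langle>m, x - p\<rangle> = 0"
proof -
 have "bounded_linear (inner x)" by (rule bounded_linear_inner_right)
 then obtain z where z: "z \<in> M" "!!m. m \<in> M ==> inner x m = inner z m"
  using riesz_subspace[of M "inner x"] assms csubspaceD[OF assms(1)] by metis
 have re: "Re \<langle>m, x - z\<rangle> = 0" if "m \<in> M" for m
  using z(2)[OF that] by (simp add: Re_cinner inner_diff_right inner_commute)
 have "\<langle>m, x - z\<rangle> = 0" if "m \<in> M" for m
 proof (rule complex_eqI)
  show "Re \<langle>m, x - z\<rangle> = Re 0" using re[OF that] by simp
  show "Im \<langle>m, x - z\<rangle> = Im 0"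
   using re[OF csubspaceD(3)[OF assms(1) that], of \<i>] by (simp add: cinner_scaleC_left)
 qed
 then show ?thesis using z by blast
qed

lemma total_closed_UNIV:
 assumes "csubspace M" "closed M" "ctotal S" "S \<subseteq> M"
 shows "x \<in> M"
proof -
 obtain p where p: "p \<in> M" "\<forall>m\<in>M. \<langle>m, x - p\<rangle> = 0"
  using projection_exists[OF assms(1,2)] by blast
 then have "x - p = 0" using assms(3,4) unfolding ctotal_def by blast
 then show ?thesis using p by simp
qed

lemma total_of_closure_cspan:
 assumes "closure (cspan S) = UNIV" shows "ctotal S"
 unfolding ctotal_def
proof (intro allI impI)
 fix w assume w: "\<forall>s\<in>S. \<langle>s, w\<rangle> = 0"
 have "closed {s. \<langle>s, w\<rangle> = 0}"
  by (intro closed_Collect_eq continuous_intros)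
 moreover have "cspan S \<subseteq> {s. \<langle>s, w\<rangle> = 0}"
  using w by (auto elim!: cspanE simp: cinner_sum_left cinner_scaleC_left)
 ultimately have "closure (cspan S) \<subseteq> {s. \<langle>s, w\<rangle> = 0}" by (rule closure_minimal[rotated])
 then have "\<langle>w, w\<rangle> = 0" using assms by blast
 then show "w = 0" by (simp add: cinner_self)
qed

lemma total_mono: "ctotal S ==> S \<subseteq> S' ==> ctotal S'"
 unfolding ctotal_def by blast

lemma total_ext: "ctotal S ==> (!!s. s \<in> S ==> \<langle>s, x\<rangle> = \<langle>s, y\<rangle>) ==> x = y"
 unfolding ctotal_def using cinner_diff_right[of _ x y] by (metis eq_iff_diff_eq_0)

text \<open>The adjoints are compared first, because totality is a test for vectors:
  \<open>\<langle>s, adj T w\<rangle> = \<langle>T s, w\<rangle>\<close>.\<close>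

lemma total_bops_eq:
 assumes "ctotal S" "T \<in> bops" "T' \<in> bops" "!!s. s \<in> S ==> T s = T' s"
 shows "T = T'"
proof -
 have "adj T w = adj T' w" for w
  by (rule total_ext[OF assms(1)]) (simp add: adj_cinner' assms)
 then have "adj T = adj T'" by (rule ext)
 then show ?thesis by (metis adj_adj assms(2,3))
qed

lemma cspan_csubspace: "csubspace (cspan S)"
 unfolding csubspace_def
proof (intro conjI ballI allI)
 show "0 \<in> cspan S" by (rule cspan_zero)
 have *: "(\<Sum>i<n. c i *\<^sub>C x i) + y \<in> cspan S" if "\<forall>i<n. x i \<in> S" "y \<in> cspan S" for n :: nat and c x y
  using that by (induction n arbitrary: y) (auto simp: add.assoc intro: cspan_insert)
 show "x + y \<in> cspan S" if "x \<in> cspan S" "y \<in> cspan S" for x y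
  using that(1) by (rule cspanE) (use * that(2) in auto)
 show "c *\<^sub>C x \<in> cspan S" if "x \<in> cspan S" for c x
  using that by (rule cspanE)
   (auto simp: cspan_def scaleC_sum_right scaleC_scaleC intro!: exI[of _ "%i. c * _ i"])
qed

lemma cspan_superset: "S \<subseteq> cspan S"
proof
 fix x assume "x \<in> S"
 then have "1 *\<^sub>C x + 0 \<in> cspan S" by (intro cspan_insert cspan_zero)
 then show "x \<in> cspan S" by simp
qed

lemma cspan_minimal: "csubspace M ==> S \<subseteq> M ==> cspan S \<subseteq> M"
 by (auto elim!: cspanE intro!: csubspace_sum csubspaceD(3))

lemma tendsto_scaleC: "(f \<longlongrightarrow> l) F ==> ((%x. c *\<^sub>C (f x::'a::chilbert)) \<longlongrightarrow> c *\<^sub>C l) F"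
 using bops_tendsto[OF bops_cscale[OF bops_id]] .

lemma csubspace_closure:
 assumes "csubspace M" shows "csubspace (closure M)"
 unfolding csubspace_def
proof (intro conjI ballI allI)
 show "0 \<in> closure M" using csubspaceD(1)[OF assms] closure_subset by blast
 show "x + y \<in> closure M" if xy: "x \<in> closure M" "y \<in> closure M" for x y
 proof -
  obtain X where X: "\<forall>n. X n \<in> M" "X \<longlonglongrightarrow> x" using xy(1) unfolding closure_sequential by blast
  obtain Y where Y: "\<forall>n. Y n \<in> M" "Y \<longlonglongrightarrow> y" using xy(2) unfolding closure_sequential by blast
  show ?thesis unfolding closure_sequential
   using X Y by (intro exI[of _ "%n. X n + Y n"] conjI tendsto_add allI csubspaceD(2)[OF assms]) auto
 qed
 show "c *\<^sub>C x \<in> closure M" if x: "x \<in> closure M" for c x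
 proof -
  obtain X where X: "\<forall>n. X n \<in> M" "X \<longlonglongrightarrow> x" using x unfolding closure_sequential by blast
  show ?thesis unfolding closure_sequential
   using X by (intro exI[of _ "%n. c *\<^sub>C X n"] conjI tendsto_scaleC allI csubspaceD(3)[OF assms]) auto
 qed
qed

section \<open>Extension of operators and isometries from total sets\<close>

lemma fst_scaleC [simp]: "fst (c *\<^sub>C x) = c *\<^sub>C fst x" and snd_scaleC [simp]: "snd (c *\<^sub>C x) = c *\<^sub>C snd x"
 by (simp_all add: scaleC_prod_def)

text \<open>The operator is handed over as its graph, so that single-valuedness follows from the
  norm bound instead of being a separate obligation. The bound also makes the first projection of
  the closed graph complete, hence closed, and totality makes it everything.\<close>

lemma graph_extension:
 fixes M :: "('a::chilbert \<times> 'b::chilbert) set"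
 assumes M: "csubspace M" and bd: "!!p. p \<in> M ==> norm (snd p) <= K * norm (fst p)" and K: "0 <= K"
  and dense: "ctotal (fst ` M)"
 obtains V where "V \<in> bops" "!!x y. (x, y) \<in> M ==> V x = y" "!!x. norm (V x) <= K * norm x"
proof -
 let ?C = "closure M"
 have C: "csubspace ?C" by (rule csubspace_closure[OF M])
 have "?C \<subseteq> {p. norm (snd p) <= K * norm (fst p)}"
 proof (rule closure_minimal)
  show "closed {p::'a \<times> 'b. norm (snd p) <= K * norm (fst p)}"
   by (intro closed_Collect_le continuous_intros)
 qed (use bd in auto)
 then have bdC: "norm (snd p) <= K * norm (fst p)" if "p \<in> ?C" for p using that by blast
 have "closed (fst ` ?C)"
  unfolding closed_sequential_limits
 proof (intro allI impI, elim conjE)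
  fix u l assume u: "\<forall>n. u n \<in> fst ` ?C" "u \<longlonglongrightarrow> l"
  then have "\<forall>n. \<exists>w. (u n, w) \<in> ?C" by (force simp: image_iff)
  then obtain w where w: "!!n. (u n, w n) \<in> ?C" by metis
  have "Cauchy u" using u(2) by (rule LIMSEQ_imp_Cauchy)
  have d: "dist (w m) (w n) <= K * dist (u m) (u n)" for m n
   using bdC[OF csubspace_diff[OF C w[of m] w[of n]]] by (simp add: dist_norm)
  have "Cauchy w"
  proof (rule metric_CauchyI)
   fix e :: real assume "e > 0"
   \<comment> \<open>\<open>K\<close> may be 0, hence \<open>K + 1\<close> in the
     denominator.\<close>
   then have "e / (K + 1) > 0" using K by simp
   then obtain N where N: "!!m n. m \<ge> N ==> n \<ge> N ==> dist (u m) (u n) < e / (K + 1)"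
    using metric_CauchyD[OF \<open>Cauchy u\<close>] by blast
   have "dist (w m) (w n) < e" if "m \<ge> N" "n \<ge> N" for m n
   proof -
    have "dist (w m) (w n) <= (K + 1) * dist (u m) (u n)" using d[of m n] by (simp add: distrib_right add_increasing2)
    also have "\<dots> < (K + 1) * (e / (K + 1))" using N[OF that] K by (intro mult_strict_left_mono) auto
    finally show ?thesis using K by simp
   qed
   then show "\<exists>N. \<forall>m\<ge>N. \<forall>n\<ge>N. dist (w m) (w n) < e" by blast
  qed
  then obtain z where z: "w \<longlonglongrightarrow> z" using Cauchy_convergent convergent_def by blast
  have "(l, z) \<in> ?C"
   by (rule closed_sequentially[OF closed_closure _ tendsto_Pair[OF u(2) z]]) (rule w)
  then show "l \<in> fst ` ?C" by force
 qed
 moreover have "csubspace (fst ` ?C)"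
  unfolding csubspace_def
 proof (intro conjI ballI allI)
  show "0 \<in> fst ` ?C" using csubspaceD(1)[OF C] by force
  show "x + y \<in> fst ` ?C" if xy: "x \<in> fst ` ?C" "y \<in> fst ` ?C" for x y
  proof -
   obtain p q where "p \<in> ?C" "q \<in> ?C" "x = fst p" "y = fst q" using xy by blast
   then show ?thesis by (intro image_eqI[of _ _ "p + q"] csubspaceD(2)[OF C]) auto
  qed
  show "c *\<^sub>C x \<in> fst ` ?C" if x: "x \<in> fst ` ?C" for c x
  proof -
   obtain p where "p \<in> ?C" "x = fst p" using x by blast
   then show ?thesis by (intro image_eqI[of _ _ "c *\<^sub>C p"] csubspaceD(3)[OF C]) auto
  qed
 qed
 ultimately have "x \<in> fst ` ?C" for x
  using total_closed_UNIV[OF _ _ dense, of "fst ` ?C" x] closure_subset[of M] by blast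
 then have "\<exists>y. (x, y) \<in> ?C" for x by (force simp: image_iff)
 then obtain V where V: "!!x. (x, V x) \<in> ?C" by metis
 have uniq: "y = V x" if "(x, y) \<in> ?C" for x y
  using bdC[OF csubspace_diff[OF C that V[of x]]] by simp
 have Vb: "norm (V x) <= K * norm x" for x using bdC[OF V[of x]] by simp
 have "V \<in> bops"
 proof (rule bopsI[OF _ _ Vb])
  show "V (x + y) = V x + V y" for x y
   using uniq[OF csubspaceD(2)[OF C V[of x] V[of y], unfolded add_Pair]] by simp
  show "V (c *\<^sub>C x) = c *\<^sub>C V x" for c x
   using uniq[of "c *\<^sub>C x" "c *\<^sub>C V x"] csubspaceD(3)[OF C V[of x], of c] by (simp add: scaleC_prod_def)
 qed
 moreover have "V x = y" if "(x, y) \<in> M" for x y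
  using uniq[of x y] that closure_subset[of M] by auto
 ultimately show thesis by (intro that[of V] Vb)
qed

text \<open>The graph is spanned by the pairs \<open>(g i, f i)\<close>. The bound on finite
  combinations contains the consistency condition: each linear relation among the \<open>g i\<close>
  also holds among the \<open>f i\<close>.\<close>

lemma total_extension:
 fixes g :: "'i => 'a::chilbert" and f :: "'i => 'b::chilbert"
 assumes dense: "ctotal (g ` S)" and K: "0 <= K"
  and bd: "!!(n::nat) c i. \<forall>k<n. i k \<in> S ==> norm (\<Sum>k<n. c k *\<^sub>C f (i k)) <= K * norm (\<Sum>k<n. c k *\<^sub>C g (i k))"
 shows "\<exists>V\<in>bops. (\<forall>i\<in>S. V (g i) = f i) \<and> (\<forall>x. norm (V x) <= K * norm x)"
proof -
 let ?M = "cspan ((%i. (g i, f i)) ` S)"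
 have bd': "norm (snd p) <= K * norm (fst p)" if "p \<in> ?M" for p
 proof -
  obtain n c x where p: "p = (\<Sum>i<(n::nat). c i *\<^sub>C x i)" "\<forall>i<n. x i \<in> (%i. (g i, f i)) ` S"
   using \<open>p \<in> ?M\<close> by (rule cspanE)
  then have "\<forall>k<n. \<exists>i. i \<in> S \<and> x k = (g i, f i)" by auto
  then obtain i where i: "\<forall>k<n. i k \<in> S \<and> x k = (g (i k), f (i k))" by metis
  have "fst p = (\<Sum>k<n. c k *\<^sub>C g (i k))" "snd p = (\<Sum>k<n. c k *\<^sub>C f (i k))"
   using i by (auto simp: p(1) fst_sum snd_sum)
  then show ?thesis using bd[of n i c] i by simp
 qed
 have mem: "(g i, f i) \<in> ?M" if "i \<in> S" for i
  using that by (intro subsetD[OF cspan_superset]) auto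
 have "g ` S \<subseteq> fst ` ?M"
 proof
  fix x assume "x \<in> g ` S"
  then obtain i where "i \<in> S" "x = g i" by blast
  then show "x \<in> fst ` ?M" using mem by (intro image_eqI[of _ _ "(g i, f i)"]) auto
 qed
 then have "ctotal (fst ` ?M)" using dense total_mono by blast
 from graph_extension[where K = K, OF cspan_csubspace bd' K this]
 obtain V where "V \<in> bops" "!!x y. (x, y) \<in> ?M ==> V x = y" "!!x. norm (V x) <= K * norm x" by blast
 then show ?thesis by (intro bexI[of _ V]) (auto intro: mem)
qed

definition isometry :: "('a::chilbert => 'b::chilbert) => bool" where
 "isometry V \<longleftrightarrow> V \<in> bops \<and> (\<forall>x y. \<langle>V x, V y\<rangle> = \<langle>x, y\<rangle>)"

lemma isometry_bops: "isometry V ==> V \<in> bops"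
 and isometry_cinner: "isometry V ==> \<langle>V x, V y\<rangle> = \<langle>x, y\<rangle>"
 by (auto simp: isometry_def)

lemma isometry_norm: "isometry V ==> norm (V x) = norm x"
 using Re_cinner_self[of "V x"] Re_cinner_self[of x] by (simp add: isometry_cinner)

lemma isometry_adj: "isometry V ==> adj V (V x) = x"
 by (rule cinner_ext_left) (simp add: adj_cinner isometry_bops isometry_cinner)

lemma isometry_adj_norm: "isometry V ==> norm (adj V x) <= norm x"
 using norm_adj_le[of V 1 x] by (simp add: isometry_bops isometry_norm)

lemma norm_of_cinner: "\<langle>x, x\<rangle> = \<langle>y, y\<rangle> ==> norm x = norm y"
 by (metis Re_cinner_self norm_ge_zero power2_eq_iff_nonneg)

text \<open>Equal Gram matrices give equal norms of all finite combinations, so a bounded extension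
  exists; that it is isometric is read off from \<open>adj V (V x) = x\<close> on the total set. The
  canonical identifications of tensor products and Fock spaces below are instances.\<close>

lemma isometry_extension:
 fixes g :: "'i => 'a::chilbert" and f :: "'i => 'b::chilbert"
 assumes dense: "ctotal (g ` S)"
  and ip: "!!i k. i \<in> S ==> k \<in> S ==> \<langle>f i, f k\<rangle> = \<langle>g i, g k\<rangle>"
 shows "\<exists>V. isometry V \<and> (\<forall>i\<in>S. V (g i) = f i)"
proof -
 have "norm (\<Sum>k<n. c k *\<^sub>C f (i k)) <= 1 * norm (\<Sum>k<n. c k *\<^sub>C g (i k))" if "\<forall>k<n. i k \<in> S" for n :: nat and c i
 proof -
  have "\<langle>\<Sum>k<n. c k *\<^sub>C f (i k), \<Sum>k<n. c k *\<^sub>C f (i k)\<rangle> = \<langle>\<Sum>k<n. c k *\<^sub>C g (i k), \<Sum>k<n. c k *\<^sub>C g (i k)\<rangle>"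
   using that unfolding cinner_sum_left unfolding cinner_sum_right cinner_scaleC_left cinner_scaleC_right
   by (intro sum.cong refl) (simp add: ip)
  from norm_of_cinner[OF this] show ?thesis by simp
 qed
 from total_extension[of g S 1 f, OF dense zero_le_one this]
 obtain V where V: "V \<in> bops" "!!i. i \<in> S ==> V (g i) = f i" by auto
 have "(%x. adj V (V x)) = (%x. x)"
 proof (rule total_bops_eq[OF dense])
  fix s assume "s \<in> g ` S"
  then obtain i where i: "i \<in> S" "s = g i" by blast
  show "adj V (V s) = s"
   by (rule total_ext[OF dense]) (auto simp: adj_cinner' V i ip)
 qed (auto intro: bops_comp adj_bops V)
 then have "adj V (V y) = y" for y by (rule fun_cong)
 then have "\<langle>V x, V y\<rangle> = \<langle>x, y\<rangle>" for x y
  using adj_cinner'[OF V(1), of x "V y"] by simp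
 then have "isometry V" using V by (simp add: isometry_def)
 then show ?thesis using V by auto
qed

section \<open>Tensor products of operators\<close>

lemma ctotal_simple: "ctotal {u \<otimes> v | (u::'a::chilbert) (v::'b::chilbert). True}"
 by (rule total_of_closure_cspan) (rule tensor_total)

lemma ctotal_simple_range: "ctotal (range (%p. fst p \<otimes> snd p))"
proof (rule total_mono[OF ctotal_simple])
 show "{u \<otimes> v | (u::'a) (v::'b). True} \<subseteq> range (%p. fst p \<otimes> snd p)"
  by (auto simp: image_iff) blast
qed

lemma tensor_zero_left [simp]: "0 \<otimes> v = 0" and tensor_zero_right [simp]: "u \<otimes> 0 = 0"
 using tensor_scaleC_left[of 0 0 v] tensor_scaleC_right[of u 0 0] by simp_all

lemma norm_tensor: "norm (u \<otimes> v) = norm u * norm v"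
proof -
 have "complex_of_real ((norm (u \<otimes> v))\<^sup>2) = complex_of_real ((norm u * norm v)\<^sup>2)"
  unfolding cinner_self[symmetric] cinner_tensor by (simp add: cinner_self power_mult_distrib)
 then have "(norm (u \<otimes> v))\<^sup>2 = (norm u * norm v)\<^sup>2" by (simp only: of_real_eq_iff)
 then show ?thesis by (rule power2_eq_imp_eq) auto
qed

lemma E_ket_bops: "E_ket \<psi> \<in> bops"
 by (rule bopsI[of _ "norm \<psi>"]) (simp_all add: E_ket_def tensor_add_left tensor_scaleC_left norm_tensor)

abbreviation E_bra :: "'f::chilbert => ('h::chilbert, 'f) tensor => 'h" where
 "E_bra \<psi> \<equiv> adj (E_ket \<psi>)"

lemma E_bra_bops: "E_bra \<psi> \<in> bops"
 by (intro adj_bops E_ket_bops)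

lemma cinner_E_bra: "\<langle>u, E_bra \<psi> \<zeta>\<rangle> = \<langle>u \<otimes> \<psi>, \<zeta>\<rangle>"
 by (simp add: adj_cinner' E_ket_bops) (simp add: E_ket_def)

lemma E_bra_tensor: "E_bra \<psi> (u \<otimes> \<phi>) = \<langle>\<psi>, \<phi>\<rangle> *\<^sub>C u"
 by (rule cinner_ext) (simp add: cinner_E_bra cinner_tensor cinner_scaleC_right)

lemma slices_ext: "(!!\<psi>. E_bra \<psi> \<zeta> = E_bra \<psi> \<zeta>') ==> \<zeta> = \<zeta>'"
 by (rule tensor_eqI) (simp add: cinner_E_bra[symmetric])

lemma tensor_left_bops: "(%v. u \<otimes> v) \<in> bops"
 by (rule bopsI[of _ "norm u"]) (simp_all add: tensor_add_right tensor_scaleC_right norm_tensor)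

text \<open>The two factors are treated one after the other: the slices \<open>E_bra s' w\<close>
  vanish by totality of \<open>S\<close>, and then the slices in the other variable by totality of
  \<open>S'\<close>.\<close>

lemma ctotal_tensor:
 assumes "ctotal (S::'a::chilbert set)" "ctotal (S'::'b::chilbert set)"
 shows "ctotal {s \<otimes> s' | s s'. s \<in> S \<and> s' \<in> S'}"
 unfolding ctotal_def
proof (intro allI impI)
 fix w assume w: "\<forall>t\<in>{s \<otimes> s' | s s'. s \<in> S \<and> s' \<in> S'}. \<langle>t, w\<rangle> = 0"
 have "E_bra s' w = 0" if "s' \<in> S'" for s'
  using assms(1)[unfolded ctotal_def, rule_format, of "E_bra s' w"] w that
  by (auto simp: cinner_E_bra)
 then have 1: "\<langle>u \<otimes> s', w\<rangle> = 0" if "s' \<in> S'" for u s'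
  using that by (metis cinner_E_bra cinner_zero_right)
 have "adj (%v. u \<otimes> v) w = 0" for u
  using assms(2)[unfolded ctotal_def, rule_format, of "adj (%v. u \<otimes> v) w"] 1
  by (auto simp: adj_cinner' tensor_left_bops)
 then have "\<langle>u \<otimes> v, w\<rangle> = 0" for u v
  using adj_cinner'[OF tensor_left_bops, of v u w] by simp
 then show "w = 0" using ctotal_simple unfolding ctotal_def by blast
qed

section \<open>Bounds and algebra of tensor products of operators\<close>

abbreviation ampr :: "('b::chilbert => 'd::chilbert) => ('a::chilbert, 'b) tensor => ('a, 'd) tensor" where
 "ampr T \<equiv> op_tensor (%x. x) T"

lemma op_tensor_unique:
 assumes "R \<in> bops" "!!u v. R (u \<otimes> v) = S u \<otimes> T v"
 shows "op_tensor S T = R"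
 unfolding op_tensor_def
proof (rule the_equality)
 show "bounded_clinear R \<and> (\<forall>u v. R (u \<otimes> v) = S u \<otimes> T v)" using assms by (auto simp: bops_def)
 fix R' assume R': "bounded_clinear R' \<and> (\<forall>u v. R' (u \<otimes> v) = S u \<otimes> T v)"
 show "R' = R"
  by (rule total_bops_eq[OF ctotal_simple]) (use R' assms in \<open>auto simp: bops_def\<close>)
qed

text \<open>This is the Gram kernel of the vectors \<open>u i\<close> for the positive operator
  \<open>K\<^sup>2 - S* S\<close>.\<close>

lemma psd_on_dominated:
 assumes "S \<in> bops" "!!u. norm (S u) <= K * norm u" "0 <= K"
 shows "psd_on A (%i j. complex_of_real (K\<^sup>2) * \<langle>u i, u j\<rangle> - \<langle>S (u i), S (u j)\<rangle>)"
proof (rule psd_onI)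
 fix c
 let ?s = "\<Sum>i\<in>A. c i *\<^sub>C u i"
 have "(\<Sum>i\<in>A. \<Sum>j\<in>A. cnj (c i) * c j * (complex_of_real (K\<^sup>2) * \<langle>u i, u j\<rangle> - \<langle>S (u i), S (u j)\<rangle>)) =
   complex_of_real (K\<^sup>2) * \<langle>?s, ?s\<rangle> - \<langle>S ?s, S ?s\<rangle>"
  unfolding bops_sum[OF assms(1)] bops_scaleC[OF assms(1)] cinner_sum_left
  unfolding cinner_sum_right cinner_scaleC_left cinner_scaleC_right
  by (simp add: sum_distrib_left sum_subtractf algebra_simps)
 also have "\<dots> = complex_of_real ((K * norm ?s)\<^sup>2 - (norm (S ?s))\<^sup>2)"
  by (simp add: cinner_self power_mult_distrib)
 finally have "Re (\<Sum>i\<in>A. \<Sum>j\<in>A. cnj (c i) * c j * (complex_of_real (K\<^sup>2) * \<langle>u i, u j\<rangle> - \<langle>S (u i), S (u j)\<rangle>))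
   = (K * norm ?s)\<^sup>2 - (norm (S ?s))\<^sup>2" by (simp only: Re_complex_of_real)
 moreover have "(norm (S ?s))\<^sup>2 <= (K * norm ?s)\<^sup>2" by (intro power_mono assms) auto
 ultimately show "0 <= Re (\<Sum>i\<in>A. \<Sum>j\<in>A. cnj (c i) * c j * (complex_of_real (K\<^sup>2) * \<langle>u i, u j\<rangle> - \<langle>S (u i), S (u j)\<rangle>))"
  by linarith
qed (simp add: cnj_cinner)

text \<open>The norm bound is an instance of the Schur product theorem: the kernel of
  \<open>K\<^sup>2 - S* S\<close> on the first components, multiplied entrywise by the Gram kernel
  of the second components, is positive semidefinite.\<close>

lemma op_tensor_left:
 fixes S :: "'a::chilbert => 'c::chilbert"
 assumes S: "S \<in> bops" "!!u. norm (S u) <= K * norm u" "0 <= K"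
 shows "\<exists>R\<in>bops. (\<forall>u (v::'b::chilbert). R (u \<otimes> v) = S u \<otimes> v) \<and> (\<forall>\<zeta>. norm (R \<zeta>) <= K * norm \<zeta>)"
proof -
 let ?g = "%p::'a \<times> 'b. fst p \<otimes> snd p" and ?f = "%p::'a \<times> 'b. S (fst p) \<otimes> snd p"
 have "ctotal (?g ` UNIV)"
  by (rule ctotal_simple_range)
 moreover have "norm (\<Sum>k<n. c k *\<^sub>C ?f (i k)) <= K * norm (\<Sum>k<n. c k *\<^sub>C ?g (i k))" for n :: nat and c i
 proof -
  let ?F = "\<Sum>k<n. c k *\<^sub>C ?f (i k)" and ?G = "\<Sum>k<n. c k *\<^sub>C ?g (i k)"
  let ?K = "%k l. complex_of_real (K\<^sup>2) * \<langle>fst (i k), fst (i l)\<rangle> - \<langle>S (fst (i k)), S (fst (i l))\<rangle>"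
  have "psd_on {..<n} (%k l. ?K k l * \<langle>snd (i k), snd (i l)\<rangle>)"
   by (intro psd_on_mult psd_on_dominated psd_on_cinner S finite_lessThan)
  then have "0 <= Re (\<Sum>k<n. \<Sum>l<n. cnj (c k) * c l * (?K k l * \<langle>snd (i k), snd (i l)\<rangle>))"
   by (rule psd_on_ge0)
  also have "(\<Sum>k<n. \<Sum>l<n. cnj (c k) * c l * (?K k l * \<langle>snd (i k), snd (i l)\<rangle>)) =
    complex_of_real (K\<^sup>2) * \<langle>?G, ?G\<rangle> - \<langle>?F, ?F\<rangle>"
   unfolding cinner_sum_left
   unfolding cinner_sum_right cinner_scaleC_left cinner_scaleC_right cinner_tensor
   by (simp add: sum_distrib_left sum_subtractf algebra_simps)
  also have "Re (complex_of_real (K\<^sup>2) * \<langle>?G, ?G\<rangle> - \<langle>?F, ?F\<rangle>) = (K * norm ?G)\<^sup>2 - (norm ?F)\<^sup>2"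
   by (simp add: cinner_self power_mult_distrib)
  finally have "(norm ?F)\<^sup>2 <= (K * norm ?G)\<^sup>2" by simp
  then show ?thesis by (rule power2_le_imp_le) (simp add: S)
 qed
 ultimately show ?thesis
  using total_extension[of ?g UNIV K ?f, OF _ S(3)] by auto
qed

lemma flip_exists: "\<exists>V::('a::chilbert, 'b::chilbert) tensor => ('b, 'a) tensor. isometry V \<and> (\<forall>u v. V (u \<otimes> v) = v \<otimes> u)"
proof -
 let ?g = "%p::'a \<times> 'b. fst p \<otimes> snd p" and ?f = "%p::'a \<times> 'b. snd p \<otimes> fst p"
 have "ctotal (?g ` UNIV)"
  by (rule ctotal_simple_range)
 from isometry_extension[of ?g UNIV ?f, OF this] show ?thesis
  by (auto simp: cinner_tensor)
qed

definition flip :: "('a::chilbert, 'b::chilbert) tensor => ('b, 'a) tensor" where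
 "flip = (SOME V. isometry V \<and> (\<forall>u v. V (u \<otimes> v) = v \<otimes> u))"

lemma flip_isometry: "isometry flip" and flip_tensor [simp]: "flip (u \<otimes> v) = v \<otimes> u"
 using someI_ex[OF flip_exists] unfolding flip_def by blast+

lemmas flip_bops = isometry_bops[OF flip_isometry]

lemma flip_flip [simp]: "flip (flip \<zeta>) = \<zeta>"
 by (rule fun_cong, rule total_bops_eq[OF ctotal_simple bops_comp[OF flip_bops flip_bops] bops_id]) auto

text \<open>A general tensor product is the composition of two ampliations acting on the left
  factor, the second one between two flips.\<close>

lemma op_tensor_ex:
 fixes S :: "'a::chilbert => 'c::chilbert" and T :: "'b::chilbert => 'd::chilbert"
 assumes "S \<in> bops" "T \<in> bops"
 shows "op_tensor S T \<in> bops \<and> (\<forall>u v. op_tensor S T (u \<otimes> v) = S u \<otimes> T v)"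
proof -
 obtain R :: "('a, 'b) tensor => ('c, 'b) tensor" where R: "R \<in> bops" "!!u v. R (u \<otimes> v) = S u \<otimes> v"
  using op_tensor_left[OF assms(1) bops_onorm onorm_ge0] assms by blast
 obtain R' :: "('b, 'c) tensor => ('d, 'c) tensor" where R': "R' \<in> bops" "!!u v. R' (u \<otimes> v) = T u \<otimes> v"
  using op_tensor_left[OF assms(2) bops_onorm onorm_ge0] assms by blast
 have b: "(%\<zeta>. flip (R' (flip (R \<zeta>)))) \<in> bops"
  by (rule bops_comp[OF flip_bops bops_comp[OF R'(1) bops_comp[OF flip_bops R(1)]]])
 have "op_tensor S T = (%\<zeta>. flip (R' (flip (R \<zeta>))))"
  by (rule op_tensor_unique[OF b]) (simp add: R R')
 then show ?thesis using b by (simp add: R R')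
qed

lemma op_tensor_bops: "S \<in> bops ==> T \<in> bops ==> op_tensor S T \<in> bops"
 and op_tensor_tensor: "S \<in> bops ==> T \<in> bops ==> op_tensor S T (u \<otimes> v) = S u \<otimes> T v"
 using op_tensor_ex by blast+

lemma tensor_bops_eq:
 assumes "T \<in> bops" "T' \<in> bops" "!!u v. T (u \<otimes> v) = T' (u \<otimes> v)"
 shows "T = T'"
 by (rule total_bops_eq[OF ctotal_simple]) (use assms in auto)

lemma op_tensor_comp:
 assumes "S \<in> bops" "T \<in> bops" "S' \<in> bops" "T' \<in> bops"
 shows "op_tensor S T (op_tensor S' T' \<zeta>) = op_tensor (%x. S (S' x)) (%x. T (T' x)) \<zeta>"
 by (rule fun_cong, rule tensor_bops_eq[OF bops_comp[OF op_tensor_bops[OF assms(1,2)] op_tensor_bops[OF assms(3,4)]]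
    op_tensor_bops[OF bops_comp[OF assms(1,3)] bops_comp[OF assms(2,4)]]])
   (simp add: op_tensor_tensor bops_comp assms)

lemma op_tensor_adj:
 assumes "S \<in> bops" "T \<in> bops"
 shows "adj (op_tensor S T) = op_tensor (adj S) (adj T)"
proof (rule tensor_bops_eq)
 fix u v
 show "adj (op_tensor S T) (u \<otimes> v) = op_tensor (adj S) (adj T) (u \<otimes> v)"
  by (rule tensor_eqI)
    (simp add: adj_cinner' op_tensor_bops op_tensor_tensor adj_bops assms cinner_tensor)
qed (intro adj_bops op_tensor_bops assms)+

lemma op_tensor_id [simp]: "op_tensor (%x. x) (%x. x) = (%x. x)"
 by (rule op_tensor_unique) auto

lemma op_tensor_id_norm:
 fixes \<zeta> :: "('a::chilbert, 'b::chilbert) tensor"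
 assumes "S \<in> bops" "!!u. norm (S u) <= K * norm u" "0 <= K"
 shows "norm (op_tensor S (%x. x) \<zeta>) <= K * norm \<zeta>"
proof -
 obtain R :: "('a, 'b) tensor => _" where R: "R \<in> bops" "!!u v. R (u \<otimes> v) = S u \<otimes> v" "!!\<zeta>. norm (R \<zeta>) <= K * norm \<zeta>"
  using op_tensor_left[OF assms] by blast
 have "op_tensor S (%x. x) = R" by (rule op_tensor_unique) (auto simp: R)
 then show ?thesis using R by simp
qed

lemma op_tensor_isometry:
 assumes "isometry S" "isometry T" shows "isometry (op_tensor S T)"
proof -
 note b = assms[THEN isometry_bops]
 have "adj (op_tensor S T) (op_tensor S T \<zeta>) = \<zeta>" for \<zeta>
  by (simp add: op_tensor_adj op_tensor_comp b adj_bops assms isometry_adj)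
 then show ?thesis unfolding isometry_def
  by (metis adj_cinner' b op_tensor_bops)
qed

lemma op_tensor_E_ket: "S \<in> bops ==> T \<in> bops ==> op_tensor S T (E_ket \<psi> u) = E_ket (T \<psi>) (S u)"
 by (simp add: E_ket_def op_tensor_tensor)

lemma E_bra_op_tensor:
 assumes "S \<in> bops" "T \<in> bops"
 shows "E_bra \<psi> (op_tensor S T \<zeta>) = S (E_bra (adj T \<psi>) \<zeta>)"
 by (rule cinner_ext) (simp add: adj_cinner'[symmetric] assms cinner_E_bra op_tensor_bops op_tensor_adj
   op_tensor_tensor adj_bops adj_cinner[symmetric])

lemma op_tensor_lincomb_left:
 assumes "S \<in> bops" "S' \<in> bops" "T \<in> bops"
 shows "op_tensor (%x. c *\<^sub>C S x + S' x) T = (%\<zeta>. c *\<^sub>C op_tensor S T \<zeta> + op_tensor S' T \<zeta>)"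
 by (rule op_tensor_unique)
   (auto intro!: bops_plus bops_cscale op_tensor_bops assms simp: op_tensor_tensor assms tensor_add_left tensor_scaleC_left)

section \<open>Hilbert spaces with an orthonormal basis indexed by a type\<close>

text \<open>The wrapper allows the Kronecker delta to be the kernel for every index type, including
  types that already carry a kernel of their own.\<close>

datatype 'x ell2_gen = Ell2Gen 'x

instantiation ell2_gen :: (type) psd_kernel
begin
definition kern_ell2_gen :: "'a ell2_gen => 'a ell2_gen => complex" where
 "kern_ell2_gen x y = (if x = y then 1 else 0)"
instance
proof
 fix n :: nat and \<alpha> :: "nat => complex" and x y :: "'a ell2_gen" and z :: "nat => 'a ell2_gen"
 show "cnj (kern x y) = kern y x" by (simp add: kern_ell2_gen_def)
 define d where "d y i = (if z i = y then \<alpha> i else 0)" for y i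
 have "cnj (\<alpha> i) * \<alpha> j * kern (z i) (z j) = (\<Sum>y\<in>z ` {..<n}. cnj (d y i) * d y j)" if "i < n" for i j
 proof -
  have "(\<Sum>y\<in>z ` {..<n}. cnj (d y i) * d y j) = (\<Sum>y\<in>z ` {..<n}. if y = z i then cnj (\<alpha> i) * \<alpha> j * kern (z i) (z j) else 0)"
   by (intro sum.cong refl) (auto simp: d_def kern_ell2_gen_def)
  then show ?thesis using that by simp
 qed
 then have "(\<Sum>i<n. \<Sum>j<n. cnj (\<alpha> i) * \<alpha> j * kern (z i) (z j)) = (\<Sum>i<n. \<Sum>j<n. \<Sum>y\<in>z ` {..<n}. cnj (d y i) * d y j)"
  by (intro sum.cong refl) auto
 also have "\<dots> = (\<Sum>i<n. \<Sum>y\<in>z ` {..<n}. \<Sum>j<n. cnj (d y i) * d y j)"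
  by (intro sum.cong refl sum.swap)
 also have "\<dots> = (\<Sum>y\<in>z ` {..<n}. \<Sum>i<n. \<Sum>j<n. cnj (d y i) * d y j)"
  by (rule sum.swap)
 also have "\<dots> = (\<Sum>y\<in>z ` {..<n}. cnj (\<Sum>i<n. d y i) * (\<Sum>i<n. d y i))"
  by (simp add: sum_product)
 finally have eq: "(\<Sum>i<n. \<Sum>j<n. cnj (\<alpha> i) * \<alpha> j * kern (z i) (z j)) =
  (\<Sum>y\<in>z ` {..<n}. cnj (\<Sum>i<n. d y i) * (\<Sum>i<n. d y i))" .
 have "0 <= Re (cnj w * w)" for w by simp
 then show "0 <= Re (\<Sum>i<n. \<Sum>j<n. cnj (\<alpha> i) * \<alpha> j * kern (z i) (z j))"
  unfolding eq Re_sum[of _ "z ` {..<n}"] by (intro sum_nonneg)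
qed
end

type_synonym 'x ell2 = "'x ell2_gen khilb"

definition basis :: "'x => 'x ell2" where "basis x = kvec (Ell2Gen x)"

lemma cinner_basis: "\<langle>basis x, basis y\<rangle> = (if x = y then 1 else 0)"
 by (simp add: basis_def cinner_kvec kern_ell2_gen_def)

lemma ctotal_basis: "ctotal (range basis)"
proof -
 have "range (basis :: 'a => _) = range kvec"
  unfolding basis_def by (auto simp: image_iff) (metis ell2_gen.exhaust)
 then show ?thesis by (simp add: total_of_closure_cspan kvec_total)
qed

lemma ctotal_basis_tensor: "ctotal (range (%(u::'a::chilbert, x). u \<otimes> basis x))"
proof -
 have "ctotal (UNIV :: 'a set)" by (auto simp: ctotal_def) (rule cinner_ext, simp)
 from ctotal_tensor[OF this ctotal_basis] show ?thesis
  by (rule total_mono) auto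
qed

abbreviation comp_at :: "'x => ('a::chilbert, 'x ell2) tensor => 'a" where
 "comp_at x \<equiv> E_bra (basis x)"

lemma comp_at_basis: "comp_at x (u \<otimes> basis y) = (if x = y then u else 0)"
 by (simp add: E_bra_tensor cinner_basis)

lemma comp_at_ext: "(!!x. comp_at x \<zeta> = comp_at x \<zeta>') ==> \<zeta> = \<zeta>'"
 by (rule total_ext[OF ctotal_basis_tensor]) (auto simp: cinner_E_bra[symmetric])

lemma power2_le_mult_imp_le: "a\<^sup>2 <= a * b ==> 0 <= a ==> 0 <= b ==> a <= (b::real)"
 by (cases "a = 0") (auto simp: power2_eq_square mult_le_cancel_left)

lemma comp_at_bessel:
 assumes "finite F" shows "(\<Sum>x\<in>F. (norm (comp_at x \<zeta>))\<^sup>2) <= (norm \<zeta>)\<^sup>2"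
proof -
 let ?\<eta> = "\<Sum>x\<in>F. comp_at x \<zeta> \<otimes> basis x"
 have 1: "\<langle>?\<eta>, \<zeta>\<rangle> = complex_of_real (\<Sum>x\<in>F. (norm (comp_at x \<zeta>))\<^sup>2)"
  by (simp add: cinner_sum_left cinner_E_bra[symmetric] cinner_self)
 have *: "\<langle>?\<eta>, ?\<eta>\<rangle> = complex_of_real (\<Sum>x\<in>F. (norm (comp_at x \<zeta>))\<^sup>2)"
  unfolding cinner_sum_left unfolding cinner_sum_right cinner_tensor cinner_basis
  using assms by (simp add: cinner_self if_distrib[where f = "%z. _ * z"] sum.delta' cong: if_cong)
 have 2: "(norm ?\<eta>)\<^sup>2 = (\<Sum>x\<in>F. (norm (comp_at x \<zeta>))\<^sup>2)"
  unfolding Re_cinner_self[symmetric] * by (simp only: Re_complex_of_real)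
 have "cmod \<langle>?\<eta>, \<zeta>\<rangle> <= norm ?\<eta> * norm \<zeta>" by (rule cinner_CS)
 then have "(norm ?\<eta>)\<^sup>2 <= norm ?\<eta> * norm \<zeta>"
  unfolding 1 norm_of_real 2[symmetric] by simp
 then have "norm ?\<eta> <= norm \<zeta>"
  by (rule power2_le_mult_imp_le) auto
 then show ?thesis unfolding 2[symmetric] by (simp add: power_mono)
qed

lemma comp_at_summable: "(%x. (norm (comp_at x \<zeta>))\<^sup>2) summable_on UNIV"
 by (rule nonneg_bdd_above_summable_on) (auto intro!: bdd_aboveI2[of _ _ "(norm \<zeta>)\<^sup>2"] comp_at_bessel)

lemma CS_summable:
 fixes f g :: "'x => 'a::real_normed_vector"
 assumes "(%x. (norm (f x))\<^sup>2) summable_on UNIV" "(%x. (norm (g x))\<^sup>2) summable_on UNIV"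
 shows "(%x. norm (f x) * norm (g x)) summable_on UNIV"
proof -
 have "(%x. (norm (f x))\<^sup>2 + (norm (g x))\<^sup>2) summable_on UNIV"
  by (intro summable_on_add assms)
 moreover have "norm (norm (f x) * norm (g x)) <= (norm (f x))\<^sup>2 + (norm (g x))\<^sup>2" for x
 proof -
  have "2 * (norm (f x) * norm (g x)) <= (norm (f x))\<^sup>2 + (norm (g x))\<^sup>2"
   using sum_squares_bound[of "norm (f x)" "norm (g x)"] by (simp add: mult.assoc)
  then show ?thesis by (simp add: abs_mult) (smt (verit) mult_nonneg_nonneg norm_ge_zero)
 qed
 ultimately have "(%x. norm (norm (f x) * norm (g x))) summable_on UNIV"
  by (rule Infinite_Sum.abs_summable_on_comparison_test')
 then show ?thesis by simp
qed

text \<open>The vector comes from the Riesz theorem instead of a series of vectors: the candidate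
  functional is bounded by the Cauchy-Schwarz and Bessel inequalities. As a vector is determined by
  its components, the second conclusion is Parseval's formula in disguise.\<close>

lemma ell2_vector:
 fixes z :: "'x => 'a::chilbert"
 assumes z: "(%x. (norm (z x))\<^sup>2) summable_on UNIV"
 shows "\<exists>w. (\<forall>x. comp_at x w = z x) \<and> (\<forall>\<zeta>. ((%x. \<langle>z x, comp_at x \<zeta>\<rangle>) has_sum \<langle>w, \<zeta>\<rangle>) UNIV)"
proof -
 define f where "f \<zeta> = (\<Sum>\<^sub>\<infinity>x. \<langle>z x, comp_at x \<zeta>\<rangle>)" for \<zeta>
 have as: "(%x. norm \<langle>z x, comp_at x \<zeta>\<rangle>) summable_on UNIV" for \<zeta>
  by (rule Infinite_Sum.abs_summable_on_comparison_test'[OF CS_summable[OF z comp_at_summable[of \<zeta>]]]) (rule cinner_CS)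
 then have s: "(%x. \<langle>z x, comp_at x \<zeta>\<rangle>) summable_on UNIV" for \<zeta>
  by (rule abs_summable_summable)
 define K where "K = sqrt (\<Sum>\<^sub>\<infinity>x. (norm (z x))\<^sup>2)"
 have bd: "cmod (f \<zeta>) <= K * norm \<zeta>" for \<zeta>
 proof -
  have "cmod (f \<zeta>) <= (\<Sum>\<^sub>\<infinity>x. norm \<langle>z x, comp_at x \<zeta>\<rangle>)"
   unfolding f_def by (rule norm_infsum_bound[OF as])
  also have "\<dots> <= K * norm \<zeta>"
  proof (rule infsum_le_finite_sums[OF as])
   fix F :: "'x set" assume F: "finite F"
   have "(\<Sum>x\<in>F. norm \<langle>z x, comp_at x \<zeta>\<rangle>) <= (\<Sum>x\<in>F. \<bar>norm (z x)\<bar> * \<bar>norm (comp_at x \<zeta>)\<bar>)"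
    by (intro sum_mono) (simp add: cinner_CS)
   also have "\<dots> <= L2_set (%x. norm (z x)) F * L2_set (%x. norm (comp_at x \<zeta>)) F"
    by (rule L2_set_mult_ineq)
   also have "\<dots> <= K * norm \<zeta>"
   proof (intro mult_mono)
    show "L2_set (%x. norm (z x)) F <= K" unfolding L2_set_def K_def
     by (intro real_sqrt_le_mono finite_sum_le_infsum z F) auto
    show "L2_set (%x. norm (comp_at x \<zeta>)) F <= norm \<zeta>" unfolding L2_set_def
     by (rule real_le_lsqrt) (auto intro!: sum_nonneg comp_at_bessel F)
   qed (auto simp: K_def L2_set_nonneg infsum_nonneg)
   finally show "(\<Sum>x\<in>F. norm \<langle>z x, comp_at x \<zeta>\<rangle>) <= K * norm \<zeta>" .
  qed
  finally show ?thesis .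
 qed
 have "\<exists>w. \<forall>\<zeta>. f \<zeta> = \<langle>w, \<zeta>\<rangle>"
 proof (rule riesz[OF _ _ bd])
  show "f (\<zeta> + \<zeta>') = f \<zeta> + f \<zeta>'" for \<zeta> \<zeta>'
   unfolding f_def bops_add[OF E_bra_bops] cinner_add_right by (intro infsum_add s)
  show "f (c *\<^sub>C \<zeta>) = c * f \<zeta>" for c \<zeta>
   unfolding f_def bops_scaleC[OF E_bra_bops] cinner_scaleC_right by (rule infsum_cmult_right')
 qed
 then obtain w where w: "!!\<zeta>. f \<zeta> = \<langle>w, \<zeta>\<rangle>" by blast
 have "comp_at x w = z x" for x
 proof (rule cinner_ext)
  fix u
  have "f (u \<otimes> basis x) = (\<Sum>\<^sub>\<infinity>y. if y = x then \<langle>z x, u\<rangle> else 0)"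
   unfolding f_def by (intro infsum_cong) (auto simp: comp_at_basis)
  also have "\<dots> = \<langle>z x, u\<rangle>"
   using infsum_cong_neutral[of "{x}" UNIV "%y. if y = x then \<langle>z x, u\<rangle> else 0" "%y. if y = x then \<langle>z x, u\<rangle> else 0"]
   by simp
  finally have "\<langle>w, u \<otimes> basis x\<rangle> = \<langle>z x, u\<rangle>" by (simp add: w)
  then show "\<langle>u, comp_at x w\<rangle> = \<langle>u, z x\<rangle>" by (metis cinner_E_bra cnj_cinner)
 qed
 moreover have "((%x. \<langle>z x, comp_at x \<zeta>\<rangle>) has_sum \<langle>w, \<zeta>\<rangle>) UNIV" for \<zeta>
  using s[of \<zeta>] by (simp add: w[symmetric] f_def)
 ultimately show ?thesis by blast
qed

lemma parseval: "((%x. \<langle>comp_at x \<zeta>, comp_at x \<zeta>'\<rangle>) has_sum \<langle>\<zeta>, \<zeta>'\<rangle>) UNIV"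
proof -
 obtain w where w: "\<forall>x. comp_at x w = comp_at x \<zeta>"
   "\<forall>\<zeta>'. ((%x. \<langle>comp_at x \<zeta>, comp_at x \<zeta>'\<rangle>) has_sum \<langle>w, \<zeta>'\<rangle>) UNIV"
  using ell2_vector[OF comp_at_summable[of \<zeta>]] by blast
 have "w = \<zeta>" by (rule comp_at_ext) (simp add: w)
 then show ?thesis using w by blast
qed

lemma parseval_norm: "((%x. (norm (comp_at x \<zeta>))\<^sup>2) has_sum (norm \<zeta>)\<^sup>2) UNIV"
 using has_sum_Re[OF parseval[of \<zeta> \<zeta>]] by (simp add: Re_cinner_self)

lemma comp_at_op_tensor: "T \<in> bops ==> comp_at x (op_tensor T (%x. x) \<zeta>) = T (comp_at x \<zeta>)"
 by (simp add: E_bra_op_tensor)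

section \<open>The ultraweak topology\<close>

text \<open>These are the functionals that generate the ultraweak topology; in terms of them,
  continuity and convergence become statements about scalars.\<close>

definition uwf :: "(nat => 'b::chilbert) => (nat => 'a::chilbert) => ('a => 'b) => complex" where
 "uwf \<xi> \<eta> T = (\<Sum>n. \<langle>\<xi> n, T (\<eta> n)\<rangle>)"

lemma square_summable_bops:
 assumes "T \<in> bops" "square_summable \<eta>" shows "square_summable (%n. T (\<eta> n))"
 unfolding square_summable_def
proof (rule summable_comparison_test'[of _ 0])
 show "summable (%n. (onorm T)\<^sup>2 * (norm (\<eta> n))\<^sup>2)"
  using assms(2) unfolding square_summable_def by (rule summable_mult)
 show "norm ((norm (T (\<eta> n)))\<^sup>2) <= (onorm T)\<^sup>2 * (norm (\<eta> n))\<^sup>2" for n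
  using power_mono[OF bops_onorm[OF assms(1), of "\<eta> n"], of 2] by (simp add: power_mult_distrib)
qed

lemma square_summable_prod:
 assumes "square_summable \<xi>" "square_summable \<eta>"
 shows "summable (%n. norm (\<xi> n) * norm (\<eta> n))"
proof (rule summable_comparison_test'[of _ 0])
 show "summable (%n. (norm (\<xi> n))\<^sup>2 + (norm (\<eta> n))\<^sup>2)"
  using assms unfolding square_summable_def by (rule summable_add)
 fix n
 have "2 * (norm (\<xi> n) * norm (\<eta> n)) <= (norm (\<xi> n))\<^sup>2 + (norm (\<eta> n))\<^sup>2"
  using sum_squares_bound[of "norm (\<xi> n)" "norm (\<eta> n)"] by (simp add: mult.assoc)
 moreover have "0 <= norm (\<xi> n) * norm (\<eta> n)" by simp
 ultimately show "norm (norm (\<xi> n) * norm (\<eta> n)) <= (norm (\<xi> n))\<^sup>2 + (norm (\<eta> n))\<^sup>2"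
  by (simp only: real_norm_def abs_of_nonneg)
qed

lemma uwf_abs_summable:
 assumes "square_summable \<xi>" "square_summable \<eta>" "T \<in> bops"
 shows "summable (%n. cmod \<langle>\<xi> n, T (\<eta> n)\<rangle>)"
 by (rule summable_comparison_test'[of _ 0, OF square_summable_prod[OF assms(1) square_summable_bops[OF assms(3,2)]]])
   (simp add: cinner_CS)

lemma uwf_sums:
 assumes "square_summable \<xi>" "square_summable \<eta>" "T \<in> bops"
 shows "(%n. \<langle>\<xi> n, T (\<eta> n)\<rangle>) sums uwf \<xi> \<eta> T"
 unfolding uwf_def by (rule summable_sums[OF summable_norm_cancel[OF uwf_abs_summable[OF assms]]])

text \<open>It makes each matrix element one of the functionals \<open>uwf\<close>.\<close>

definition single :: "'a::chilbert => nat => 'a" where "single u n = (if n = 0 then u else 0)"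

lemma square_summable_single [simp]: "square_summable (single u)"
 unfolding square_summable_def single_def
 by (rule summable_finite[of "{0}"]) auto

lemma uwf_single [simp]: "uwf (single u) (single v) T = \<langle>u, T v\<rangle>"
proof -
 have "(%n. \<langle>single u n, T (single v n)\<rangle>) sums (\<Sum>n\<in>{0}. \<langle>single u n, T (single v n)\<rangle>)"
  by (rule sums_finite) (auto simp: single_def)
 then show ?thesis unfolding uwf_def by (simp add: single_def sums_iff)
qed

lemma uwf_lincomb:
 assumes "square_summable \<xi>" "square_summable \<eta>" "S \<in> bops" "T \<in> bops"
 shows "uwf \<xi> \<eta> (%x. c *\<^sub>C S x + T x) = c * uwf \<xi> \<eta> S + uwf \<xi> \<eta> T"
proof -
 have "(%n. c * \<langle>\<xi> n, S (\<eta> n)\<rangle> + \<langle>\<xi> n, T (\<eta> n)\<rangle>) sums (c * uwf \<xi> \<eta> S + uwf \<xi> \<eta> T)"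
  by (intro sums_add sums_mult uwf_sums assms)
 then show ?thesis unfolding uwf_def by (simp add: sums_iff cinner_add_right cinner_scaleC_right)
qed

lemma uwf_conj:
 assumes "X \<in> bops"
 shows "uwf \<xi> \<eta> (%x. X (T (Y x))) = uwf (%n. adj X (\<xi> n)) (%n. Y (\<eta> n)) T"
 unfolding uwf_def by (simp add: adj_cinner assms)

lemma topspace_uw [simp]: "topspace uw_topology = bops"
proof
 show "topspace uw_topology \<subseteq> (bops :: ('a => 'b) set)"
  unfolding uw_topology_def topology_generated_by_topspace by blast
 have "{T \<in> bops. (\<Sum>n. \<langle>single (0::'b) n, T (single (0::'a) n)\<rangle>) \<in> UNIV} \<in>
   {{T \<in> bops. (\<Sum>n. \<langle>\<xi> n, T (\<eta> n)\<rangle>) \<in> U} | \<xi> \<eta> U. square_summable \<xi> \<and> square_summable \<eta> \<and> open U}"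
  by (intro CollectI exI[of _ "single (0::'b)"] exI[of _ "single (0::'a)"] exI[of _ UNIV]) auto
 then show "(bops :: ('a => 'b) set) \<subseteq> topspace uw_topology"
  unfolding uw_topology_def topology_generated_by_topspace by auto
qed

lemma continuous_map_uwf:
 assumes "square_summable \<xi>" "square_summable \<eta>"
 shows "continuous_map uw_topology euclidean (uwf \<xi> \<eta>)"
 unfolding continuous_map_def
proof (intro conjI allI impI)
 fix U :: "complex set" assume "openin euclidean U"
 then have "{T \<in> bops. (\<Sum>n. \<langle>\<xi> n, T (\<eta> n)\<rangle>) \<in> U} \<in>
   {{T \<in> bops. (\<Sum>n. \<langle>\<xi> n, T (\<eta> n)\<rangle>) \<in> U} | \<xi> \<eta> U. square_summable \<xi> \<and> square_summable \<eta> \<and> open U}"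
  using assms by auto
 then show "openin uw_topology {T \<in> topspace uw_topology. uwf \<xi> \<eta> T \<in> U}"
  unfolding topspace_uw uwf_def unfolding uw_topology_def by (rule topology_generated_by_Basis)
qed auto

lemma continuous_map_into_uw:
 fixes f :: "'x => 'a::chilbert => 'b::chilbert"
 assumes "!!x. x \<in> topspace X ==> f x \<in> bops"
  "!!\<xi> \<eta>. square_summable \<xi> ==> square_summable \<eta> ==> continuous_map X euclidean (%x. uwf \<xi> \<eta> (f x))"
 shows "continuous_map X uw_topology f"
 unfolding uw_topology_def
proof (rule continuous_on_generated_topo)
 fix V assume "V \<in> {{T \<in> bops. (\<Sum>n. \<langle>\<xi> n, (T::'a => 'b) (\<eta> n)\<rangle>) \<in> U} | \<xi> \<eta> U. square_summable \<xi> \<and> square_summable \<eta> \<and> open U}"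
 then obtain \<xi> :: "nat => 'b" and \<eta> :: "nat => 'a" and U where V: "V = {T \<in> bops. uwf \<xi> \<eta> T \<in> U}"
   "square_summable \<xi>" "square_summable \<eta>" "open U"
  unfolding uwf_def by blast
 have "f -` V \<inter> topspace X = {x \<in> topspace X. uwf \<xi> \<eta> (f x) \<in> U}"
  using assms(1) by (auto simp: V)
 then show "openin X (f -` V \<inter> topspace X)"
  using assms(2)[OF V(2,3)] V(4) by (auto simp: continuous_map_def)
next
 show "f ` topspace X \<subseteq> \<Union> {{T \<in> bops. (\<Sum>n. \<langle>\<xi> n, (T::'a => 'b) (\<eta> n)\<rangle>) \<in> U} | \<xi> \<eta> U. square_summable \<xi> \<and> square_summable \<eta> \<and> open U}"
  using assms(1) topspace_uw[where ?'a = 'a and ?'b = 'b]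
  unfolding uw_topology_def topology_generated_by_topspace by blast
qed

definition uw_ball :: "((nat => 'b::chilbert) \<times> (nat => 'a::chilbert)) set => real => ('a => 'b) => ('a => 'b) set" where
 "uw_ball F \<epsilon> T = {S \<in> bops. \<forall>(\<xi>, \<eta>)\<in>F. cmod (uwf \<xi> \<eta> S - uwf \<xi> \<eta> T) < \<epsilon>}"

text \<open>Induction on the generation of the open set: a finite intersection only enlarges the
  finite set of functionals and shrinks the radius. It serves to describe convergence and, in
  \<open>domination\<close>, to bound a continuous functional by finitely many
  \<open>uwf\<close>.\<close>

lemma uw_nbhd:
 fixes U :: "('a::chilbert => 'b::chilbert) set"
 assumes "openin uw_topology U" "T \<in> U"
 shows "\<exists>F \<epsilon>. finite F \<and> \<epsilon> > 0 \<and> (\<forall>(\<xi>, \<eta>)\<in>F. square_summable \<xi> \<and> square_summable \<eta>) \<and> uw_ball F \<epsilon> T \<subseteq> U"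
proof -
 have "generate_topology_on {{T \<in> bops. (\<Sum>n. \<langle>\<xi> n, (T::'a => 'b) (\<eta> n)\<rangle>) \<in> U} | \<xi> \<eta> U. square_summable \<xi> \<and> square_summable \<eta> \<and> open U} U"
  using assms(1) unfolding uw_topology_def openin_topology_generated_by_iff .
 then show ?thesis using assms(2)
 proof (induction arbitrary: T rule: generate_topology_on.induct)
  case (Int a b)
  obtain F \<epsilon> where 1: "finite F" "\<epsilon> > 0" "\<forall>(\<xi>, \<eta>)\<in>F. square_summable \<xi> \<and> square_summable \<eta>" "uw_ball F \<epsilon> T \<subseteq> a"
   using Int.IH(1)[of T] Int.prems by blast
  obtain F' \<epsilon>' where 2: "finite F'" "\<epsilon>' > 0" "\<forall>(\<xi>, \<eta>)\<in>F'. square_summable \<xi> \<and> square_summable \<eta>" "uw_ball F' \<epsilon>' T \<subseteq> b"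
   using Int.IH(2)[of T] Int.prems by blast
  have "uw_ball (F \<union> F') (min \<epsilon> \<epsilon>') T \<subseteq> uw_ball F \<epsilon> T \<inter> uw_ball F' \<epsilon>' T"
   unfolding uw_ball_def by auto
  then show ?case using 1 2
   by (intro exI[of _ "F \<union> F'"] exI[of _ "min \<epsilon> \<epsilon>'"]) auto
 next
  case (UN K)
  then obtain k where k: "k \<in> K" "T \<in> k" by blast
  obtain F \<epsilon> where "finite F" "\<epsilon> > 0" "\<forall>(\<xi>, \<eta>)\<in>F. square_summable \<xi> \<and> square_summable \<eta>" "uw_ball F \<epsilon> T \<subseteq> k"
   using UN.IH[OF k] by blast
  then show ?case using k by (intro exI[of _ F] exI[of _ \<epsilon>]) auto
 next
  case (Basis s)
  then obtain \<xi> :: "nat => 'b" and \<eta> :: "nat => 'a" and U where V: "s = {T \<in> bops. uwf \<xi> \<eta> T \<in> U}"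
    "square_summable \<xi>" "square_summable \<eta>" "open U"
   unfolding uwf_def by blast
  then have "uwf \<xi> \<eta> T \<in> U" using Basis.prems by simp
  then obtain \<epsilon> where \<epsilon>: "\<epsilon> > 0" "ball (uwf \<xi> \<eta> T) \<epsilon> \<subseteq> U" using V(4) open_contains_ball by blast
  then have "uw_ball {(\<xi>, \<eta>)} \<epsilon> T \<subseteq> s" unfolding uw_ball_def V(1)
   by (auto simp: subset_iff dist_norm norm_minus_commute)
  then show ?case using V \<epsilon> by (intro exI[of _ "{(\<xi>, \<eta>)}"] exI[of _ \<epsilon>]) auto
 qed auto
qed

lemma limitin_uw_iff:
 fixes f :: "'x => 'a::chilbert => 'b::chilbert"
 shows "limitin uw_topology f L F \<longleftrightarrow> L \<in> bops \<and> (\<forall>\<^sub>F x in F. f x \<in> bops) \<and>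
   (\<forall>\<xi> \<eta>. square_summable \<xi> \<longrightarrow> square_summable \<eta> \<longrightarrow> ((%x. uwf \<xi> \<eta> (f x)) \<longlongrightarrow> uwf \<xi> \<eta> L) F)"
proof (intro iffI conjI allI impI)
 assume l: "limitin uw_topology f L F"
 then show "L \<in> bops" by (simp add: limitin_def)
 show "\<forall>\<^sub>F x in F. f x \<in> bops"
  using l \<open>L \<in> bops\<close> openin_topspace[of uw_topology] unfolding limitin_def by (metis topspace_uw)
 fix \<xi> :: "nat => 'b" and \<eta> :: "nat => 'a" assume "square_summable \<xi>" "square_summable \<eta>"
 from continuous_map_limit[OF continuous_map_uwf[OF this] l]
 show "((%x. uwf \<xi> \<eta> (f x)) \<longlongrightarrow> uwf \<xi> \<eta> L) F" by (simp add: o_def)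
next
 assume *: "L \<in> bops \<and> (\<forall>\<^sub>F x in F. f x \<in> bops) \<and>
   (\<forall>\<xi> \<eta>. square_summable \<xi> \<longrightarrow> square_summable \<eta> \<longrightarrow> ((%x. uwf \<xi> \<eta> (f x)) \<longlongrightarrow> uwf \<xi> \<eta> L) F)"
 show "limitin uw_topology f L F"
  unfolding limitin_def
 proof (intro conjI allI impI)
  show "L \<in> topspace uw_topology" using * by simp
  fix U assume U: "openin uw_topology U \<and> L \<in> U"
  then obtain G \<epsilon> where G: "finite G" "\<epsilon> > 0" "\<forall>(\<xi>, \<eta>)\<in>G. square_summable \<xi> \<and> square_summable \<eta>" "uw_ball G \<epsilon> L \<subseteq> U"
   using uw_nbhd by blast
  have "\<forall>\<^sub>F x in F. \<forall>(\<xi>, \<eta>)\<in>G. cmod (uwf \<xi> \<eta> (f x) - uwf \<xi> \<eta> L) < \<epsilon>"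
  proof (rule eventually_ball_finite[OF G(1)], safe)
   fix \<xi> \<eta> assume "(\<xi>, \<eta>) \<in> G"
   then have "((%x. uwf \<xi> \<eta> (f x)) \<longlongrightarrow> uwf \<xi> \<eta> L) F" using * G(3) by blast
   from tendstoD[OF this G(2)] show "\<forall>\<^sub>F x in F. cmod (uwf \<xi> \<eta> (f x) - uwf \<xi> \<eta> L) < \<epsilon>"
    by (simp add: dist_norm)
  qed
  then show "\<forall>\<^sub>F x in F. f x \<in> U"
   using conjunct1[OF conjunct2[OF *]]
   by eventually_elim (use G(4) in \<open>auto simp: uw_ball_def\<close>)
 qed
qed

lemma limitin_uw_bops: "limitin uw_topology f L F ==> L \<in> bops"
 by (simp add: limitin_uw_iff)

lemma limitin_uw_cinner: "limitin uw_topology f L F ==> ((%x. \<langle>u, f x v\<rangle>) \<longlongrightarrow> \<langle>u, L v\<rangle>) F"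
 using continuous_map_limit[OF continuous_map_uwf[OF square_summable_single square_summable_single], of f L F u v]
 by (simp add: o_def)

lemma limitin_uw_unique:
 assumes "limitin uw_topology f L F" "limitin uw_topology f L' F" "F \<noteq> bot"
 shows "L = L'"
 by (rule bops_ext) (rule tendsto_unique[OF assms(3) limitin_uw_cinner[OF assms(1)] limitin_uw_cinner[OF assms(2)]])

text \<open>On bounded sets the weak and the ultraweak topology agree: the series are dominated by a
  fixed summable one, and Tannery's theorem lets the limit pass through the sum.\<close>

lemma uwf_tendsto:
 fixes f :: "'x => 'a::chilbert => 'b::chilbert"
 assumes f: "\<forall>\<^sub>F x in F. f x \<in> bops \<and> (\<forall>v. norm (f x v) <= K * norm v)" and L: "L \<in> bops"
  and lim: "!!u v. ((%x. \<langle>u, f x v\<rangle>) \<longlongrightarrow> \<langle>u, L v\<rangle>) F"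
  and ss: "square_summable \<xi>" "square_summable \<eta>"
 shows "((%x. uwf \<xi> \<eta> (f x)) \<longlongrightarrow> uwf \<xi> \<eta> L) F"
proof (cases "F = bot")
 case False
 have "((%x. \<Sum>n. \<langle>\<xi> n, f x (\<eta> n)\<rangle>) \<longlongrightarrow> (\<Sum>n. \<langle>\<xi> n, L (\<eta> n)\<rangle>)) F"
 proof (rule tannerys_theorem[THEN conjunct2, THEN conjunct2, OF _ _ _ False])
  show "((%x. \<langle>\<xi> n, f x (\<eta> n)\<rangle>) \<longlongrightarrow> \<langle>\<xi> n, L (\<eta> n)\<rangle>) F" for n by (rule lim)
  show "summable (%n. K * (norm (\<xi> n) * norm (\<eta> n)))"
   by (intro summable_mult square_summable_prod ss)
  have "cmod \<langle>\<xi> n, T (\<eta> n)\<rangle> <= K * (norm (\<xi> n) * norm (\<eta> n))" if "!!v. norm (T v) <= K * norm v" for n T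
   using order_trans[OF cinner_CS mult_left_mono[OF that norm_ge_zero], of "\<xi> n" "\<eta> n"] by (simp add: mult_ac)
  then show "\<forall>\<^sub>F (n, x) in at_top \<times>\<^sub>F F. cmod \<langle>\<xi> n, f x (\<eta> n)\<rangle> <= K * (norm (\<xi> n) * norm (\<eta> n))"
   using f unfolding eventually_prod_filter case_prod_conv
   by (intro exI[of _ "%_. True"] exI[of _ "%x. f x \<in> bops \<and> (\<forall>v. norm (f x v) <= K * norm v)"]) auto
 qed
 then show ?thesis unfolding uwf_def .
qed simp

lemma limitin_uwI:
 assumes "\<forall>\<^sub>F x in F. f x \<in> bops \<and> (\<forall>v. norm (f x v) <= K * norm v)" "L \<in> bops"
  "!!u v. ((%x. \<langle>u, f x v\<rangle>) \<longlongrightarrow> \<langle>u, L v\<rangle>) F"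
 shows "limitin uw_topology f L F"
 unfolding limitin_uw_iff using uwf_tendsto[OF assms] assms(1,2) by (auto elim: eventually_mono)

lemma uw_closure_bops: "T \<in> uw_topology closure_of S ==> T \<in> bops"
 using closure_of_subset_topspace[of uw_topology S] by auto

lemma uw_closure_uwf_eq:
 assumes "T \<in> uw_topology closure_of S"
  and "square_summable \<xi>" "square_summable \<eta>" "square_summable \<xi>'" "square_summable \<eta>'"
  and "!!S'. S' \<in> S ==> uwf \<xi> \<eta> S' = uwf \<xi>' \<eta>' S'"
 shows "uwf \<xi> \<eta> T = uwf \<xi>' \<eta>' T"
 by (rule forall_in_closure_of_eq[OF assms(1) Hausdorff_space_euclidean continuous_map_uwf[OF assms(2,3)]
    continuous_map_uwf[OF assms(4,5)]]) (rule assms(6))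

lemma uw_closure_cinner_eq:
 assumes "T \<in> uw_topology closure_of S" "!!S'. S' \<in> S ==> \<langle>u, S' v\<rangle> = \<langle>u', S' v'\<rangle>"
 shows "\<langle>u, T v\<rangle> = \<langle>u', T v'\<rangle>"
 using uw_closure_uwf_eq[OF assms(1), of "single u" "single v" "single u'" "single v'"] assms(2) by simp

lemma op_span_superset: "S \<subseteq> op_span S"
proof
 fix T assume "T \<in> S"
 then show "T \<in> op_span S" unfolding op_span_def
  by (intro CollectI exI[of _ "1::nat"] exI[of _ "%_. 1"] exI[of _ "%_. T"]) auto
qed

lemma op_span_bops: "S \<subseteq> bops ==> op_span S \<subseteq> bops"
 unfolding op_span_def by (auto intro!: bops_sum_op bops_cscale)

lemma op_span_cinner_eq:
 assumes "T \<in> op_span S" "!!S'. S' \<in> S ==> \<langle>u, S' v\<rangle> = \<langle>u', S' v'\<rangle>"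
 shows "\<langle>u, T v\<rangle> = \<langle>u', T v'\<rangle>"
proof -
 obtain n c R where T: "T = (%x. \<Sum>i<n::nat. c i *\<^sub>C R i x)" "\<forall>i<n. R i \<in> S"
  using assms(1) unfolding op_span_def by blast
 show ?thesis unfolding T(1) cinner_sum_right cinner_scaleC_right
  by (intro sum.cong refl) (use T(2) assms(2) in auto)
qed

lemma uw_span_closure_cinner_eq:
 assumes "T \<in> uw_topology closure_of op_span S" "!!S'. S' \<in> S ==> \<langle>u, S' v\<rangle> = \<langle>u', S' v'\<rangle>"
 shows "\<langle>u, T v\<rangle> = \<langle>u', T v'\<rangle>"
 by (rule uw_closure_cinner_eq[OF assms(1)], erule op_span_cinner_eq, rule assms(2))

section \<open>Functionals given by families, and normality of ampliations\<close>

text \<open>Lists a family with support in the countable set \<open>C\<close> as a sequence, the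
  form that \<open>uwf\<close> requires. The default 0 fills the positions beyond the last element
  when \<open>C\<close> is finite.\<close>

definition enum_seq :: "'i set => ('i => 'c::zero) => nat => 'c" where
 "enum_seq C y k = (if k \<in> to_nat_on C ` C then y (inv_into C (to_nat_on C) k) else 0)"

lemma enum_seq_at: "countable C ==> i \<in> C ==> enum_seq C y (to_nat_on C i) = y i"
 by (simp add: enum_seq_def inj_on_to_nat_on)

lemma has_sum_enum:
 fixes f :: "'i => 'c::{comm_monoid_add, topological_space}"
 assumes C: "countable C" and "!!i. i \<in> C ==> g (to_nat_on C i) = f i" "!!i. i \<notin> C ==> f i = 0"
  "!!k. k \<notin> to_nat_on C ` C ==> g k = 0"
 shows "(g has_sum S) UNIV \<longleftrightarrow> (f has_sum S) UNIV"
proof -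
 have "(g has_sum S) UNIV \<longleftrightarrow> (g has_sum S) (to_nat_on C ` C)"
  by (rule has_sum_cong_neutral) (use assms in auto)
 also have "\<dots> \<longleftrightarrow> ((g \<circ> to_nat_on C) has_sum S) C"
  by (rule has_sum_reindex[OF inj_on_to_nat_on[OF C]])
 also have "\<dots> \<longleftrightarrow> (f has_sum S) UNIV"
  by (rule has_sum_cong_neutral) (use assms in auto)
 finally show ?thesis .
qed

lemma square_summable_enum:
 assumes C: "countable C" and "(%i. (norm (y i))\<^sup>2) summable_on UNIV" "!!i. i \<notin> C ==> y i = 0"
 shows "square_summable (enum_seq C y)"
proof -
 obtain S where "((%i. (norm (y i))\<^sup>2) has_sum S) UNIV" using assms(2) summable_on_def by blast
 then have "((%k. (norm (enum_seq C y k))\<^sup>2) has_sum S) UNIV"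
  by (subst has_sum_enum[OF C]) (auto simp: enum_seq_at[OF C] assms(3), auto simp: enum_seq_def)
 then show ?thesis unfolding square_summable_def
  by (intro summable_on_imp_summable) (auto simp: summable_on_def)
qed

text \<open>Square summability over an arbitrary index set forces countable support, so that the
  family can be enumerated.\<close>

lemma uwf_of_family:
 fixes z :: "'i => 'b::chilbert" and w :: "'i => 'a::chilbert"
 assumes z: "(%i. (norm (z i))\<^sup>2) summable_on UNIV" and w: "(%i. (norm (w i))\<^sup>2) summable_on UNIV"
 shows "\<exists>\<xi> \<eta>. square_summable \<xi> \<and> square_summable \<eta> \<and>
  (\<forall>T\<in>bops. ((%i. \<langle>z i, T (w i)\<rangle>) has_sum uwf \<xi> \<eta> T) UNIV)"
proof -
 define C where "C = {i. z i \<noteq> 0} \<union> {i. w i \<noteq> 0}"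
 have C: "countable C" unfolding C_def
  using summable_countable_real[OF z] summable_countable_real[OF w] by simp
 have z0: "i \<notin> C ==> z i = 0" and w0: "i \<notin> C ==> w i = 0" for i by (auto simp: C_def)
 note ssz = square_summable_enum[OF C z z0] and ssw = square_summable_enum[OF C w w0]
 have "((%i. \<langle>z i, T (w i)\<rangle>) has_sum uwf (enum_seq C z) (enum_seq C w) T) UNIV" if T: "T \<in> bops" for T
 proof -
  have "((%k. \<langle>enum_seq C z k, T (enum_seq C w k)\<rangle>) has_sum uwf (enum_seq C z) (enum_seq C w) T) UNIV"
   by (rule norm_summable_imp_has_sum[OF uwf_abs_summable[OF ssz ssw T] uwf_sums[OF ssz ssw T]])
  then show ?thesis
   by (subst (asm) has_sum_enum[OF C]) (auto simp: enum_seq_at[OF C] z0, auto simp: enum_seq_def)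
 qed
 then show ?thesis using ssz ssw by blast
qed

lemma summable_components:
 assumes "square_summable \<zeta>"
 shows "(%p. (norm (comp_at (snd p) (\<zeta> (fst p))))\<^sup>2) summable_on UNIV"
proof -
 have "(%p. (norm (comp_at (snd p) (\<zeta> (fst p))))\<^sup>2) summable_on (SIGMA n:UNIV. UNIV)"
 proof (rule summable_on_SigmaI)
  show "((%x. (norm (comp_at (snd (n, x)) (\<zeta> (fst (n, x)))))\<^sup>2) has_sum (norm (\<zeta> n))\<^sup>2) UNIV" for n
   using parseval_norm by simp
  show "(%n. (norm (\<zeta> n))\<^sup>2) summable_on UNIV"
   using assms unfolding square_summable_def by (subst summable_on_UNIV_nonneg_real_iff) auto
 qed auto
 then show ?thesis by simp
qed

text \<open>Expanding all vectors in the basis of the second factor gives a family indexed by pairs,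
  which is again square summable. Hence an ultraweak functional of \<open>T \<otimes> 1\<close> is
  one of \<open>T\<close>, even for an uncountable basis.\<close>

lemma uwf_ampliation:
 fixes \<xi> :: "nat => ('b::chilbert, 'x ell2) tensor" and \<eta> :: "nat => ('a::chilbert, 'x ell2) tensor"
 assumes ss: "square_summable \<xi>" "square_summable \<eta>"
 shows "\<exists>\<xi>' \<eta>'. square_summable \<xi>' \<and> square_summable \<eta>' \<and>
  (\<forall>T\<in>bops. uwf \<xi> \<eta> (op_tensor T (%x. x)) = uwf \<xi>' \<eta>' T)"
proof -
 define z where "z p = comp_at (snd p) (\<xi> (fst p))" for p
 define w where "w p = comp_at (snd p) (\<eta> (fst p))" for p
 obtain \<xi>' \<eta>' where ss': "square_summable \<xi>'" "square_summable \<eta>'"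
  and u: "!!T. T \<in> bops ==> ((%p. \<langle>z p, T (w p)\<rangle>) has_sum uwf \<xi>' \<eta>' T) UNIV"
  using uwf_of_family[of z w] summable_components[OF ss(1)] summable_components[OF ss(2)] unfolding z_def w_def by blast
 have "uwf \<xi> \<eta> (op_tensor T (%x. x)) = uwf \<xi>' \<eta>' T" if T: "T \<in> bops" for T
 proof -
  have "((%p. \<langle>z p, T (w p)\<rangle>) has_sum uwf \<xi>' \<eta>' T) (SIGMA n:UNIV. UNIV)" using u[OF T] by simp
  then have "((%n. \<langle>\<xi> n, op_tensor T (%x. x) (\<eta> n)\<rangle>) has_sum uwf \<xi>' \<eta>' T) UNIV"
  proof (rule has_sum_SigmaD)
   show "((%x. \<langle>z (n, x), T (w (n, x))\<rangle>) has_sum \<langle>\<xi> n, op_tensor T (%x. x) (\<eta> n)\<rangle>) UNIV" for n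
    using parseval[of "\<xi> n" "op_tensor T (%x. x) (\<eta> n)"] by (simp add: z_def w_def comp_at_op_tensor T)
  qed
  from has_sum_imp_sums[OF this] show ?thesis unfolding uwf_def[of \<xi> \<eta>] by (rule sums_unique[symmetric])
 qed
 then show ?thesis using ss' by blast
qed

lemma normal_ampliation_conj:
 fixes X :: "('b::chilbert, 'x ell2) tensor => 'd::chilbert" and Y :: "'c::chilbert => ('a::chilbert, 'x ell2) tensor"
 assumes "X \<in> bops" "Y \<in> bops"
 shows "continuous_map uw_topology uw_topology (%T x. X (op_tensor T (%x. x) (Y x)))"
proof (rule continuous_map_into_uw)
 show "(%x. X (op_tensor T (%x. x) (Y x))) \<in> bops" if "T \<in> topspace uw_topology" for T
  by (rule bops_comp[OF assms(1) bops_comp[OF op_tensor_bops assms(2)]]) (use that in auto)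
 fix \<xi> :: "nat => 'd" and \<eta> :: "nat => 'c" assume ss: "square_summable \<xi>" "square_summable \<eta>"
 obtain \<xi>' \<eta>' where ss': "square_summable \<xi>'" "square_summable \<eta>'"
  and u: "!!T. T \<in> bops ==> uwf (%n. adj X (\<xi> n)) (%n. Y (\<eta> n)) (op_tensor T (%x. x)) = uwf \<xi>' \<eta>' T"
  using uwf_ampliation[OF square_summable_bops[OF adj_bops[OF assms(1)] ss(1)] square_summable_bops[OF assms(2) ss(2)]] by blast
 show "continuous_map uw_topology euclidean (%T. uwf \<xi> \<eta> (%x. X (op_tensor T (%x. x) (Y x))))"
 proof (rule continuous_map_eq[OF continuous_map_uwf[OF ss']])
  show "uwf \<xi>' \<eta>' T = uwf \<xi> \<eta> (%x. X (op_tensor T (%x. x) (Y x)))" if "T \<in> topspace uw_topology" for T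
   using that by (subst uwf_conj[OF assms(1)]) (simp add: u)
 qed
qed

lemma normal_conj:
 assumes "X \<in> bops" "Y \<in> bops"
 shows "continuous_map uw_topology uw_topology (%T x. X (T (Y x)))"
proof (rule continuous_map_into_uw)
 show "(%x. X (T (Y x))) \<in> bops" if "T \<in> topspace uw_topology" for T
  by (rule bops_comp[OF assms(1) bops_comp[OF _ assms(2)]]) (use that in auto)
 show "continuous_map uw_topology euclidean (%T. uwf \<xi> \<eta> (%x. X (T (Y x))))"
  if "square_summable \<xi>" "square_summable \<eta>" for \<xi> \<eta>
  unfolding uwf_conj[OF assms(1)]
  by (rule continuous_map_uwf[OF square_summable_bops[OF adj_bops[OF assms(1)] that(1)] square_summable_bops[OF assms(2) that(2)]])
qed

section \<open>Von Neumann algebras\<close>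

locale von_neumann =
 fixes A :: "('h::chilbert => 'h) set"
 assumes vN: "von_neumann_algebra A"
begin

lemma A_bops: "a \<in> A ==> a \<in> bops"
 and A_adj: "a \<in> A ==> adj a \<in> A"
 and A_bicommutant: "commutant (commutant A) = A"
 using vN unfolding von_neumann_algebra_def by auto

lemma commutant_bops: "b \<in> commutant A ==> b \<in> bops"
 by (simp add: commutant_def)

lemma commutantD: "b \<in> commutant A ==> a \<in> A ==> a (b u) = b (a u)"
 unfolding commutant_def by (metis (mono_tags, lifting) comp_apply mem_Collect_eq)

lemma commutant_adj:
 assumes b: "b \<in> commutant A" shows "adj b \<in> commutant A"
proof -
 have bb: "b \<in> bops" by (rule commutant_bops[OF b])
 have "a \<circ> adj b = adj b \<circ> a" if a: "a \<in> A" for a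
 proof (rule bops_ext)
  fix x y
  have "\<langle>x, (a \<circ> adj b) y\<rangle> = \<langle>b (adj a x), y\<rangle>"
   by (simp add: adj_cinner' bb flip: adj_cinner[OF A_bops[OF a]])
  also have "\<dots> = \<langle>adj a (b x), y\<rangle>" by (simp add: commutantD[OF b A_adj[OF a]])
  also have "\<dots> = \<langle>x, (adj b \<circ> a) y\<rangle>" by (simp add: adj_cinner' bb adj_cinner[OF A_bops[OF a]])
  finally show "\<langle>x, (a \<circ> adj b) y\<rangle> = \<langle>x, (adj b \<circ> a) y\<rangle>" .
 qed
 then show ?thesis by (simp add: commutant_def adj_bops[OF bb])
qed

text \<open>The bicommutant property in the form of a membership test, from which the closure
  properties of \<open>A\<close> are read off.\<close>

lemma A_I:
 assumes "T \<in> bops" "!!b u. b \<in> commutant A ==> T (b u) = b (T u)"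
 shows "T \<in> A"
proof -
 have "T \<in> commutant (commutant A)"
  unfolding commutant_def[of "commutant A"] using assms by auto
 then show ?thesis by (simp add: A_bicommutant)
qed

lemma A_id: "(%u. u) \<in> A"
 by (rule A_I) auto

lemma A_comp: "a \<in> A ==> b \<in> A ==> (%u. a (b u)) \<in> A"
 by (rule A_I) (auto intro: bops_comp[OF A_bops A_bops] simp: commutantD)

lemma A_plus: "a \<in> A ==> b \<in> A ==> (%u. a u + b u) \<in> A"
 by (rule A_I) (auto intro: bops_plus A_bops simp: commutantD bops_add commutant_bops)

lemma A_scale: "a \<in> A ==> (%u. c *\<^sub>C a u) \<in> A"
 by (rule A_I) (auto intro: bops_cscale A_bops simp: commutantD bops_scaleC commutant_bops)

lemma A_rscale: "a \<in> A ==> (%u. r *\<^sub>R a u) \<in> A"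
 using A_scale[of a "complex_of_real r"] by (simp add: scaleC_of_real)

lemma A_lincomb: "a \<in> A ==> b \<in> A ==> (%u. c *\<^sub>C a u + b u) \<in> A"
 by (intro A_plus A_scale)

lemma A_zero: "(%u. 0) \<in> A"
 using A_scale[OF A_id, of 0] by simp

lemma A_diff: "a \<in> A ==> b \<in> A ==> (%u. a u - b u) \<in> A"
 using A_plus[OF _ A_rscale[of b "-1"], of a] by simp

text \<open>Commutation with \<open>b\<close> survives weak limits, because \<open>b\<close> can be
  moved to the other side of the inner product as \<open>adj b\<close>.\<close>

lemma A_weak_limit:
 assumes "L \<in> bops" "\<forall>\<^sub>F x in F. f x \<in> A" "!!u v. ((%x. \<langle>u, f x v\<rangle>) \<longlongrightarrow> \<langle>u, L v\<rangle>) F" "F \<noteq> bot"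
 shows "L \<in> A"
proof (rule A_I[OF assms(1)])
 fix b v assume b: "b \<in> commutant A"
 show "L (b v) = b (L v)"
 proof (rule cinner_ext)
  fix u
  have "((%x. \<langle>u, f x (b v)\<rangle>) \<longlongrightarrow> \<langle>adj b u, L v\<rangle>) F"
   by (rule Lim_transform_eventually[OF assms(3)[of "adj b u" v] eventually_mono[OF assms(2)]])
     (simp add: adj_cinner commutant_bops b commutantD)
  then have "\<langle>u, L (b v)\<rangle> = \<langle>adj b u, L v\<rangle>"
   by (rule tendsto_unique[OF assms(4) assms(3)])
  then show "\<langle>u, L (b v)\<rangle> = \<langle>u, b (L v)\<rangle>" by (simp add: adj_cinner commutant_bops b)
 qed
qed

text \<open>Commutation is checked on elementary tensors. Its matrix elements are linear and
  ultraweakly continuous in \<open>T\<close>, so it passes to the closed span.\<close>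

lemma uw_tensor_commute:
 assumes T: "T \<in> uw_tensor A M" and M: "M \<subseteq> bops" and b: "b \<in> commutant A"
 shows "T (op_tensor b (%x. x) \<zeta>) = op_tensor b (%x. x) (T \<zeta>)"
proof (rule cinner_ext)
 fix \<xi>
 have "\<langle>\<xi>, T (op_tensor b (%x. x) \<zeta>)\<rangle> = \<langle>adj (op_tensor b (%x. x)) \<xi>, T \<zeta>\<rangle>"
  using T unfolding uw_tensor_def
 proof (rule uw_span_closure_cinner_eq)
  fix S assume "S \<in> {op_tensor a z | a z. a \<in> A \<and> z \<in> M}"
  then obtain a z where S: "S = op_tensor a z" "a \<in> A" "z \<in> bops" using M by blast
  show "\<langle>\<xi>, S (op_tensor b (%x. x) \<zeta>)\<rangle> = \<langle>adj (op_tensor b (%x. x)) \<xi>, S \<zeta>\<rangle>"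
   unfolding S(1) by (simp add: adj_cinner op_tensor_bops op_tensor_comp A_bops commutant_bops S b commutantD[OF b S(2)])
 qed
 then show "\<langle>\<xi>, T (op_tensor b (%x. x) \<zeta>)\<rangle> = \<langle>\<xi>, op_tensor b (%x. x) (T \<zeta>)\<rangle>"
  by (simp add: adj_cinner op_tensor_bops commutant_bops b)
qed

lemma uw_tensor_bops: "T \<in> uw_tensor A M ==> T \<in> bops"
 unfolding uw_tensor_def by (rule uw_closure_bops)

lemma ket_uw_tensor_bops: "l \<in> ket_uw_tensor A ==> l \<in> bops"
 unfolding ket_uw_tensor_def by (rule uw_closure_bops)

lemma ket_uw_tensor_commute:
 fixes l :: "'h => ('a::chilbert, 'h) tensor"
 assumes l: "l \<in> ket_uw_tensor A" and b: "b \<in> commutant A"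
 shows "l (b u) = ampr b (l u)"
proof (rule cinner_ext)
 fix \<xi>
 have "\<langle>\<xi>, l (b u)\<rangle> = \<langle>adj (ampr b) \<xi>, l u\<rangle>"
  using l unfolding ket_uw_tensor_def
 proof (rule uw_span_closure_cinner_eq)
  fix S :: "'h => ('a, 'h) tensor" assume "S \<in> {%u. c \<otimes> a u | c a. a \<in> A}"
  then obtain c a where S: "S = (%u. c \<otimes> a u)" "a \<in> A" by blast
  show "\<langle>\<xi>, S (b u)\<rangle> = \<langle>adj (ampr b) \<xi>, S u\<rangle>"
   unfolding S(1) by (simp add: adj_cinner op_tensor_bops op_tensor_tensor commutant_bops b commutantD[OF b S(2)])
 qed
 then show "\<langle>\<xi>, l (b u)\<rangle> = \<langle>\<xi>, ampr b (l u)\<rangle>"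
  by (simp add: adj_cinner op_tensor_bops commutant_bops b)
qed

end

section \<open>Normal representations\<close>

text \<open>Merges two successive multiplicity spaces into one, so that iterated ampliations remain
  ampliations of operators on the same space.\<close>

lemma flatten_exists:
 "\<exists>V::(('a::chilbert, 'x ell2) tensor, 'y ell2) tensor => ('a, ('x \<times> 'y) ell2) tensor.
  isometry V \<and> (\<forall>u x y. V ((u \<otimes> basis x) \<otimes> basis y) = u \<otimes> basis (x, y))"
proof -
 let ?g = "%p::'a \<times> 'x \<times> 'y. (fst p \<otimes> basis (fst (snd p))) \<otimes> basis (snd (snd p))"
 let ?f = "%p::'a \<times> 'x \<times> 'y. fst p \<otimes> basis (snd p)"
 have "ctotal (range ?g)"
  by (rule total_mono[OF ctotal_tensor[OF ctotal_basis_tensor ctotal_basis]]) (auto simp: image_iff, blast)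
 from isometry_extension[of ?g UNIV ?f, OF this] show ?thesis
  by (auto simp: cinner_tensor cinner_basis)
qed

definition flatten :: "(('a::chilbert, 'x ell2) tensor, 'y ell2) tensor => ('a, ('x \<times> 'y) ell2) tensor" where
 "flatten = (SOME V. isometry V \<and> (\<forall>u x y. V ((u \<otimes> basis x) \<otimes> basis y) = u \<otimes> basis (x, y)))"

lemmas flatten_isometry = someI_ex[OF flatten_exists, folded flatten_def, THEN conjunct1]
 and flatten_basis = someI_ex[OF flatten_exists, folded flatten_def, THEN conjunct2, rule_format]

abbreviation amp :: "('a::chilbert => 'b::chilbert) => ('a, 'c::chilbert) tensor => ('b, 'c) tensor" where
 "amp T \<equiv> op_tensor T (%x. x)"

lemma amp_bops: "T \<in> bops ==> amp T \<in> bops"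
 by (simp add: op_tensor_bops)

lemma amp_tensor: "T \<in> bops ==> amp T (u \<otimes> v) = T u \<otimes> v"
 by (simp add: op_tensor_tensor)

lemma amp_comp: "S \<in> bops ==> T \<in> bops ==> amp S (amp T \<zeta>) = amp (%x. S (T x)) \<zeta>"
 by (simp add: op_tensor_comp)

lemma amp_adj: "T \<in> bops ==> adj (amp T) = amp (adj T)"
 by (simp add: op_tensor_adj)

lemma amp_lincomb: "S \<in> bops ==> T \<in> bops ==> amp (%x. c *\<^sub>C S x + T x) \<zeta> = c *\<^sub>C amp S \<zeta> + amp T \<zeta>"
 by (simp add: op_tensor_lincomb_left)

lemma flatten_amp:
 assumes "T \<in> bops"
 shows "flatten (amp (amp T) \<zeta>) = amp T (flatten \<zeta>)"
proof (rule fun_cong, rule total_bops_eq[OF ctotal_tensor[OF ctotal_basis_tensor ctotal_basis]])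
 show "(%\<zeta>. flatten (amp (amp T) \<zeta>)) \<in> bops"
  by (rule bops_comp[OF isometry_bops[OF flatten_isometry] amp_bops[OF amp_bops[OF assms]]])
 show "(%\<zeta>. amp T (flatten \<zeta>)) \<in> bops"
  by (rule bops_comp[OF amp_bops[OF assms] isometry_bops[OF flatten_isometry]])
qed (auto simp: amp_tensor amp_bops assms flatten_basis)

lemma cinner_basis_sum:
 assumes "finite I"
 shows "\<langle>\<Sum>i\<in>I. w i \<otimes> basis i, \<Sum>i\<in>I. w' i \<otimes> basis i\<rangle> = (\<Sum>i\<in>I. \<langle>w i, w' i\<rangle>)"
 unfolding cinner_sum_left unfolding cinner_sum_right cinner_tensor cinner_basis
 using assms by (simp add: if_distrib[where f = "%z. _ * z"] sum.delta' cong: if_cong)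

locale normal_rep = von_neumann A for A :: "('h::chilbert => 'h) set" +
 fixes J :: "('h => 'h) => 'e::chilbert => 'e"
 assumes J_bops: "a \<in> A ==> J a \<in> bops"
  and J_lin: "clinear_on A J"
  and J_mult: "a \<in> A ==> b \<in> A ==> J (a \<circ> b) = J a \<circ> J b"
  and J_adj: "a \<in> A ==> J (adj a) = adj (J a)"
  and J_id: "J (%u. u) = (%x. x)"
  and J_normal: "continuous_map (subtopology uw_topology A) uw_topology J"
begin

lemma J_comp: "a \<in> A ==> b \<in> A ==> J (%u. a (b u)) x = J a (J b x)"
 using J_mult[of a b] by (simp add: o_def)

lemma J_lincomb: "a \<in> A ==> b \<in> A ==> J (%u. c *\<^sub>C a u + b u) x = c *\<^sub>C J a x + J b x"
 using J_lin unfolding clinear_on_def by metis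

lemma J_zero: "J (%u. 0) x = 0"
 using J_lincomb[OF A_zero A_zero, of 1 x] by simp

lemma J_scale: "a \<in> A ==> J (%u. c *\<^sub>C a u) x = c *\<^sub>C J a x"
 using J_lincomb[OF _ A_zero, of a c x] by (simp add: J_zero)

lemma J_plus: "a \<in> A ==> b \<in> A ==> J (%u. a u + b u) x = J a x + J b x"
 using J_lincomb[of a b 1 x] by simp

lemma J_cinner: "a \<in> A ==> b \<in> A ==> \<langle>J a x, J b y\<rangle> = \<langle>x, J (%u. adj a (b u)) y\<rangle>"
 by (simp add: J_comp A_adj J_adj adj_cinner' J_bops)

text \<open>Continuity of \<open>a \<mapsto> \<langle>y, J a y\<rangle>\<close> at 0 yields a basic
  neighbourhood on which the functional is less than 1; by homogeneity this inclusion becomes an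
  inequality.\<close>

lemma domination:
 "\<exists>F K. finite F \<and> 0 <= K \<and> (\<forall>(\<xi>, \<eta>)\<in>F. square_summable \<xi> \<and> square_summable \<eta>) \<and>
  (\<forall>a\<in>A. cmod \<langle>y, J a y\<rangle> <= K * (\<Sum>(\<xi>, \<eta>)\<in>F. cmod (uwf \<xi> \<eta> a)))"
proof -
 have "continuous_map (subtopology uw_topology A) euclidean (uwf (single y) (single y) \<circ> J)"
  by (rule continuous_map_compose[OF J_normal continuous_map_uwf]) auto
 moreover have "openin euclidean (ball (0::complex) 1)" by simp
 ultimately have "openin (subtopology uw_topology A) {a \<in> topspace (subtopology uw_topology A). (uwf (single y) (single y) \<circ> J) a \<in> ball 0 1}"
  unfolding continuous_map_def by blast
 then obtain V where V: "openin uw_topology V"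
   "{a \<in> topspace (subtopology uw_topology A). (uwf (single y) (single y) \<circ> J) a \<in> ball 0 1} = V \<inter> A"
  unfolding openin_subtopology by blast
 have V': "a \<in> V \<longleftrightarrow> cmod \<langle>y, J a y\<rangle> < 1" if "a \<in> A" for a
  using V(2) that A_bops[OF that] by (auto simp: set_eq_iff dist_norm)
 have "(%u. 0) \<in> V" by (simp add: V' A_zero J_zero)
 then obtain F \<epsilon> where F: "finite F" "\<epsilon> > 0" "\<forall>(\<xi>, \<eta>)\<in>F. square_summable \<xi> \<and> square_summable \<eta>"
   "uw_ball F \<epsilon> (%u. 0) \<subseteq> V"
  using uw_nbhd[OF V(1)] by metis
 have "cmod \<langle>y, J a y\<rangle> <= (2 / \<epsilon>) * (\<Sum>(\<xi>, \<eta>)\<in>F. cmod (uwf \<xi> \<eta> a))" if a: "a \<in> A" for a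
 proof (rule ccontr)
  define p where "p = cmod \<langle>y, J a y\<rangle>"
  define m where "m = (\<Sum>(\<xi>, \<eta>)\<in>F. cmod (uwf \<xi> \<eta> a))"
  have m0: "m \<ge> 0" unfolding m_def by (intro sum_nonneg) auto
  assume "\<not> cmod \<langle>y, J a y\<rangle> <= (2 / \<epsilon>) * (\<Sum>(\<xi>, \<eta>)\<in>F. cmod (uwf \<xi> \<eta> a))"
  then have pm: "p > (2 / \<epsilon>) * m" unfolding p_def m_def by simp
  have p0: "p > 0" using pm m0 F(2) by (smt (verit) divide_nonneg_pos mult_nonneg_nonneg)
  \<comment> \<open>With this scaling the functional has modulus exactly 1, while the multiple of
    \<open>a\<close> still lies in the neighbourhood where it is less than 1.\<close>
  let ?c = "complex_of_real (1 / p)"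
  have "(%u. ?c *\<^sub>C a u) \<in> uw_ball F \<epsilon> (%u. 0)"
   unfolding uw_ball_def
  proof (intro CollectI conjI ballI, safe)
   show "(%u. ?c *\<^sub>C a u) \<in> bops" by (intro bops_cscale A_bops a)
   fix \<xi> \<eta> assume f: "(\<xi>, \<eta>) \<in> F"
   then have ss: "square_summable \<xi>" "square_summable \<eta>" using F(3) by auto
   have "uwf \<xi> \<eta> (%u. ?c *\<^sub>C a u) - uwf \<xi> \<eta> (%u. 0) = ?c * uwf \<xi> \<eta> a"
    using uwf_lincomb[OF ss A_bops[OF a] bops_zero_op, of ?c] by simp
   then have "cmod (uwf \<xi> \<eta> (%u. ?c *\<^sub>C a u) - uwf \<xi> \<eta> (%u. 0)) = cmod (uwf \<xi> \<eta> a) / p"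
    using p0 by (simp add: norm_mult norm_divide)
   also have "cmod (uwf \<xi> \<eta> a) <= m"
    unfolding m_def using member_le_sum[OF f, of "%(\<xi>, \<eta>). cmod (uwf \<xi> \<eta> a)"] F(1) by (simp add: case_prod_unfold)
   then have "cmod (uwf \<xi> \<eta> a) / p <= m / p" using p0 by (simp add: divide_right_mono)
   also have "m / p < \<epsilon>" using pm p0 F(2) m0 by (simp add: field_simps)
   finally show "cmod (uwf \<xi> \<eta> (%u. ?c *\<^sub>C a u) - uwf \<xi> \<eta> (%u. 0)) < \<epsilon>" .
  qed
  then have "cmod \<langle>y, J (%u. ?c *\<^sub>C a u) y\<rangle> < 1" using F(4) V' A_scale[OF a] by blast
  then show False using p0 by (simp add: J_scale a cinner_scaleC_right norm_mult norm_divide p_def)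
 qed
 then show ?thesis using F by (intro exI[of _ F] exI[of _ "2 / \<epsilon>"]) auto
qed

text \<open>The domination is applied to \<open>adj b\<close> composed with \<open>b\<close>. Each
  functional \<open>uwf\<close> becomes a matrix element of an ampliation, Cauchy-Schwarz separates
  its two vectors, and all of them are stored as orthogonal components of one vector
  \<open>\<Xi>\<close>.\<close>

lemma dominating_vector:
 "\<exists>\<Xi>::('h, (nat \<times> ((nat => 'h) \<times> (nat => 'h)) \<times> bool) ell2) tensor.
  \<forall>b\<in>A. norm (J b y) <= norm (amp b \<Xi>)"
proof -
 obtain F :: "((nat => 'h) \<times> (nat => 'h)) set" and K where F: "finite F" "0 <= K" "\<forall>(\<xi>, \<eta>)\<in>F. square_summable \<xi> \<and> square_summable \<eta>"
  and K: "!!a. a \<in> A ==> cmod \<langle>y, J a y\<rangle> <= K * (\<Sum>(\<xi>, \<eta>)\<in>F. cmod (uwf \<xi> \<eta> a))"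
  using domination[of y] by blast
 have "\<exists>w::('h, nat ell2) tensor. \<forall>n. comp_at n w = \<xi> n" if "square_summable \<xi>" for \<xi>
  using ell2_vector[of \<xi>] that unfolding square_summable_def
  by (subst (asm) summable_on_UNIV_nonneg_real_iff) auto
 then obtain v where v: "!!\<xi> n. square_summable \<xi> ==> comp_at n (v \<xi> :: ('h, nat ell2) tensor) = \<xi> n" by metis
 have uwf: "uwf \<xi> \<eta> T = \<langle>v \<xi>, amp T (v \<eta>)\<rangle>" if "square_summable \<xi>" "square_summable \<eta>" "T \<in> bops" for \<xi> \<eta> T
  using has_sum_imp_sums[OF parseval[of "v \<xi>" "amp T (v \<eta>)"]] that
  by (simp add: comp_at_op_tensor v uwf_def sums_iff)
 \<comment> \<open>The factor \<open>sqrt K\<close> absorbs the constant of the domination; the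
   Boolean selects the left or the right sequence of the pair.\<close>
 define w where "w q = sqrt K *\<^sub>R v (if snd q then fst (fst q) else snd (fst q))" for q :: "((nat => 'h) \<times> (nat => 'h)) \<times> bool"
 let ?I = "F \<times> (UNIV :: bool set)"
 define \<Xi> where "\<Xi> = (\<Sum>q\<in>?I. w q \<otimes> basis q)"
 have fin: "finite ?I" using F(1) by simp
 have "norm (J b y) <= norm (amp b (flatten \<Xi>))" if b: "b \<in> A" for b
 proof -
  have bb: "b \<in> bops" by (rule A_bops[OF b])
  have est: "cmod (uwf \<xi> \<eta> (%u. adj b (b u))) <= (norm (amp b (v \<xi>)))\<^sup>2 + (norm (amp b (v \<eta>)))\<^sup>2" if "(\<xi>, \<eta>) \<in> F" for \<xi> \<eta>
  proof -
   have ss: "square_summable \<xi>" "square_summable \<eta>" using F(3) that by auto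
   have "uwf \<xi> \<eta> (%u. adj b (b u)) = \<langle>v \<xi>, amp (adj b) (amp b (v \<eta>))\<rangle>"
    by (simp add: uwf[OF ss bops_comp[OF adj_bops[OF bb] bb]] amp_comp adj_bops bb)
   also have "\<dots> = \<langle>amp b (v \<xi>), amp b (v \<eta>)\<rangle>"
    by (simp add: amp_adj[symmetric] bb adj_cinner' amp_bops)
   finally have "cmod (uwf \<xi> \<eta> (%u. adj b (b u))) <= norm (amp b (v \<xi>)) * norm (amp b (v \<eta>))"
    by (simp add: cinner_CS)
   moreover have "2 * (norm (amp b (v \<xi>)) * norm (amp b (v \<eta>))) <= (norm (amp b (v \<xi>)))\<^sup>2 + (norm (amp b (v \<eta>)))\<^sup>2"
    using sum_squares_bound[of "norm (amp b (v \<xi>))" "norm (amp b (v \<eta>))"] by (simp add: mult.assoc)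
   moreover have "0 <= norm (amp b (v \<xi>)) * norm (amp b (v \<eta>))" by simp
   ultimately show ?thesis by linarith
  qed
  have "(norm (J b y))\<^sup>2 = cmod \<langle>y, J (%u. adj b (b u)) y\<rangle>"
   using J_cinner[OF b b, of y y] by (metis cinner_self norm_of_real abs_of_nonneg zero_le_power2)
  also have "\<dots> <= K * (\<Sum>(\<xi>, \<eta>)\<in>F. cmod (uwf \<xi> \<eta> (%u. adj b (b u))))"
   by (rule K[OF A_comp[OF A_adj[OF b] b]])
  also have "\<dots> <= K * (\<Sum>(\<xi>, \<eta>)\<in>F. (norm (amp b (v \<xi>)))\<^sup>2 + (norm (amp b (v \<eta>)))\<^sup>2)"
   using est by (intro mult_left_mono sum_mono F) auto
  also have "\<dots> = (\<Sum>p\<in>F. \<Sum>s\<in>UNIV. (norm (amp b (w (p, s))))\<^sup>2)"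
   using F(2) by (simp add: UNIV_bool w_def bops_scaleR amp_bops bb power_mult_distrib case_prod_unfold sum_distrib_left algebra_simps)
  also have "\<dots> = (\<Sum>q\<in>?I. (norm (amp b (w q)))\<^sup>2)"
   by (simp add: sum.cartesian_product)
  also have "\<dots> = (norm (amp (amp b) \<Xi>))\<^sup>2"
  proof -
   have "amp (amp b) \<Xi> = (\<Sum>q\<in>?I. amp b (w q) \<otimes> basis q)"
    unfolding \<Xi>_def by (simp add: bops_sum amp_bops bb amp_tensor)
   then have "\<langle>amp (amp b) \<Xi>, amp (amp b) \<Xi>\<rangle> = (\<Sum>q\<in>?I. \<langle>amp b (w q), amp b (w q)\<rangle>)"
    by (simp only: cinner_basis_sum[OF fin])
   then have "Re \<langle>amp (amp b) \<Xi>, amp (amp b) \<Xi>\<rangle> = Re (\<Sum>q\<in>?I. \<langle>amp b (w q), amp b (w q)\<rangle>)" by simp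
   then show ?thesis by (simp add: Re_cinner_self)
  qed
  finally have "norm (J b y) <= norm (amp (amp b) \<Xi>)" by (rule power2_le_imp_le) simp
  also have "\<dots> = norm (amp b (flatten \<Xi>))"
   by (simp add: flatten_amp[OF bb, symmetric] isometry_norm[OF flatten_isometry])
  finally show ?thesis .
 qed
 then show ?thesis by blast
qed

text \<open>For \<open>0 <= T <= 1\<close> put \<open>T\<^sub>0 = T\<close> and \<open>T\<^sub>n\<^sub>+\<^sub>1 = T\<^sub>n (1 - T\<^sub>n)\<close>; then \<open>T\<close> is the sum of
 the squares \<open>T\<^sub>n\<^sup>2\<close>. This replaces the square root of \<open>T\<close>.\<close>

lemma dominated_decomposition:
 fixes \<Xi> :: "('h, 'c::chilbert) tensor"
 assumes dom: "!!b. b \<in> A ==> norm (J b y) <= norm (amp b \<Xi>)"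
 shows "\<exists>Z::nat => ('h, 'c) tensor. \<forall>a\<in>A. \<forall>b\<in>A. (%n. \<langle>amp a (Z n), amp b (Z n)\<rangle>) sums \<langle>J a y, J b y\<rangle>"
proof -
 \<comment> \<open>The orthogonal complement of the cyclic subspace of \<open>\<Xi>\<close>. The
   contraction \<open>R\<close> will vanish there; as the complement is invariant under the
   ampliation, \<open>R\<close> intertwines on the whole space.\<close>
 define W where "W = {w. \<forall>b\<in>A. \<langle>amp b \<Xi>, w\<rangle> = 0}"
 define M where "M = {(amp b \<Xi> + w, J b y) | b w. b \<in> A \<and> w \<in> W}"
 have W: "csubspace W"
  unfolding csubspace_def W_def by (auto simp: cinner_add_right cinner_scaleC_right)
 have "csubspace M"
  unfolding csubspace_def
 proof (intro conjI ballI allI)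
  show "0 \<in> M" unfolding M_def
   by (intro CollectI exI[of _ "%u. 0"] exI[of _ 0] conjI A_zero csubspaceD(1)[OF W])
     (simp add: J_zero zero_prod_def op_tensor_unique[of "%x. 0"])
  fix p q assume "p \<in> M" "q \<in> M"
  then obtain b w b' w' where p: "p = (amp b \<Xi> + w, J b y)" "b \<in> A" "w \<in> W"
   and q: "q = (amp b' \<Xi> + w', J b' y)" "b' \<in> A" "w' \<in> W" unfolding M_def by blast
  show "p + q \<in> M" unfolding M_def
   by (intro CollectI exI[of _ "%u. b u + b' u"] exI[of _ "w + w'"] conjI A_plus csubspaceD(2)[OF W] p q)
     (use amp_lincomb[of b b' 1 \<Xi>] in \<open>simp add: p q J_plus A_bops\<close>)
  show "c *\<^sub>C p \<in> M" for c unfolding M_def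
   by (intro CollectI exI[of _ "%u. c *\<^sub>C b u"] exI[of _ "c *\<^sub>C w"] conjI A_scale csubspaceD(3)[OF W] p)
     (use amp_lincomb[of b "%x. 0" c \<Xi>] in \<open>simp add: p J_scale A_bops scaleC_prod_def scaleC_add_right op_tensor_unique[of "%x. 0"]\<close>)
 qed
 moreover have "norm (snd p) <= 1 * norm (fst p)" if "p \<in> M" for p
 proof -
  obtain b w where p: "p = (amp b \<Xi> + w, J b y)" "b \<in> A" "w \<in> W" using \<open>p \<in> M\<close> unfolding M_def by blast
  have "\<langle>amp b \<Xi>, w\<rangle> = 0" using p unfolding W_def by blast
  then have "(norm (amp b \<Xi>))\<^sup>2 <= (norm (amp b \<Xi> + w))\<^sup>2" by (simp add: norm_power2_add)
  then have "norm (amp b \<Xi>) <= norm (amp b \<Xi> + w)" by (rule power2_le_imp_le) simp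
  then show ?thesis using dom[OF p(2)] by (simp add: p)
 qed
 moreover have tot: "ctotal (fst ` M)"
  unfolding ctotal_def
 proof (intro allI impI)
  fix v assume v: "\<forall>s\<in>fst ` M. \<langle>s, v\<rangle> = 0"
  have "amp b \<Xi> \<in> fst ` M" if "b \<in> A" for b
   using that csubspaceD(1)[OF W] unfolding M_def by force
  then have vW: "v \<in> W" using v unfolding W_def by blast
  have "(amp (%u. 0) \<Xi> + v, J (%u. 0) y) \<in> M" unfolding M_def using vW A_zero by blast
  then have "v \<in> fst ` M" by (force simp: op_tensor_unique[of "%x. 0"])
  then have "\<langle>v, v\<rangle> = 0" using v by blast
  then show "v = 0" by (simp add: cinner_self)
 qed
 ultimately obtain R where R: "R \<in> bops" "!!x z. (x, z) \<in> M ==> R x = z" "!!x. norm (R x) <= 1 * norm x"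
  using graph_extension[of M 1] by (metis zero_le_one)
 have RM: "R (amp b \<Xi> + w) = J b y" if "b \<in> A" "w \<in> W" for b w
  using R(2) that unfolding M_def by blast
 have R\<Xi>: "R (amp b \<Xi>) = J b y" if "b \<in> A" for b
  using RM[OF that csubspaceD(1)[OF W]] by simp
 have inter: "R (amp a x) = J a (R x)" if a: "a \<in> A" for a x
 proof (rule fun_cong, rule total_bops_eq[OF tot])
  show "(%x. R (amp a x)) \<in> bops" by (rule bops_comp[OF R(1) amp_bops[OF A_bops[OF a]]])
  show "(%x. J a (R x)) \<in> bops" by (rule bops_comp[OF J_bops[OF a] R(1)])
  fix s assume "s \<in> fst ` M"
  then obtain b w where s: "s = amp b \<Xi> + w" "b \<in> A" "w \<in> W" unfolding M_def by force
  have "\<langle>amp c \<Xi>, amp a w\<rangle> = 0" if c: "c \<in> A" for c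
  proof -
   have "\<langle>amp c \<Xi>, amp a w\<rangle> = \<langle>amp (%u. adj a (c u)) \<Xi>, w\<rangle>"
    by (simp add: amp_comp[symmetric] A_bops a c adj_bops amp_adj[symmetric] adj_cinner amp_bops)
   then show ?thesis using s(3) A_comp[OF A_adj[OF a] c] unfolding W_def by simp
  qed
  then have aw: "amp a w \<in> W" unfolding W_def by blast
  have as: "amp a s = amp (%u. a (b u)) \<Xi> + amp a w"
   by (simp add: s bops_add amp_bops amp_comp A_bops a)
  have "R (amp a s) = J (%u. a (b u)) y"
   unfolding as by (rule RM[OF A_comp[OF a s(2)] aw])
  moreover have "R s = J b y" unfolding s(1) by (rule RM[OF s(2,3)])
  ultimately show "R (amp a s) = J a (R s)" by (simp add: J_comp a s(2))
 qed
 define T where "T = rec_nat (%x. adj R (R x)) (%_ S x. S x - S (S x))"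
 have T0: "T 0 = (%x. adj R (R x))" and TS: "T (Suc n) = (%x. T n x - T n (T n x))" for n
  by (simp_all add: T_def)
 have adjR: "adj R (J a z) = amp a (adj R z)" if a: "a \<in> A" for a z
 proof (rule cinner_ext)
  fix x
  have "\<langle>x, adj R (J a z)\<rangle> = \<langle>J (adj a) (R x), z\<rangle>"
   by (simp add: adj_cinner' R J_adj a adj_cinner J_bops)
  also have "\<dots> = \<langle>R (adj (amp a) x), z\<rangle>" by (simp add: inter[OF A_adj[OF a], symmetric] amp_adj A_bops a)
  also have "\<dots> = \<langle>x, amp a (adj R z)\<rangle>"
   by (simp add: adj_cinner'[OF R(1), symmetric] adj_cinner amp_bops A_bops a)
  finally show "\<langle>x, adj R (J a z)\<rangle> = \<langle>x, amp a (adj R z)\<rangle>" .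
 qed
 have Tprops: "T n \<in> bops \<and> (\<forall>x z. \<langle>T n x, z\<rangle> = \<langle>x, T n z\<rangle>) \<and> (\<forall>x. 0 <= Re \<langle>x, T n x\<rangle> \<and> Re \<langle>x, T n x\<rangle> <= (norm x)\<^sup>2)
   \<and> (\<forall>a\<in>A. \<forall>x. T n (amp a x) = amp a (T n x))" for n
 proof (induction n)
  case 0
  have "Re \<langle>x, T 0 x\<rangle> = (norm (R x))\<^sup>2" for x by (simp add: T0 adj_cinner' R Re_cinner_self)
  moreover have "(norm (R x))\<^sup>2 <= (norm x)\<^sup>2" for x using R(3)[of x] by (simp add: power_mono)
  ultimately show ?case
   by (auto simp: T0 adj_cinner adj_cinner' R inter adjR intro: bops_comp[OF adj_bops[OF R(1)] R(1)])
 next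
  case (Suc n)
  then have b: "T n \<in> bops" and sa: "!!x z. \<langle>T n x, z\<rangle> = \<langle>x, T n z\<rangle>"
   and pos: "!!x. 0 <= Re \<langle>x, T n x\<rangle>" "!!x. Re \<langle>x, T n x\<rangle> <= (norm x)\<^sup>2"
   and comm: "!!a x. a \<in> A ==> T n (amp a x) = amp a (T n x)" by auto
  have "T (Suc n) \<in> bops" unfolding TS by (intro bops_minus_op b bops_comp[OF b b])
  moreover have "\<langle>T (Suc n) x, z\<rangle> = \<langle>x, T (Suc n) z\<rangle>" for x z
   by (simp add: TS cinner_diff_left cinner_diff_right sa)
  moreover have "0 <= Re \<langle>x, T (Suc n) x\<rangle>" for x
  proof -
   have "Re \<langle>x, T (Suc n) x\<rangle> = ((norm (T n x))\<^sup>2 - Re \<langle>T n x, T n (T n x)\<rangle>) + Re \<langle>x - T n x, T n (x - T n x)\<rangle>"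
    by (simp add: TS cinner_diff_left cinner_diff_right sa bops_diff b Re_cinner_self[symmetric])
   then show ?thesis using pos(1)[of "x - T n x"] pos(2)[of "T n x"] by linarith
  qed
  moreover have "Re \<langle>x, T (Suc n) x\<rangle> <= (norm x)\<^sup>2" for x
  proof -
   have "Re \<langle>x, T (Suc n) x\<rangle> = Re \<langle>x, T n x\<rangle> - (norm (T n x))\<^sup>2"
    using sa[of x "T n x"] by (simp add: TS cinner_diff_right Re_cinner_self[symmetric])
   then show ?thesis using pos(2)[of x] by (smt (verit) zero_le_power2)
  qed
  moreover have "T (Suc n) (amp a x) = amp a (T (Suc n) x)" if "a \<in> A" for a x
   by (simp add: TS comm that bops_diff amp_bops A_bops)
  ultimately show ?case by blast
 qed
 then have Tb: "T n \<in> bops" and Tsa: "\<langle>T n x, z\<rangle> = \<langle>x, T n z\<rangle>"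
  and Tpos: "0 <= Re \<langle>x, T n x\<rangle>" and Tcomm: "a \<in> A ==> T n (amp a x) = amp a (T n x)" for n x z a by auto
 \<comment> \<open>The square of \<open>T n\<close> is \<open>T n - T (Suc n)\<close>, so the sum
   telescopes.\<close>
 have tele: "(\<Sum>n<N. \<langle>T n x, T n z\<rangle>) = \<langle>x, T 0 z\<rangle> - \<langle>x, T N z\<rangle>" for N x z
  by (induction N) (simp_all add: TS cinner_diff_right Tsa)
 have T_lim: "(%n. T n x) \<longlonglongrightarrow> 0" for x
 proof -
  have "(\<Sum>n<N. (norm (T n x))\<^sup>2) <= Re \<langle>x, T 0 x\<rangle>" for N
  proof -
   have "(\<Sum>n<N. (norm (T n x))\<^sup>2) = Re (\<Sum>n<N. \<langle>T n x, T n x\<rangle>)" by (simp add: Re_cinner_self)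
   also have "\<dots> = Re \<langle>x, T 0 x\<rangle> - Re \<langle>x, T N x\<rangle>" unfolding tele by simp
   finally show ?thesis using Tpos[of x N] by simp
  qed
  then have "summable (%n. (norm (T n x))\<^sup>2)" by (intro summableI_nonneg_bounded) auto
  then have "(%n. (norm (T n x))\<^sup>2) \<longlonglongrightarrow> 0" by (rule summable_LIMSEQ_zero)
  then have "(%n. sqrt ((norm (T n x))\<^sup>2)) \<longlonglongrightarrow> sqrt 0" by (rule tendsto_real_sqrt)
  then show ?thesis by (simp add: tendsto_norm_zero_iff)
 qed
 have sums: "(%n. \<langle>T n x, T n z\<rangle>) sums \<langle>R x, R z\<rangle>" for x z
 proof -
  have "(%N. \<langle>x, T 0 z\<rangle> - \<langle>x, T N z\<rangle>) \<longlonglongrightarrow> \<langle>x, T 0 z\<rangle> - \<langle>x, 0\<rangle>"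
   by (intro tendsto_intros T_lim)
  then show ?thesis unfolding sums_def tele by (simp add: T0 adj_cinner' R)
 qed
 have "(%n. \<langle>amp a (T n \<Xi>), amp b (T n \<Xi>)\<rangle>) sums \<langle>J a y, J b y\<rangle>" if "a \<in> A" "b \<in> A" for a b
  using sums[of "amp a \<Xi>" "amp b \<Xi>"] by (simp add: Tcomm that R\<Xi>)
 then show ?thesis by (intro exI[of _ "%n. T n \<Xi>"]) auto
qed

text \<open>A normal vector functional of \<open>J\<close> is a vector functional of an ampliation:
  the countably many vectors of the decomposition become the components of one vector. Their square
  summability is the case in which \<open>a\<close> and \<open>b\<close> are both the
  identity.\<close>

lemma state_vector:
 "\<exists>W::('h, ((nat \<times> ((nat => 'h) \<times> (nat => 'h)) \<times> bool) \<times> nat) ell2) tensor.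
  \<forall>a\<in>A. \<forall>b\<in>A. \<langle>amp a W, amp b W\<rangle> = \<langle>J a y, J b y\<rangle>"
proof -
 obtain \<Xi> :: "('h, (nat \<times> ((nat => 'h) \<times> (nat => 'h)) \<times> bool) ell2) tensor" where "!!b. b \<in> A ==> norm (J b y) <= norm (amp b \<Xi>)"
  using dominating_vector by blast
 from dominated_decomposition[OF this] obtain Z :: "nat => ('h, (nat \<times> ((nat => 'h) \<times> (nat => 'h)) \<times> bool) ell2) tensor"
  where Z: "!!a b. a \<in> A ==> b \<in> A ==> (%n. \<langle>amp a (Z n), amp b (Z n)\<rangle>) sums \<langle>J a y, J b y\<rangle>" by blast
 have "(%n. Re \<langle>Z n, Z n\<rangle>) sums Re \<langle>y, y\<rangle>"
  using sums_Re[OF Z[OF A_id A_id]] by (simp add: J_id)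
 then have "summable (%n. (norm (Z n))\<^sup>2)" by (simp add: Re_cinner_self sums_iff)
 then have "(%n. (norm (Z n))\<^sup>2) summable_on UNIV"
  by (subst summable_on_UNIV_nonneg_real_iff) auto
 then obtain W where W: "!!n. comp_at n W = Z n" using ell2_vector[of Z] by blast
 have "\<langle>amp a (flatten W), amp b (flatten W)\<rangle> = \<langle>J a y, J b y\<rangle>" if ab: "a \<in> A" "b \<in> A" for a b
 proof -
  have "\<langle>amp a (flatten W), amp b (flatten W)\<rangle> = \<langle>amp (amp a) W, amp (amp b) W\<rangle>"
   by (simp add: flatten_amp[symmetric] A_bops ab isometry_cinner flatten_isometry)
  moreover have "(%n. \<langle>amp a (Z n), amp b (Z n)\<rangle>) sums \<langle>amp (amp a) W, amp (amp b) W\<rangle>"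
   using has_sum_imp_sums[OF parseval[of "amp (amp a) W" "amp (amp b) W"]]
   by (simp add: comp_at_op_tensor amp_bops A_bops ab W)
  ultimately show ?thesis using sums_unique2[OF _ Z[OF ab]] by simp
 qed
 then show ?thesis by blast
qed

text \<open>By Zorn's lemma there is a maximal set of vectors with pairwise orthogonal cyclic
  subspaces; a vector orthogonal to all of these subspaces could be added to it.\<close>

lemma cyclic_decomposition:
 "\<exists>B. (\<forall>y\<in>B. \<forall>y'\<in>B. y \<noteq> y' \<longrightarrow> (\<forall>a\<in>A. \<langle>y, J a y'\<rangle> = 0)) \<and> ctotal {J a y | a y. a \<in> A \<and> y \<in> B}"
proof -
 define \<A> where "\<A> = {B. 0 \<notin> B \<and> (\<forall>y\<in>B. \<forall>y'\<in>B. y \<noteq> y' \<longrightarrow> (\<forall>a\<in>A. \<langle>y, J a y'\<rangle> = 0))}"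
 have "\<exists>M\<in>\<A>. \<forall>X\<in>\<A>. M \<subseteq> X \<longrightarrow> X = M"
 proof (rule subset_Zorn')
  fix C assume C: "subset.chain \<A> C"
  show "\<Union>C \<in> \<A>" unfolding \<A>_def
  proof (intro CollectI conjI ballI impI)
   show "0 \<notin> \<Union>C" using C unfolding subset.chain_def \<A>_def by blast
   fix y y' a assume y: "y \<in> \<Union>C" "y' \<in> \<Union>C" "y \<noteq> y'" "a \<in> A"
   then obtain X Y where "X \<in> C" "Y \<in> C" "y \<in> X" "y' \<in> Y" by blast
   moreover have "X \<subseteq> Y \<or> Y \<subseteq> X" using subset.chain_total[OF C \<open>X \<in> C\<close> \<open>Y \<in> C\<close>] by auto
   ultimately obtain Z where "Z \<in> C" "y \<in> Z" "y' \<in> Z" by blast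
   then show "\<langle>y, J a y'\<rangle> = 0" using C y unfolding subset.chain_def \<A>_def by blast
  qed
 qed
 then obtain B where B: "B \<in> \<A>" "!!X. X \<in> \<A> ==> B \<subseteq> X ==> X = B" by blast
 have "ctotal {J a y | a y. a \<in> A \<and> y \<in> B}"
  unfolding ctotal_def
 proof (intro allI impI, rule ccontr)
  fix w assume w: "\<forall>s\<in>{J a y | a y. a \<in> A \<and> y \<in> B}. \<langle>s, w\<rangle> = 0" "w \<noteq> 0"
  have w': "\<langle>J a y, w\<rangle> = 0" if "a \<in> A" "y \<in> B" for a y using w(1) that by blast
  have "\<langle>w, J a y\<rangle> = 0" if "a \<in> A" "y \<in> B" for a y
   using w'[OF that] by (metis cnj_cinner complex_cnj_zero)
  moreover have "\<langle>y, J a w\<rangle> = 0" if "a \<in> A" "y \<in> B" for a y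
   using w'[OF A_adj[OF that(1)] that(2)] by (simp add: J_adj that adj_cinner J_bops)
  ultimately have "insert w B \<in> \<A>" using B(1) w(2) unfolding \<A>_def by auto
  then have "w \<in> B" using B(2) by blast
  then have "\<langle>w, w\<rangle> = 0" using w'[OF A_id] by (simp add: J_id)
  then show False using w(2) by (simp add: cinner_self)
 qed
 then show ?thesis using B(1) unfolding \<A>_def by blast
qed

text \<open>On one cyclic subspace \<open>J a y \<mapsto> amp a (W y)\<close> is isometric by
  \<open>state_vector\<close>. Different cyclic subspaces must stay orthogonal, so each is tagged
  with its own basis vector; this is why the type \<open>'e\<close> occurs in the index.\<close>

theorem intertwining_isometry:
 "\<exists>U::'e => ('h, (((nat \<times> ((nat => 'h) \<times> (nat => 'h)) \<times> bool) \<times> nat) \<times> 'e) ell2) tensor.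
  isometry U \<and> (\<forall>a\<in>A. \<forall>x. U (J a x) = amp a (U x))"
proof -
 obtain W :: "'e => ('h, ((nat \<times> ((nat => 'h) \<times> (nat => 'h)) \<times> bool) \<times> nat) ell2) tensor"
  where W: "!!y a b. a \<in> A ==> b \<in> A ==> \<langle>amp a (W y), amp b (W y)\<rangle> = \<langle>J a y, J b y\<rangle>"
  using state_vector by metis
 obtain B where B: "!!y y' a. y \<in> B ==> y' \<in> B ==> y \<noteq> y' ==> a \<in> A ==> \<langle>y, J a y'\<rangle> = 0"
  "ctotal {J a y | a y. a \<in> A \<and> y \<in> B}"
  using cyclic_decomposition by blast
 define g where "g p = J (fst p) (snd p)" for p
 define f where "f p = flatten (amp (fst p) (W (snd p)) \<otimes> basis (snd p))" for p :: "('h => 'h) \<times> 'e"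
 have tot: "ctotal (g ` (A \<times> B))"
  by (rule total_mono[OF B(2)]) (force simp: g_def)
 have "\<langle>f p, f q\<rangle> = \<langle>g p, g q\<rangle>" if "p \<in> A \<times> B" "q \<in> A \<times> B" for p q
 proof (cases "snd p = snd q")
  case True
  then show ?thesis using that
   by (auto simp: g_def f_def isometry_cinner[OF flatten_isometry] cinner_tensor cinner_basis W)
 next
  case False
  have pq: "fst p \<in> A" "snd p \<in> B" "fst q \<in> A" "snd q \<in> B" using that by auto
  have "\<langle>g p, g q\<rangle> = 0"
   unfolding g_def J_cinner[OF pq(1,3)]
   by (rule B(1)[OF pq(2,4) False A_comp[OF A_adj[OF pq(1)] pq(3)]])
  then show ?thesis using False
   by (simp add: f_def isometry_cinner[OF flatten_isometry] cinner_tensor cinner_basis)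
 qed
 from isometry_extension[of g "A \<times> B" f, OF tot this]
 obtain U where U0: "isometry U \<and> (\<forall>p\<in>A \<times> B. U (g p) = f p)" ..
 note U = conjunct1[OF U0] conjunct2[OF U0]
 have U': "U (J a y) = flatten (amp a (W y) \<otimes> basis y)" if "a \<in> A" "y \<in> B" for a y
  using bspec[OF U(2), of "(a, y)"] that by (simp add: g_def f_def)
 have "U (J a x) = amp a (U x)" if a: "a \<in> A" for a x
 proof (rule fun_cong, rule total_bops_eq[OF tot])
  show "(%x. U (J a x)) \<in> bops" by (rule bops_comp[OF isometry_bops[OF U(1)] J_bops[OF a]])
  show "(%x. amp a (U x)) \<in> bops" by (rule bops_comp[OF amp_bops[OF A_bops[OF a]] isometry_bops[OF U(1)]])
  fix s assume "s \<in> g ` (A \<times> B)"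
  then obtain b y where s: "s = J b y" "b \<in> A" "y \<in> B" by (auto simp: g_def)
  have "U (J a s) = flatten (amp (%u. a (b u)) (W y) \<otimes> basis y)"
   using U'[OF A_comp[OF a s(2)] s(3)] by (simp add: s J_comp a)
  also have "\<dots> = flatten (amp (amp a) (amp b (W y) \<otimes> basis y))"
   by (simp add: amp_tensor amp_bops amp_comp A_bops a s)
  also have "\<dots> = amp a (U s)" by (simp add: flatten_amp A_bops a U' s)
  finally show "U (J a s) = amp a (U s)" .
 qed
 then show ?thesis using U(1) by blast
qed

end

section \<open>Ampliations of a normal representation\<close>

lemma amp_slices_ext:
 fixes \<zeta> :: "(('a::chilbert, 'f::chilbert) tensor, 'x ell2) tensor"
 assumes "!!\<psi>. amp (E_bra \<psi>) \<zeta> = amp (E_bra \<psi>) \<zeta>'"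
 shows "\<zeta> = \<zeta>'"
proof (rule comp_at_ext, rule slices_ext)
 fix x \<psi>
 show "E_bra \<psi> (comp_at x \<zeta>) = E_bra \<psi> (comp_at x \<zeta>')"
  using arg_cong[OF assms[of \<psi>], of "comp_at x"] by (simp add: comp_at_op_tensor E_bra_bops)
qed

lemma E_bra_E_ket: "E_bra \<psi> (E_ket \<phi> u) = \<langle>\<psi>, \<phi>\<rangle> *\<^sub>C u"
 by (simp add: E_bra_tensor E_ket_def[of \<phi>])

lemma amp_scale: "amp (%u. c *\<^sub>C u) \<zeta> = c *\<^sub>C \<zeta>"
 by (subst op_tensor_unique[OF bops_cscale[OF bops_id]]) (auto simp: tensor_scaleC_left)

lemma amp_norm: "T \<in> bops ==> norm (amp T \<zeta>) <= onorm T * norm \<zeta>"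
 by (rule op_tensor_id_norm[OF _ bops_onorm onorm_ge0])

lemma tensor_bops_eqI:
 assumes "T \<in> bops" "T' \<in> bops" "!!u v. T (u \<otimes> v) = T' (u \<otimes> v)"
 shows "T \<zeta> = T' \<zeta>"
 using tensor_bops_eq[OF assms] by simp

lemma has_sum_sum:
 fixes f :: "'i => 'x => 'a::topological_comm_monoid_add"
 assumes "!!i. i \<in> I ==> (f i has_sum s i) A"
 shows "((%x. \<Sum>i\<in>I. f i x) has_sum (\<Sum>i\<in>I. s i)) A"
 using assms by (induction I rule: infinite_finite_induct) (auto intro: has_sum_add has_sum_0)

text \<open>Fixes one realisation \<open>U\<close> of \<open>J\<close> inside a multiple of the
  identity representation; every ampliation of \<open>J\<close> is defined through it.\<close>

locale amplified_rep = normal_rep A J for A :: "('h::chilbert => 'h) set" and J :: "('h => 'h) => 'e::chilbert => 'e" +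
 fixes U :: "'e => ('h, 'x ell2) tensor"
 assumes U: "isometry U" and U_J: "a \<in> A ==> U (J a y) = amp a (U y)"
begin

lemma U_bops: "U \<in> bops"
 by (rule isometry_bops[OF U])

lemma J_norm:
 assumes "a \<in> A" shows "norm (J a y) <= onorm a * norm y"
 using amp_norm[OF A_bops[OF assms], of "U y"]
 by (simp add: U_J[OF assms, symmetric] isometry_norm[OF U])

lemma J_cinner_U: "a \<in> A ==> \<langle>x, J a y\<rangle> = \<langle>U x, amp a (U y)\<rangle>"
 by (simp add: U_J[symmetric] isometry_cinner[OF U])

text \<open>This is \<open>U \<otimes> 1\<close> with the last two factors interchanged: in the
  target \<open>(h \<otimes> f) \<otimes> ell2\<close> an operator on \<open>h \<otimes> f\<close>
  can be ampliated.\<close>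

lemma Uhat_exists: "\<exists>V::('e, 'f::chilbert) tensor => (('h, 'f) tensor, 'x ell2) tensor.
  isometry V \<and> (\<forall>y \<psi>. V (y \<otimes> \<psi>) = amp (E_ket \<psi>) (U y))"
proof -
 define g :: "'e \<times> 'f => ('e, 'f) tensor" where "g p = fst p \<otimes> snd p" for p
 define f :: "'e \<times> 'f => (('h, 'f) tensor, 'x ell2) tensor" where "f p = amp (E_ket (snd p)) (U (fst p))" for p
 have tot: "ctotal (g ` UNIV)" unfolding g_def by (rule ctotal_simple_range)
 have "\<langle>f p, f q\<rangle> = \<langle>g p, g q\<rangle>" for p q
 proof -
  have "\<langle>f p, f q\<rangle> = \<langle>U (fst p), amp (E_bra (snd p)) (amp (E_ket (snd q)) (U (fst q)))\<rangle>"
   unfolding f_def by (simp add: amp_adj[symmetric] E_ket_bops adj_cinner' amp_bops)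
  also have "\<dots> = \<langle>g p, g q\<rangle>"
   by (simp add: amp_comp E_ket_bops E_bra_bops E_bra_E_ket amp_scale cinner_scaleC_right
     isometry_cinner[OF U] g_def cinner_tensor mult.commute)
  finally show ?thesis .
 qed
 from isometry_extension[of g UNIV f, OF tot this]
 obtain V where V: "isometry V \<and> (\<forall>p\<in>UNIV. V (g p) = f p)" ..
 then show ?thesis by (auto simp: g_def f_def intro!: exI[of _ V])
qed

definition Uhat :: "('e, 'f::chilbert) tensor => (('h, 'f) tensor, 'x ell2) tensor" where
 "Uhat = (SOME V. isometry V \<and> (\<forall>y \<psi>. V (y \<otimes> \<psi>) = amp (E_ket \<psi>) (U y)))"

lemmas Uhat_isometry = someI_ex[OF Uhat_exists, folded Uhat_def, THEN conjunct1]
 and Uhat_tensor = someI_ex[OF Uhat_exists, folded Uhat_def, THEN conjunct2, rule_format]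

lemmas Uhat_bops = isometry_bops[OF Uhat_isometry]

lemma E_bra_Uhat: "amp (E_bra \<psi>) (Uhat \<zeta>) = U (E_bra \<psi> \<zeta>)"
proof (rule tensor_bops_eqI[of "%\<zeta>. amp (E_bra \<psi>) (Uhat \<zeta>)" "%\<zeta>. U (E_bra \<psi> \<zeta>)"])
 show "(%\<zeta>. amp (E_bra \<psi>) (Uhat \<zeta>)) \<in> bops"
  by (rule bops_comp[OF amp_bops[OF E_bra_bops] Uhat_bops])
 show "(%\<zeta>. U (E_bra \<psi> \<zeta>)) \<in> bops" by (rule bops_comp[OF U_bops E_bra_bops])
 show "amp (E_bra \<psi>) (Uhat (u \<otimes> v)) = U (E_bra \<psi> (u \<otimes> v))" for u v
  by (simp add: Uhat_tensor amp_comp E_bra_bops E_ket_bops E_bra_E_ket amp_scale E_bra_tensor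
    bops_scaleC U_bops)
qed

lemma E_bra_adj_Uhat: "E_bra \<psi> (adj Uhat \<zeta>) = adj U (amp (E_bra \<psi>) \<zeta>)"
proof (rule cinner_ext)
 fix y
 have "\<langle>y, E_bra \<psi> (adj Uhat \<zeta>)\<rangle> = \<langle>amp (E_ket \<psi>) (U y), \<zeta>\<rangle>"
  by (simp add: cinner_E_bra adj_cinner' Uhat_bops Uhat_tensor)
 also have "\<dots> = \<langle>y, adj U (amp (E_bra \<psi>) \<zeta>)\<rangle>"
  by (simp add: adj_cinner' U_bops amp_bops E_ket_bops flip: amp_adj)
 finally show "\<langle>y, E_bra \<psi> (adj Uhat \<zeta>)\<rangle> = \<langle>y, adj U (amp (E_bra \<psi>) \<zeta>)\<rangle>" .
qed

lemma Uhat_op_tensor: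
 assumes a: "a \<in> A" and z: "z \<in> bops"
 shows "Uhat (op_tensor (J a) z \<zeta>) = amp (op_tensor a z) (Uhat \<zeta>)"
proof (rule tensor_bops_eqI[of "%\<zeta>. Uhat (op_tensor (J a) z \<zeta>)" "%\<zeta>. amp (op_tensor a z) (Uhat \<zeta>)"])
 note b = A_bops[OF a] J_bops[OF a] z
 show "(%\<zeta>. Uhat (op_tensor (J a) z \<zeta>)) \<in> bops"
  by (rule bops_comp[OF Uhat_bops op_tensor_bops]) (rule b)+
 show "(%\<zeta>. amp (op_tensor a z) (Uhat \<zeta>)) \<in> bops"
  by (rule bops_comp[OF amp_bops[OF op_tensor_bops] Uhat_bops]) (rule b)+
 fix u v
 have "amp (op_tensor a z) (Uhat (u \<otimes> v)) = amp (%x. E_ket (z v) (a x)) (U u)"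
  by (simp add: Uhat_tensor amp_comp op_tensor_bops b E_ket_bops op_tensor_E_ket)
 also have "\<dots> = amp (E_ket (z v)) (U (J a u))"
  by (simp add: U_J a amp_comp E_ket_bops b)
 finally show "Uhat (op_tensor (J a) z (u \<otimes> v)) = amp (op_tensor a z) (Uhat (u \<otimes> v))"
  by (simp add: op_tensor_tensor b Uhat_tensor)
qed

lemma Uhat_op_tensor_id:
 assumes z: "z \<in> bops"
 shows "Uhat (ampr z \<zeta>) = amp (ampr z) (Uhat \<zeta>)"
proof (rule tensor_bops_eqI[of "%\<zeta>. Uhat (ampr z \<zeta>)" "%\<zeta>. amp (ampr z) (Uhat \<zeta>)"])
 show "(%\<zeta>. Uhat (ampr z \<zeta>)) \<in> bops"
  by (rule bops_comp[OF Uhat_bops op_tensor_bops[OF bops_id z]])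
 show "(%\<zeta>. amp (ampr z) (Uhat \<zeta>)) \<in> bops"
  by (rule bops_comp[OF amp_bops[OF op_tensor_bops[OF bops_id z]] Uhat_bops])
 show "Uhat (ampr z (u \<otimes> v)) = amp (ampr z) (Uhat (u \<otimes> v))" for u v
  by (simp add: Uhat_tensor amp_comp op_tensor_bops z E_ket_bops op_tensor_E_ket op_tensor_tensor)
qed

text \<open>The ampliation \<open>J \<otimes> id\<close>, written as a compression of
  \<open>T \<otimes> 1\<close>. In this form it is defined for every bounded \<open>T\<close> and
  its normality is that of an ampliation.\<close>

definition Jhat :: "(('h, 'f::chilbert) tensor => ('h, 'f) tensor) => ('e, 'f) tensor => ('e, 'f) tensor" where
 "Jhat T \<zeta> = adj Uhat (amp T (Uhat \<zeta>))"

lemma Jhat_normal: "continuous_map uw_topology uw_topology Jhat"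
 using normal_ampliation_conj[OF adj_bops[OF Uhat_bops] Uhat_bops] unfolding Jhat_def .

lemma Jhat_op_tensor: "a \<in> A ==> z \<in> bops ==> Jhat (op_tensor a z) = op_tensor (J a) z"
 unfolding Jhat_def by (rule ext) (simp add: Uhat_op_tensor[symmetric] isometry_adj[OF Uhat_isometry])

lemma Jhat_lincomb:
 assumes "S \<in> bops" "T \<in> bops"
 shows "Jhat (%x. c *\<^sub>C S x + T x) = (%x. c *\<^sub>C Jhat S x + Jhat T x)"
 unfolding Jhat_def
 by (rule ext) (simp add: amp_lincomb assms bops_add[OF adj_bops[OF Uhat_bops]] bops_scaleC[OF adj_bops[OF Uhat_bops]])

text \<open>\<open>colhat W\<close> is the image of \<open>W\<close> under the ampliation of \<open>J\<close> to operators \<open>h \<rightarrow> h \<otimes> f\<close>.\<close>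

definition col_in :: "('h => ('h, 'f::chilbert) tensor) => bool" where
 "col_in W \<longleftrightarrow> W \<in> bops \<and> (\<forall>\<psi>. (%u. E_bra \<psi> (W u)) \<in> A)"

definition colhat :: "('h => ('h, 'f::chilbert) tensor) => 'e => ('e, 'f) tensor" where
 "colhat W y = adj Uhat (amp W (U y))"

lemma colhat_bops: "W \<in> bops ==> colhat W \<in> bops"
 unfolding colhat_def by (rule bops_comp[OF adj_bops[OF Uhat_bops] bops_comp[OF amp_bops U_bops]])

lemma E_bra_colhat:
 assumes "col_in W" shows "E_bra \<psi> (colhat W y) = J (%u. E_bra \<psi> (W u)) y"
proof -
 have W: "W \<in> bops" "(%u. E_bra \<psi> (W u)) \<in> A" using assms by (auto simp: col_in_def)
 show ?thesis unfolding colhat_def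
  by (simp add: E_bra_adj_Uhat amp_comp E_bra_bops W U_J[OF W(2), symmetric] isometry_adj[OF U])
qed

text \<open>The compression by \<open>adj Uhat\<close> loses nothing here: each slice of
  \<open>W\<close> belongs to \<open>A\<close>, so the corresponding slice of
  \<open>amp W (U y)\<close> already has the form \<open>U (J a y)\<close>.\<close>

lemma Uhat_colhat:
 assumes "col_in W" shows "Uhat (colhat W y) = amp W (U y)"
proof (rule amp_slices_ext)
 fix \<psi>
 have W: "W \<in> bops" "(%u. E_bra \<psi> (W u)) \<in> A" using assms by (auto simp: col_in_def)
 show "amp (E_bra \<psi>) (Uhat (colhat W y)) = amp (E_bra \<psi>) (amp W (U y))"
  by (simp add: E_bra_Uhat E_bra_colhat assms amp_comp E_bra_bops W U_J[OF W(2)])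
qed

text \<open>Multiplicativity of the ampliation across spaces: the ampliated \<open>adj W\<close>,
  \<open>T\<close> and \<open>W'\<close> compose to \<open>J\<close> of their composition. This is
  what collapses one time step of the flow to an operator of \<open>A\<close>.\<close>

lemma colhat_sandwich:
 assumes W: "col_in W" "col_in W'" and T: "T \<in> bops" and S: "(%u. adj W (T (W' u))) \<in> A"
 shows "\<langle>colhat W y, Jhat T (colhat W' y')\<rangle> = \<langle>y, J (%u. adj W (T (W' u))) y'\<rangle>"
proof -
 have b: "W \<in> bops" "W' \<in> bops" using W by (auto simp: col_in_def)
 have "\<langle>colhat W y, Jhat T (colhat W' y')\<rangle> = \<langle>amp W (U y), amp T (amp W' (U y'))\<rangle>"
  unfolding Jhat_def by (simp add: adj_cinner' Uhat_bops Uhat_colhat W)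
 also have "\<dots> = \<langle>U y, amp (adj W) (amp (%u. T (W' u)) (U y'))\<rangle>"
  by (simp add: amp_adj[symmetric] b adj_cinner' amp_bops amp_comp T)
 also have "\<dots> = \<langle>U y, amp (%u. adj W (T (W' u))) (U y')\<rangle>"
  by (simp add: amp_comp adj_bops b bops_comp[OF T b(2)])
 also have "\<dots> = \<langle>y, J (%u. adj W (T (W' u))) y'\<rangle>"
  by (simp add: U_J[OF S, symmetric] isometry_cinner[OF U])
 finally show ?thesis .
qed

lemma colhat_norm: "W \<in> bops ==> norm (colhat W y) <= onorm W * norm y"
 unfolding colhat_def
 using order_trans[OF isometry_adj_norm[OF Uhat_isometry] amp_norm, of W "U y"]
 by (simp add: isometry_norm[OF U])

lemma colhat_plus: "W \<in> bops ==> W' \<in> bops ==> colhat (%u. W u + W' u) y = colhat W y + colhat W' y"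
 using amp_lincomb[of W W' 1 "U y"] bops_add[OF adj_bops[OF Uhat_bops]] by (simp add: colhat_def)

lemma colhat_op_tensor:
 assumes W: "col_in W" and z: "z \<in> bops"
 shows "colhat (%u. ampr z (W u)) y = ampr z (colhat W y)"
proof -
 have b: "W \<in> bops" using W by (auto simp: col_in_def)
 have "colhat (%u. ampr z (W u)) y = adj Uhat (amp (ampr z) (amp W (U y)))"
  by (simp add: colhat_def amp_comp b op_tensor_bops z)
 also have "\<dots> = adj Uhat (Uhat (ampr z (colhat W y)))"
  by (simp add: Uhat_op_tensor_id z Uhat_colhat W)
 finally show ?thesis by (simp add: isometry_adj[OF Uhat_isometry])
qed

lemma colhat_E_ket:
 assumes a: "a \<in> A" shows "colhat (%u. E_ket \<psi> (a u)) y = J a y \<otimes> \<psi>"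
proof -
 have "colhat (%u. E_ket \<psi> (a u)) y = adj Uhat (Uhat (J a y \<otimes> \<psi>))"
  by (simp add: colhat_def Uhat_tensor U_J a amp_comp E_ket_bops A_bops)
 then show ?thesis by (simp add: isometry_adj[OF Uhat_isometry])
qed

text \<open>Through \<open>U\<close> the form is a sum, over the basis of the multiplicity space, of
  forms of the given matrix.\<close>

lemma J_mat_positive:
 assumes a: "a \<in> mats n A" and pos: "mat_positive n a"
 shows "mat_positive n (%i j. J (a i j))"
 unfolding mat_positive_def
proof
 fix \<xi> :: "nat => 'e"
 have aA: "a i j \<in> A" if "i < n" "j < n" for i j using a that by (auto simp: mats_def)
 have "((%x. \<Sum>i<n. \<Sum>j<n. \<langle>comp_at x (U (\<xi> i)), a i j (comp_at x (U (\<xi> j)))\<rangle>) has_sum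
   (\<Sum>i<n. \<Sum>j<n. \<langle>\<xi> i, J (a i j) (\<xi> j)\<rangle>)) UNIV"
 proof (intro has_sum_sum)
  fix i j assume "i \<in> {..<n}" "j \<in> {..<n}"
  then have "a i j \<in> A" by (auto intro: aA)
  then show "((%x. \<langle>comp_at x (U (\<xi> i)), a i j (comp_at x (U (\<xi> j)))\<rangle>) has_sum \<langle>\<xi> i, J (a i j) (\<xi> j)\<rangle>) UNIV"
   using parseval[of "U (\<xi> i)" "amp (a i j) (U (\<xi> j))"]
   by (simp add: J_cinner_U comp_at_op_tensor A_bops)
 qed
 note hs = this
 have pos': "0 <= Re (\<Sum>i<n. \<Sum>j<n. \<langle>comp_at x (U (\<xi> i)), a i j (comp_at x (U (\<xi> j)))\<rangle>) \<and>
   Im (\<Sum>i<n. \<Sum>j<n. \<langle>comp_at x (U (\<xi> i)), a i j (comp_at x (U (\<xi> j)))\<rangle>) = 0" for x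
  using spec[OF pos[unfolded mat_positive_def complex_nonneg_Reals_iff], of "%i. comp_at x (U (\<xi> i))"] .
 have "0 <= Re (\<Sum>i<n. \<Sum>j<n. \<langle>\<xi> i, J (a i j) (\<xi> j)\<rangle>)"
  by (rule has_sum_nonneg[OF has_sum_Re[OF hs]]) (use pos' in blast)
 moreover have "((%x::'x. 0) has_sum Im (\<Sum>i<n. \<Sum>j<n. \<langle>\<xi> i, J (a i j) (\<xi> j)\<rangle>)) UNIV"
  using has_sum_Im[OF hs] unfolding conjunct2[OF pos'] .
 then have "Im (\<Sum>i<n. \<Sum>j<n. \<langle>\<xi> i, J (a i j) (\<xi> j)\<rangle>) = 0"
  using has_sum_unique[OF _ has_sum_0] by blast
 ultimately show "(\<Sum>i<n. \<Sum>j<n. \<langle>\<xi> i, J (a i j) (\<xi> j)\<rangle>) \<in> \<real>\<^sub>\<ge>\<^sub>0"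
  unfolding complex_nonneg_Reals_iff by blast
qed

end

section \<open>Operator matrices and their norms under representations\<close>

lemma mat_norm_bdd:
 fixes a :: "nat => nat => 'a::chilbert => 'a"
 assumes "!!i j. i < n ==> j < n ==> a i j \<in> bops"
 shows "bdd_above {L2_set (%i. norm (\<Sum>j<n. a i j (\<xi> j))) {..<n} | \<xi>. L2_set (%j. norm (\<xi> j)) {..<n} <= 1}"
proof -
 let ?L = "%\<xi>. L2_set (%i. norm (\<Sum>j<n. a i j (\<xi> j))) {..<n}" and ?N = "%\<xi>. L2_set (%j. norm (\<xi> j)) {..<n}"
 define C where "C = (\<Sum>i<n. \<Sum>j<n. onorm (a i j))"
 have "?L \<xi> <= C" if "?N \<xi> <= 1" for \<xi>
 proof -
  have x1: "norm (\<xi> j) <= 1" if "j < n" for j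
  proof -
   have "norm (\<xi> j) <= ?N \<xi>" by (rule member_le_L2_set) (use that in auto)
   then show ?thesis using \<open>?N \<xi> <= 1\<close> by linarith
  qed
  have "?L \<xi> <= (\<Sum>i<n. norm (\<Sum>j<n. a i j (\<xi> j)))" by (rule L2_set_le_sum) auto
  also have "\<dots> <= C" unfolding C_def
  proof (rule sum_mono)
   fix i assume i: "i \<in> {..<n}"
   show "norm (\<Sum>j<n. a i j (\<xi> j)) <= (\<Sum>j<n. onorm (a i j))"
   proof (rule sum_norm_le)
    fix j assume j: "j \<in> {..<n}"
    have "norm (a i j (\<xi> j)) <= onorm (a i j) * norm (\<xi> j)" using i j by (intro bops_onorm assms) auto
    also have "\<dots> <= onorm (a i j) * 1" using i j by (intro mult_left_mono x1 onorm_ge0 assms) auto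
    finally show "norm (a i j (\<xi> j)) <= onorm (a i j)" by simp
   qed
  qed
  finally show ?thesis .
 qed
 then show ?thesis by (intro bdd_aboveI[of _ C]) blast
qed

lemma mat_norm_ge0:
 fixes a :: "nat => nat => 'a::chilbert => 'a"
 assumes "!!i j. i < n ==> j < n ==> a i j \<in> bops"
 shows "0 <= mat_norm n a"
proof -
 have "L2_set (%i. norm (\<Sum>j<n. a i j ((%_. 0) j))) {..<n} <= mat_norm n a"
  unfolding mat_norm_def
  by (rule cSup_upper[OF CollectI mat_norm_bdd[OF assms]], intro exI[of _ "%_. 0"]) (auto simp: L2_set_def)
 then show ?thesis using L2_set_nonneg order_trans by blast
qed

lemma mat_norm_bound:
 assumes "!!i j. i < n ==> j < n ==> a i j \<in> bops"
 shows "L2_set (%i. norm (\<Sum>j<n. a i j (\<xi> j))) {..<n} <= mat_norm n a * L2_set (%j. norm (\<xi> j)) {..<n}"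
proof -
 let ?L = "%\<xi>. L2_set (%i. norm (\<Sum>j<n. a i j (\<xi> j))) {..<n}" and ?N = "%\<xi>. L2_set (%j. norm (\<xi> j)) {..<n}"
 note bdd = mat_norm_bdd[OF assms]
 have hom: "?L (%j. r *\<^sub>R \<xi> j) = r * ?L \<xi>" if "r \<ge> 0" for r \<xi>
 proof -
  have "L2_set (%i. norm (\<Sum>j<n. a i j (r *\<^sub>R \<xi> j))) {..<n} = L2_set (%i. r * norm (\<Sum>j<n. a i j (\<xi> j))) {..<n}"
   using that by (intro L2_set_cong refl) (simp add: bops_scaleR assms scaleR_sum_right[symmetric])
  then show ?thesis using that by (simp add: L2_set_right_distrib)
 qed
 show ?thesis
 proof (cases "?N \<xi> = 0")
  case True
  then have "\<xi> j = 0" if "j < n" for j using that by (simp add: L2_set_eq_0_iff)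
  then have "?L \<xi> = ?L (%j. 0 *\<^sub>R \<xi> j)" by (intro L2_set_cong refl) (auto intro!: sum.cong arg_cong[of _ _ norm])
  then show ?thesis using True hom[of 0 \<xi>] by simp
 next
  case False
  define r where "r = ?N \<xi>"
  have r: "r > 0" using False L2_set_nonneg[of "%j. norm (\<xi> j)" "{..<n}"] unfolding r_def by linarith
  have "?N (%j. (1/r) *\<^sub>R \<xi> j) = 1"
   using r L2_set_right_distrib[of "1/r" "%j. norm (\<xi> j)" "{..<n}"] by (simp add: r_def)
  then have "?L (%j. (1/r) *\<^sub>R \<xi> j) <= mat_norm n a"
   unfolding mat_norm_def by (intro cSup_upper bdd) auto
  then have "(1/r) * ?L \<xi> <= mat_norm n a" using r by (simp add: hom)
  then show ?thesis using r by (simp add: field_simps r_def)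
 qed
qed

lemma mat_norm_leI:
 assumes "!!\<xi>. L2_set (%j. norm (\<xi> j)) {..<n} <= 1 ==> L2_set (%i. norm (\<Sum>j<n. a i j (\<xi> j))) {..<n} <= K"
 shows "mat_norm n a <= K"
 unfolding mat_norm_def
proof (rule cSup_least)
 show "{L2_set (%i. norm (\<Sum>j<n. a i j (\<xi> j))) {..<n} | \<xi>. L2_set (%j. norm (\<xi> j)) {..<n} <= 1} \<noteq> {}"
  by (auto intro!: exI[of _ "%_. 0"] simp: L2_set_def)
qed (use assms in auto)

text \<open>Parseval's formula in the multiplicity space reduces the estimate to the given matrix
  acting on each family of components.\<close>

lemma (in amplified_rep) J_mat_norm:
 assumes a: "a \<in> mats n A"
 shows "L2_set (%i. norm (\<Sum>j<n. J (a i j) (\<xi> j))) {..<n} <= mat_norm n a * L2_set (%j. norm (\<xi> j)) {..<n}"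
proof -
 have aA: "a i j \<in> A" if "i < n" "j < n" for i j using a that by (auto simp: mats_def)
 have m0: "mat_norm n a \<ge> 0" by (rule mat_norm_ge0) (auto intro: A_bops aA)
 have comp: "(\<Sum>i<n. (norm (\<Sum>j<n. a i j (comp_at x (U (\<xi> j)))))\<^sup>2) <= (mat_norm n a)\<^sup>2 * (\<Sum>j<n. (norm (comp_at x (U (\<xi> j))))\<^sup>2)" for x
 proof -
  have "L2_set (%i. norm (\<Sum>j<n. a i j (comp_at x (U (\<xi> j))))) {..<n} <= mat_norm n a * L2_set (%j. norm (comp_at x (U (\<xi> j)))) {..<n}"
   by (rule mat_norm_bound) (auto intro: A_bops aA)
  from power_mono[OF this L2_set_nonneg, of 2] show ?thesis
   by (simp add: L2_set_def power_mult_distrib sum_nonneg)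
 qed
 have "((%x. \<Sum>i<n. (norm (\<Sum>j<n. a i j (comp_at x (U (\<xi> j)))))\<^sup>2) has_sum (\<Sum>i<n. (norm (\<Sum>j<n. J (a i j) (\<xi> j)))\<^sup>2)) UNIV"
 proof (intro has_sum_sum)
  fix i assume i: "i \<in> {..<n}"
  have "U (\<Sum>j<n. J (a i j) (\<xi> j)) = (\<Sum>j<n. amp (a i j) (U (\<xi> j)))"
   using i by (auto simp: bops_sum U_bops U_J aA intro!: sum.cong)
  then have "comp_at x (U (\<Sum>j<n. J (a i j) (\<xi> j))) = (\<Sum>j<n. a i j (comp_at x (U (\<xi> j))))" for x
   using i by (auto simp: bops_sum E_bra_bops comp_at_op_tensor aA A_bops intro!: sum.cong)
  then show "((%x. (norm (\<Sum>j<n. a i j (comp_at x (U (\<xi> j)))))\<^sup>2) has_sum (norm (\<Sum>j<n. J (a i j) (\<xi> j)))\<^sup>2) UNIV"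
   using parseval_norm[of "U (\<Sum>j<n. J (a i j) (\<xi> j))"] by (simp add: isometry_norm[OF U])
 qed
 moreover have "((%x. (mat_norm n a)\<^sup>2 * (\<Sum>j<n. (norm (comp_at x (U (\<xi> j))))\<^sup>2)) has_sum (mat_norm n a)\<^sup>2 * (\<Sum>j<n. (norm (\<xi> j))\<^sup>2)) UNIV"
  by (intro has_sum_cmult_right has_sum_sum) (use parseval_norm[of "U (\<xi> _)"] isometry_norm[OF U] in simp)
 ultimately have "(\<Sum>i<n. (norm (\<Sum>j<n. J (a i j) (\<xi> j)))\<^sup>2) <= (mat_norm n a)\<^sup>2 * (\<Sum>j<n. (norm (\<xi> j))\<^sup>2)"
  by (rule has_sum_mono) (rule comp)
 then have "sqrt (\<Sum>i<n. (norm (\<Sum>j<n. J (a i j) (\<xi> j)))\<^sup>2) <= sqrt ((mat_norm n a)\<^sup>2 * (\<Sum>j<n. (norm (\<xi> j))\<^sup>2))"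
  by (rule real_sqrt_le_mono)
 then show ?thesis using m0 by (simp add: L2_set_def real_sqrt_mult)
qed

instance chilbert \<subseteq> banach ..

section \<open>Step functions\<close>

abbreviation piece :: "real => real => 'k::chilbert => real => 'k" where
 "piece a b c \<equiv> (%s. if s \<in> {a..<b} then c else 0)"

abbreviation lo :: "real => (real => 'k::chilbert) => real => 'k" where "lo r \<equiv> restr {0..<r}"

abbreviation hi :: "real => (real => 'k::chilbert) => real => 'k" where "hi r \<equiv> restr {r..}"

text \<open>The future of \<open>f\<close> after \<open>r\<close>, moved back to the origin.
  Together with \<open>lo r f\<close> it determines a step function, since these vanish at negative
  arguments.\<close>

abbreviation lshift :: "real => (real => 'k::chilbert) => real => 'k" where
 "lshift r f \<equiv> (%s. if 0 <= s then f (s + r) else 0)"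

abbreviation rshift :: "real => (real => 'k::chilbert) => real => 'k" where
 "rshift r f \<equiv> (%s. if r <= s then f (s - r) else 0)"

lemma step_zero: "(%_. 0) \<in> step_functions"
 unfolding step_functions_def by (intro CollectI exI[of _ 0]) auto

lemma step_add_piece:
 assumes "f \<in> step_functions" "0 <= a" shows "(%s. f s + piece a b c s) \<in> step_functions"
proof -
 obtain n :: nat and a' b' c' where f: "\<forall>i<n. 0 <= a' i" "f = (%s. \<Sum>i<n. piece (a' i) (b' i) (c' i) s)"
  using assms(1) unfolding step_functions_def by blast
 show ?thesis unfolding step_functions_def
  by (intro CollectI exI[of _ "Suc n"] exI[of _ "a'(n := a)"] exI[of _ "b'(n := b)"] exI[of _ "c'(n := c)"])
    (use f assms in \<open>auto simp: f less_Suc_eq cong: if_cong intro!: ext\<close>)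
qed

lemma step_induct [consumes 1, case_names zero add]:
 assumes "f \<in> step_functions" "P (%_. 0)"
  "!!f a b c. f \<in> step_functions ==> P f ==> 0 <= a ==> P (%s. f s + piece a b c s)"
 shows "P f"
proof -
 obtain n :: nat and a b c where f: "\<forall>i<n. 0 <= a i" "f = (%s. \<Sum>i<n. piece (a i) (b i) (c i) s)"
  using assms(1) unfolding step_functions_def by blast
 have "(%s. \<Sum>i<m. piece (a i) (b i) (c i) s) \<in> step_functions \<and> P (%s. \<Sum>i<m. piece (a i) (b i) (c i) s)" if "m <= n" for m
  using that
 proof (induction m)
  case 0
  then show ?case using assms(2) by (simp add: step_zero)
 next
  case (Suc m)
  then show ?case
   using step_add_piece[of _ "a m" "b m" "c m"] assms(3)[of _ "a m" "b m" "c m"] f(1) by simp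
 qed
 from this[of n] show ?thesis by (simp add: f(2))
qed

lemma step_piece: "0 <= a ==> piece a b c \<in> step_functions"
 using step_add_piece[OF step_zero, of a b c] by (simp cong: if_cong)

lemma step_add: "g \<in> step_functions ==> f \<in> step_functions ==> (%s. f s + g s) \<in> step_functions"
proof (induction rule: step_induct)
 case (add g a b c)
 have eq: "(%s. f s + (g s + piece a b c s)) = (%s. (f s + g s) + piece a b c s)" by (simp add: add.assoc)
 show ?case unfolding eq by (rule step_add_piece[OF add.IH[OF add.prems] add.hyps(2)])
qed simp

lemma step_linear_image:
 assumes "f \<in> step_functions" "\<Phi> (%_. 0) = (%_. 0)" "!!f g. \<Phi> (%s. f s + g s) = (%s. \<Phi> f s + \<Phi> g s)"
  "!!a b c. 0 <= a ==> \<Phi> (piece a b c) \<in> step_functions"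
 shows "\<Phi> f \<in> step_functions"
 using assms(1)
proof (induction rule: step_induct)
 case (add f a b c)
 show ?case unfolding assms(3) by (rule step_add[OF assms(4)[OF add.hyps(2)] add.IH])
qed (simp add: assms step_zero)

lemma step_scale: "f \<in> step_functions ==> (%s. z *\<^sub>C f s) \<in> step_functions"
proof (erule step_linear_image[where \<Phi> = "%f s. z *\<^sub>C f s"])
 show "(%s. z *\<^sub>C piece a b c s) \<in> step_functions" if "0 <= a" for a b and c :: 'a
  using step_piece[OF that, of b "z *\<^sub>C c"] by (simp add: if_distrib[of "scaleC z"] cong: if_cong)
qed (auto simp: scaleC_add_right)

lemma step_restr_below: "f \<in> step_functions ==> lo r f \<in> step_functions"
proof (erule step_linear_image[where \<Phi> = "lo r"])
 show "lo r (piece a b c) \<in> step_functions" if "0 <= a" for a b and c :: 'a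
 proof -
  have "lo r (piece a b c) = piece a (min b r) c" using that by (auto simp: restr_def)
  then show ?thesis using step_piece[OF that] by metis
 qed
qed (auto simp: restr_def)

lemma step_restr_above: "f \<in> step_functions ==> 0 <= r ==> hi r f \<in> step_functions"
proof (erule step_linear_image[where \<Phi> = "hi r"])
 show "hi r (piece a b c) \<in> step_functions" if "0 <= a" "0 <= r" for a b and c :: 'a
 proof -
  have "hi r (piece a b c) = piece (max a r) b c" using that by (auto simp: restr_def)
  then show ?thesis using step_piece[of "max a r" b c] that by simp
 qed
qed (auto simp: restr_def)

lemma step_lshift: "f \<in> step_functions ==> lshift r f \<in> step_functions"
proof (erule step_linear_image[where \<Phi> = "lshift r"])
 show "lshift r (piece a b c) \<in> step_functions" if "0 <= a" for a b and c :: 'a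
 proof -
  have "lshift r (piece a b c) = piece (max 0 (a - r)) (b - r) c" by auto
  then show ?thesis using step_piece[of "max 0 (a - r)" "b - r" c] by simp
 qed
qed auto

lemma step_rshift: "f \<in> step_functions ==> 0 <= r ==> rshift r f \<in> step_functions"
proof (erule step_linear_image[where \<Phi> = "rshift r"])
 show "rshift r (piece a b c) \<in> step_functions" if "0 <= a" "0 <= r" for a b and c :: 'a
 proof -
  have "rshift r (piece a b c) = piece (a + r) (b + r) c" using that by auto
  then show ?thesis using step_piece[of "a + r" "b + r" c] that by simp
 qed
qed auto

lemma step_negative: "f \<in> step_functions ==> s < 0 ==> f s = 0"
 by (induction rule: step_induct) auto

lemma step_const: "0 <= a ==> restr {a..<b} (%_. c) \<in> step_functions"
 using step_piece[of a b c] by (simp add: restr_def)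

lemma L2_ext:
 assumes "!!h. h \<in> step_functions ==> \<langle>L2_of h, F\<rangle> = \<langle>L2_of h, G\<rangle>" shows "F = (G :: 'k::chilbert L2)"
proof (rule khilb_eqI)
 fix z :: "'k step"
 show "\<langle>kvec z, F\<rangle> = \<langle>kvec z, G\<rangle>"
  using assms[OF Rep_step[of z]] by (simp add: L2_of_def Rep_step_inverse)
qed

lemma L2_of_add:
 assumes "f \<in> step_functions" "g \<in> step_functions"
 shows "L2_of (%s. f s + g s) = L2_of f + L2_of g"
 by (rule L2_ext)
   (simp add: cinner_add_right cinner_L2_of assms step_add integrable_step_cinner)

lemma L2_of_scale:
 assumes "f \<in> step_functions" shows "L2_of (%s. z *\<^sub>C f s) = z *\<^sub>C L2_of f"
 by (rule L2_ext) (simp add: cinner_scaleC_right cinner_L2_of assms step_scale)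

lemma L2_of_zero [simp]: "L2_of (%_. 0) = 0"
 using L2_of_scale[OF step_zero, of 0] by simp

text \<open>Additivity of the inner product over past and future is what exponential vectors turn
  into the tensor factorisation of Fock space.\<close>

lemma L2_split:
 fixes f g :: "real => 'k::chilbert"
 assumes "f \<in> step_functions" "g \<in> step_functions" "0 <= r"
 shows "\<langle>L2_of f, L2_of g\<rangle> = \<langle>L2_of (lo r f), L2_of (lo r g)\<rangle> + \<langle>L2_of (lshift r f), L2_of (lshift r g)\<rangle>"
proof -
 have "(\<integral>s. \<langle>f s, g s\<rangle> \<partial>lborel) = (\<integral>s. \<langle>lo r f s, lo r g s\<rangle> + \<langle>hi r f s, hi r g s\<rangle> \<partial>lborel)"
  using assms by (intro Bochner_Integration.integral_cong refl) (auto simp: restr_def not_le step_negative)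
 also have "\<dots> = (\<integral>s. \<langle>lo r f s, lo r g s\<rangle> \<partial>lborel) + (\<integral>s. \<langle>hi r f s, hi r g s\<rangle> \<partial>lborel)"
  by (intro Bochner_Integration.integral_add integrable_step_cinner step_restr_below step_restr_above assms)
 also have "(\<integral>s. \<langle>hi r f s, hi r g s\<rangle> \<partial>lborel) = (\<integral>s. \<langle>hi r f (r + 1 * s), hi r g (r + 1 * s)\<rangle> \<partial>lborel)"
  by (subst lborel_integral_real_affine[of 1 _ r]) auto
 also have "\<dots> = (\<integral>s. \<langle>lshift r f s, lshift r g s\<rangle> \<partial>lborel)"
  by (intro Bochner_Integration.integral_cong refl) (auto simp: restr_def add.commute)
 finally show ?thesis
  by (simp add: cinner_L2_of assms step_restr_below step_lshift)
qed

lemma cinner_L2_rshift: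
 fixes f g :: "real => 'k::chilbert"
 assumes "f \<in> step_functions" "g \<in> step_functions" "0 <= r"
 shows "\<langle>L2_of (rshift r f), L2_of (rshift r g)\<rangle> = \<langle>L2_of f, L2_of g\<rangle>"
proof -
 have "lshift r (rshift r f) = f" "lo r (rshift r f) = (%_. 0)" if "f \<in> step_functions" for f :: "real => 'k"
  using step_negative[OF that] assms(3) by (auto simp: restr_def not_le)
 then show ?thesis
  using L2_split[OF step_rshift[OF assms(1,3)] step_rshift[OF assms(2,3)] assms(3)] assms by simp
qed

section \<open>Exponential vectors\<close>

lemma norm_npart: "norm (npart n x) = norm x ^ n"
proof -
 have "complex_of_real ((norm (npart n x))\<^sup>2) = complex_of_real ((norm x ^ n)\<^sup>2)"
  unfolding cinner_self[symmetric] cinner_npart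
  by (simp add: cinner_self power_mult[symmetric] mult.commute)
 then have "(norm (npart n x))\<^sup>2 = (norm x ^ n)\<^sup>2" by (simp only: of_real_eq_iff)
 then show ?thesis by (rule power2_eq_imp_eq) auto
qed

lemma npart_ext:
 assumes "!!n x. \<langle>npart n x, F\<rangle> = \<langle>npart n x, G\<rangle>" shows "F = (G :: 'a::chilbert fock)"
 by (rule total_ext[OF total_of_closure_cspan[OF npart_total]]) (use assms in auto)

lemma npart_scale: "npart n (z *\<^sub>C x) = z ^ n *\<^sub>C npart n x"
 by (rule npart_ext) (simp add: cinner_npart cinner_scaleC_right power_mult_distrib)

lemma npart_one_add: "npart 1 (x + y) = npart 1 x + npart 1 y"
 by (rule npart_ext) (simp add: cinner_npart cinner_add_right)

definition expv :: "'a::chilbert => 'a fock" where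
 "expv x = (\<Sum>n. (1 / sqrt (fact n)) *\<^sub>R npart n x)"

text \<open>The term is the geometric mean of a term of the exponential series of
  \<open>2 * a\<^sup>2\<close> and a term of the geometric series of ratio 1/2; it is bounded by
  their arithmetic mean.\<close>

lemma summable_root_exp: "summable (%n. a ^ n / sqrt (fact n))"
proof (rule summable_comparison_test'[of _ 0])
 have "summable (%n. inverse (fact n) * (2 * a\<^sup>2) ^ n)" by (rule summable_exp)
 moreover have "summable (%n. (1/2::real) ^ n)" by (rule summable_geometric) simp
 ultimately show "summable (%n. inverse (fact n) * (2 * a\<^sup>2) ^ n + (1/2) ^ n)" by (rule summable_add)
 fix n :: nat
 define u where "u = inverse (fact n) * (2 * a\<^sup>2) ^ n"
 define v where "v = (1/2::real) ^ n"
 have uv: "0 <= u" "0 <= v" by (auto simp: u_def v_def)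
 have "norm (a ^ n / sqrt (fact n)) = sqrt ((a ^ n / sqrt (fact n))\<^sup>2)" by simp
 also have "(a ^ n / sqrt (fact n))\<^sup>2 = u * v"
  by (simp add: u_def v_def power_divide power_mult_distrib field_simps power_mult[symmetric])
 also have "sqrt (u * v) <= (u + v) / 2" by (rule arith_geo_mean_sqrt) (use uv in auto)
 also have "\<dots> <= u + v" using uv by simp
 finally show "norm (a ^ n / sqrt (fact n)) <= inverse (fact n) * (2 * a\<^sup>2) ^ n + (1/2) ^ n"
  by (simp add: u_def v_def)
qed

lemma expv_sums: "(%n. (1 / sqrt (fact n)) *\<^sub>R npart n x) sums expv x"
 unfolding expv_def
 by (rule summable_sums, rule summable_norm_cancel) (use summable_root_exp[of "norm x"] in \<open>simp add: norm_npart\<close>)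

lemma cinner_npart_expv: "\<langle>npart m y, expv x\<rangle> = complex_of_real (1 / sqrt (fact m)) * \<langle>y, x\<rangle> ^ m"
proof -
 have "(%n. \<langle>npart m y, (1 / sqrt (fact n)) *\<^sub>R npart n x\<rangle>) sums \<langle>npart m y, expv x\<rangle>"
  using bounded_linear.sums[OF bounded_bilinear.bounded_linear_right[OF bounded_bilinear_cinner] expv_sums] .
 moreover have "(%n. \<langle>npart m y, (1 / sqrt (fact n)) *\<^sub>R npart n x\<rangle>) sums (\<Sum>n\<in>{m}. \<langle>npart m y, (1 / sqrt (fact n)) *\<^sub>R npart n x\<rangle>)"
  by (rule sums_finite) (auto simp: cinner_scaleR_right cinner_npart)
 ultimately show ?thesis using sums_unique2 by (fastforce simp: cinner_scaleR_right cinner_npart)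
qed

lemma cinner_expv: "\<langle>expv y, expv x\<rangle> = exp \<langle>y, x\<rangle>"
proof -
 have "(%n. \<langle>(1 / sqrt (fact n)) *\<^sub>R npart n y, expv x\<rangle>) sums \<langle>expv y, expv x\<rangle>"
  using bounded_linear.sums[OF bounded_bilinear.bounded_linear_left[OF bounded_bilinear_cinner] expv_sums] .
 moreover have "\<langle>(1 / sqrt (fact n)) *\<^sub>R npart n y, expv x\<rangle> = \<langle>y, x\<rangle> ^ n /\<^sub>R fact n" for n
 proof -
  have "\<langle>(1 / sqrt (fact n)) *\<^sub>R npart n y, expv x\<rangle> = complex_of_real ((1 / sqrt (fact n)) * (1 / sqrt (fact n))) * \<langle>y, x\<rangle> ^ n"
   unfolding cinner_scaleR_left cinner_npart_expv by (simp only: of_real_mult mult.assoc)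
  also have "(1 / sqrt (fact n)) * (1 / sqrt (fact n)) = (inverse (fact n) :: real)"
   by (simp add: field_simps)
  finally show ?thesis by (simp add: scaleR_conv_of_real)
 qed
 ultimately show ?thesis using exp_converges[of "\<langle>y, x\<rangle>"] sums_unique2 by fastforce
qed

text \<open>As a function of \<open>z\<close> the inner product with
  \<open>expv (z *\<^sub>C x)\<close> is an entire power series with the n-particle components as
  coefficients; if it vanishes identically, so do all coefficients.\<close>

lemma expv_orth_npart:
 assumes "!!z. \<langle>w, expv (z *\<^sub>C x)\<rangle> = 0" shows "\<langle>w, npart n x\<rangle> = 0"
proof -
 define a where "a n = complex_of_real (1 / sqrt (fact n)) * \<langle>w, npart n x\<rangle>" for n
 have s: "(%n. a n * z ^ n) sums 0" for z
 proof -
  have "(%n. \<langle>w, (1 / sqrt (fact n)) *\<^sub>R npart n (z *\<^sub>C x)\<rangle>) sums \<langle>w, expv (z *\<^sub>C x)\<rangle>"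
   using bounded_linear.sums[OF bounded_bilinear.bounded_linear_right[OF bounded_bilinear_cinner] expv_sums] .
  then show ?thesis
   by (simp add: assms npart_scale cinner_scaleR_right cinner_scaleC_right a_def mult_ac)
 qed
 have "conv_radius a = \<infinity>"
  by (rule conv_radius_inftyI'') (use s sums_summable in blast)
 then have "fps_conv_radius (Abs_fps a) > 0" by (simp add: fps_conv_radius_def)
 moreover have "eval_fps (Abs_fps a) z = eval_fps 0 z" for z
  using s[of z] by (simp add: eval_fps_def sums_iff)
 ultimately have "Abs_fps a = 0"
  by (intro eval_fps_eqD) auto
 then have "a n = 0" by (metis Abs_fps_inverse UNIV_I fps_nth_Abs_fps fps_zero_nth)
 then show ?thesis by (simp add: a_def)
qed

lemma coh_expv: "coh f = exp (- (norm (L2_of f))\<^sup>2 / 2) *\<^sub>R expv (L2_of f)"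
 by (simp add: coh_def expv_def)

text \<open>The inner product of two normalised exponential vectors as a function of the three inner
  products of their arguments: an exponential of a linear form, so sums turn into products.\<close>

definition coh_kernel :: "complex => complex => complex => complex" where
 "coh_kernel p q c = exp (c - p / 2 - q / 2)"

lemma cinner_coh: "\<langle>coh f, coh g\<rangle> = coh_kernel \<langle>L2_of f, L2_of f\<rangle> \<langle>L2_of g, L2_of g\<rangle> \<langle>L2_of f, L2_of g\<rangle>"
proof -
 have "\<langle>coh f, coh g\<rangle> = complex_of_real (exp (- (norm (L2_of f))\<^sup>2 / 2)) * complex_of_real (exp (- (norm (L2_of g))\<^sup>2 / 2)) * exp \<langle>L2_of f, L2_of g\<rangle>"
  by (simp add: coh_expv cinner_scaleR_left cinner_scaleR_right cinner_expv)
 also have "\<dots> = coh_kernel \<langle>L2_of f, L2_of f\<rangle> \<langle>L2_of g, L2_of g\<rangle> \<langle>L2_of f, L2_of g\<rangle>"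
  unfolding coh_kernel_def cinner_self exp_of_real[symmetric] exp_add[symmetric]
  by (rule arg_cong[of _ _ exp]) (simp add: algebra_simps)
 finally show ?thesis .
qed

lemma coh_kernel_mult: "coh_kernel (p + p') (q + q') (c + c') = coh_kernel p q c * coh_kernel p' q' c'"
 unfolding coh_kernel_def exp_add[symmetric] by (simp add: algebra_simps add_divide_distrib)

lemma cinner_coh_split:
 assumes "f \<in> step_functions" "g \<in> step_functions" "0 <= r"
 shows "\<langle>coh f, coh g\<rangle> = \<langle>coh (lo r f), coh (lo r g)\<rangle> * \<langle>coh (lshift r f), coh (lshift r g)\<rangle>"
 unfolding cinner_coh coh_kernel_mult[symmetric]
 by (simp only: L2_split[OF assms(1,1,3)] L2_split[OF assms(2,2,3)] L2_split[OF assms])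

lemma cinner_coh_rshift:
 assumes "f \<in> step_functions" "g \<in> step_functions" "0 <= r"
 shows "\<langle>coh (rshift r f), coh (rshift r g)\<rangle> = \<langle>coh f, coh g\<rangle>"
 unfolding cinner_coh by (simp only: cinner_L2_rshift assms)

lemma rshift_lshift: "0 <= r ==> rshift r (lshift r f) = hi r f"
 by (auto simp: restr_def)

lemma cinner_coh_restr:
 assumes "f \<in> step_functions" "g \<in> step_functions" "0 <= r"
 shows "\<langle>coh (hi r f), coh (hi r g)\<rangle> = \<langle>coh (lshift r f), coh (lshift r g)\<rangle>"
 using cinner_coh_rshift[OF step_lshift[OF assms(1)] step_lshift[OF assms(2)] assms(3), of r r]
 by (simp only: rshift_lshift[OF assms(3)])

lemma coh_zero: "coh (%_. 0) = expv 0"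
 by (simp add: coh_expv)

lemma cinner_npart_coh: "\<langle>npart m y, coh f\<rangle> = complex_of_real (exp (- (norm (L2_of f))\<^sup>2 / 2)) * (complex_of_real (1 / sqrt (fact m)) * \<langle>y, L2_of f\<rangle> ^ m)"
 by (simp add: coh_expv cinner_scaleR_right cinner_npart_expv)

lemma cinner_npart_vacuum: "\<langle>npart 1 y, vacuum\<rangle> = 0"
 by (simp add: cinner_npart_coh)

lemma cinner_vacuum_coh: "\<langle>vacuum, coh f\<rangle> = complex_of_real (exp (- (norm (L2_of f))\<^sup>2 / 2))"
 by (simp add: coh_zero coh_expv[of f] cinner_scaleR_right cinner_expv)

lemma cinner_vacuum [simp]: "\<langle>vacuum, vacuum\<rangle> = 1"
 by (simp add: cinner_vacuum_coh)

lemma coh_orth_npart: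
 assumes "!!z. \<langle>w, coh (%s. z *\<^sub>C f s)\<rangle> = 0" "f \<in> step_functions"
 shows "\<langle>w, npart n (L2_of f)\<rangle> = 0"
proof (rule expv_orth_npart)
 fix z
 show "\<langle>w, expv (z *\<^sub>C L2_of f)\<rangle> = 0"
  using assms(1)[of z] by (simp add: coh_expv cinner_scaleR_right L2_of_scale assms(2))
qed

lemma L2_of_dense: "closure (L2_of ` step_functions) = (UNIV :: 'k::chilbert L2 set)"
proof -
 have "csubspace (L2_of ` (step_functions :: (real => 'k) set))"
  unfolding csubspace_def
 proof (intro conjI ballI allI)
  show "0 \<in> L2_of ` (step_functions :: (real => 'k) set)" using step_zero L2_of_zero by (metis image_eqI)
  show "x + y \<in> L2_of ` step_functions" if "x \<in> L2_of ` step_functions" "y \<in> L2_of ` step_functions" for x y :: "'k L2"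
   using that by (auto simp: L2_of_add[symmetric] intro!: imageI step_add)
  show "c *\<^sub>C x \<in> L2_of ` step_functions" if "x \<in> L2_of ` step_functions" for c and x :: "'k L2"
   using that by (auto simp: L2_of_scale[symmetric] intro!: imageI step_scale)
 qed
 then have "cspan (L2_of ` step_functions) \<subseteq> L2_of ` (step_functions :: (real => 'k) set)"
  by (rule cspan_minimal) simp
 then show ?thesis using L2_of_total closure_mono by blast
qed

lemma npart_tendsto:
 assumes "X \<longlonglongrightarrow> x" shows "(%k. npart n (X k)) \<longlonglongrightarrow> npart n (x::'a::chilbert)"
proof -
 have "(%k. (norm (npart n (X k) - npart n x))\<^sup>2) \<longlonglongrightarrow> (norm x ^ n)\<^sup>2 + (norm x ^ n)\<^sup>2 - 2 * Re (\<langle>x, x\<rangle> ^ n)"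
  unfolding norm_power2_diff norm_npart cinner_npart by (simp only: refl if_True, intro tendsto_intros assms)
 moreover have "(norm x ^ n)\<^sup>2 + (norm x ^ n)\<^sup>2 - 2 * Re (\<langle>x, x\<rangle> ^ n) = 0"
  by (simp add: cinner_self power_mult[symmetric] mult.commute flip: of_real_power)
 ultimately have "(%k. sqrt ((norm (npart n (X k) - npart n x))\<^sup>2)) \<longlonglongrightarrow> sqrt 0"
  by (intro tendsto_real_sqrt) simp
 then show ?thesis by (simp add: tendsto_norm_zero_iff LIM_zero_iff)
qed

text \<open>Scaling the test function extracts each \<open>npart n (L2_of f)\<close> from the
  exponential vectors; density of the step functions and continuity of \<open>npart n\<close> then
  reach all n-particle vectors.\<close>

lemma ctotal_coh: "ctotal (coh ` (step_functions :: (real => 'k::chilbert) set))"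
 unfolding ctotal_def
proof (intro allI impI)
 fix w :: "'k L2 fock" assume "\<forall>s\<in>coh ` step_functions. \<langle>s, w\<rangle> = 0"
 then have "\<langle>w, coh f\<rangle> = 0" if "f \<in> step_functions" for f using that by (metis cnj_cinner complex_cnj_zero image_eqI)
 note w0 = this
 have 0: "\<langle>w, npart n (L2_of f)\<rangle> = 0" if "f \<in> step_functions" for n f
  by (rule coh_orth_npart[OF w0[OF step_scale[OF that]] that])
 have "\<langle>w, npart n x\<rangle> = 0" for n x
 proof -
  have "x \<in> closure (L2_of ` step_functions)" by (simp add: L2_of_dense)
  then obtain X where X: "!!k. X k \<in> L2_of ` step_functions" "X \<longlonglongrightarrow> x"
   unfolding closure_sequential by blast
  have "(%k. \<langle>w, npart n (X k)\<rangle>) \<longlonglongrightarrow> \<langle>w, npart n x\<rangle>"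
   by (intro tendsto_intros npart_tendsto X)
  moreover have "\<langle>w, npart n (X k)\<rangle> = 0" for k using X(1)[of k] 0 by auto
  ultimately show ?thesis by (simp add: LIMSEQ_const_iff)
 qed
 then have "\<langle>npart n x, w\<rangle> = \<langle>npart n x, 0\<rangle>" for n x by (metis cnj_cinner complex_cnj_zero cinner_zero_right)
 then show "w = 0" by (rule npart_ext)
qed

lemma ctotal_tensor_coh: "ctotal ((%p. fst p \<otimes> coh (snd p)) ` (UNIV \<times> step_functions) :: ('a::chilbert, 'k::chilbert L2 fock) tensor set)"
proof -
 have "ctotal (UNIV :: 'a set)" by (auto simp: ctotal_def) (rule cinner_ext, simp)
 from ctotal_tensor[OF this ctotal_coh] show ?thesis
  by (rule total_mono) (auto simp: image_iff, blast)
qed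

lemma tensor_coh_ext:
 assumes "!!u f. f \<in> step_functions ==> \<langle>u \<otimes> coh f, \<zeta>\<rangle> = \<langle>u \<otimes> coh f, \<zeta>'\<rangle>"
 shows "\<zeta> = (\<zeta>' :: ('a::chilbert, 'k::chilbert L2 fock) tensor)"
 by (rule total_ext[OF ctotal_tensor_coh]) (use assms in auto)

lemma tensor_coh_bops_eq:
 assumes "S \<in> bops" "T \<in> bops" "!!u f. f \<in> step_functions ==> S (u \<otimes> coh f) = T (u \<otimes> coh f)"
 shows "S = (T :: ('a::chilbert, 'k::chilbert L2 fock) tensor => _)"
 by (rule total_bops_eq[OF ctotal_tensor_coh]) (use assms in auto)

section \<open>The factorisation of Fock space\<close>

lemma fock_shift_exists:
 assumes "0 <= r"
 shows "\<exists>V::'k::chilbert L2 fock => 'k L2 fock. isometry V \<and> (\<forall>f\<in>step_functions. V (coh f) = coh (rshift r f))"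
 by (rule isometry_extension[OF ctotal_coh]) (rule cinner_coh_rshift[OF _ _ assms])

lemma fock_shift_unique:
 assumes "0 <= r"
 shows "isometry (fock_shift r :: 'k::chilbert L2 fock => _) \<and>
  (\<forall>f\<in>step_functions. fock_shift r (coh f) = coh (rshift r f :: real => 'k))"
proof -
 obtain V :: "'k::chilbert L2 fock => 'k L2 fock" where V: "isometry V" "\<forall>f\<in>step_functions. V (coh f) = coh (rshift r f)"
  using fock_shift_exists[OF assms] by blast
 have "fock_shift r = V"
  unfolding fock_shift_def
 proof (rule the_equality)
  show "V \<in> bops \<and> (\<forall>f\<in>step_functions. V (coh f) = coh (rshift r f))" using V isometry_bops by blast
  show "V' = V" if "V' \<in> bops \<and> (\<forall>f\<in>step_functions. V' (coh f) = coh (rshift r f))" for V'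
   by (rule total_bops_eq[OF ctotal_coh]) (use that V isometry_bops in auto)
 qed
 then show ?thesis using V by simp
qed

lemmas fock_shift_isometry = fock_shift_unique[THEN conjunct1]
 and fock_shift_coh = fock_shift_unique[THEN conjunct2, rule_format]

lemma fock_split_exists:
 assumes "0 <= r"
 shows "\<exists>D::('a::chilbert, 'k::chilbert L2 fock) tensor => (('a, 'k L2 fock) tensor, 'k L2 fock) tensor. isometry D \<and>
  (\<forall>u. \<forall>f\<in>step_functions. D (u \<otimes> coh f) = (u \<otimes> coh (lo r f)) \<otimes> coh (lshift r f))"
proof -
 define g :: "'a \<times> (real => 'k) => ('a, 'k L2 fock) tensor" where "g p = fst p \<otimes> coh (snd p)" for p
 define f :: "'a \<times> (real => 'k) => (('a, 'k L2 fock) tensor, 'k L2 fock) tensor"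
  where "f p = (fst p \<otimes> coh (lo r (snd p))) \<otimes> coh (lshift r (snd p))" for p
 have tot: "ctotal (g ` (UNIV \<times> step_functions))" unfolding g_def by (rule ctotal_tensor_coh)
 have "\<langle>f p, f q\<rangle> = \<langle>g p, g q\<rangle>" if "p \<in> UNIV \<times> step_functions" "q \<in> UNIV \<times> step_functions" for p q
  using that cinner_coh_split[OF _ _ assms, of "snd p" "snd q"]
  by (auto simp: f_def g_def cinner_tensor simp del: if_split)
 from isometry_extension[of g _ f, OF tot this]
 obtain D where "isometry D \<and> (\<forall>p\<in>UNIV \<times> step_functions. D (g p) = f p)" ..
 then show ?thesis by (intro exI[of _ D]) (auto simp: f_def g_def cong: if_cong)
qed

text \<open>\<open>fock_split r\<close> identifies \<open>h \<otimes> \<F>\<close> with \<open>(h \<otimes> \<F>\<^sub>[\<^sub>0\<^sub>,\<^sub>r\<^sub>)) \<otimes> \<F>\<close>, shifting the second Fock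
 factor back to the origin.\<close>

definition fock_split :: "real => ('a::chilbert, 'k::chilbert L2 fock) tensor => (('a, 'k L2 fock) tensor, 'k L2 fock) tensor" where
 "fock_split r = (SOME D. isometry D \<and> (\<forall>u. \<forall>f\<in>step_functions. D (u \<otimes> coh f) = (u \<otimes> coh (lo r f)) \<otimes> coh (lshift r f)))"

lemmas fock_split_isometry = someI_ex[OF fock_split_exists, folded fock_split_def, THEN conjunct1]
 and fock_split_coh = someI_ex[OF fock_split_exists, folded fock_split_def, THEN conjunct2, rule_format]

lemmas fock_split_bops = isometry_bops[OF fock_split_isometry]

section \<open>Ampliation over an arbitrary Hilbert space\<close>

text \<open>A maximal orthonormal set is total, and its own elements serve as labels of basis
  vectors.\<close>

lemma ell2_isometry_exists: "\<exists>S::'f::chilbert => 'f ell2. isometry S"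
proof -
 define \<A> where "\<A> = {B::'f set. \<forall>y\<in>B. \<forall>y'\<in>B. \<langle>y, y'\<rangle> = (if y = y' then 1 else 0)}"
 have "\<exists>M\<in>\<A>. \<forall>X\<in>\<A>. M \<subseteq> X \<longrightarrow> X = M"
 proof (rule subset_Zorn')
  fix C assume C: "subset.chain \<A> C"
  show "\<Union>C \<in> \<A>" unfolding \<A>_def
  proof (intro CollectI ballI)
   fix y y' assume y: "y \<in> \<Union>C" "y' \<in> \<Union>C"
   then obtain X Y where "X \<in> C" "Y \<in> C" "y \<in> X" "y' \<in> Y" by blast
   moreover have "X \<subseteq> Y \<or> Y \<subseteq> X" using subset.chain_total[OF C \<open>X \<in> C\<close> \<open>Y \<in> C\<close>] by auto
   ultimately obtain Z where "Z \<in> C" "y \<in> Z" "y' \<in> Z" by blast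
   then show "\<langle>y, y'\<rangle> = (if y = y' then 1 else 0)" using C unfolding subset.chain_def \<A>_def by blast
  qed
 qed
 then obtain B where B: "B \<in> \<A>" "!!X. X \<in> \<A> ==> B \<subseteq> X ==> X = B" by blast
 have on: "\<langle>y, y'\<rangle> = (if y = y' then 1 else 0)" if "y \<in> B" "y' \<in> B" for y y'
  using B(1) that unfolding \<A>_def by blast
 have "ctotal ((%y. y) ` B)"
  unfolding ctotal_def
 proof (intro allI impI, rule ccontr)
  fix w assume w: "\<forall>s\<in>(%y. y) ` B. \<langle>s, w\<rangle> = 0" "w \<noteq> 0"
  define e where "e = (1 / norm w) *\<^sub>R w"
  have e: "\<langle>e, e\<rangle> = 1" using w(2) by (simp add: e_def cinner_scaleR_left cinner_scaleR_right cinner_self power2_eq_square)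
  have ye: "\<langle>y, e\<rangle> = 0" "\<langle>e, y\<rangle> = 0" if "y \<in> B" for y
  proof -
   show "\<langle>y, e\<rangle> = 0" using w(1) that by (simp add: e_def cinner_scaleR_right)
   then show "\<langle>e, y\<rangle> = 0" by (metis cnj_cinner complex_cnj_zero)
  qed
  then have "e \<notin> B" using e by force
  then have "insert e B \<in> \<A>" using on e ye unfolding \<A>_def by auto
  then have "e \<in> B" using B(2) by blast
  with \<open>e \<notin> B\<close> show False by simp
 qed
 from isometry_extension[of "%y. y" B basis, OF this] show ?thesis
  by (auto simp: cinner_basis on)
qed

text \<open>An isometry \<open>S\<close> from the second factor to a space with a basis writes
  \<open>T \<otimes> z\<close> as \<open>T \<otimes> 1\<close> between
  \<open>1 \<otimes> S z\<close> and \<open>1 \<otimes> adj S\<close>, which reduces normality to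
  that of ampliations.\<close>

lemma normal_tensor_right:
 fixes z :: "'f::chilbert => 'g::chilbert"
 assumes X: "X \<in> bops" and Y: "Y \<in> bops" and z: "z \<in> bops"
 shows "continuous_map uw_topology uw_topology (%T::'a::chilbert => 'b::chilbert. %x. X (op_tensor T z (Y x)))"
proof -
 obtain S :: "'g => 'g ell2" where S: "isometry S" using ell2_isometry_exists by blast
 note Sb = isometry_bops[OF S]
 have Xb: "(%\<zeta>. X (ampr (adj S) \<zeta>)) \<in> bops"
  by (rule bops_comp[OF X op_tensor_bops[OF bops_id adj_bops[OF Sb]]])
 have Yb: "(%x. ampr (%v. S (z v)) (Y x)) \<in> bops"
  by (rule bops_comp[OF op_tensor_bops[OF bops_id bops_comp[OF Sb z]] Y])
 have eq: "X (ampr (adj S) (amp T (ampr (%v. S (z v)) (Y x)))) = X (op_tensor T z (Y x))"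
  if "T \<in> bops" for T :: "'a => 'b" and x
  by (simp add: op_tensor_comp that Sb z adj_bops bops_comp isometry_adj[OF S])
 show ?thesis
  by (rule continuous_map_eq[OF normal_ampliation_conj[OF Xb Yb]]) (rule ext, simp add: eq)
qed

section \<open>Subspaces of Fock space\<close>

lemma projection_op_exists:
 fixes M :: "'a::chilbert set"
 assumes "csubspace M" "closed M"
 shows "\<exists>p\<in>bops. (\<forall>x. p x \<in> M) \<and> (\<forall>x. \<forall>m\<in>M. \<langle>m, x - p x\<rangle> = 0)"
proof -
 obtain p where p: "!!x. p x \<in> M" "!!x m. m \<in> M ==> \<langle>m, x - p x\<rangle> = 0"
  using projection_exists[OF assms] by metis
 have uniq: "p x = q" if "q \<in> M" "!!m. m \<in> M ==> \<langle>m, x - q\<rangle> = 0" for x q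
 proof -
  have m: "q - p x \<in> M" by (rule csubspace_diff[OF assms(1) that(1) p(1)])
  have "\<langle>q - p x, (x - p x) - (x - q)\<rangle> = 0"
   unfolding cinner_diff_right[of _ "x - p x" "x - q"] that(2)[OF m] p(2)[OF m] by simp
  then show ?thesis by (simp add: cinner_self)
 qed
 have "p \<in> bops"
 proof (rule bopsI)
  show "p (x + y) = p x + p y" for x y
  proof (rule uniq)
   fix m assume m: "m \<in> M"
   have "\<langle>m, x + y - (p x + p y)\<rangle> = \<langle>m, x - p x\<rangle> + \<langle>m, y - p y\<rangle>" by (simp add: cinner_add_right cinner_diff_right)
   then show "\<langle>m, x + y - (p x + p y)\<rangle> = 0" using p(2)[OF m] by simp
  qed (intro csubspaceD(2)[OF assms(1)] p)
  show "p (c *\<^sub>C x) = c *\<^sub>C p x" for c x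
  proof (rule uniq)
   fix m assume m: "m \<in> M"
   show "\<langle>m, c *\<^sub>C x - c *\<^sub>C p x\<rangle> = 0" using p(2)[OF m, of x] by (simp add: scaleC_diff_right[symmetric] cinner_scaleC_right)
  qed (intro csubspaceD(3)[OF assms(1)] p)
  show "norm (p x) <= 1 * norm x" for x
  proof -
   have "(norm x)\<^sup>2 = (norm (p x + (x - p x)))\<^sup>2" by simp
   also have "\<dots> = (norm (p x))\<^sup>2 + (norm (x - p x))\<^sup>2" unfolding norm_power2_add by (simp add: p)
   finally have "(norm (p x))\<^sup>2 <= (norm x)\<^sup>2" by simp
   then show ?thesis using power2_le_imp_le by fastforce
  qed
 qed
 then show ?thesis using p by blast
qed

lemma fock_sub_csubspace: "csubspace (fock_sub J)"
 unfolding fock_sub_def by (rule csubspace_closure[OF cspan_csubspace])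

lemma fock_sub_closed: "closed (fock_sub J)"
 unfolding fock_sub_def by (rule closed_closure)

lemma npart_fock_sub:
 assumes "f \<in> step_functions" "!!s. s \<notin> J ==> f s = 0"
 shows "npart n (L2_of f) \<in> fock_sub J"
 unfolding fock_sub_def
 by (rule subsetD[OF closure_subset], rule subsetD[OF cspan_superset]) (use assms in blast)

lemma coh_fock_sub:
 assumes "f \<in> step_functions" "!!s. s \<notin> J ==> f s = 0"
 shows "coh f \<in> fock_sub J"
proof -
 have "(\<Sum>n<N. (1 / sqrt (fact n)) *\<^sub>R npart n (L2_of f)) \<in> fock_sub J" for N
  by (intro csubspace_sum csubspaceD(4) fock_sub_csubspace npart_fock_sub assms)
 then have "expv (L2_of f) \<in> fock_sub J"
  by (rule closed_sequentially[OF fock_sub_closed _ expv_sums[of "L2_of f", unfolded sums_def]])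
 then show ?thesis unfolding coh_expv by (rule csubspaceD(4)[OF fock_sub_csubspace])
qed

lemma fock_sub_orth:
 fixes w :: "'k::chilbert L2 fock"
 assumes "!!f. f \<in> step_functions ==> (!!s. s \<notin> J ==> f s = 0) ==> \<langle>coh f, w\<rangle> = 0" "\<phi> \<in> fock_sub J"
 shows "\<langle>\<phi>, w\<rangle> = 0"
proof -
 have "\<langle>npart n (L2_of f), w\<rangle> = 0" if f: "f \<in> step_functions" "!!s. s \<notin> J ==> f s = 0" for n f
 proof -
  have "\<langle>w, coh (%s. z *\<^sub>C f s)\<rangle> = 0" for z
  proof -
   have "\<langle>coh (%s. z *\<^sub>C f s), w\<rangle> = 0" by (rule assms(1)[OF step_scale[OF f(1)]]) (simp add: f(2))
   then show ?thesis by (metis cnj_cinner complex_cnj_zero)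
  qed
  then have "\<langle>w, npart n (L2_of f)\<rangle> = 0" by (rule coh_orth_npart[OF _ f(1)])
  then show ?thesis by (metis cnj_cinner complex_cnj_zero)
 qed
 then have "{npart n (L2_of f) | n f. f \<in> step_functions \<and> (\<forall>s. s \<notin> J \<longrightarrow> f s = 0)} \<subseteq> {s. \<langle>s, w\<rangle> = 0}" by blast
 moreover have "csubspace {s. \<langle>s, w\<rangle> = 0}"
  by (auto simp: csubspace_def cinner_add_left cinner_scaleC_left)
 ultimately have "cspan {npart n (L2_of f) | n f. f \<in> step_functions \<and> (\<forall>s. s \<notin> J \<longrightarrow> f s = 0)} \<subseteq> {s. \<langle>s, w\<rangle> = 0}"
  by (intro cspan_minimal)
 moreover have "closed {s. \<langle>s, w\<rangle> = 0}" by (intro closed_Collect_eq continuous_intros)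
 ultimately have "fock_sub J \<subseteq> {s. \<langle>s, w\<rangle> = 0}" unfolding fock_sub_def by (rule closure_minimal)
 then show ?thesis using assms(2) by blast
qed

text \<open>The description denotes the orthogonal projection onto \<open>fock_sub J\<close>: an
  element of the corner vanishes on the complement, so its values on the subspace determine
  it.\<close>

lemma fock_id_props:
 fixes \<phi> \<psi> :: "'k::chilbert L2 fock"
 shows "(fock_id J :: 'k L2 fock => 'k L2 fock) \<in> fock_ops J" "\<psi> \<in> fock_sub J ==> fock_id J \<psi> = \<psi>" "\<phi> \<in> fock_sub J ==> \<langle>\<phi>, fock_id J \<psi>\<rangle> = \<langle>\<phi>, \<psi>\<rangle>"
proof -
 obtain p :: "'k L2 fock => 'k L2 fock" where p: "p \<in> bops" "!!x. p x \<in> fock_sub J" "!!x m. m \<in> fock_sub J ==> \<langle>m, x - p x\<rangle> = 0"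
  using projection_op_exists[OF fock_sub_csubspace fock_sub_closed] by blast
 have pid: "p x = x" if "x \<in> fock_sub J" for x
  using p(3)[OF csubspace_diff[OF fock_sub_csubspace that p(2)], of x x] by (simp add: cinner_self)
 have p_ops: "p \<in> fock_ops J"
  unfolding fock_ops_def
 proof (intro CollectI conjI allI impI)
  fix \<psi> :: "'k L2 fock" assume "\<forall>\<phi>\<in>fock_sub J. \<langle>\<phi>, \<psi>\<rangle> = 0"
  then have "\<langle>p \<psi>, \<psi> - (\<psi> - p \<psi>)\<rangle> = 0" using p(2)[of \<psi>] p(3)[OF p(2)[of \<psi>], of \<psi>] by (simp add: cinner_diff_right)
  then show "p \<psi> = 0" by (simp add: cinner_self)
 qed (use p in auto)
 have "fock_id J = p"
  unfolding fock_id_def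
 proof (rule the_equality)
  show "p \<in> fock_ops J \<and> (\<forall>\<psi>\<in>fock_sub J. p \<psi> = \<psi>)" using p_ops pid by blast
  fix q :: "'k L2 fock => 'k L2 fock" assume q: "q \<in> fock_ops J \<and> (\<forall>\<psi>\<in>fock_sub J. q \<psi> = \<psi>)"
  then have qb: "q \<in> bops" by (simp add: fock_ops_def)
  show "q = p"
  proof
   fix x
   have "q (x - p x) = 0" using q p(3) unfolding fock_ops_def by blast
   then show "q x = p x" using q p(2) by (simp add: bops_diff[OF qb])
  qed
 qed
 then show "(fock_id J :: 'k L2 fock => 'k L2 fock) \<in> fock_ops J" "\<psi> \<in> fock_sub J ==> fock_id J \<psi> = \<psi>" "\<phi> \<in> fock_sub J ==> \<langle>\<phi>, fock_id J \<psi>\<rangle> = \<langle>\<phi>, \<psi>\<rangle>"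
  using p_ops pid p(3)[of \<phi> \<psi>] by (simp_all add: cinner_diff_right)
qed

lemma fock_ops_bops: "z \<in> fock_ops J ==> z \<in> bops"
 by (simp add: fock_ops_def)

lemmas fock_id_bops = fock_ops_bops[OF fock_id_props(1)]

lemma fock_id_range: "fock_id J \<psi> \<in> fock_sub J"
 using fock_id_props(1) unfolding fock_ops_def by blast

lemma adj_fock_id: "adj (fock_id J) = fock_id J"
 by (rule adj_eqI) (metis cnj_cinner fock_id_props(3) fock_id_range)

lemma fock_ops_corner:
 assumes z: "z \<in> fock_ops J"
 shows "fock_id J (z \<psi>) = z \<psi>" "z (fock_id J \<psi>) = z \<psi>"
proof -
 show "fock_id J (z \<psi>) = z \<psi>" by (rule fock_id_props(2)) (use z in \<open>auto simp: fock_ops_def\<close>)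
 have "\<forall>\<phi>\<in>fock_sub J. \<langle>\<phi>, \<psi> - fock_id J \<psi>\<rangle> = 0" by (simp add: cinner_diff_right fock_id_props(3))
 then have "z (\<psi> - fock_id J \<psi>) = 0" using z unfolding fock_ops_def by blast
 then show "z (fock_id J \<psi>) = z \<psi>" by (simp add: bops_diff fock_ops_bops[OF z])
qed

lemma fock_ops_compress:
 fixes z :: "'k::chilbert L2 fock => 'k L2 fock"
 assumes "z \<in> bops"
 shows "(%\<psi>. fock_id J (z (fock_id J \<psi>))) \<in> fock_ops J"
 unfolding fock_ops_def
proof (intro CollectI conjI allI impI)
 show "(%\<psi>. fock_id J (z (fock_id J \<psi>))) \<in> bops"
  by (rule bops_comp[OF fock_id_bops bops_comp[OF assms fock_id_bops]])
 show "range (%\<psi>. fock_id J (z (fock_id J \<psi>))) \<subseteq> fock_sub J" using fock_id_range by blast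
 fix \<psi> :: "'k L2 fock" assume "\<forall>\<phi>\<in>fock_sub J. \<langle>\<phi>, \<psi>\<rangle> = 0"
 then have "fock_id J \<psi> = 0" using fock_id_props(1)[of J] unfolding fock_ops_def by blast
 then show "fock_id J (z (fock_id J \<psi>)) = 0" by (simp add: bops_0 assms fock_id_bops)
qed

lemma fock_ops_shift:
 assumes "z \<in> bops" "0 <= r"
 shows "(%\<psi>. fock_shift r (z (adj (fock_shift r) \<psi>))) \<in> fock_ops {r..}"
 unfolding fock_ops_def
proof (intro CollectI conjI allI impI)
 note T = isometry_bops[OF fock_shift_isometry[OF assms(2)]]
 show "(%\<psi>. fock_shift r (z (adj (fock_shift r) \<psi>))) \<in> bops"
  by (rule bops_comp[OF T bops_comp[OF assms(1) adj_bops[OF T]]])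
 have sub: "fock_shift r \<psi> \<in> fock_sub {r..}" for \<psi> :: "'a L2 fock"
 proof -
  have "\<langle>coh f, adj (fock_shift r) (fock_shift r \<psi> - fock_id {r..} (fock_shift r \<psi>))\<rangle> = \<langle>coh f, 0\<rangle>" if f: "f \<in> step_functions" for f
  proof -
   have m: "coh (rshift r f) \<in> fock_sub {r..}" by (rule coh_fock_sub[OF step_rshift[OF f assms(2)]]) auto
   show ?thesis
    by (simp add: adj_cinner' T fock_shift_coh assms f cinner_diff_right fock_id_props(3)[OF m])
  qed
  then have "adj (fock_shift r) (fock_shift r \<psi> - fock_id {r..} (fock_shift r \<psi>)) = 0"
   by (intro total_ext[OF ctotal_coh]) auto
  then have "\<langle>fock_shift r \<psi>, fock_shift r \<psi> - fock_id {r..} (fock_shift r \<psi>)\<rangle> = 0"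
   by (metis adj_cinner' T cinner_zero_right)
  moreover have "\<langle>fock_id {r..} (fock_shift r \<psi>), fock_shift r \<psi> - fock_id {r..} (fock_shift r \<psi>)\<rangle> = 0"
   by (simp add: cinner_diff_right fock_id_props(3)[OF fock_id_range])
  ultimately have "\<langle>fock_shift r \<psi> - fock_id {r..} (fock_shift r \<psi>), fock_shift r \<psi> - fock_id {r..} (fock_shift r \<psi>)\<rangle> = 0"
   by (simp add: cinner_diff_left)
  then have "fock_shift r \<psi> = fock_id {r..} (fock_shift r \<psi>)" by (simp add: cinner_self)
  then show ?thesis using fock_id_range by metis
 qed
 then show "range (%\<psi>. fock_shift r (z (adj (fock_shift r) \<psi>))) \<subseteq> fock_sub {r..}" by blast
 fix \<psi> :: "'a L2 fock" assume o: "\<forall>\<phi>\<in>fock_sub {r..}. \<langle>\<phi>, \<psi>\<rangle> = 0"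
 have "adj (fock_shift r) \<psi> = 0"
  by (rule cinner_ext) (simp add: adj_cinner' T o sub)
 then show "fock_shift r (z (adj (fock_shift r) \<psi>)) = 0" by (simp add: bops_0 assms T)
qed

section \<open>The cocycle identity of a quantum stochastic flow\<close>

text \<open>The factorisation at \<open>r\<close> with the future left in place. This is the form in
  which \<open>split_tensor\<close> tests operators; \<open>fock_split\<close> in addition moves the
  future to the origin.\<close>

definition fock_cut :: "real => ('a::chilbert, 'k::chilbert L2 fock) tensor => (('a, 'k L2 fock) tensor, 'k L2 fock) tensor" where
 "fock_cut r \<zeta> = ampr (fock_shift r) (fock_split r \<zeta>)"

lemma fock_cut_isometry:
 assumes "0 <= r" shows "isometry (fock_cut r)"
proof -
 have id: "isometry (%x. x)" by (simp add: isometry_def)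
 note i = op_tensor_isometry[OF id fock_shift_isometry[OF assms]] fock_split_isometry[OF assms]
 show ?thesis unfolding isometry_def fock_cut_def
  using bops_comp[OF isometry_bops[OF i(1)] isometry_bops[OF i(2)]]
  by (simp add: isometry_cinner[OF i(1)] isometry_cinner[OF i(2)])
qed

lemma fock_cut_coh:
 assumes "0 <= r" "f \<in> step_functions"
 shows "fock_cut r (u \<otimes> coh f) = (u \<otimes> coh (lo r f)) \<otimes> coh (hi r f)"
proof -
 have "fock_shift r (coh (lshift r f)) = coh (hi r f)"
  using fock_shift_coh[OF assms(1) step_lshift[OF assms(2), of r]] unfolding rshift_lshift[OF assms(1)] .
 then show ?thesis unfolding fock_cut_def
  by (simp add: fock_split_coh assms op_tensor_tensor isometry_bops[OF fock_shift_isometry])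
qed

lemma split_tensor_eq:
 fixes X :: "('h::chilbert, 'k::chilbert L2 fock) tensor => ('h, 'k L2 fock) tensor"
 assumes "Y \<in> bops" "!!u v f g. f \<in> step_functions ==> g \<in> step_functions ==>
  \<langle>u \<otimes> coh f, Y (v \<otimes> coh g)\<rangle> = \<langle>u \<otimes> coh (lo r f), X (v \<otimes> coh (lo r g))\<rangle> *
    \<langle>coh (hi r f), z (coh (hi r g))\<rangle>"
 shows "split_tensor r X z = Y"
 unfolding split_tensor_def
proof (rule the_equality)
 show "Y \<in> bops \<and> (\<forall>u v. \<forall>f\<in>step_functions. \<forall>g\<in>step_functions.
   \<langle>u \<otimes> coh f, Y (v \<otimes> coh g)\<rangle> = \<langle>u \<otimes> coh (lo r f), X (v \<otimes> coh (lo r g))\<rangle> *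
    \<langle>coh (hi r f), z (coh (hi r g))\<rangle>)"
  using assms by blast
 fix Y' assume Y': "Y' \<in> bops \<and> (\<forall>u v. \<forall>f\<in>step_functions. \<forall>g\<in>step_functions.
   \<langle>u \<otimes> coh f, Y' (v \<otimes> coh g)\<rangle> = \<langle>u \<otimes> coh (lo r f), X (v \<otimes> coh (lo r g))\<rangle> *
    \<langle>coh (hi r f), z (coh (hi r g))\<rangle>)"
 show "Y' = Y"
 proof (rule tensor_coh_bops_eq[OF conjunct1[OF Y'] assms(1)])
  fix v and g :: "real => 'k" assume g: "g \<in> step_functions"
  show "Y' (v \<otimes> coh g) = Y (v \<otimes> coh g)"
   by (rule tensor_coh_ext) (use Y' assms(2) g in auto)
 qed
qed

lemma split_tensor_cut:
 fixes X :: "('h::chilbert, 'k::chilbert L2 fock) tensor => ('h, 'k L2 fock) tensor"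
 assumes r: "0 <= r" and X: "X \<in> bops" and z: "z \<in> bops"
 shows "split_tensor r X z = (%\<zeta>. adj (fock_cut r) (op_tensor X z (fock_cut r \<zeta>)))"
proof (rule split_tensor_eq)
 note D = isometry_bops[OF fock_cut_isometry[OF r]]
 show "(%\<zeta>. adj (fock_cut r) (op_tensor X z (fock_cut r \<zeta>))) \<in> bops"
  by (rule bops_comp[OF adj_bops[OF D] bops_comp[OF op_tensor_bops[OF X z] D]])
 fix u v :: 'h and f g :: "real => 'k" assume "f \<in> step_functions" "g \<in> step_functions"
 then show "\<langle>u \<otimes> coh f, adj (fock_cut r) (op_tensor X z (fock_cut r (v \<otimes> coh g)))\<rangle> =
  \<langle>u \<otimes> coh (lo r f), X (v \<otimes> coh (lo r g))\<rangle> * \<langle>coh (hi r f), z (coh (hi r g))\<rangle>"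
  by (simp add: adj_cinner' D fock_cut_coh r op_tensor_tensor X z cinner_tensor)
qed

section \<open>Linear maps on ultraweak tensor products\<close>

lemma op_spanE:
 assumes "T \<in> op_span S"
 obtains n c R where "T = (%x. \<Sum>i<n::nat. c i *\<^sub>C R i x)" "\<forall>i<n. R i \<in> S"
 using assms unfolding op_span_def by (elim CollectE exE conjE)

text \<open>Addition is used only through its continuity in each argument: first one operand is
  taken in the closure and the other in the span, then the second operand is closed up as
  well.\<close>

lemma uw_closure_lincomb:
 fixes S :: "('a::chilbert => 'b::chilbert) set"
 assumes S: "S \<subseteq> bops" and T: "T \<in> uw_topology closure_of op_span S" and R: "R \<in> uw_topology closure_of op_span S"
 shows "(%x. c *\<^sub>C T x + R x) \<in> uw_topology closure_of op_span S"
proof -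
 let ?V = "op_span S" and ?C = "uw_topology closure_of op_span S"
 have cont: "continuous_map uw_topology uw_topology (%T x. c *\<^sub>C T x + R x)" if R: "R \<in> bops" for c and R :: "'a => 'b"
 proof (rule continuous_map_into_uw)
  show "(%x. c *\<^sub>C T x + R x) \<in> bops" if "T \<in> topspace uw_topology" for T :: "'a => 'b"
   using that R by (auto intro: bops_plus bops_cscale)
  fix \<xi> :: "nat => 'b" and \<eta> :: "nat => 'a" assume ss: "square_summable \<xi>" "square_summable \<eta>"
  show "continuous_map uw_topology euclidean (%T. uwf \<xi> \<eta> (%x. c *\<^sub>C T x + R x))"
  proof (rule continuous_map_eq)
   show "continuous_map uw_topology euclidean (%T. c * uwf \<xi> \<eta> T + uwf \<xi> \<eta> R)"
    using continuous_map_compose[OF continuous_map_uwf[OF ss], of euclidean "%z. c * z + uwf \<xi> \<eta> R"]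
    by (simp add: o_def continuous_intros)
  qed (simp add: uwf_lincomb ss R)
 qed
 have span: "(%x. c *\<^sub>C T x + R x) \<in> ?V" if TV: "T \<in> ?V" and RV: "R \<in> ?V" for c T R
 proof -
  obtain n d T' where T: "T = (%x. \<Sum>i<n::nat. d i *\<^sub>C T' i x)" "\<forall>i<n. T' i \<in> S" by (rule op_spanE[OF TV])
  obtain m e R' where R: "R = (%x. \<Sum>i<m::nat. e i *\<^sub>C R' i x)" "\<forall>i<m. R' i \<in> S" by (rule op_spanE[OF RV])
  define f where "f i = (if i < n then c * d i else e (i - n))" for i
  define Q where "Q i = (if i < n then T' i else R' (i - n))" for i
  have "(\<Sum>i<n + m. f i *\<^sub>C Q i x) = (\<Sum>i<n. f i *\<^sub>C Q i x) + (\<Sum>i<m. f (n + i) *\<^sub>C Q (n + i) x)" for x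
   by (induction m) (simp_all add: add.assoc)
  also have "\<dots> x = c *\<^sub>C T x + R x" for x
   by (simp add: f_def Q_def T R scaleC_sum_right scaleC_scaleC)
  finally have eq: "(%x. c *\<^sub>C T x + R x) = (%x. \<Sum>i<n + m. f i *\<^sub>C Q i x)" by (intro ext) simp
  have "\<forall>i<n + m. Q i \<in> S" using T R by (auto simp: Q_def)
  then show ?thesis unfolding eq op_span_def
   by (intro CollectI exI[of _ "n + m"] exI[of _ f] exI[of _ Q] conjI refl)
 qed
 have bT: "T \<in> bops" by (rule uw_closure_bops[OF T])
 have 1: "(%x. c *\<^sub>C T x + R' x) \<in> ?C" if R': "R' \<in> ?V" for R'
 proof -
  have "R' \<in> bops" using R' op_span_bops[OF S] by blast
  note c = continuous_map_image_closure_subset[OF cont[OF this, of c], of ?V]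
  have "(%T x. c *\<^sub>C T x + R' x) ` ?V \<subseteq> ?V" using span[OF _ R'] by (intro image_subsetI)
  note sub = subset_trans[OF c closure_of_mono[OF this]]
  show ?thesis by (rule subsetD[OF sub imageI[OF T]])
 qed
 have eq: "(%x. 1 *\<^sub>C R x + c *\<^sub>C T x) = (%x. c *\<^sub>C T x + R x)" for R by (simp add: add.commute)
 note c = continuous_map_image_closure_subset[OF cont[OF bops_cscale[OF bT, of c], of 1], of ?V]
 have "(%R x. 1 *\<^sub>C R x + c *\<^sub>C T x) ` ?V \<subseteq> ?C" unfolding eq using 1 by (intro image_subsetI)
 note sub = subset_trans[OF c closure_of_mono[OF this]]
 have "(%x. 1 *\<^sub>C R x + c *\<^sub>C T x) \<in> uw_topology closure_of ?C" by (rule subsetD[OF sub imageI[OF R]])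
 then show ?thesis unfolding eq by simp
qed

lemma uw_closure_sum:
 assumes "S \<subseteq> bops" "\<forall>i<n::nat. T i \<in> uw_topology closure_of op_span S"
 shows "(%x. \<Sum>i<n. c i *\<^sub>C T i x) \<in> uw_topology closure_of op_span S"
 using assms(2)
proof (induction n)
 case 0
 have "(%x. 0) \<in> op_span S" unfolding op_span_def by (intro CollectI exI[of _ "0::nat"]) auto
 then show ?case using closure_of_subset[of "op_span S" uw_topology] op_span_bops[OF assms(1)] by auto
next
 case (Suc n)
 then have IH: "(%x. \<Sum>i<n. c i *\<^sub>C T i x) \<in> uw_topology closure_of op_span S"
  and Tn: "T n \<in> uw_topology closure_of op_span S" by simp_all
 have eq: "(%x. \<Sum>i<Suc n. c i *\<^sub>C T i x) = (%x. c n *\<^sub>C T n x + (\<Sum>i<n. c i *\<^sub>C T i x))"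
  by (simp add: add.commute)
 show ?case unfolding eq by (rule uw_closure_lincomb[OF assms(1) Tn IH])
qed

context von_neumann
begin

lemma uw_tensor_generators: "M \<subseteq> bops ==> {op_tensor a z | a z. a \<in> A \<and> z \<in> M} \<subseteq> bops"
 by (auto intro!: op_tensor_bops A_bops)

lemma op_tensor_uw_tensor:
 assumes "a \<in> A" "z \<in> M" "M \<subseteq> bops" shows "op_tensor a z \<in> uw_tensor A M"
 unfolding uw_tensor_def
 by (rule subsetD[OF closure_of_subset]; (rule subsetD[OF op_span_superset])?)
   (use assms op_span_bops[OF uw_tensor_generators[OF assms(3)]] in auto)

text \<open>Elementary tensors are mapped correctly by assumption, their span by linearity and the
  closure by continuity.\<close>

lemma uw_tensor_map:
 fixes M :: "('f::chilbert => 'f) set" and M' :: "('g::chilbert => 'g) set"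
 assumes T: "T \<in> uw_tensor A M" and cont: "continuous_map uw_topology uw_topology \<Phi>"
  and lin: "!!(n::nat) c S. \<forall>i<n. S i \<in> bops ==> \<Phi> (%x. \<Sum>i<n. c i *\<^sub>C S i x) = (%x. \<Sum>i<n. c i *\<^sub>C \<Phi> (S i) x)"
  and gen: "!!a z. a \<in> A ==> z \<in> M ==> \<Phi> (op_tensor a z) \<in> uw_tensor A M'"
  and M: "M \<subseteq> bops" "M' \<subseteq> bops"
 shows "\<Phi> T \<in> uw_tensor A M'"
proof -
 have "\<Phi> ` op_span {op_tensor a z | a z. a \<in> A \<and> z \<in> M} \<subseteq> uw_tensor A M'"
 proof (rule image_subsetI)
  fix R assume "R \<in> op_span {op_tensor a z | a z. a \<in> A \<and> z \<in> M}"
  then obtain n c S where R: "R = (%x. \<Sum>i<n::nat. c i *\<^sub>C S i x)" "\<forall>i<n. S i \<in> {op_tensor a z | a z. a \<in> A \<and> z \<in> M}"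
   unfolding op_span_def by blast
  have S: "S i \<in> bops \<and> \<Phi> (S i) \<in> uw_tensor A M'" if "i < n" for i
  proof -
   have "S i \<in> {op_tensor a z | a z. a \<in> A \<and> z \<in> M}" using R(2) that by blast
   then show ?thesis
   proof (elim CollectE exE conjE)
    fix a z assume az: "S i = op_tensor a z" "a \<in> A" "z \<in> M"
    have "z \<in> bops" using az(3) M(1) by blast
    then show ?thesis using gen[OF az(2,3)] op_tensor_bops[OF A_bops[OF az(2)], of z] by (simp add: az(1))
   qed
  qed
  then have "\<Phi> R = (%x. \<Sum>i<n. c i *\<^sub>C \<Phi> (S i) x)" unfolding R(1) by (intro lin) simp
  also have "\<dots> \<in> uw_tensor A M'" unfolding uw_tensor_def
   by (rule uw_closure_sum[OF uw_tensor_generators[OF M(2)]]) (use S in \<open>simp add: uw_tensor_def\<close>)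
  finally show "\<Phi> R \<in> uw_tensor A M'" .
 qed
 note sub = closure_of_mono[OF this, of uw_topology]
 have "\<Phi> T \<in> \<Phi> ` (uw_topology closure_of op_span {op_tensor a z | a z. a \<in> A \<and> z \<in> M})"
  using T unfolding uw_tensor_def by (rule imageI)
 from subsetD[OF sub subsetD[OF continuous_map_image_closure_subset[OF cont] this]]
 show ?thesis unfolding uw_tensor_def by simp
qed

lemma uw_tensor_conj:
 fixes M :: "('f::chilbert => 'f) set" and M' :: "('g::chilbert => 'g) set"
 assumes T: "T \<in> uw_tensor A M" and Z: "Z \<in> bops" and M: "M \<subseteq> bops" "M' \<subseteq> bops"
  and gen: "!!z. z \<in> M ==> (%\<psi>. Z (z (adj Z \<psi>))) \<in> M'"
 shows "(%\<zeta>. ampr Z (T (adj (ampr Z) \<zeta>))) \<in> uw_tensor A M'"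
proof (rule uw_tensor_map[OF T])
 note b = op_tensor_bops[OF bops_id Z]
 show "continuous_map uw_topology uw_topology (%T \<zeta>. ampr Z (T (adj (ampr Z) \<zeta>)))"
  by (rule normal_conj[OF b adj_bops[OF b]])
 show "(%\<zeta>. ampr Z (op_tensor a z (adj (ampr Z) \<zeta>))) \<in> uw_tensor A M'"
  if "a \<in> A" "z \<in> M" for a z
 proof -
  have zb: "z \<in> bops" using that M by blast
  have "(%\<zeta>. ampr Z (op_tensor a z (adj (ampr Z) \<zeta>))) = op_tensor a (%\<psi>. Z (z (adj Z \<psi>)))"
   by (rule ext) (simp add: op_tensor_adj op_tensor_comp Z zb A_bops that adj_bops bops_comp)
  then show ?thesis using op_tensor_uw_tensor[OF that(1) gen[OF that(2)] M(2)] by simp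
 qed
qed (use M in \<open>auto simp: bops_sum[OF op_tensor_bops[OF bops_id Z]] bops_scaleC[OF op_tensor_bops[OF bops_id Z]]\<close>)

end

text \<open>Projecting to the past replaces the future of the exponential vector by the vacuum, at
  the price of their overlap. Both sides lie in the subspace and have the same inner products with
  the exponential vectors supported in \<open>[0, r)\<close>.\<close>

lemma fock_id_coh:
 fixes f :: "real => 'k::chilbert"
 assumes f: "f \<in> step_functions" and r: "0 <= r"
 shows "fock_id {0..<r} (coh f) = \<langle>vacuum, coh (lshift r f)\<rangle> *\<^sub>C coh (lo r f)"
proof -
 let ?p = "fock_id {0..<r} (coh f)" and ?q = "\<langle>vacuum, coh (lshift r f)\<rangle> *\<^sub>C coh (lo r f)"
 have q: "?q \<in> fock_sub {0..<r}"
  by (rule csubspaceD(3)[OF fock_sub_csubspace], rule coh_fock_sub[OF step_restr_below[OF f]]) (auto simp: restr_def)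
 have orth: "\<langle>\<phi>, ?p - ?q\<rangle> = 0" if "\<phi> \<in> fock_sub {0..<r}" for \<phi>
 proof (rule fock_sub_orth[OF _ that])
  fix h :: "real => 'k" assume h: "h \<in> step_functions" "!!s. s \<notin> {0..<r} ==> h s = 0"
  have h1: "lo r h = h" using h(2) by (auto simp: restr_def)
  have h2: "lshift r h = (%_. 0)" using h(2) by auto
  have "\<langle>coh h, ?p\<rangle> = \<langle>coh h, coh f\<rangle>" by (rule fock_id_props(3)[OF coh_fock_sub[OF h]])
  also have "\<dots> = \<langle>coh h, ?q\<rangle>"
   using cinner_coh_split[OF h(1) f r] unfolding h1 h2 by (simp add: cinner_scaleC_right mult.commute)
  finally show "\<langle>coh h, ?p - ?q\<rangle> = 0" by (simp add: cinner_diff_right)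
 qed
 have "?p - ?q \<in> fock_sub {0..<r}"
  by (rule csubspace_diff[OF fock_sub_csubspace fock_id_range q])
 from orth[OF this] have "?p - ?q = 0" by (simp add: cinner_self)
 then show ?thesis by simp
qed

lemma fock_ops_subset: "fock_ops J \<subseteq> bops" using fock_ops_bops by blast

section \<open>Adaptedness and the ampliation in the cocycle identity\<close>

locale flow = von_neumann A for A :: "('h::chilbert => 'h) set" +
 fixes j :: "('h, 'k::chilbert) map_process"
 assumes flow: "qs_flow A j"
begin

lemma j_normal: "0 <= t ==> normal_map A (uw_tensor A bops) (j t)"
 and j_process: "a \<in> A ==> op_process (%t. j t a)"
 and j_0: "a \<in> A ==> j 0 a = amp a"
 and j_k_hat: "0 <= r ==> 0 <= t ==> a \<in> A ==> j (r + t) a = k_hat A j r (shift_endo r (j t a))"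
 and j_continuous: "a \<in> A ==> continuous_map (top_of_set {0..}) uw_topology (%t. j t a)"
 using flow unfolding qs_flow_def qs_cocycle_def normal_cb_process_def process_on_def process_in_def
  pointwise_uw_continuous_def by auto

lemma j_in_uw_tensor:
 assumes "0 <= t" "a \<in> A" shows "j t a \<in> uw_tensor A bops"
proof -
 have c: "continuous_map (subtopology uw_topology A) (subtopology uw_topology (uw_tensor A bops)) (j t)"
  using j_normal[OF assms(1)] by (simp add: normal_map_def)
 have "a \<in> topspace (subtopology uw_topology A)" using assms(2) A_bops by auto
 with continuous_map_image_subset_topspace[OF c] show ?thesis by auto
qed

lemma j_bops: "0 <= t ==> a \<in> A ==> j t a \<in> bops"
 by (rule uw_tensor_bops[OF j_in_uw_tensor])

lemma j_rep:
 assumes t: "0 <= t" shows "normal_rep A (j t)"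
proof (intro normal_rep.intro normal_rep_axioms.intro)
 show "von_neumann A" by (rule von_neumann_axioms)
 show "j t a \<in> bops" if "a \<in> A" for a by (rule j_bops[OF t that])
 have nm: "clinear_on A (j t)" "continuous_map (subtopology uw_topology A) (subtopology uw_topology (uw_tensor A bops)) (j t)"
  using j_normal[OF t] by (simp_all add: normal_map_def)
 then show "clinear_on A (j t)" "continuous_map (subtopology uw_topology A) uw_topology (j t)"
  by (simp_all add: continuous_map_in_subtopology)
qed (use flow t in \<open>auto simp: qs_flow_def\<close>)

definition iso :: "real => ('h, 'k L2 fock) tensor =>
  ('h, (((nat \<times> ((nat => 'h) \<times> (nat => 'h)) \<times> bool) \<times> nat) \<times> ('h, 'k L2 fock) tensor) ell2) tensor" where
 "iso t = (SOME U. isometry U \<and> (\<forall>a\<in>A. \<forall>x. U (j t a x) = amp a (U x)))"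

lemma rep:
 assumes "0 <= t" shows "amplified_rep A (j t) (iso t)"
proof -
 interpret normal_rep A "j t" by (rule j_rep[OF assms])
 have "isometry (iso t) \<and> (\<forall>a\<in>A. \<forall>x. iso t (j t a x) = amp a (iso t x))"
  unfolding iso_def by (rule someI_ex[OF intertwining_isometry])
 then show ?thesis by unfold_locales auto
qed

abbreviation jhat :: "real => (('h, 'f::chilbert) tensor => ('h, 'f) tensor) =>
  (('h, 'k L2 fock) tensor, 'f) tensor => (('h, 'k L2 fock) tensor, 'f) tensor" where
 "jhat t \<equiv> amplified_rep.Jhat (iso t)"

abbreviation jcol :: "real => ('h => ('h, 'f::chilbert) tensor) =>
  ('h, 'k L2 fock) tensor => (('h, 'k L2 fock) tensor, 'f) tensor" where
 "jcol t \<equiv> amplified_rep.colhat (iso t)"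

lemma j_adapted:
 fixes f g :: "real => 'k"
 assumes t: "0 <= t" and a: "a \<in> A" and f: "f \<in> step_functions" "g \<in> step_functions"
 shows "\<langle>u \<otimes> coh f, j t a (v \<otimes> coh g)\<rangle> = \<langle>coh (hi t f), coh (hi t g)\<rangle> *
  \<langle>u \<otimes> coh (lo t f), j t a (v \<otimes> coh (lo t g))\<rangle>"
proof -
 have sl: "\<langle>u, slice \<psi> T \<phi> v\<rangle> = \<langle>u \<otimes> \<psi>, T (v \<otimes> \<phi>)\<rangle>" for \<psi> \<phi> :: "'k L2 fock" and T :: "('h, 'k L2 fock) tensor => _"
  by (simp add: slice_def cinner_E_bra) (simp add: E_ket_def)
 have "slice (coh f) (j t a) (coh g) = (%u. \<langle>coh (hi t f), coh (hi t g)\<rangle> *\<^sub>C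
      slice (coh (lo t f)) (j t a) (coh (lo t g)) u)"
  using j_process[OF a] t f unfolding op_process_def by blast
 from fun_cong[OF this, of v] have "\<langle>u, slice (coh f) (j t a) (coh g) v\<rangle> = \<langle>u, \<langle>coh (hi t f), coh (hi t g)\<rangle> *\<^sub>C
      slice (coh (lo t f)) (j t a) (coh (lo t g)) v\<rangle>" by simp
 then show ?thesis by (simp only: sl cinner_scaleC_right)
qed

lemma corner_uw_tensor:
 fixes X :: "('h, 'k L2 fock) tensor => ('h, 'k L2 fock) tensor"
 assumes X: "X \<in> uw_tensor A (fock_ops J)"
 shows "\<langle>u \<otimes> \<phi>, X (v \<otimes> \<psi>)\<rangle> = \<langle>u \<otimes> fock_id J \<phi>, X (v \<otimes> fock_id J \<psi>)\<rangle>"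
proof (rule uw_span_closure_cinner_eq[OF X[unfolded uw_tensor_def]], elim CollectE exE conjE, hypsubst)
 fix S a and z :: "'k L2 fock => 'k L2 fock" assume az: "a \<in> A" "z \<in> fock_ops J"
 have p: "fock_id J \<in> bops" by (rule fock_ops_bops[OF fock_id_props(1)])
 have "\<langle>fock_id J \<phi>, z \<psi>\<rangle> = \<langle>\<phi>, z \<psi>\<rangle>"
  using adj_cinner[OF p, of \<phi> "z \<psi>"] by (simp add: adj_fock_id fock_ops_corner[OF az(2)])
 then show "\<langle>u \<otimes> \<phi>, op_tensor a z (v \<otimes> \<psi>)\<rangle> = \<langle>u \<otimes> fock_id J \<phi>, op_tensor a z (v \<otimes> fock_id J \<psi>)\<rangle>"
  by (simp add: op_tensor_tensor[OF A_bops[OF az(1)] fock_ops_bops[OF az(2)]] cinner_tensor fock_ops_corner[OF az(2)])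
qed

lemma cut_matrix:
 fixes X :: "('h, 'k L2 fock) tensor => ('h, 'k L2 fock) tensor"
 assumes r: "0 <= r" and X: "X \<in> bops" and z: "z \<in> bops" and f: "f \<in> step_functions" "g \<in> step_functions"
 shows "\<langle>u \<otimes> coh f, adj (fock_cut r) (op_tensor X z (fock_cut r (v \<otimes> coh g)))\<rangle> =
  \<langle>u \<otimes> coh (lo r f), X (v \<otimes> coh (lo r g))\<rangle> * \<langle>coh (hi r f), z (coh (hi r g))\<rangle>"
 by (simp add: adj_cinner'[OF isometry_bops[OF fock_cut_isometry[OF r]]] fock_cut_coh[OF r] f op_tensor_tensor[OF X z] cinner_tensor)

text \<open>The witness is the compression of \<open>j r a\<close> to the Fock space of the past.
  For uniqueness, testing the future in the vacuum, which \<open>fock_id {r..}\<close> fixes,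
  recovers the matrix elements between past exponential vectors from \<open>j r a\<close>; an
  operator of the corner is determined by these.\<close>

lemma k_low_props:
 assumes r: "0 <= r" and a: "a \<in> A"
 shows "k_low A j r a \<in> uw_tensor A (fock_ops {0..<r}) \<and> split_tensor r (k_low A j r a) (fock_id {r..}) = j r a"
proof -
 let ?p = "fock_id {0..<r} :: 'k L2 fock => 'k L2 fock" and ?q = "fock_id {r..} :: 'k L2 fock => 'k L2 fock"
 have p: "?p \<in> bops" "?q \<in> bops" by (rule fock_ops_bops[OF fock_id_props(1)])+
 define X where "X = (%\<zeta>. ampr ?p (j r a (ampr ?p \<zeta>)))"
 have Pb: "op_tensor (%x::'h. x) ?p \<in> bops" by (rule op_tensor_bops[OF bops_id p(1)])
 have adjp: "adj (op_tensor (%x::'h. x) ?p) = ampr ?p"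
  by (simp add: op_tensor_adj p adj_fock_id)
 have low: "lo r (lo r f) = lo r f" "hi r (lo r f) = (%_. 0)" for f :: "real => 'k"
  by (auto simp: restr_def)
 have coh_q: "?q (coh (hi r g)) = coh (hi r g)" if "g \<in> step_functions" for g
  by (rule fock_id_props(2)[OF coh_fock_sub[OF step_restr_above[OF that r]]]) (simp add: restr_def)
 have coh_p: "?p (coh (lo r g)) = coh (lo r g)" if "g \<in> step_functions" for g
  by (rule fock_id_props(2)[OF coh_fock_sub[OF step_restr_below[OF that]]]) (auto simp: restr_def)
 have XA: "X \<in> uw_tensor A (fock_ops {0..<r})"
  using uw_tensor_conj[OF j_in_uw_tensor[OF r a] p(1) subset_refl fock_ops_subset[of "{0..<r}"]]
  unfolding X_def adjp adj_fock_id using fock_ops_compress by blast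
 have Xb: "X \<in> bops" by (rule uw_tensor_bops[OF XA])
 have Xm: "\<langle>u \<otimes> coh (lo r f), X (v \<otimes> coh (lo r g))\<rangle> = \<langle>u \<otimes> coh (lo r f), j r a (v \<otimes> coh (lo r g))\<rangle>"
  if f: "f \<in> step_functions" "g \<in> step_functions" for f g u v
 proof -
  have "\<langle>u \<otimes> coh (lo r f), X (v \<otimes> coh (lo r g))\<rangle> =
   \<langle>ampr ?p (u \<otimes> coh (lo r f)), j r a (ampr ?p (v \<otimes> coh (lo r g)))\<rangle>"
   unfolding X_def by (rule adj_cinner[OF Pb, unfolded adjp, symmetric])
  then show ?thesis by (simp add: op_tensor_tensor p coh_p f)
 qed
 have Xs: "split_tensor r X ?q = j r a"
  by (rule split_tensor_eq[OF j_bops[OF r a]]) (simp add: j_adapted[OF r a] Xm coh_q)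
 have uniq: "X' = X" if X': "X' \<in> uw_tensor A (fock_ops {0..<r})" "split_tensor r X' ?q = j r a" for X'
 proof -
  have X'b: "X' \<in> bops" by (rule uw_tensor_bops[OF X'(1)])
  have m: "\<langle>u \<otimes> coh (lo r f), X' (v \<otimes> coh (lo r g))\<rangle> = \<langle>u \<otimes> coh (lo r f), X (v \<otimes> coh (lo r g))\<rangle>"
   if f: "f \<in> step_functions" "g \<in> step_functions" for f g u v
  proof -
   have "\<langle>u \<otimes> coh (lo r f), X' (v \<otimes> coh (lo r g))\<rangle> * \<langle>vacuum :: 'k L2 fock, ?q vacuum\<rangle> = \<langle>u \<otimes> coh (lo r f), j r a (v \<otimes> coh (lo r g))\<rangle>"
    using cut_matrix[OF r X'b p(2) step_restr_below[OF f(1)] step_restr_below[OF f(2)], of u r v r]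
    unfolding fun_cong[OF split_tensor_cut[OF r X'b p(2)], symmetric] X'(2) low by simp
   moreover have "?q vacuum = vacuum" using coh_q[OF step_zero] by (simp add: restr_def)
   ultimately show ?thesis using Xm[OF f] by simp
  qed
  have "\<langle>u \<otimes> coh f, X' (v \<otimes> coh g)\<rangle> = \<langle>u \<otimes> coh f, X (v \<otimes> coh g)\<rangle>"
   if f: "f \<in> step_functions" "g \<in> step_functions" for f g u v
   unfolding corner_uw_tensor[OF X'(1), of u "coh f"] corner_uw_tensor[OF XA, of u "coh f"]
   by (simp add: fock_id_coh f r tensor_scaleC_right cinner_scaleC_left cinner_scaleC_right bops_scaleC X'b Xb m[OF f])
  then show "X' = X" by (intro tensor_coh_bops_eq X'b Xb tensor_coh_ext)
 qed
 show ?thesis unfolding k_low_def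
 proof (rule theI[of _ X])
  show "X \<in> uw_tensor A (fock_ops {0..<r}) \<and> split_tensor r X ?q = j r a" using XA Xs ..
 qed (elim conjE, rule uniq)
qed

text \<open>In \<open>split_tensor\<close> the first operator is only seen by exponential vectors
  cut at \<open>r\<close>, where \<open>k_low\<close> and \<open>j r a\<close> have the same matrix
  elements.\<close>

lemma k_low_split:
 assumes r: "0 <= r" and a: "a \<in> A" and z: "z \<in> fock_ops {r..}"
 shows "split_tensor r (k_low A j r a) z = (%\<zeta>. adj (fock_cut r) (op_tensor (j r a) z (fock_cut r \<zeta>)))"
proof (rule split_tensor_eq)
 note zb = fock_ops_bops[OF z] and qb = fock_ops_bops[OF fock_id_props(1), of "{r..}"]
 note cb = isometry_bops[OF fock_cut_isometry[OF r]]
 show "(%\<zeta>. adj (fock_cut r) (op_tensor (j r a) z (fock_cut r \<zeta>))) \<in> bops"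
  by (rule bops_comp[OF adj_bops[OF cb] bops_comp[OF op_tensor_bops[OF j_bops[OF r a] zb] cb]])
 note kl = k_low_props[OF r a]
 have Xb: "k_low A j r a \<in> bops" by (rule uw_tensor_bops[OF conjunct1[OF kl]])
 fix u v and f g :: "real => 'k" assume f: "f \<in> step_functions" "g \<in> step_functions"
 have low: "lo r (lo r f) = lo r f" "hi r (lo r f) = (%_. 0)" for f :: "real => 'k"
  by (auto simp: restr_def)
 have "fock_id {r..} vacuum = (vacuum :: 'k L2 fock)" by (rule fock_id_props(2)[OF coh_fock_sub[OF step_zero]]) simp
 then have "\<langle>u \<otimes> coh (lo r f), j r a (v \<otimes> coh (lo r g))\<rangle> = \<langle>u \<otimes> coh (lo r f), k_low A j r a (v \<otimes> coh (lo r g))\<rangle>"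
  using cut_matrix[OF r Xb qb step_restr_below[OF f(1)] step_restr_below[OF f(2)], of u r v r]
  unfolding fun_cong[OF split_tensor_cut[OF r Xb qb], symmetric] conjunct2[OF kl] low by simp
 then show "\<langle>u \<otimes> coh f, adj (fock_cut r) (op_tensor (j r a) z (fock_cut r (v \<otimes> coh g)))\<rangle> =
   \<langle>u \<otimes> coh (lo r f), k_low A j r a (v \<otimes> coh (lo r g))\<rangle> * \<langle>coh (hi r f), z (coh (hi r g))\<rangle>"
  unfolding cut_matrix[OF r j_bops[OF r a] zb f] by simp
qed

text \<open>This places the values of the ampliation in the tensor product with \<open>A\<close>; by
  normality it suffices to treat elementary tensors \<open>a \<otimes> y\<close>.\<close>

lemma cut_uw_tensor:
 fixes z :: "'k L2 fock => 'k L2 fock"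
 assumes r: "0 <= r" and X: "X \<in> uw_tensor A bops" and z: "z \<in> bops"
 shows "(%\<zeta>. adj (fock_cut r) (op_tensor X z (fock_cut r \<zeta>))) \<in> uw_tensor A bops"
proof (rule uw_tensor_map[OF X])
 have cb: "fock_cut r \<in> bops" by (rule isometry_bops[OF fock_cut_isometry[OF r]])
 note ab = adj_bops[OF cb]
 show cont: "continuous_map uw_topology uw_topology (%X \<zeta>. adj (fock_cut r) (op_tensor X z (fock_cut r \<zeta>)))"
  by (rule normal_tensor_right[OF ab cb z])
 show "(%\<zeta>. adj (fock_cut r) (op_tensor (%x. \<Sum>i<n. c i *\<^sub>C S i x) z (fock_cut r \<zeta>))) =
   (%x. \<Sum>i<n. c i *\<^sub>C adj (fock_cut r) (op_tensor (S i) z (fock_cut r x)))"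
  if "\<forall>i<n. S i \<in> bops" for n :: nat and c and S :: "nat => ('h, 'k L2 fock) tensor => ('h, 'k L2 fock) tensor"
 proof
  fix \<zeta>
  have b: "(%x. \<Sum>i<n. c i *\<^sub>C S i x) \<in> bops" using that by (intro bops_sum_op bops_cscale) auto
  have "op_tensor (%x. \<Sum>i<n. c i *\<^sub>C S i x) z = (%\<zeta>. \<Sum>i<n. c i *\<^sub>C op_tensor (S i) z \<zeta>)"
   using that
  proof (induction n)
   case 0 then show ?case by (intro op_tensor_unique) auto
  next
   case (Suc n)
   have b: "(%x. \<Sum>i<n. c i *\<^sub>C S i x) \<in> bops" using Suc.prems by (intro bops_sum_op bops_cscale) auto
   have e: "(%x. \<Sum>i<Suc n. c i *\<^sub>C S i x) = (%x. c n *\<^sub>C S n x + (\<Sum>i<n. c i *\<^sub>C S i x))"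
    by (simp add: add.commute)
   have "S n \<in> bops" using Suc.prems by simp
   from op_tensor_lincomb_left[OF this b z, of "c n"] show ?case unfolding e
    using Suc by (simp add: add.commute)
  qed
  then show "adj (fock_cut r) (op_tensor (%x. \<Sum>i<n. c i *\<^sub>C S i x) z (fock_cut r \<zeta>)) = (\<Sum>i<n. c i *\<^sub>C adj (fock_cut r) (op_tensor (S i) z (fock_cut r \<zeta>)))"
   by (simp add: bops_sum[OF ab] bops_scaleC[OF ab])
 qed
 fix a and y :: "'k L2 fock => 'k L2 fock" assume a: "a \<in> A" and y: "y \<in> bops"
 \<comment> \<open>With \<complex> as initial space, cutting produces the Fock space operator that
   acts as \<open>y\<close> on the past and as \<open>z\<close> on the future.\<close>
 let ?c = "fock_cut r :: (complex, 'k L2 fock) tensor => _"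
 have ccb: "?c \<in> bops" by (rule isometry_bops[OF fock_cut_isometry[OF r]])
 have lb: "(%\<psi>::'k L2 fock. (1::complex) \<otimes> \<psi>) \<in> bops" by (rule tensor_left_bops)
 define w where "w = (%\<psi>. adj (%\<psi>. (1::complex) \<otimes> \<psi>) (adj ?c (op_tensor (ampr y) z (?c (1 \<otimes> \<psi>)))))"
 have wb: "w \<in> bops" unfolding w_def
  by (rule bops_comp[OF adj_bops[OF lb] bops_comp[OF adj_bops[OF ccb] bops_comp[OF op_tensor_bops[OF op_tensor_bops[OF bops_id y] z] bops_comp[OF ccb lb]]]])
 have w: "\<langle>coh f, w (coh g)\<rangle> = \<langle>coh (lo r f), y (coh (lo r g))\<rangle> * \<langle>coh (hi r f), z (coh (hi r g))\<rangle>"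
  if f: "f \<in> step_functions" "g \<in> step_functions" for f g
  unfolding w_def by (simp add: adj_cinner'[OF lb] adj_cinner'[OF ccb] fock_cut_coh[OF r] f
    op_tensor_tensor[OF op_tensor_bops[OF bops_id y] z] op_tensor_tensor y cinner_tensor) (simp add: cinner_complex_def)
 have "(%\<zeta>. adj (fock_cut r) (op_tensor (op_tensor a y) z (fock_cut r \<zeta>))) = op_tensor a w"
 proof (rule tensor_coh_bops_eq)
  show "(%\<zeta>. adj (fock_cut r) (op_tensor (op_tensor a y) z (fock_cut r \<zeta>))) \<in> bops"
   by (rule bops_comp[OF ab bops_comp[OF op_tensor_bops[OF op_tensor_bops[OF A_bops[OF a] y] z] cb]])
  show "op_tensor a w \<in> bops" by (rule op_tensor_bops[OF A_bops[OF a] wb])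
  fix v g assume g: "g \<in> (step_functions :: (real => 'k) set)"
  show "adj (fock_cut r) (op_tensor (op_tensor a y) z (fock_cut r (v \<otimes> coh g))) = op_tensor a w (v \<otimes> coh g)"
  proof (rule tensor_coh_ext)
   fix u f assume f: "f \<in> (step_functions :: (real => 'k) set)"
   show "\<langle>u \<otimes> coh f, adj (fock_cut r) (op_tensor (op_tensor a y) z (fock_cut r (v \<otimes> coh g)))\<rangle> = \<langle>u \<otimes> coh f, op_tensor a w (v \<otimes> coh g)\<rangle>"
    unfolding cut_matrix[OF r op_tensor_bops[OF A_bops[OF a] y] z f g] op_tensor_tensor[OF A_bops[OF a] y]
     op_tensor_tensor[OF A_bops[OF a] wb] cinner_tensor w[OF f g] by simp
  qed
 qed
 then show "(%\<zeta>. adj (fock_cut r) (op_tensor (op_tensor a y) z (fock_cut r \<zeta>))) \<in> uw_tensor A bops"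
  using op_tensor_uw_tensor[OF a wb subset_refl] by simp
qed simp_all

text \<open>The choice in \<open>k_hat\<close> is resolved in two steps: the cut of
  \<open>jhat\<close> satisfies the specification, and two normal linear maps that agree on
  elementary tensors agree on the ultraweak closure of their span.\<close>

lemma k_hat_jhat:
 assumes r: "0 <= r" and T: "T \<in> uw_tensor A (fock_ops {r..})"
 shows "k_hat A j r T = (%\<zeta>. adj (fock_cut r) (jhat r T (fock_cut r \<zeta>)))"
proof -
 interpret R: amplified_rep A "j r" "iso r" by (rule rep[OF r])
 let ?M = "uw_tensor A (fock_ops {r..}) :: (('h, 'k L2 fock) tensor => ('h, 'k L2 fock) tensor) set"
 let ?G = "{op_tensor a z | a (z::'k L2 fock => _). a \<in> A \<and> z \<in> fock_ops {r..}}"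
 have G: "?G \<subseteq> bops" by (rule uw_tensor_generators[OF fock_ops_subset])
 have cb: "fock_cut r \<in> bops" by (rule isometry_bops[OF fock_cut_isometry[OF r]])
 note ab = adj_bops[OF cb]
 define K0 where "K0 T = (%\<zeta>. adj (fock_cut r) (jhat r T (fock_cut r \<zeta>)))" for T :: "('h, 'k L2 fock) tensor => ('h, 'k L2 fock) tensor"
 have lin: "K0 (%x. c *\<^sub>C S x + S' x) = (%x. c *\<^sub>C K0 S x + K0 S' x)" if "S \<in> bops" "S' \<in> bops" for c S S'
  unfolding K0_def R.Jhat_lincomb[OF that] by (simp add: bops_add[OF ab] bops_scaleC[OF ab])
 have K00: "K0 (%_. 0) = (%_. 0)" using lin[of "%_. 0" "%_. 0" 1] by (simp add: fun_eq_iff)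
 have cont: "continuous_map uw_topology uw_topology K0"
  using continuous_map_compose[OF R.Jhat_normal normal_conj[OF ab cb]] by (simp add: o_def K0_def[abs_def])
 have K0op: "K0 (op_tensor a z) = split_tensor r (k_low A j r a) z" if "a \<in> A" "z \<in> fock_ops {r..}" for a z
  unfolding k_low_split[OF r that] K0_def R.Jhat_op_tensor[OF that(1) fock_ops_bops[OF that(2)]] ..
 have K0M: "K0 T \<in> uw_tensor A bops" if "T \<in> ?M" for T
 proof (rule uw_tensor_map[OF that cont _ _ fock_ops_subset subset_refl])
  show "K0 (op_tensor a z) \<in> uw_tensor A bops" if "a \<in> A" "z \<in> fock_ops {r..}" for a z
   unfolding K0op[OF that] k_low_split[OF r that]
   by (rule cut_uw_tensor[OF r j_in_uw_tensor[OF r that(1)] fock_ops_bops[OF that(2)]])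
  show "K0 (%x. \<Sum>i<n. c i *\<^sub>C S i x) = (%x. \<Sum>i<n. c i *\<^sub>C K0 (S i) x)" if "\<forall>i<n. S i \<in> bops"
   for n :: nat and c and S :: "nat => ('h, 'k L2 fock) tensor => ('h, 'k L2 fock) tensor"
   using that
  proof (induction n)
   case (Suc n)
   have b: "(%x. \<Sum>i<n. c i *\<^sub>C S i x) \<in> bops" using Suc.prems by (intro bops_sum_op bops_cscale) auto
   have e: "(%x. \<Sum>i<Suc n. c i *\<^sub>C S i x) = (%x. c n *\<^sub>C S n x + (\<Sum>i<n. c i *\<^sub>C S i x))"
    by (simp add: add.commute)
   show ?case unfolding e using lin[OF _ b, of "S n" "c n"] Suc by (simp add: add.commute)
  qed (simp add: K00)
 qed
 define K where "K = k_hat A j r"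
 have "normal_map ?M (uw_tensor A bops) K \<and> (\<forall>a\<in>A. \<forall>z\<in>fock_ops {r..}. K (op_tensor a z) = split_tensor r (k_low A j r a) z)"
  unfolding K_def k_hat_def
 proof (rule someI[of _ K0], intro conjI ballI)
  show "normal_map ?M (uw_tensor A bops) K0"
   unfolding normal_map_def clinear_on_def continuous_map_in_subtopology
  proof (intro conjI ballI allI)
   show "K0 (%u. c *\<^sub>C S u + S' u) = (%v. c *\<^sub>C K0 S v + K0 S' v)" if "S \<in> ?M" "S' \<in> ?M" for S S' c
    by (rule lin[OF uw_tensor_bops[OF that(1)] uw_tensor_bops[OF that(2)]])
  qed (use K0M continuous_map_from_subtopology[OF cont] in auto)
 qed (rule K0op)
 then have KM: "clinear_on ?M K" "continuous_map (subtopology uw_topology ?M) uw_topology K"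
  and Kop: "!!a z. a \<in> A ==> z \<in> fock_ops {r..} ==> K (op_tensor a z) = K0 (op_tensor a z)"
  by (auto simp: normal_map_def continuous_map_in_subtopology K0op)
 have M0: "(%_. 0) \<in> ?M" using uw_closure_sum[OF G, of 0] by (simp add: uw_tensor_def)
 have span: "K S = K0 S" if SG: "S \<in> op_span ?G" for S
 proof -
  obtain n c R where S: "S = (%x. \<Sum>i<n::nat. c i *\<^sub>C R i x)" "\<forall>i<n. R i \<in> ?G" by (rule op_spanE[OF SG])
  have RM: "\<forall>i<n. R i \<in> ?M"
   unfolding uw_tensor_def using S(2) closure_of_subset[of "op_span ?G" uw_topology] op_span_bops[OF G] op_span_superset[of ?G] by fastforce
  have KR: "K (R i) = K0 (R i)" if "i < n" for i using S(2) that Kop by auto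
  have "K (%x. \<Sum>i<m. c i *\<^sub>C R i x) = K0 (%x. \<Sum>i<m. c i *\<^sub>C R i x)" if "m <= n" for m
   using that
  proof (induction m)
   case 0
   have "K (%u. 1 *\<^sub>C 0 + 0) = (%v. 1 *\<^sub>C K (%_. 0) v + K (%_. 0) v)"
    using KM(1)[unfolded clinear_on_def, rule_format, OF M0 M0, of 1] .
   then show ?case by (simp add: K00 fun_eq_iff)
  next
   case (Suc m)
   have m: "(%x. \<Sum>i<m. c i *\<^sub>C R i x) \<in> ?M" unfolding uw_tensor_def
    by (rule uw_closure_sum[OF G]) (use RM Suc.prems in \<open>auto simp: uw_tensor_def\<close>)
   have Rm: "R m \<in> ?M" using RM Suc.prems by simp
   have e: "(%x. \<Sum>i<Suc m. c i *\<^sub>C R i x) = (%x. c m *\<^sub>C R m x + (\<Sum>i<m. c i *\<^sub>C R i x))"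
    by (simp add: add.commute)
   show ?case unfolding e lin[OF uw_tensor_bops[OF Rm] uw_tensor_bops[OF m]]
    using KM(1)[unfolded clinear_on_def, rule_format, OF Rm m, of "c m"] Suc KR by simp
  qed
  then show ?thesis unfolding S(1) by simp
 qed
 have "\<langle>u, K T v\<rangle> = \<langle>u, K0 T v\<rangle>" for u v
 proof (rule forall_in_closure_of_eq[where X = "subtopology uw_topology ?M" and Y = euclidean and S = "op_span ?G" and f = "%T. \<langle>u, K T v\<rangle>" and g = "%T. \<langle>u, K0 T v\<rangle>"])
  have sub: "op_span ?G \<subseteq> ?M" unfolding uw_tensor_def by (rule closure_of_subset) (use op_span_bops[OF G] in simp)
  have "subtopology uw_topology ?M closure_of op_span ?G = ?M"
   unfolding closure_of_subtopology Int_absorb1[OF sub] by (simp add: uw_tensor_def)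
  then show "T \<in> subtopology uw_topology ?M closure_of op_span ?G" using T by simp
  have c: "continuous_map (subtopology uw_topology ?M) euclidean (%T. \<langle>u, F T v\<rangle>)" if "continuous_map (subtopology uw_topology ?M) uw_topology F"
   for F :: "(('h, 'k L2 fock) tensor => ('h, 'k L2 fock) tensor) => ('h, 'k L2 fock) tensor => ('h, 'k L2 fock) tensor"
   using continuous_map_compose[OF that continuous_map_uwf[OF square_summable_single[of u] square_summable_single[of v]]] by (simp add: o_def)
  show "continuous_map (subtopology uw_topology ?M) euclidean (%T. \<langle>u, K T v\<rangle>)" by (rule c[OF KM(2)])
  show "continuous_map (subtopology uw_topology ?M) euclidean (%T. \<langle>u, K0 T v\<rangle>)"
   by (rule c[OF continuous_map_from_subtopology[OF cont]])
  show "\<langle>u, K S v\<rangle> = \<langle>u, K0 S v\<rangle>" if "S \<in> op_span ?G" for S by (simp only: span[OF that])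
 qed simp
 then show ?thesis unfolding K_def K0_def[symmetric] by (rule bops_ext)
qed

text \<open>Both \<open>shift_endo\<close> and \<open>fock_cut\<close> contain the shift isometry.
  It passes through \<open>Uhat\<close> as an operator on the Fock factor and cancels, which leaves
  \<open>fock_split\<close> alone.\<close>

theorem cocycle:
 assumes r: "0 <= r" and t: "0 <= t" and a: "a \<in> A"
 shows "j (r + t) a \<zeta> = adj (fock_split r) (jhat r (j t a) (fock_split r \<zeta>))"
proof -
 interpret R: amplified_rep A "j r" "iso r" by (rule rep[OF r])
 let ?V = "ampr (fock_shift r) :: ('h, 'k L2 fock) tensor => _"
 let ?W = "ampr (fock_shift r) :: (('h, 'k L2 fock) tensor, 'k L2 fock) tensor => _"
 have Vi: "isometry (fock_shift r :: 'k L2 fock => _)" using fock_shift_unique[OF r] ..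
 note Vb = isometry_bops[OF Vi]
 have Ii: "isometry (%x::'x::chilbert. x)" by (simp add: isometry_def)
 have VVi: "isometry ?V" by (rule op_tensor_isometry[OF _ Vi]) (simp add: isometry_def)
 note VVb = isometry_bops[OF VVi] and jb = j_bops[OF t a]
 have Wb: "?W \<in> bops" by (rule op_tensor_bops[OF bops_id Vb])
 have Db: "fock_split r \<in> bops" using fock_split_bops[OF r] .
 have sh: "shift_endo r (j t a) = (%\<zeta>. ?V (j t a (adj ?V \<zeta>)))" by (simp add: shift_endo_def fun_eq_iff)
 have mem: "shift_endo r (j t a) \<in> uw_tensor A (fock_ops {r..})" unfolding sh
  by (rule uw_tensor_conj[OF j_in_uw_tensor[OF t a] Vb subset_refl fock_ops_subset]) (rule fock_ops_shift[OF _ r])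
 have shb: "shift_endo r (j t a) \<in> bops" by (rule uw_tensor_bops[OF mem])
 have cut: "fock_cut r = (%\<zeta>. ?W (fock_split r \<zeta>))" by (simp add: fock_cut_def fun_eq_iff)
 have "j (r + t) a \<zeta> = adj (fock_cut r) (jhat r (shift_endo r (j t a)) (fock_cut r \<zeta>))"
  unfolding j_k_hat[OF r t a] k_hat_jhat[OF r mem] ..
 also have "\<dots> = adj (fock_split r) (adj ?W (adj R.Uhat (amp (shift_endo r (j t a)) (R.Uhat (?W (fock_split r \<zeta>))))))"
  unfolding cut adj_comp[OF Wb Db] R.Jhat_def ..
 also have "R.Uhat (?W (fock_split r \<zeta>)) = amp ?V (R.Uhat (fock_split r \<zeta>))"
  by (rule R.Uhat_op_tensor_id[OF Vb])
 also have "amp (shift_endo r (j t a)) (amp ?V (R.Uhat (fock_split r \<zeta>))) = amp ?V (amp (j t a) (R.Uhat (fock_split r \<zeta>)))"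
  unfolding amp_comp[OF shb VVb] amp_comp[OF VVb jb] by (simp add: sh isometry_adj[OF VVi])
 also have "adj ?W (adj R.Uhat \<xi>) = adj R.Uhat (adj (amp ?V) \<xi>)" for \<xi> :: "(('h, 'k L2 fock) tensor, (((nat \<times> ((nat => 'h) \<times> (nat => 'h)) \<times> bool) \<times> nat) \<times> ('h, 'k L2 fock) tensor) ell2) tensor"
 proof (rule cinner_ext)
  fix y
  show "\<langle>y, adj ?W (adj R.Uhat \<xi>)\<rangle> = \<langle>y, adj R.Uhat (adj (amp ?V) \<xi>)\<rangle>"
   by (simp add: adj_cinner' Wb R.Uhat_bops amp_bops VVb R.Uhat_op_tensor_id[OF Vb])
 qed
 also have "adj (amp ?V) (amp ?V \<xi>) = \<xi>" for \<xi> :: "(('h, 'k L2 fock) tensor, (((nat \<times> ((nat => 'h) \<times> (nat => 'h)) \<times> bool) \<times> nat) \<times> ('h, 'k L2 fock) tensor) ell2) tensor"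
  by (rule isometry_adj, rule op_tensor_isometry[OF VVi]) (simp add: isometry_def)
 finally show ?thesis by (simp add: R.Jhat_def)
qed

end

section \<open>Adapted vectors and Euler steps\<close>

text \<open>\<open>cexp s\<close> is the vacuum conditional expectation onto the past of \<open>s\<close>, and \<open>adapted s\<close> its range.\<close>

definition cexp :: "real => ('a::chilbert, 'k::chilbert L2 fock) tensor => ('a, 'k L2 fock) tensor" where
 "cexp s \<zeta> = E_bra vacuum (fock_split s \<zeta>)"

definition adapted :: "real => ('a::chilbert, 'k::chilbert L2 fock) tensor set" where
 "adapted s = {y. cexp s y = y}"

lemma cexp_bops: "0 <= s ==> cexp s \<in> bops"
 using bops_comp[OF E_bra_bops fock_split_bops] by (simp add: cexp_def[abs_def])

lemma cexp_coh:
 assumes "0 <= s" "f \<in> step_functions"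
 shows "cexp s (u \<otimes> coh f) = \<langle>vacuum, coh (lshift s f)\<rangle> *\<^sub>C (u \<otimes> coh (lo s f))"
 by (simp add: cexp_def fock_split_coh assms E_bra_tensor)

lemma coh_restr_below:
 fixes f g :: "real => 'k::chilbert"
 assumes "f \<in> step_functions" "g \<in> step_functions" "0 <= s"
 shows "\<langle>coh f, coh (lo s g)\<rangle> = \<langle>coh (lo s f), coh (lo s g)\<rangle> * \<langle>coh (lshift s f), vacuum\<rangle>"
proof -
 have "lo s (lo s g) = lo s g" "lshift s (lo s g) = (%_. 0)"
  by (auto simp: restr_def)
 then show ?thesis using cinner_coh_split[OF assms(1) step_restr_below[OF assms(2)] assms(3)] by simp
qed

lemma cexp_adj:
 assumes s: "0 <= s" shows "adj (cexp s) = (cexp s :: ('a::chilbert, 'k::chilbert L2 fock) tensor => _)"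
proof (rule tensor_coh_bops_eq[OF adj_bops[OF cexp_bops[OF s]] cexp_bops[OF s]])
 fix v :: 'a and g :: "real => 'k" assume g: "g \<in> step_functions"
 show "adj (cexp s) (v \<otimes> coh g) = cexp s (v \<otimes> coh g)"
 proof (rule tensor_coh_ext)
  fix u :: 'a and f :: "real => 'k" assume f: "f \<in> step_functions"
  have "\<langle>coh (lo s f), coh g\<rangle> = cnj \<langle>coh g, coh (lo s f)\<rangle>" by (simp add: cnj_cinner)
  then show "\<langle>u \<otimes> coh f, adj (cexp s) (v \<otimes> coh g)\<rangle> = \<langle>u \<otimes> coh f, cexp s (v \<otimes> coh g)\<rangle>"
   by (simp add: adj_cinner'[OF cexp_bops[OF s]] cexp_coh s f g cinner_scaleC_left cinner_scaleC_right cinner_tensor coh_restr_below cnj_cinner)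
 qed
qed

lemma cexp_self_adjoint: "0 <= s ==> \<langle>x, cexp s y\<rangle> = \<langle>cexp s x, y\<rangle>"
 using adj_cinner'[OF cexp_bops, of s x y] by (simp add: cexp_adj)

text \<open>A vector of the form \<open>cexp s \<zeta>\<close> carries the vacuum after
  \<open>s\<close>, so a cut at any later time splits off a vacuum factor.\<close>

lemma split_cexp:
 assumes s: "0 <= s" and t: "s <= t"
 shows "fock_split t (cexp s \<zeta>) = cexp s \<zeta> \<otimes> (vacuum :: 'k::chilbert L2 fock)"
proof -
 have t0: "0 <= t" using s t by simp
 have "(%\<zeta>. fock_split t (cexp s \<zeta>)) = (%\<zeta>. cexp s \<zeta> \<otimes> (vacuum :: 'k L2 fock))"
 proof (rule tensor_coh_bops_eq)
  show "(%\<zeta>. fock_split t (cexp s \<zeta>)) \<in> bops" by (rule bops_comp[OF fock_split_bops[OF t0] cexp_bops[OF s]])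
  show "(%\<zeta>. cexp s \<zeta> \<otimes> vacuum) \<in> bops" using bops_comp[OF E_ket_bops cexp_bops[OF s]] by (simp add: E_ket_def)
  fix u f assume f: "f \<in> (step_functions :: (real => 'k) set)"
  have "lo t (lo s f) = lo s f" "lshift t (lo s f) = (%_. 0)"
   using t t0 by (auto simp: restr_def)
  then show "fock_split t (cexp s (u \<otimes> coh f)) = cexp s (u \<otimes> coh f) \<otimes> vacuum"
   by (simp add: cexp_coh s f bops_scaleC[OF fock_split_bops[OF t0]] fock_split_coh[OF t0] step_restr_below tensor_scaleC_left)
 qed
 then show ?thesis by (rule fun_cong)
qed

lemma adapted_split: "0 <= s ==> s <= t ==> y \<in> adapted s ==> fock_split t y = y \<otimes> vacuum"
 using split_cexp[of s t y] by (simp add: adapted_def)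

lemma adaptedI_split: "fock_split s y = y \<otimes> vacuum ==> y \<in> adapted s"
 by (simp add: adapted_def cexp_def E_bra_tensor)

lemma adapted_mono: "0 <= s ==> s <= t ==> y \<in> adapted s ==> y \<in> adapted t"
 by (rule adaptedI_split[OF adapted_split])

lemma fixed_points_csubspace: "T \<in> bops ==> csubspace {y. T y = y}"
 by (simp add: csubspace_def bops_0 bops_add bops_scaleC)

lemma adapted_csubspace: "0 <= s ==> csubspace (adapted s)"
 unfolding adapted_def by (rule fixed_points_csubspace[OF cexp_bops])

lemma adapted_closed:
 assumes "0 <= s" shows "closed (adapted s)"
 unfolding adapted_def
 by (rule closed_Collect_eq[OF bops_continuous_on[OF cexp_bops[OF assms] continuous_on_id] continuous_on_id])

lemma adapted_vacuum: "(u::'a::chilbert) \<otimes> (vacuum :: 'k::chilbert L2 fock) \<in> adapted 0"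
proof -
 have "lo 0 (%_::real. 0::'k) = (%_. 0)" by (auto simp: restr_def)
 then have "cexp 0 (u \<otimes> vacuum) = u \<otimes> (vacuum :: 'k L2 fock)"
  by (simp add: cexp_coh step_zero cong: if_cong)
 then show ?thesis by (simp add: adapted_def)
qed

text \<open>The range of \<open>fock_split s\<close> is the tensor product of the adapted vectors with the Fock space.\<close>

lemma split_projection:
 fixes \<zeta> :: "(('a::chilbert, 'k::chilbert L2 fock) tensor, 'k L2 fock) tensor"
 assumes s: "0 <= s" and \<zeta>: "amp (cexp s) \<zeta> = \<zeta>"
 shows "fock_split s (adj (fock_split s) \<zeta>) = \<zeta>"
proof -
 note Db = fock_split_bops[OF s] and Pb = cexp_bops[OF s]
 note bb = bops_comp[OF Db adj_bops[OF Db]]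
 have gen: "fock_split s (adj (fock_split s) ((u \<otimes> coh (lo s f)) \<otimes> \<psi>)) = (u \<otimes> coh (lo s f)) \<otimes> \<psi>"
  if f: "f \<in> step_functions" for u :: 'a and f :: "real => 'k" and \<psi>
 proof -
  let ?y = "u \<otimes> coh (lo s f)"
  have "(%\<psi>. fock_split s (adj (fock_split s) (?y \<otimes> \<psi>))) = (%\<psi>. ?y \<otimes> \<psi>)"
  proof (rule total_bops_eq[OF ctotal_coh])
   show "(%\<psi>. fock_split s (adj (fock_split s) (?y \<otimes> \<psi>))) \<in> bops" by (rule bops_comp[OF bb tensor_left_bops])
   show "(%\<psi>. ?y \<otimes> \<psi>) \<in> bops" by (rule tensor_left_bops)
   fix \<phi> :: "'k L2 fock" assume "\<phi> \<in> coh ` step_functions"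
   then obtain g where g: "g \<in> step_functions" "\<phi> = coh g" by blast
   \<comment> \<open>The past of \<open>f\<close> pasted to the shifted \<open>g\<close>: its
     exponential vector is split into exactly the product that has to be reached.\<close>
   define f' where "f' = (%x. lo s f x + rshift s g x)"
   have f': "f' \<in> step_functions" unfolding f'_def
    by (rule step_add[OF step_rshift[OF g(1) s] step_restr_below[OF f]])
   have "lo s f' = lo s f" "lshift s f' = g"
    using step_negative[OF g(1)] by (auto simp: f'_def restr_def fun_eq_iff)
   then have "?y \<otimes> \<phi> = fock_split s (u \<otimes> coh f')" by (simp add: fock_split_coh[OF s f'] g)
   then show "fock_split s (adj (fock_split s) (?y \<otimes> \<phi>)) = ?y \<otimes> \<phi>"
    by (simp add: isometry_adj[OF fock_split_isometry[OF s]])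
  qed
  then show ?thesis by (rule fun_cong)
 qed
 have "fock_split s (adj (fock_split s) (amp (cexp s) \<xi>)) = amp (cexp s) \<xi>" for \<xi> :: "(('a, 'k L2 fock) tensor, 'k L2 fock) tensor"
 proof (rule tensor_bops_eqI[OF bops_comp[OF bb amp_bops[OF Pb]] amp_bops[OF Pb]])
  fix y :: "('a, 'k L2 fock) tensor" and \<psi> :: "'k L2 fock"
  have "(%y :: ('a, 'k L2 fock) tensor. fock_split s (adj (fock_split s) (cexp s y \<otimes> \<psi>))) = (%y. cexp s y \<otimes> \<psi>)"
  proof (rule tensor_coh_bops_eq)
   have b: "(%y. cexp s y \<otimes> \<psi>) \<in> bops" using bops_comp[OF E_ket_bops Pb] by (simp add: E_ket_def)
   then show "(%y. fock_split s (adj (fock_split s) (cexp s y \<otimes> \<psi>))) \<in> bops" by (rule bops_comp[OF bb])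
   show "(%y. cexp s y \<otimes> \<psi>) \<in> bops" by (rule b)
   fix u :: 'a and f :: "real => 'k" assume f: "f \<in> step_functions"
   show "fock_split s (adj (fock_split s) (cexp s (u \<otimes> coh f) \<otimes> \<psi>)) = cexp s (u \<otimes> coh f) \<otimes> \<psi>"
    unfolding cexp_coh[OF s f] tensor_scaleC_left bops_scaleC[OF bb] gen[OF f] ..
  qed
  then show "fock_split s (adj (fock_split s) (amp (cexp s) (y \<otimes> \<psi>))) = amp (cexp s) (y \<otimes> \<psi>)"
   by (simp add: amp_tensor[OF Pb] fun_eq_iff)
 qed
 from this[of \<zeta>] show ?thesis by (simp only: \<zeta>)
qed

section \<open>Increments of the creation process\<close>

lemma L2_interval:
 fixes f :: "real => 'k::chilbert"
 assumes "0 <= a" "a <= b"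
 shows "\<langle>L2_of (restr {a..<b} (%_. c)), L2_of (restr {a..<b} (%_. d :: 'k))\<rangle> = complex_of_real (b - a) * \<langle>c, d\<rangle>"
proof -
 have "\<langle>L2_of (restr {a..<b} (%_. c)), L2_of (restr {a..<b} (%_. d))\<rangle> = (\<integral>s. indicator {a..<b} s *\<^sub>R \<langle>c, d\<rangle> \<partial>lborel)"
  unfolding cinner_L2_of[OF step_const[OF assms(1)] step_const[OF assms(1)]]
  by (intro Bochner_Integration.integral_cong) (auto simp: restr_def indicator_def)
 then show ?thesis using assms by (simp add: scaleR_conv_of_real)
qed

lemma L2_interval_cut:
 fixes f :: "real => 'k::chilbert"
 assumes f: "f \<in> step_functions" and "0 <= a" "b <= t"
 shows "\<langle>L2_of (lo t f), L2_of (restr {a..<b} (%_. c))\<rangle> = \<langle>L2_of f, L2_of (restr {a..<b} (%_. c))\<rangle>"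
 unfolding cinner_L2_of[OF f step_const[OF assms(2)]] cinner_L2_of[OF step_restr_below[OF f] step_const[OF assms(2)]]
 using assms by (intro Bochner_Integration.integral_cong) (auto simp: restr_def)

lemma L2_interval_shift:
 fixes f :: "real => 'k::chilbert"
 assumes f: "f \<in> step_functions" and s: "0 <= s"
 shows "\<langle>L2_of (lshift s f), L2_of (lo h (%_. c))\<rangle> = \<langle>L2_of f, L2_of (restr {s..<s + h} (%_. c))\<rangle>"
proof -
 have "lo s (restr {s..<s + h} (%_. c)) = (%_. 0)" "lshift s (restr {s..<s + h} (%_. c)) = lo h (%_. c)"
  using s by (auto simp: restr_def fun_eq_iff)
 then show ?thesis using L2_split[OF f step_const[OF s] s, of "s + h" c] by simp
qed

text \<open>The one-particle vector \<open>c\<close> spread over \<open>[0, h)\<close>. Its squared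
  norm is proportional to \<open>h\<close>, so a noise increment has size
  \<open>sqrt h\<close>.\<close>

definition onepart :: "real => 'k::chilbert => 'k L2 fock" where
 "onepart h c = npart 1 (L2_of (lo h (%_. c)))"

lemma cinner_part: "0 <= h ==> \<langle>onepart h c, onepart h d\<rangle> = complex_of_real h * \<langle>c, d\<rangle>"
 using L2_interval[of 0 h c d] by (simp add: onepart_def cinner_npart)

lemma norm_part:
 assumes "0 <= h" shows "(norm (onepart h c))\<^sup>2 = h * (norm c)\<^sup>2"
 using cinner_part[OF assms, of c c] unfolding cinner_self of_real_mult[symmetric] of_real_eq_iff .

lemma part_bops:
 assumes h: "0 <= h" shows "(onepart h :: 'k::chilbert => _) \<in> bops"
proof (rule bopsI)
 have r: "lo h (%_. c + d :: 'k) = (%s. lo h (%_. c) s + lo h (%_. d) s)"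
  "lo h (%_. z *\<^sub>C c :: 'k) = (%s. z *\<^sub>C lo h (%_. c) s)" for c d z
  by (auto simp: restr_def)
 show "onepart h (c + d) = onepart h c + onepart h d" "onepart h (z *\<^sub>C c) = z *\<^sub>C onepart h c" for c d :: 'k and z
  using npart_scale[of 1 z "L2_of (lo h (%_. c))"]
  by (simp_all only: onepart_def r L2_of_add[OF step_const step_const] L2_of_scale[OF step_const] order_refl npart_one_add) simp
 show "norm (onepart h c) <= sqrt h * norm c" for c :: 'k
  by (rule power2_le_imp_le) (simp_all add: norm_part[OF h] power_mult_distrib h)
qed

lemma adj_part_vacuum:
 assumes "0 <= h" shows "adj (onepart h) vacuum = 0"
proof (rule cinner_ext)
 fix c :: 'a
 show "\<langle>c, adj (onepart h) vacuum\<rangle> = \<langle>c, 0\<rangle>"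
  unfolding adj_cinner'[OF part_bops[OF assms]] unfolding onepart_def cinner_npart_vacuum by simp
qed

text \<open>The increment over \<open>[s, s + h]\<close> of the creation process, on vectors adapted to \<open>s\<close>.\<close>

definition incr :: "real => real => (('a::chilbert, 'k::chilbert L2 fock) tensor, 'k) tensor => ('a, 'k L2 fock) tensor" where
 "incr s h z = adj (fock_split s) (ampr (onepart h) z)"

lemma incr_bops: "0 <= s ==> 0 <= h ==> incr s h \<in> bops"
 using bops_comp[OF adj_bops[OF fock_split_bops] op_tensor_bops[OF bops_id part_bops]]
 by (simp add: incr_def[abs_def])

text \<open>\<open>adj (onepart h)\<close> composed with \<open>onepart h\<close> is multiplication
  by \<open>h\<close>; this is the source of the Ito estimate for increments.\<close>

lemma cinner_op_tensor_part:
 fixes z w :: "('b::chilbert, 'a::chilbert) tensor"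
 assumes h: "0 <= h" shows "\<langle>ampr (onepart h) z, ampr (onepart h) w\<rangle> = complex_of_real h * \<langle>z, w\<rangle>"
proof -
 have adj: "adj (onepart h) (onepart h c) = h *\<^sub>R c" for c :: 'a
  by (rule cinner_ext) (simp add: adj_cinner'[OF part_bops[OF h]] cinner_part[OF h] cinner_scaleR_right)
 have "adj (ampr (onepart h)) (ampr (onepart h) \<zeta>) = h *\<^sub>R \<zeta>" for \<zeta> :: "('b, 'a) tensor"
  by (rule tensor_bops_eqI[OF bops_comp[OF adj_bops[OF op_tensor_bops[OF bops_id part_bops[OF h]]] op_tensor_bops[OF bops_id part_bops[OF h]]] bops_rscale[OF bops_id]])
    (simp add: op_tensor_adj part_bops h op_tensor_tensor adj_bops adj bops_scaleR[OF tensor_left_bops])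
 then show ?thesis
  using adj_cinner'[OF op_tensor_bops[OF bops_id part_bops[OF h]], of z "ampr (onepart h) w"]
  by (simp add: cinner_scaleR_right)
qed

lemma norm_op_tensor_part:
 fixes z :: "('b::chilbert, 'a::chilbert) tensor"
 assumes h: "0 <= h" shows "(norm (ampr (onepart h) z))\<^sup>2 = h * (norm z)\<^sup>2"
 using cinner_op_tensor_part[OF h, of z z] unfolding cinner_self of_real_mult[symmetric] of_real_eq_iff .

lemma E_bra_vacuum_part:
 fixes z :: "('b::chilbert, 'a::chilbert) tensor"
 assumes "0 <= h" shows "E_bra vacuum (ampr (onepart h) z) = 0"
proof -
 have "E_bra (0 :: 'a) z = 0" by (rule cinner_ext) (simp add: cinner_E_bra)
 then show ?thesis by (simp add: E_bra_op_tensor part_bops assms adj_part_vacuum)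
qed

lemma incr_norm:
 assumes s: "0 <= s" and h: "0 <= h" shows "(norm (incr s h z))\<^sup>2 <= h * (norm z)\<^sup>2"
 unfolding incr_def norm_op_tensor_part[OF h, symmetric]
 by (rule power_mono[OF isometry_adj_norm[OF fock_split_isometry[OF s]]]) simp

text \<open>Adaptedness of every slice at once, expressed as a fixed point of
  \<open>cexp s \<otimes> 1\<close>.\<close>

definition adapted_col :: "real => (('a::chilbert, 'k::chilbert L2 fock) tensor, 'c::chilbert) tensor set" where
 "adapted_col s = {z. amp (cexp s) z = z}"

lemma adapted_col_csubspace: "0 <= s ==> csubspace (adapted_col s)"
 unfolding adapted_col_def by (rule fixed_points_csubspace[OF amp_bops[OF cexp_bops]])

lemma adapted_colI: "0 <= s ==> (!!\<psi>. E_bra \<psi> z \<in> adapted s) ==> z \<in> adapted_col s"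
 unfolding adapted_col_def adapted_def
 by (auto intro!: slices_ext simp: E_bra_op_tensor cexp_bops)

lemma adapted_col_mono:
 assumes s: "0 <= s" "s <= t" and z: "z \<in> adapted_col s" shows "z \<in> adapted_col t"
proof (rule adapted_colI)
 show "0 <= t" using s by simp
 fix \<psi>
 have "E_bra \<psi> z = cexp s (E_bra \<psi> z)"
  using z E_bra_op_tensor[OF cexp_bops[OF s(1)] bops_id, of \<psi> z] by (simp add: adapted_col_def)
 then have "E_bra \<psi> z \<in> adapted s" by (simp add: adapted_def)
 then show "E_bra \<psi> z \<in> adapted t" by (rule adapted_mono[OF s])
qed

text \<open>Since \<open>z = amp (cexp s) z\<close>, two bounded operators need to be compared only
  on exponential vectors of the past tensored with \<open>c\<close>.\<close>

lemma adapted_col_ext: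
 fixes S T :: "(('a::chilbert, 'k::chilbert L2 fock) tensor, 'c::chilbert) tensor => 'd::chilbert"
 assumes s: "0 <= s" and b: "S \<in> bops" "T \<in> bops" and z: "z \<in> adapted_col s"
  and eq: "!!u f c. f \<in> step_functions ==> u \<otimes> coh (lo s f) \<in> adapted s ==> S ((u \<otimes> coh (lo s f)) \<otimes> c) = T ((u \<otimes> coh (lo s f)) \<otimes> c)"
 shows "S z = T z"
proof -
 note P = cexp_bops[OF s]
 have "S (amp (cexp s) z) = T (amp (cexp s) z)"
 proof (rule tensor_bops_eqI[OF bops_comp[OF b(1) amp_bops[OF P]] bops_comp[OF b(2) amp_bops[OF P]]])
  fix y :: "('a, 'k L2 fock) tensor" and c :: 'c
  have "(%y. S (E_ket c (cexp s y))) = (%y. T (E_ket c (cexp s y)))"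
  proof (rule tensor_coh_bops_eq[OF bops_comp[OF b(1) bops_comp[OF E_ket_bops P]] bops_comp[OF b(2) bops_comp[OF E_ket_bops P]]])
   fix u :: 'a and f :: "real => 'k" assume f: "f \<in> step_functions"
   have "cexp s (u \<otimes> coh (lo s f)) = u \<otimes> coh (lo s f)"
   proof -
    have "lo s (lo s f) = lo s f" "lshift s (lo s f) = (%_. 0)"
     by (auto simp: restr_def)
    then show ?thesis by (simp add: cexp_coh[OF s step_restr_below[OF f]])
   qed
   then have "u \<otimes> coh (lo s f) \<in> adapted s" by (simp add: adapted_def)
   from eq[OF f this] show "S (E_ket c (cexp s (u \<otimes> coh f))) = T (E_ket c (cexp s (u \<otimes> coh f)))"
    by (simp add: cexp_coh[OF s f] E_ket_def tensor_scaleC_left bops_scaleC b)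
  qed
  then show "S (amp (cexp s) (y \<otimes> c)) = T (amp (cexp s) (y \<otimes> c))"
   by (simp add: amp_tensor[OF P] E_ket_def fun_eq_iff)
 qed
 then show ?thesis using z by (simp add: adapted_col_def)
qed

text \<open>Martingale property: an adapted vector has the vacuum as its future factor, and the
  vacuum is orthogonal to one-particle vectors.\<close>

lemma incr_orth:
 assumes s: "0 <= s" and h: "0 <= h" and y: "y \<in> adapted s"
 shows "\<langle>y, incr s h z\<rangle> = 0"
proof -
 have "\<langle>y, incr s h z\<rangle> = \<langle>y \<otimes> vacuum, ampr (onepart h) z\<rangle>"
  using y by (simp add: incr_def adj_cinner'[OF fock_split_bops[OF s]] adapted_split[OF s order_refl])
 also have "\<dots> = \<langle>y, E_bra vacuum (ampr (onepart h) z)\<rangle>" by (simp add: cinner_E_bra)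
 finally show ?thesis by (simp add: E_bra_vacuum_part[OF h])
qed

text \<open>Exponential vectors are eigenvectors of annihilation, so an increment of creation is
  seen by \<open>coh f\<close> as a scalar factor. This reduces adaptedness and additivity of
  increments to statements about intervals.\<close>

lemma incr_formula:
 fixes f :: "real => 'k::chilbert"
 assumes s: "0 <= s" and h: "0 <= h" and f: "f \<in> step_functions" and y: "y \<in> adapted s"
 shows "\<langle>v \<otimes> coh f, incr s h (y \<otimes> c)\<rangle> = \<langle>v \<otimes> coh f, y\<rangle> * \<langle>L2_of f, L2_of (restr {s..<s + h} (%_. c))\<rangle>"
proof -
 let ?F = "lshift s f"
 have f2: "?F \<in> step_functions" by (rule step_lshift[OF f])
 have "\<langle>coh ?F, onepart h c\<rangle> = cnj \<langle>onepart h c, coh ?F\<rangle>" by (simp add: cnj_cinner)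
 also have "\<dots> = \<langle>coh ?F, vacuum\<rangle> * \<langle>L2_of ?F, L2_of (lo h (%_. c))\<rangle>"
  unfolding onepart_def cinner_npart_coh using cinner_vacuum_coh[of ?F] cnj_cinner[of vacuum "coh ?F"]
  by (simp add: cnj_cinner)
 finally have p: "\<langle>coh ?F, onepart h c\<rangle> = \<langle>coh ?F, vacuum\<rangle> * \<langle>L2_of f, L2_of (restr {s..<s + h} (%_. c))\<rangle>"
  unfolding L2_interval_shift[OF f s] .
 have "\<langle>v \<otimes> coh f, y\<rangle> = \<langle>fock_split s (v \<otimes> coh f), fock_split s y\<rangle>"
  by (simp add: isometry_cinner[OF fock_split_isometry[OF s]])
 also have "\<dots> = \<langle>v \<otimes> coh (lo s f), y\<rangle> * \<langle>coh ?F, vacuum\<rangle>"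
  by (simp add: adapted_split[OF s order_refl y] fock_split_coh[OF s f] cinner_tensor)
 finally have "\<langle>v \<otimes> coh f, y\<rangle> = \<langle>v \<otimes> coh (lo s f), y\<rangle> * \<langle>coh ?F, vacuum\<rangle>" .
 then show ?thesis
  by (simp add: incr_def adj_cinner'[OF fock_split_bops[OF s]] fock_split_coh[OF s f] op_tensor_tensor part_bops h cinner_tensor p)
qed

lemma incr_adapted:
 fixes z :: "(('a::chilbert, 'k::chilbert L2 fock) tensor, 'k) tensor"
 assumes s: "0 <= s" and h: "0 <= h" and z: "z \<in> adapted_col s"
 shows "incr s h z \<in> adapted (s + h)"
proof -
 have t: "0 <= s + h" using s h by simp
 have "cexp (s + h) (incr s h z) = incr s h z"
 proof (rule adapted_col_ext[OF s bops_comp[OF cexp_bops[OF t] incr_bops[OF s h]] incr_bops[OF s h] z])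
  fix u :: 'a and c :: 'k and g :: "real => 'k" let ?y = "u \<otimes> coh (lo s g)" assume y: "?y \<in> adapted s"
  show "cexp (s + h) (incr s h (?y \<otimes> c)) = incr s h (?y \<otimes> c)"
  proof (rule tensor_coh_ext)
   fix v :: 'a and f :: "real => 'k" assume f: "f \<in> step_functions"
   have yt: "?y \<in> adapted (s + h)" by (rule adapted_mono[OF s _ y]) (use h in simp)
   have "\<langle>v \<otimes> coh f, cexp (s + h) (incr s h (?y \<otimes> c))\<rangle> = \<langle>cexp (s + h) (v \<otimes> coh f), incr s h (?y \<otimes> c)\<rangle>"
    by (rule cexp_self_adjoint[OF t])
   also have "\<dots> = \<langle>cexp (s + h) (v \<otimes> coh f), ?y\<rangle> * \<langle>L2_of f, L2_of (restr {s..<s + h} (%_. c))\<rangle>"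
    unfolding cexp_coh[OF t f] cinner_scaleC_left incr_formula[OF s h step_restr_below[OF f] y]
     L2_interval_cut[OF f s order_refl] by simp
   also have "\<langle>cexp (s + h) (v \<otimes> coh f), ?y\<rangle> = \<langle>v \<otimes> coh f, cexp (s + h) ?y\<rangle>"
    by (rule cexp_self_adjoint[OF t, symmetric])
   finally show "\<langle>v \<otimes> coh f, cexp (s + h) (incr s h (?y \<otimes> c))\<rangle> = \<langle>v \<otimes> coh f, incr s h (?y \<otimes> c)\<rangle>"
    using yt by (simp add: incr_formula[OF s h f y] adapted_def)
  qed
 qed
 then show ?thesis by (simp add: adapted_def)
qed

lemma incr_add:
 fixes z :: "(('a::chilbert, 'k::chilbert L2 fock) tensor, 'k) tensor"
 assumes s: "0 <= s" and h: "0 <= h" "0 <= h'" and z: "z \<in> adapted_col s"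
 shows "incr s (h + h') z = incr s h z + incr (s + h) h' z"
proof -
 have t: "0 <= s + h" "0 <= h + h'" using s h by simp_all
 show ?thesis
 proof (rule adapted_col_ext[OF s incr_bops[OF s t(2)] bops_plus[OF incr_bops[OF s h(1)] incr_bops[OF t(1) h(2)]] z])
  fix u :: 'a and c :: 'k and g :: "real => 'k" let ?y = "u \<otimes> coh (lo s g)" assume y: "?y \<in> adapted s"
  have yt: "?y \<in> adapted (s + h)" by (rule adapted_mono[OF s _ y]) (use h in simp)
  have "restr {s..<s + (h + h')} (%_. c) = (%x. restr {s..<s + h} (%_. c) x + restr {s + h..<s + h + h'} (%_. c) x)"
   using h by (auto simp: restr_def fun_eq_iff)
  then have "L2_of (restr {s..<s + (h + h')} (%_. c)) = L2_of (restr {s..<s + h} (%_. c)) + L2_of (restr {s + h..<s + h + h'} (%_. c))"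
   using L2_of_add[OF step_const[OF s] step_const[OF t(1)]] by simp
  then show "incr s (h + h') (?y \<otimes> c) = incr s h (?y \<otimes> c) + incr (s + h) h' (?y \<otimes> c)"
   by (intro tensor_coh_ext) (simp only: cinner_add_right incr_formula[OF s h(1) _ y] incr_formula[OF s t(2) _ y] incr_formula[OF t(1) h(2) _ yt] distrib_left)
 qed
qed

section \<open>Criteria for weak and norm convergence\<close>

text \<open>For a bounded family the test vectors for which convergence holds form a closed
  subspace.\<close>

lemma weak_tendsto_total:
 fixes f :: "'x => 'a::chilbert"
 assumes S: "ctotal S" and lim: "!!s. s \<in> S ==> ((%x. \<langle>s, f x\<rangle>) \<longlongrightarrow> \<langle>s, l\<rangle>) F"
  and K: "\<forall>\<^sub>F x in F. norm (f x) <= K"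
 shows "((%x. \<langle>w, f x\<rangle>) \<longlongrightarrow> \<langle>w, l\<rangle>) F"
proof -
 let ?M = "{w. ((%x. \<langle>w, f x\<rangle>) \<longlongrightarrow> \<langle>w, l\<rangle>) F}"
 have "w \<in> ?M"
 proof (rule total_closed_UNIV[OF _ _ S])
  show "csubspace ?M"
   unfolding csubspace_def by (auto simp: cinner_add_left cinner_scaleC_left intro: tendsto_add tendsto_mult_left)
  show "closed ?M"
   unfolding closed_sequential_limits
  proof (intro allI impI, elim conjE)
   fix v w assume v: "\<forall>n. v n \<in> ?M" and w: "v \<longlonglongrightarrow> w"
   show "w \<in> ?M"
   proof (clarify, rule tendstoI)
    fix e :: real assume e: "0 < e"
    let ?c = "\<bar>K\<bar> + norm l + 1"
    have "\<forall>\<^sub>F n in sequentially. dist (v n) w < e / 2 / ?c"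
     using w e by (intro tendstoD) (auto intro!: divide_pos_pos add_nonneg_pos)
    then obtain n where n: "norm (v n - w) < e / 2 / ?c" unfolding dist_norm eventually_sequentially by auto
    have c: "0 < ?c" by (intro add_nonneg_pos) auto
    have nc: "norm (w - v n) * ?c < e / 2" using n pos_less_divide_eq[OF c] by (simp only: norm_minus_commute[of w])
    have "((%x. \<langle>v n, f x\<rangle>) \<longlongrightarrow> \<langle>v n, l\<rangle>) F" using v by simp
    from tendstoD[OF this, of "e / 2"] K e have "\<forall>\<^sub>F x in F. norm (f x) <= K \<and> dist \<langle>v n, f x\<rangle> \<langle>v n, l\<rangle> < e / 2"
     by (intro eventually_conj) auto
    then show "\<forall>\<^sub>F x in F. dist \<langle>w, f x\<rangle> \<langle>w, l\<rangle> < e"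
    proof (rule eventually_mono)
     fix x assume x: "norm (f x) <= K \<and> dist \<langle>v n, f x\<rangle> \<langle>v n, l\<rangle> < e / 2"
     have "\<langle>w, f x\<rangle> - \<langle>w, l\<rangle> = \<langle>w - v n, f x - l\<rangle> + (\<langle>v n, f x\<rangle> - \<langle>v n, l\<rangle>)"
      by (simp add: cinner_diff_left cinner_diff_right)
     then have "cmod (\<langle>w, f x\<rangle> - \<langle>w, l\<rangle>) <= norm (w - v n) * norm (f x - l) + cmod (\<langle>v n, f x\<rangle> - \<langle>v n, l\<rangle>)"
      using norm_triangle_ineq[of "\<langle>w - v n, f x - l\<rangle>" "\<langle>v n, f x\<rangle> - \<langle>v n, l\<rangle>"] cinner_CS[of "w - v n" "f x - l"] by simp
     also have "norm (w - v n) * norm (f x - l) <= norm (w - v n) * ?c"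
      using x norm_triangle_ineq4[of "f x" l] by (intro mult_left_mono) auto
     finally show "dist \<langle>w, f x\<rangle> \<langle>w, l\<rangle> < e" using nc x by (simp add: dist_norm)
    qed
   qed
  qed
 qed (use lim in auto)
 then show ?thesis by simp
qed

text \<open>The Radon-Riesz property: expand the square of \<open>norm (f x - l)\<close>.\<close>

lemma weak_norm_tendsto:
 fixes f :: "'x => 'a::chilbert"
 assumes "((%x. \<langle>l, f x\<rangle>) \<longlongrightarrow> \<langle>l, l\<rangle>) F" "((%x. \<langle>f x, f x\<rangle>) \<longlongrightarrow> \<langle>l, l\<rangle>) F"
 shows "(f \<longlongrightarrow> l) F"
proof -
 have "((%x. Re \<langle>f x, f x\<rangle> + Re \<langle>l, l\<rangle> - 2 * Re \<langle>l, f x\<rangle>) \<longlongrightarrow> Re \<langle>l, l\<rangle> + Re \<langle>l, l\<rangle> - 2 * Re \<langle>l, l\<rangle>) F"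
  by (rule tendsto_diff[OF tendsto_add[OF tendsto_Re[OF assms(2)] tendsto_const] tendsto_mult_left[OF tendsto_Re[OF assms(1)]]])
 moreover have "Re \<langle>f x, f x\<rangle> + Re \<langle>l, l\<rangle> - 2 * Re \<langle>l, f x\<rangle> = (norm (f x - l))\<^sup>2" for x
  using norm_power2_diff[of "f x" l] cnj_cinner[of "f x" l] by (simp add: Re_cinner_self complex_eq_iff)
 ultimately have "((%x. (norm (f x - l))\<^sup>2) \<longlongrightarrow> 0) F" by simp
 from tendsto_real_sqrt[OF this] have "((%x. norm (f x - l)) \<longlongrightarrow> 0) F" by simp
 then show ?thesis by (rule LIM_zero_cancel[OF tendsto_norm_zero_cancel])
qed

lemma flip_op_tensor:
 assumes "b \<in> bops" shows "flip (ampr b \<zeta>) = amp b (flip \<zeta>)"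
 by (rule tensor_bops_eqI[OF bops_comp[OF isometry_bops[OF flip_isometry] op_tensor_bops[OF bops_id assms]] bops_comp[OF amp_bops[OF assms] isometry_bops[OF flip_isometry]]])
   (simp add: op_tensor_tensor assms)

section \<open>Columns over the algebra and single time steps\<close>

context flow
begin

text \<open>By adaptedness of the process, \<open>j s a\<close> acts as the identity on the Fock
  space after \<open>s\<close>; in particular it leaves a vacuum future alone.\<close>

lemma j_preserves_adapted:
 assumes s: "0 <= s" and a: "a \<in> A" and y: "y \<in> adapted s"
 shows "j s a y \<in> adapted s"
proof -
 note jb = j_bops[OF s a] and P = cexp_bops[OF s]
 have "(%x. cexp s (j s a (cexp s x))) = (%x. j s a (cexp s x))"
 proof (rule tensor_coh_bops_eq[OF bops_comp[OF P bops_comp[OF jb P]] bops_comp[OF jb P]], rule tensor_coh_ext)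
  fix u v and f g :: "real => 'k" assume g: "g \<in> step_functions" and f: "f \<in> step_functions"
  have z: "lo s (lo s g) = lo s g" "lshift s (lo s g) = (%_. 0)"
   by (auto simp: restr_def)
  have "\<langle>v \<otimes> coh f, j s a (u \<otimes> coh (lo s g))\<rangle> = \<langle>coh (lshift s f), vacuum\<rangle> * \<langle>v \<otimes> coh (lo s f), j s a (u \<otimes> coh (lo s g))\<rangle>"
   unfolding j_adapted[OF s a f step_restr_below[OF g]] cinner_coh_restr[OF f step_restr_below[OF g] s] z ..
  then show "\<langle>v \<otimes> coh f, cexp s (j s a (cexp s (u \<otimes> coh g)))\<rangle> = \<langle>v \<otimes> coh f, j s a (cexp s (u \<otimes> coh g))\<rangle>"
   by (simp add: cexp_self_adjoint[OF s] cexp_coh[OF s] f g bops_scaleC[OF jb] cinner_scaleC_left cinner_scaleC_right cnj_cinner)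
 qed
 from fun_cong[OF this, of y] y show ?thesis by (simp add: adapted_def)
qed

text \<open>Columns with entries in \<open>A\<close>. The predicate coincides with
  \<open>col_in\<close>, but does not mention the representation and hence serves for all times
  simultaneously.\<close>

definition column :: "('h => ('h, 'f::chilbert) tensor) => bool" where
 "column W \<longleftrightarrow> W \<in> bops \<and> (\<forall>\<psi>. (%u. E_bra \<psi> (W u)) \<in> A)"

lemma column_bops: "column W ==> W \<in> bops" and column_slice: "column W ==> (%u. E_bra \<psi> (W u)) \<in> A"
 by (simp_all add: column_def)

lemma col_in_iff: "amplified_rep.col_in A W \<longleftrightarrow> column W"
 using amplified_rep.col_in_def[OF rep[of 0]] by (simp add: column_def)

lemma column_commute:
 assumes W: "column W" and b: "b \<in> commutant A" shows "W (b u) = amp b (W u)"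
proof (rule slices_ext)
 fix \<psi>
 show "E_bra \<psi> (W (b u)) = E_bra \<psi> (amp b (W u))"
  using commutantD[OF b column_slice[OF W]] by (simp add: E_bra_op_tensor commutant_bops[OF b])
qed

text \<open>An element \<open>b\<close> of the commutant passes through \<open>W'\<close>,
  \<open>T\<close> and \<open>adj W\<close> in turn, in between as
  \<open>b \<otimes> 1\<close>.\<close>

lemma sandwich_in:
 assumes W: "column W" "column W'" and T: "T \<in> uw_tensor A bops"
 shows "(%u. adj W (T (W' u))) \<in> A"
proof (rule A_I)
 note Wb = column_bops[OF W(1)] column_bops[OF W(2)]
 show "(%u. adj W (T (W' u))) \<in> bops"
  by (rule bops_comp[OF adj_bops[OF Wb(1)] bops_comp[OF uw_tensor_bops[OF T] Wb(2)]])
 fix b u assume b: "b \<in> commutant A"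
 note bb = commutant_bops[OF b]
 have "adj W (amp b \<zeta>) = b (adj W \<zeta>)" for \<zeta>
 proof (rule cinner_ext)
  fix x
  have "\<langle>x, adj W (amp b \<zeta>)\<rangle> = \<langle>amp (adj b) (W x), \<zeta>\<rangle>"
   by (simp add: adj_cinner'[OF Wb(1)] amp_adj[OF bb, symmetric] adj_cinner[OF amp_bops[OF bb]])
  also have "\<dots> = \<langle>x, b (adj W \<zeta>)\<rangle>"
   by (simp add: column_commute[OF W(1) commutant_adj[OF b], symmetric] adj_cinner'[OF Wb(1), symmetric] adj_cinner[OF bb])
  finally show "\<langle>x, adj W (amp b \<zeta>)\<rangle> = \<langle>x, b (adj W \<zeta>)\<rangle>" .
 qed
 then show "adj W (T (W' (b u))) = b (adj W (T (W' u)))"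
  by (simp add: column_commute[OF W(2) b] uw_tensor_commute[OF T subset_refl b])
qed

lemma column_E_ket: "a \<in> A ==> column (%u. E_ket \<psi> (a u))"
 unfolding column_def by (simp add: bops_comp[OF E_ket_bops A_bops] E_bra_E_ket A_scale)

lemma column_plus: "column W ==> column W' ==> column (%u. W u + W' u)"
 unfolding column_def by (simp add: bops_plus bops_add[OF E_bra_bops] A_plus)

lemma column_op_tensor: "column W ==> z \<in> bops ==> column (%u. ampr z (W u))"
 unfolding column_def by (simp add: bops_comp[OF op_tensor_bops[OF bops_id]] E_bra_op_tensor)

lemma column_ket:
 assumes l: "l \<in> ket_uw_tensor A" shows "column (%u. flip (l u))"
 unfolding column_def
proof (intro conjI allI)
 show fb: "(%u. flip (l u)) \<in> bops"
  by (rule bops_comp[OF isometry_bops[OF flip_isometry] ket_uw_tensor_bops[OF l]])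
 fix c
 show "(%u. E_bra c (flip (l u))) \<in> A"
 proof (rule A_I[OF bops_comp[OF E_bra_bops fb]])
  fix b u assume b: "b \<in> commutant A"
  note bb = commutant_bops[OF b]
  show "E_bra c (flip (l (b u))) = b (E_bra c (flip (l u)))"
   by (simp add: ket_uw_tensor_commute[OF l b] flip_op_tensor[OF bb] E_bra_op_tensor[OF bb])
 qed
qed

lemma jcol_adapted:
 assumes s: "0 <= s" and W: "column W" and y: "y \<in> adapted s"
 shows "jcol s W y \<in> adapted_col s"
proof -
 interpret R: amplified_rep A "j s" "iso s" by (rule rep[OF s])
 show ?thesis
  by (rule adapted_colI[OF s]) (use W in \<open>simp add: R.E_bra_colhat col_in_iff j_preserves_adapted s y column_slice\<close>)
qed

lemma jcol_bops: "0 <= s ==> column W ==> jcol s W \<in> bops"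
 using amplified_rep.colhat_bops[OF rep] column_bops by blast

lemma jcol_norm: "0 <= s ==> column W ==> norm (jcol s W y) <= onorm W * norm y"
 by (rule amplified_rep.colhat_norm[OF rep column_bops])

text \<open>Ampliates the column \<open>W\<close> at time \<open>s\<close> and glues its fresh Fock
  factor to the past. These steps are the factors of a time-ordered product.\<close>

definition step :: "real => ('h => ('h, 'k L2 fock) tensor) => ('h, 'k L2 fock) tensor => ('h, 'k L2 fock) tensor" where
 "step s W y = adj (fock_split s) (jcol s W y)"

lemma step_bops: "0 <= s ==> column W ==> step s W \<in> bops"
 using bops_comp[OF adj_bops[OF fock_split_bops] jcol_bops] by (simp add: step_def[abs_def])

lemma step_norm:
 assumes s: "0 <= s" and W: "column W" shows "norm (step s W y) <= onorm W * norm y"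
 using isometry_adj_norm[OF fock_split_isometry[OF s], of "jcol s W y"] jcol_norm[OF s W, of y] by (simp add: step_def)

text \<open>On vectors split at \<open>s\<close> the cocycle identity turns
  \<open>j (s + h) a\<close> into the ampliation of \<open>j h a\<close>, and
  \<open>colhat_sandwich\<close> contracts this with the two columns. Adaptedness ensures that
  splitting undoes the gluing.\<close>

lemma single_step:
 assumes s: "0 <= s" and h: "0 <= h" and y: "y1 \<in> adapted s" "y2 \<in> adapted s"
  and W: "column W1" "column W2" and a: "a \<in> A"
 shows "\<langle>step s W1 y1, j (s + h) a (step s W2 y2)\<rangle> = \<langle>y1, j s (%u. adj W1 (j h a (W2 u))) y2\<rangle>"
proof -
 interpret R: amplified_rep A "j s" "iso s" by (rule rep[OF s])
 have split: "fock_split s (step s W y) = jcol s W y" if "column W" "y \<in> adapted s" for W y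
  unfolding step_def by (rule split_projection[OF s]) (use jcol_adapted[OF s that] in \<open>simp add: adapted_col_def\<close>)
 have "\<langle>step s W1 y1, j (s + h) a (step s W2 y2)\<rangle> = \<langle>jcol s W1 y1, jhat s (j h a) (jcol s W2 y2)\<rangle>"
  by (simp add: cocycle[OF s h a] adj_cinner'[OF fock_split_bops[OF s]] split W y)
 also have "\<dots> = \<langle>y1, j s (%u. adj W1 (j h a (W2 u))) y2\<rangle>"
  by (rule R.colhat_sandwich[OF _ _ j_bops[OF h a] sandwich_in[OF W j_in_uw_tensor[OF h a]]]) (simp_all add: col_in_iff W)
 finally show ?thesis .
qed

lemma j_weak_continuous:
 assumes "a \<in> A" shows "continuous_on {0..} (%t. \<langle>x, j t a y\<rangle>)"
 using continuous_map_compose[OF j_continuous[OF assms] continuous_map_uwf[OF square_summable_single[of x] square_summable_single[of y]]]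
 by (simp add: o_def)

lemma j_norm: "0 <= t ==> a \<in> A ==> norm (j t a y) <= onorm a * norm y"
 by (rule amplified_rep.J_norm[OF rep])

lemma cinner_j: "0 <= t ==> a \<in> A ==> b \<in> A ==> \<langle>j t a x, j t b y\<rangle> = \<langle>x, j t (%u. adj a (b u)) y\<rangle>"
 by (rule normal_rep.J_cinner[OF j_rep])

text \<open>Multiplicativity improves weak to strong continuity: the squared norm of
  \<open>j t a y\<close> is the matrix element of \<open>j t\<close> at \<open>adj a\<close>
  composed with \<open>a\<close>, which is continuous.\<close>

lemma j_strong_continuous:
 assumes a: "a \<in> A" shows "continuous_on {0..} (%t. j t a y)"
 unfolding continuous_on
proof
 fix t :: real assume t: "t \<in> {0..}"
 have aa: "(%u. adj a (a u)) \<in> A" by (rule A_comp[OF A_adj[OF a] a])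
 have lim: "((%t. \<langle>x, j t b y\<rangle>) \<longlongrightarrow> \<langle>x, j t b y\<rangle>) (at t within {0..})" if "b \<in> A" for b x
  using j_weak_continuous[OF that, of x y] t by (simp add: continuous_on)
 show "((%t. j t a y) \<longlongrightarrow> j t a y) (at t within {0..})"
 proof (rule weak_norm_tendsto[OF lim[OF a]])
  have "\<forall>\<^sub>F s in at t within {0..}. \<langle>y, j s (%u. adj a (a u)) y\<rangle> = \<langle>j s a y, j s a y\<rangle>"
   unfolding eventually_at_filter by (rule always_eventually) (auto simp: cinner_j a)
  from Lim_transform_eventually[OF lim[OF aa] this] show "((%x. \<langle>j x a y, j x a y\<rangle>) \<longlongrightarrow> \<langle>j t a y, j t a y\<rangle>) (at t within {0..})"
   using t by (simp add: cinner_j a)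
 qed
qed

text \<open>The squared norm is a matrix element of \<open>j t\<close> at the operator
  \<open>W* W\<close>, which belongs to \<open>A\<close>; weak continuity is tested slice by
  slice.\<close>

lemma jcol_continuous:
 fixes W :: "'h => ('h, 'f::chilbert) tensor"
 assumes W: "column W" shows "continuous_on {0..} (%t. jcol t W y)"
 unfolding continuous_on
proof
 fix t :: real assume t: "t \<in> {0..}"
 have idT: "(%\<zeta>::('h, 'f) tensor. \<zeta>) \<in> uw_tensor A bops" using op_tensor_uw_tensor[OF A_id bops_id subset_refl] by simp
 note WW = sandwich_in[OF W W idT]
 have lim: "((%t. \<langle>x, j t b y\<rangle>) \<longlongrightarrow> \<langle>x, j t b y\<rangle>) (at t within {0..})" if "b \<in> A" for b x
  using j_weak_continuous[OF that, of x y] t by (simp add: continuous_on)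
 have ev: "\<forall>\<^sub>F s in at t within {0..}. 0 <= s" unfolding eventually_at_filter by (rule always_eventually) auto
 have eq: "\<langle>jcol s W y, jcol s W y\<rangle> = \<langle>y, j s (%u. adj W (W u)) y\<rangle>" if "0 <= s" for s
 proof -
  interpret R: amplified_rep A "j s" "iso s" by (rule rep[OF that])
  have "R.Jhat (%x. x) \<zeta> = \<zeta>" for \<zeta> :: "(('h, 'k L2 fock) tensor, 'f) tensor" by (simp add: R.Jhat_def isometry_adj[OF R.Uhat_isometry])
  then show ?thesis using R.colhat_sandwich[OF _ _ bops_id WW] W by (simp add: col_in_iff)
 qed
 have slice: "\<langle>x \<otimes> c, jcol s W y\<rangle> = \<langle>x, j s (%u. E_bra c (W u)) y\<rangle>" if "0 <= s" for s x c
 proof -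
  interpret R: amplified_rep A "j s" "iso s" by (rule rep[OF that])
  have "\<langle>x \<otimes> c, jcol s W y\<rangle> = \<langle>x, E_bra c (jcol s W y)\<rangle>" by (simp add: cinner_E_bra)
  also have "\<dots> = \<langle>x, j s (%u. E_bra c (W u)) y\<rangle>" using W by (simp add: R.E_bra_colhat col_in_iff)
  finally show ?thesis .
 qed
 show "((%t. jcol t W y) \<longlongrightarrow> jcol t W y) (at t within {0..})"
 proof (rule weak_norm_tendsto)
  show "((%s. \<langle>jcol t W y, jcol s W y\<rangle>) \<longlongrightarrow> \<langle>jcol t W y, jcol t W y\<rangle>) (at t within {0..})"
  proof (rule weak_tendsto_total[OF ctotal_simple, where K = "onorm W * norm y"])
   show "\<forall>\<^sub>F s in at t within {0..}. norm (jcol s W y) <= onorm W * norm y"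
    using ev by eventually_elim (rule jcol_norm[OF _ W])
   fix z :: "(('h, 'k L2 fock) tensor, 'f) tensor" assume "z \<in> {u \<otimes> v | u v. True}"
   then obtain x c where z: "z = x \<otimes> c" by blast
   have "\<forall>\<^sub>F s in at t within {0..}. \<langle>x, j s (%u. E_bra c (W u)) y\<rangle> = \<langle>z, jcol s W y\<rangle>"
    using ev by eventually_elim (simp add: z slice)
   from Lim_transform_eventually[OF lim[OF column_slice[OF W]] this]
   show "((%s. \<langle>z, jcol s W y\<rangle>) \<longlongrightarrow> \<langle>z, jcol t W y\<rangle>) (at t within {0..})" using t by (simp add: z slice)
  qed
  have "\<forall>\<^sub>F s in at t within {0..}. \<langle>y, j s (%u. adj W (W u)) y\<rangle> = \<langle>jcol s W y, jcol s W y\<rangle>"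
   using ev by eventually_elim (simp add: eq)
  from Lim_transform_eventually[OF lim[OF WW] this]
  show "((%s. \<langle>jcol s W y, jcol s W y\<rangle>) \<longlongrightarrow> \<langle>jcol t W y, jcol t W y\<rangle>) (at t within {0..})" using t by (simp add: eq)
 qed
qed

definition ecol :: "('h => 'h) => ('h => ('h, 'k) tensor) => real => 'h => ('h, 'k L2 fock) tensor" where
 "ecol k L h u = E_ket vacuum (complex_of_real h *\<^sub>C k u + u) + ampr (onepart h) (L u)"

lemma column_ecol:
 assumes "k \<in> A" "column L" "0 <= h" shows "column (ecol k L h)"
 using column_plus[OF column_E_ket[OF A_lincomb[OF assms(1) A_id], of vacuum "complex_of_real h"] column_op_tensor[OF assms(2) part_bops[OF assms(3)]]]
 by (simp add: ecol_def[abs_def])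

text \<open>Connects the multiplicative and the additive picture: one factor of the product is one
  Euler step with drift \<open>j s k\<close> and noise coefficient \<open>jcol s L\<close>.\<close>

lemma step_ecol:
 assumes s: "0 <= s" and h: "0 <= h" and k: "k \<in> A" and L: "column L" and y: "y \<in> adapted s"
 shows "step s (ecol k L h) y = y + h *\<^sub>R j s k y + incr s h (jcol s L y)"
proof -
 interpret R: amplified_rep A "j s" "iso s" by (rule rep[OF s])
 let ?E = "%u. E_ket vacuum (complex_of_real h *\<^sub>C k u + u)" and ?N = "%u. ampr (onepart h) (L u)"
 have a: "(%u. complex_of_real h *\<^sub>C k u + u) \<in> A" by (rule A_lincomb[OF k A_id])
 have b: "?E \<in> bops" "?N \<in> bops"
  by (rule column_bops[OF column_E_ket[OF a]], rule column_bops[OF column_op_tensor[OF L part_bops[OF h]]])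
 have e: "ecol k L h = (%u. ?E u + ?N u)" by (simp add: ecol_def fun_eq_iff)
 have "jcol s (ecol k L h) y = j s (%u. complex_of_real h *\<^sub>C k u + u) y \<otimes> vacuum + ampr (onepart h) (jcol s L y)"
  unfolding e R.colhat_plus[OF b] R.colhat_E_ket[OF a]
  using R.colhat_op_tensor[OF _ part_bops[OF h], of L] L by (simp add: col_in_iff)
 also have "j s (%u. complex_of_real h *\<^sub>C k u + u) y = y + h *\<^sub>R j s k y"
  using R.J_lincomb[OF k A_id, of "complex_of_real h" y] by (simp add: R.J_id scaleC_of_real)
 finally have e: "jcol s (ecol k L h) y = (y + h *\<^sub>R j s k y) \<otimes> vacuum + ampr (onepart h) (jcol s L y)" .
 have ad: "y + h *\<^sub>R j s k y \<in> adapted s"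
  by (intro csubspaceD[OF adapted_csubspace[OF s]] y j_preserves_adapted[OF s k y])
 have "adj (fock_split s) ((y + h *\<^sub>R j s k y) \<otimes> vacuum) = y + h *\<^sub>R j s k y"
  unfolding adapted_split[OF s order_refl ad, symmetric] by (rule isometry_adj[OF fock_split_isometry[OF s]])
 then show ?thesis unfolding step_def e incr_def bops_add[OF adj_bops[OF fock_split_bops[OF s]]] by simp
qed

end

section \<open>Stochastic differential equations on Fock space\<close>

lemma bounded_strong_tendsto:
 fixes T :: "'i => 'a::chilbert => 'b::chilbert"
 assumes T: "\<forall>\<^sub>F i in F. T i \<in> bops \<and> (\<forall>v. norm (T i v) <= c * norm v)" and x: "(x \<longlongrightarrow> x0) F"
  and lim: "((%i. T i x0) \<longlongrightarrow> p) F"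
 shows "((%i. T i (x i)) \<longlongrightarrow> p) F"
proof -
 have "((%i. T i (x i - x0)) \<longlongrightarrow> 0) F"
 proof (rule Lim_null_comparison)
  show "\<forall>\<^sub>F i in F. norm (T i (x i - x0)) <= c * norm (x i - x0)" using T by eventually_elim blast
  show "((%i. c * norm (x i - x0)) \<longlongrightarrow> 0) F"
   using tendsto_mult_right_zero[OF tendsto_norm_zero[OF LIM_zero[OF x]]] by simp
 qed
 moreover have "\<forall>\<^sub>F i in F. T i (x i - x0) + T i x0 = T i (x i)"
  using T by eventually_elim (simp add: bops_diff)
 ultimately show ?thesis using Lim_transform_eventually[OF tendsto_add[OF _ lim]] by fastforce
qed

text \<open>The induction is run on the majorant \<open>A + B * (\<Sum>i<n. a i)\<close>, which
  grows by at most the factor \<open>1 + B\<close> in each step.\<close>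

lemma discrete_gronwall:
 fixes a :: "nat => real"
 assumes "!!n. n <= N ==> a n <= A + B * (\<Sum>i<n. a i)" "0 <= B" "n <= N"
 shows "a n <= A * (1 + B) ^ n"
proof -
 have "A + B * (\<Sum>i<n. a i) <= A * (1 + B) ^ n" if "n <= N" for n
  using that
 proof (induction n)
  case (Suc n)
  have "A + B * (\<Sum>i<Suc n. a i) = (A + B * (\<Sum>i<n. a i)) + B * a n" by (simp add: distrib_left)
  also have "\<dots> <= (1 + B) * (A + B * (\<Sum>i<n. a i))"
   using mult_left_mono[OF assms(1)[of n] assms(2)] Suc.prems by (simp add: algebra_simps)
  also have "\<dots> <= (1 + B) * (A * (1 + B) ^ n)"
   using Suc assms(2) by (intro mult_left_mono) auto
  finally show ?case by (simp add: mult.left_commute)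
 qed simp
 from this[OF assms(3)] assms(1)[OF assms(3)] show ?thesis by linarith
qed

lemma norm_components:
 fixes x :: "'a::real_normed_vector \<times> 'b::real_normed_vector"
 assumes "norm x <= B" shows "norm (fst x) <= B" "norm (snd x) <= B"
 using assms norm_fst_le[of "fst x" "snd x"] norm_snd_le[of "snd x" "fst x"] by auto

text \<open>The equation \<open>dX = K X dt + dA\<^sup>*(L X)\<close>, where \<open>C s h\<close> is the increment of the creation process over
 \<open>[s, s + h]\<close> and \<open>Ha\<close>, \<open>Za\<close> are the adapted vectors. Dyadic partitions are nested, so that Riemann sums
 and Euler polygons can be compared without common refinements.\<close>

locale sde =
 fixes Ha :: "real => 'e::chilbert set" and Za :: "real => 'z::chilbert set"
  and C :: "real => real => 'z => 'e" and K :: "real => 'e => 'e" and L :: "real => 'e => 'z" and \<kappa> :: real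
 assumes Ha: "0 <= s ==> csubspace (Ha s)" "0 <= s ==> closed (Ha s)" "0 <= s ==> s <= t ==> y \<in> Ha s ==> y \<in> Ha t"
  and Za: "0 <= s ==> csubspace (Za s)" "0 <= s ==> s <= t ==> z \<in> Za s ==> z \<in> Za t"
  and C_bops: "0 <= s ==> 0 <= h ==> C s h \<in> bops"
  and C_norm: "0 <= s ==> 0 <= h ==> (norm (C s h z))\<^sup>2 <= h * (norm z)\<^sup>2"
  and C_in: "0 <= s ==> 0 <= h ==> z \<in> Za s ==> C s h z \<in> Ha (s + h)"
  and C_orth: "0 <= s ==> 0 <= h ==> y \<in> Ha s ==> \<langle>y, C s h z\<rangle> = 0"
  and C_add: "0 <= s ==> 0 <= h ==> 0 <= h' ==> z \<in> Za s ==> C s (h + h') z = C s h z + C (s + h) h' z"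
  and K: "0 <= s ==> K s \<in> bops" "0 <= s ==> y \<in> Ha s ==> K s y \<in> Ha s" "0 <= s ==> norm (K s y) <= \<kappa> * norm y"
   "continuous_on {0..} (%s. K s y)"
  and L: "0 <= s ==> L s \<in> bops" "0 <= s ==> y \<in> Ha s ==> L s y \<in> Za s" "0 <= s ==> norm (L s y) <= \<kappa> * norm y"
   "continuous_on {0..} (%s. L s y)"
  and \<kappa>: "0 <= \<kappa>"
begin

section \<open>Riemann sums of drift and noise\<close>

definition inc :: "real => real => 'e \<times> 'z => 'e" where
 "inc s h z = h *\<^sub>R fst z + C s h (snd z)"

definition gsum :: "real => real => nat => (nat => 'e \<times> 'z) => 'e" where
 "gsum s h n z = (\<Sum>i<n. inc (s + real i * h) h (z i))"

lemma inc_lin: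
 assumes "0 <= s" "0 <= h"
 shows "inc s h (z + w) = inc s h z + inc s h w" "inc s h (z - w) = inc s h z - inc s h w" "inc s h (c *\<^sub>C z) = c *\<^sub>C inc s h z"
 using C_bops[OF assms]
 by (simp_all add: inc_def bops_add bops_diff bops_scaleC scaleR_add_right scaleR_diff_right scaleC_scaleR scaleC_add_right)

lemma gsum_lin:
 assumes "0 <= s" "0 <= h"
 shows "gsum s h n (%i. z i - w i) = gsum s h n z - gsum s h n w" "gsum s h n (%i. c *\<^sub>C z i) = c *\<^sub>C gsum s h n z"
  "gsum s h n (%i. z i + w i) = gsum s h n z + gsum s h n w"
 using assms by (simp_all add: gsum_def inc_lin sum_subtractf sum.distrib scaleC_sum_right)

lemma gsum_append: "gsum s h (m + n) z = gsum s h m z + gsum (s + real m * h) h n (%i. z (m + i))"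
 by (induction n) (simp_all add: gsum_def algebra_simps)

text \<open>Pythagoras: each new increment is orthogonal to the partial sum before it. Adaptedness
  of the partial sums is carried along because the orthogonality depends on it.\<close>

lemma martingale_sum:
 assumes s: "0 <= s" and h: "0 <= h" and q: "!!i. i < n ==> q i \<in> Za (s + real i * h)"
 shows "(\<Sum>i<n. C (s + real i * h) h (q i)) \<in> Ha (s + real n * h) \<and>
  (norm (\<Sum>i<n. C (s + real i * h) h (q i)))\<^sup>2 <= h * (\<Sum>i<n. (norm (q i))\<^sup>2)"
 using q
proof (induction n)
 case 0
 show ?case using csubspaceD(1)[OF Ha(1)[OF s]] by simp
next
 case (Suc n)
 let ?x = "\<Sum>i<n. C (s + real i * h) h (q i)" and ?c = "C (s + real n * h) h (q n)"
 have t: "0 <= s + real n * h" using s h by simp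
 have IH: "?x \<in> Ha (s + real n * h)" "(norm ?x)\<^sup>2 <= h * (\<Sum>i<n. (norm (q i))\<^sup>2)" using Suc by auto
 have e: "s + real (Suc n) * h = s + real n * h + h" by (simp add: algebra_simps)
 have "?x + ?c \<in> Ha (s + real n * h + h)"
  by (rule csubspaceD(2)[OF Ha(1)]) (use t h IH(1) Ha(3)[OF t] C_in[OF t h] Suc.prems[of n] in auto)
 moreover have "(norm (?x + ?c))\<^sup>2 <= h * (\<Sum>i<n. (norm (q i))\<^sup>2) + h * (norm (q n))\<^sup>2"
  unfolding norm_power2_add using IH(2) C_norm[OF t h, of "q n"] C_orth[OF t h IH(1), of "q n"] by simp
 ultimately show ?case unfolding e by (simp add: distrib_left)
qed

lemma gsum_norm:
 assumes s: "0 <= s" and h: "0 <= h" and q: "!!i. i < n ==> snd (z i) \<in> Za (s + real i * h)"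
 shows "norm (gsum s h n z) <= h * (\<Sum>i<n. norm (fst (z i))) + sqrt (h * (\<Sum>i<n. (norm (snd (z i)))\<^sup>2))"
proof -
 have "gsum s h n z = h *\<^sub>R (\<Sum>i<n. fst (z i)) + (\<Sum>i<n. C (s + real i * h) h (snd (z i)))"
  by (simp add: gsum_def inc_def sum.distrib scaleR_sum_right)
 then have "norm (gsum s h n z) <= h * norm (\<Sum>i<n. fst (z i)) + norm (\<Sum>i<n. C (s + real i * h) h (snd (z i)))"
  using norm_triangle_ineq h by (metis abs_of_nonneg norm_scaleR)
 also have "norm (\<Sum>i<n. C (s + real i * h) h (snd (z i))) <= sqrt (h * (\<Sum>i<n. (norm (snd (z i)))\<^sup>2))"
  using martingale_sum[of s h n "%i. snd (z i)"] s h q by (intro real_le_rsqrt) auto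
 also have "h * norm (\<Sum>i<n. fst (z i)) <= h * (\<Sum>i<n. norm (fst (z i)))"
  by (rule mult_left_mono[OF norm_sum h])
 finally show ?thesis by simp
qed

lemma gsum_norm_const:
 assumes s: "0 <= s" and h: "0 <= h" and q: "!!i. i < n ==> snd (z i) \<in> Za (s + real i * h)"
  and B: "!!i. i < n ==> norm (fst (z i)) <= B" "!!i. i < n ==> norm (snd (z i)) <= B" and B0: "0 <= B"
 shows "norm (gsum s h n z) <= (real n * h + sqrt (real n * h)) * B"
proof -
 have "(\<Sum>i<n. norm (fst (z i))) <= real n * B" using sum_bounded_above[of "{..<n}" "%i. norm (fst (z i))" B] B by simp
 moreover have "(\<Sum>i<n. (norm (snd (z i)))\<^sup>2) <= real n * B\<^sup>2"
  using sum_bounded_above[of "{..<n}" "%i. (norm (snd (z i)))\<^sup>2" "B\<^sup>2"] B by (simp add: power_mono)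
 ultimately have "h * (\<Sum>i<n. norm (fst (z i))) + sqrt (h * (\<Sum>i<n. (norm (snd (z i)))\<^sup>2)) <= h * (real n * B) + sqrt (h * (real n * B\<^sup>2))"
  using h by (intro add_mono real_sqrt_le_mono mult_left_mono)
 also have "sqrt (h * (real n * B\<^sup>2)) = sqrt (real n * h) * B" using B0 by (simp add: real_sqrt_mult mult_ac)
 finally show ?thesis using gsum_norm[OF s h, of n z] q by (simp add: algebra_simps)
qed

lemma gsum_in:
 assumes s: "0 <= s" and h: "0 <= h" and q: "!!i. i < n ==> fst (z i) \<in> Ha (s + real i * h) \<and> snd (z i) \<in> Za (s + real i * h)"
 shows "gsum s h n z \<in> Ha (s + real n * h)"
proof -
 have t: "0 <= s + real n * h" using s h by simp
 note sub = csubspaceD[OF Ha(1)[OF t]]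
 have "fst (z i) \<in> Ha (s + real n * h)" if "i < n" for i
  by (rule Ha(3)[of "s + real i * h"]) (use q[OF that] that s h in \<open>auto intro: mult_right_mono\<close>)
 then have "(\<Sum>i<n. h *\<^sub>R fst (z i)) \<in> Ha (s + real n * h)"
  by (intro csubspace_sum[OF Ha(1)[OF t]] sub(4)) auto
 moreover have "(\<Sum>i<n. C (s + real i * h) h (snd (z i))) \<in> Ha (s + real n * h)"
  using martingale_sum[of s h n "%i. snd (z i)"] s h q by auto
 ultimately show ?thesis using sub(2) by (simp add: gsum_def inc_def sum.distrib)
qed

lemma C_split:
 assumes s: "0 <= s" and d: "0 <= d" and z: "z \<in> Za s"
 shows "C s (real r * d) z = (\<Sum>j<r. C (s + real j * d) d z)"
proof (induction r)
 case 0
 show ?case using C_norm[OF s order_refl, of z] by simp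
next
 case (Suc r)
 have "C s (real r * d + d) z = C s (real r * d) z + C (s + real r * d) d z"
  by (rule C_add[OF s _ d z]) (use d in simp)
 then show ?case using Suc by (simp add: algebra_simps)
qed

text \<open>Subdividing the cells while the integrand stays frozen at the coarse points changes
  nothing, by additivity of the increments.\<close>

lemma gsum_refine:
 assumes s: "0 <= s" and h: "0 <= h" and q: "!!i. i < n ==> snd (z i) \<in> Za (s + real i * h)" and r: "0 < r"
 shows "gsum s h n z = gsum s (h / real r) (n * r) (%i. z (i div r))"
proof -
 let ?d = "h / real r"
 have "(\<Sum>i\<in>{m * r..<m * r + r}. inc (s + real i * ?d) ?d (z (i div r))) = inc (s + real m * h) h (z m)" if m: "m < n" for m
 proof -
  have t: "0 <= s + real m * h" using s h by simp
  have pos: "s + real (m * r + j) * ?d = s + real m * h + real j * ?d" for j using r by (simp add: field_simps)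
  have "(\<Sum>i\<in>{m * r..<m * r + r}. inc (s + real i * ?d) ?d (z (i div r))) = (\<Sum>j<r. inc (s + real (m * r + j) * ?d) ?d (z ((m * r + j) div r)))"
   unfolding sum.atLeastLessThan_shift_0[of _ "m * r"] by (simp add: atLeast0LessThan)
  also have "\<dots> = (\<Sum>j<r. inc (s + real m * h + real j * ?d) ?d (z m))"
   unfolding pos by (intro sum.cong refl) simp
  also have "\<dots> = inc (s + real m * h) h (z m)"
   using C_split[OF t _ q[OF m], of ?d r] r h by (simp add: inc_def sum.distrib sum_constant_scaleR)
  finally show ?thesis .
 qed
 then have "gsum s h n z = (\<Sum>m<n. \<Sum>i\<in>{m * r..<m * r + r}. inc (s + real i * ?d) ?d (z (i div r)))"
  by (simp add: gsum_def)
 then show ?thesis by (simp add: gsum_def sum.nat_group)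
qed

definition adp :: "(real => 'e \<times> 'z) => bool" where
 "adp z \<longleftrightarrow> (\<forall>s\<ge>0. fst (z s) \<in> Ha s \<and> snd (z s) \<in> Za s)"

abbreviation rsum :: "real => real => nat => (real => 'e \<times> 'z) => 'e" where
 "rsum s h n z \<equiv> gsum s h n (%i. z (s + real i * h))"

text \<open>After refining with frozen integrand, the difference is a single sum over the fine grid
  of oscillations within cells of length \<open>h\<close>. Drift contributes the length of the
  interval, noise its square root.\<close>

lemma rsum_refine:
 assumes s: "0 <= s" and h: "0 <= h" and z: "adp z" and r: "0 < r" and \<epsilon>: "0 <= \<epsilon>" and T: "s + real n * h <= T"
  and osc: "!!x y. 0 <= x ==> x <= T ==> 0 <= y ==> y <= T ==> \<bar>x - y\<bar> <= h ==> norm (z x - z y) <= \<epsilon>"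
 shows "norm (rsum s h n z - rsum s (h / real r) (n * r) z) <= (T + sqrt T) * \<epsilon>"
proof -
 let ?d = "h / real r"
 have d: "0 <= ?d" using h by simp
 have pos: "0 <= s + real i * h" "0 <= s + real i * ?d" for i using s h by auto
 have ad: "fst (z t) \<in> Ha t" "snd (z t) \<in> Za t" if "0 <= t" for t using z that by (auto simp: adp_def)
 have dv: "real (i div r) * h <= real i * ?d" "real i * ?d <= real (i div r) * h + h" if "i < n * r" for i
 proof -
  have i: "real i = real (i div r) * real r + real (i mod r)" by (metis div_mult_mod_eq of_nat_add of_nat_mult)
  have "real (i mod r) <= real r" using r by (simp add: less_imp_le)
  then have m: "real (i mod r) * ?d <= h" using h r by (simp add: divide_le_eq mult_mono mult.commute)
  have m0: "0 <= real (i mod r) * ?d" by (rule mult_nonneg_nonneg[OF of_nat_0_le_iff d])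
  have "real i * ?d = real (i div r) * h + real (i mod r) * ?d" using r unfolding i by (simp add: field_simps)
  then show "real (i div r) * h <= real i * ?d" "real i * ?d <= real (i div r) * h + h" using m m0 by linarith+
 qed
 have "rsum s h n z = gsum s ?d (n * r) (%i. z (s + real (i div r) * h))"
  by (rule gsum_refine[OF s h _ r]) (use ad pos in auto)
 then have "rsum s h n z - rsum s ?d (n * r) z = gsum s ?d (n * r) (%i. z (s + real (i div r) * h) - z (s + real i * ?d))"
  by (simp add: gsum_lin(1)[OF s d])
 also have "norm \<dots> <= (real (n * r) * ?d + sqrt (real (n * r) * ?d)) * \<epsilon>"
 proof (rule gsum_norm_const[OF s d _ _ _ \<epsilon>])
  fix i assume i: "i < n * r"
  have "snd (z (s + real (i div r) * h)) \<in> Za (s + real i * ?d)"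
   by (rule Za(2)[OF pos(1) _ ad(2)[OF pos(1)]]) (use dv[OF i] in simp)
  then show "snd (z (s + real (i div r) * h) - z (s + real i * ?d)) \<in> Za (s + real i * ?d)"
   using csubspace_diff[OF Za(1)[OF pos(2)] _ ad(2)[OF pos(2)]] by simp
  have "real i * ?d <= real (n * r) * ?d" using i d by (intro mult_right_mono of_nat_mono) auto
  then have "s + real i * ?d <= T" using T r by simp
  moreover then have "s + real (i div r) * h <= T" using dv[OF i] by simp
  ultimately have n: "norm (z (s + real (i div r) * h) - z (s + real i * ?d)) <= \<epsilon>"
   by (intro osc pos) (use dv[OF i] in \<open>auto simp: abs_le_iff\<close>)
  show "norm (fst (z (s + real (i div r) * h) - z (s + real i * ?d))) <= \<epsilon>" "norm (snd (z (s + real (i div r) * h) - z (s + real i * ?d))) <= \<epsilon>"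
   using norm_components[OF n] by blast+
 qed
 also have "\<dots> <= (T + sqrt T) * \<epsilon>"
  using T s r \<epsilon> by (intro mult_right_mono add_mono real_sqrt_le_mono) auto
 finally show ?thesis .
qed

abbreviation idx :: "nat => real => nat" where "idx M t \<equiv> nat \<lfloor>t * 2 ^ M\<rfloor>"

lemma idx_bounds:
 assumes "0 <= t" shows "real (idx M t) <= t * 2 ^ M" "t * 2 ^ M < real (idx M t) + 1"
 using assms by (simp_all add: floor_correct)

lemma idx_time:
 assumes "0 <= t" shows "real (idx M t) * (1 / 2 ^ M) <= t" "t < real (idx M t) * (1 / 2 ^ M) + 1 / 2 ^ M"
 using idx_bounds[OF assms, of M] by (simp_all add: field_simps)

abbreviation R :: "(real => 'e \<times> 'z) => nat => real => 'e" where
 "R z M t \<equiv> rsum 0 (1 / 2 ^ M) (idx M t) z"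

text \<open>The coarse grid stops short of \<open>t\<close> by up to one coarse cell, so besides the
  refinement error there are up to \<open>r\<close> surplus fine cells; they account for the term
  with \<open>B\<close>.\<close>

lemma R_cauchy:
 assumes z: "adp z" and t: "0 <= t" "t <= T" and \<epsilon>: "0 <= \<epsilon>" and M: "M <= M'"
  and osc: "!!x y. 0 <= x ==> x <= T ==> 0 <= y ==> y <= T ==> \<bar>x - y\<bar> <= 1 / 2 ^ M ==> norm (z x - z y) <= \<epsilon>"
  and B: "!!x. 0 <= x ==> x <= T ==> norm (z x) <= B"
 shows "norm (R z M t - R z M' t) <= (T + sqrt T) * \<epsilon> + (1 / 2 ^ M + sqrt (1 / 2 ^ M)) * B"
proof -
 define r :: nat where "r = 2 ^ (M' - M)"
 let ?n = "idx M t" and ?n' = "idx M' t" and ?h = "1 / 2 ^ M :: real" and ?h' = "1 / 2 ^ M' :: real"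
 have r: "0 < r" by (simp add: r_def)
 have pw: "2 ^ M' = (2::real) ^ M * real r" using M by (simp add: r_def flip: power_add)
 have hr: "?h' = ?h / real r" by (simp add: pw)
 have B0: "0 <= B" using order_trans[OF norm_ge_zero B[of 0]] t by simp
 have "real (?n * r) <= t * 2 ^ M * real r" using idx_bounds(1)[OF t(1), of M] r by (simp add: mult_right_mono)
 also have "\<dots> < real ?n' + 1" using idx_bounds(2)[OF t(1), of M'] by (simp add: pw mult.assoc)
 finally have le: "?n * r <= ?n'" by linarith
 have "real ?n' <= t * 2 ^ M * real r" using idx_bounds(1)[OF t(1), of M'] by (simp add: pw mult.assoc)
 also have "\<dots> <= (real ?n + 1) * real r" using idx_bounds(2)[OF t(1), of M] by (intro mult_right_mono) auto
 finally have up: "real (?n' - ?n * r) <= real r" using le by (simp add: of_nat_diff algebra_simps)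
 let ?k = "?n' - ?n * r"
 have "R z M' t = gsum 0 ?h' (?n * r + ?k) (%i. z (0 + real i * ?h'))" using le by simp
 also have "\<dots> = rsum 0 ?h' (?n * r) z + gsum (0 + real (?n * r) * ?h') ?h' ?k (%i. z (0 + real (?n * r + i) * ?h'))"
  by (rule gsum_append)
 finally have R': "R z M' t = rsum 0 ?h' (?n * r) z + gsum (0 + real (?n * r) * ?h') ?h' ?k (%i. z (0 + real (?n * r + i) * ?h'))" .
 have 1: "norm (R z M t - rsum 0 ?h' (?n * r) z) <= (T + sqrt T) * \<epsilon>"
  unfolding hr by (rule rsum_refine[OF order_refl _ z r \<epsilon> _ osc]) (use idx_time(1)[OF t(1), of M] t in auto)
 have 2: "norm (gsum (0 + real (?n * r) * ?h') ?h' ?k (%i. z (0 + real (?n * r + i) * ?h'))) <= (real ?k * ?h' + sqrt (real ?k * ?h')) * B"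
 proof (rule gsum_norm_const[OF _ _ _ _ _ B0])
  fix i assume i: "i < ?k"
  have e: "0 + real (?n * r) * ?h' + real i * ?h' = 0 + real (?n * r + i) * ?h'" by (simp add: algebra_simps add_divide_distrib)
  show "snd (z (0 + real (?n * r + i) * ?h')) \<in> Za (0 + real (?n * r) * ?h' + real i * ?h')"
   unfolding e using z by (auto simp: adp_def)
  have "?n * r + i <= ?n'" using i le by linarith
  then have "real (?n * r + i) * ?h' <= real ?n' * ?h'" by (intro mult_right_mono of_nat_mono) auto
  also have "\<dots> <= T" using idx_time(1)[OF t(1), of M'] t by simp
  finally have n: "norm (z (0 + real (?n * r + i) * ?h')) <= B" by (intro B) auto
  show "norm (fst (z (0 + real (?n * r + i) * ?h'))) <= B" "norm (snd (z (0 + real (?n * r + i) * ?h'))) <= B"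
   using norm_components[OF n] by blast+
 qed auto
 have "real ?k * ?h' <= real r * ?h'" by (rule mult_right_mono[OF up]) simp
 then have "real ?k * ?h' <= ?h" using r by (simp add: hr)
 then have "(real ?k * ?h' + sqrt (real ?k * ?h')) * B <= (?h + sqrt ?h) * B"
  using B0 by (intro mult_right_mono add_mono real_sqrt_le_mono) auto
 with 1 2 show ?thesis unfolding R' using norm_triangle_ineq4[of "R z M t - rsum 0 ?h' (?n * r) z" "gsum (0 + real (?n * r) * ?h') ?h' ?k (%i. z (0 + real (?n * r + i) * ?h'))"]
  by (simp add: algebra_simps)
qed

section \<open>The stochastic integral\<close>

text \<open>The integral of \<open>fst z\<close> against time plus the integral of
  \<open>snd z\<close> against the creation process.\<close>

definition I :: "(real => 'e \<times> 'z) => real => 'e" where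
 "I z t = lim (%M. R z M t)"

lemma modulus:
 fixes z :: "real => 'e \<times> 'z"
 assumes c: "continuous_on {0..} z" and \<epsilon>: "0 < \<epsilon>"
 obtains N where "!!M x y. N <= M ==> 0 <= x ==> x <= T ==> 0 <= y ==> y <= T ==> \<bar>x - y\<bar> <= 1 / 2 ^ M ==> norm (z x - z y) <= \<epsilon>"
proof -
 have "uniformly_continuous_on {0..T} z"
  by (rule compact_uniformly_continuous[OF continuous_on_subset[OF c]]) auto
 then obtain d where d: "d > 0" "!!x y. x \<in> {0..T} ==> y \<in> {0..T} ==> dist y x < d ==> dist (z y) (z x) < \<epsilon>"
  unfolding uniformly_continuous_on_def using \<epsilon> by metis
 obtain N where N: "(1 / 2 :: real) ^ N < d" using real_arch_pow_inv[OF d(1), of "1/2"] by auto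
 show thesis
 proof (rule that[of N])
  fix M x y assume "N <= M" "0 <= x" "x <= T" "0 <= y" "y <= T" "\<bar>x - y\<bar> <= 1 / 2 ^ M"
  moreover have "(1 / 2 :: real) ^ M <= (1 / 2) ^ N" by (rule power_decreasing[OF \<open>N <= M\<close>]) auto
  ultimately show "norm (z x - z y) <= \<epsilon>" using N d(2)[of y x] by (auto simp: dist_norm power_one_over)
 qed
qed

lemma bound_on:
 fixes z :: "real => 'b::real_normed_vector"
 assumes c: "continuous_on {0..} z"
 obtains B where "0 < B" "!!x. 0 <= x ==> x <= T ==> norm (z x) <= B"
proof -
 have "bounded (z ` {0..T})"
  by (rule compact_imp_bounded[OF compact_continuous_image[OF continuous_on_subset[OF c]]]) auto
 then obtain B where "!!x. x \<in> z ` {0..T} ==> norm x <= B" "0 < B" unfolding bounded_pos by blast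
 then show thesis using that[of B] by auto
qed

lemma R_tendsto:
 assumes z: "adp z" and c: "continuous_on {0..} z" and t: "0 <= t"
 shows "(%M. R z M t) \<longlonglongrightarrow> I z t"
proof -
 obtain B where B: "0 < B" "!!x. 0 <= x ==> x <= t ==> norm (z x) <= B" using bound_on[OF c, where T = t] by blast
 have "Cauchy (%M. R z M t)"
 proof (rule metric_CauchyI)
  fix e :: real assume e: "0 < e"
  define D where "D = t + sqrt t + 1"
  let ?\<epsilon> = "e / 4 / D"
  have p: "0 < D" using t by (simp add: D_def add_nonneg_pos)
  then have \<epsilon>: "0 < ?\<epsilon>" using e by simp
  obtain N where N: "!!M x y. N <= M ==> 0 <= x ==> x <= t ==> 0 <= y ==> y <= t ==> \<bar>x - y\<bar> <= 1 / 2 ^ M ==> norm (z x - z y) <= ?\<epsilon>"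
   using modulus[OF c \<epsilon>, where T = t] by blast
  have "(%M. ((1 / 2) ^ M + sqrt ((1 / 2) ^ M)) * B) \<longlonglongrightarrow> (0 + sqrt 0) * B"
   by (intro tendsto_intros LIMSEQ_power_zero) auto
  then have "\<forall>\<^sub>F M in sequentially. ((1 / 2) ^ M + sqrt ((1 / 2) ^ M)) * B < e / 4"
   using e by (intro order_tendstoD) auto
  then obtain N' where N': "!!M. N' <= M ==> ((1 / 2) ^ M + sqrt ((1 / 2) ^ M)) * B < e / 4"
   unfolding eventually_sequentially by blast
  let ?M = "max N N'"
  have "(t + sqrt t) * ?\<epsilon> <= D * ?\<epsilon>" using \<epsilon> by (intro mult_right_mono) (auto simp: D_def)
  also have "\<dots> = e / 4" using p by simp
  finally have q: "(t + sqrt t) * ?\<epsilon> <= e / 4" .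
  have "norm (R z ?M t - R z m t) < e / 2" if "?M <= m" for m
  proof -
   have "norm (R z ?M t - R z m t) <= (t + sqrt t) * ?\<epsilon> + (1 / 2 ^ ?M + sqrt (1 / 2 ^ ?M)) * B"
    by (rule R_cauchy[OF z t order_refl less_imp_le[OF \<epsilon>] that N B(2)]) auto
   with q N'[of ?M, unfolded power_one_over] show ?thesis by linarith
  qed
  then have d: "dist (R z m t) (R z ?M t) < e / 2" if "?M <= m" for m using that by (simp add: dist_norm norm_minus_commute)
  show "\<exists>M. \<forall>m\<ge>M. \<forall>n\<ge>M. dist (R z m t) (R z n t) < e"
  proof (intro exI[of _ ?M] allI impI)
   fix m n assume "?M <= m" "?M <= n"
   from d[OF this(1)] d[OF this(2)] show "dist (R z m t) (R z n t) < e"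
    using dist_triangle2[of "R z m t" "R z n t" "R z ?M t"] by linarith
  qed
 qed
 then show ?thesis unfolding I_def using Cauchy_convergent_iff convergent_LIMSEQ_iff by blast
qed

lemma rsum_in:
 assumes z: "adp z" and s: "0 <= s" and h: "0 <= h" shows "rsum s h n z \<in> Ha (s + real n * h)"
 by (rule gsum_in[OF s h]) (use z s h in \<open>auto simp: adp_def\<close>)

lemma I_in:
 assumes z: "adp z" "continuous_on {0..} z" and t: "0 <= t" shows "I z t \<in> Ha t"
proof (rule Lim_in_closed_set[OF Ha(2)[OF t] _ _ R_tendsto[OF z t]])
 show "\<forall>\<^sub>F M in sequentially. R z M t \<in> Ha t"
 proof (rule always_eventually, rule allI)
  fix M
  show "R z M t \<in> Ha t"
   by (rule Ha(3)[OF _ _ rsum_in[OF z(1)]]) (use idx_time(1)[OF t, of M] in auto)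
 qed
qed simp

lemma I_diff:
 assumes z: "adp z" "continuous_on {0..} z" and w: "adp w" "continuous_on {0..} w" and t: "0 <= t"
  and zw: "adp (%s. z s - w s)"
 shows "I (%s. z s - w s) t = I z t - I w t"
proof (rule LIMSEQ_unique)
 show "(%M. R (%s. z s - w s) M t) \<longlonglongrightarrow> I (%s. z s - w s) t"
  by (rule R_tendsto[OF zw _ t]) (intro continuous_on_diff z w)
 show "(%M. R (%s. z s - w s) M t) \<longlonglongrightarrow> I z t - I w t"
  using tendsto_diff[OF R_tendsto[OF z t] R_tendsto[OF w t]] by (simp add: gsum_lin)
qed

lemma exp_sum:
 fixes \<mu> h :: real
 assumes "0 < \<mu>" "0 <= h" shows "h * (\<Sum>i<n. exp (\<mu> * (real i * h))) <= exp (\<mu> * (real n * h)) / \<mu>"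
proof (induction n)
 case (Suc n)
 have "h * (\<Sum>i<Suc n. exp (\<mu> * (real i * h))) <= exp (\<mu> * (real n * h)) / \<mu> + h * exp (\<mu> * (real n * h))"
  using Suc by (simp add: distrib_left)
 also have "\<dots> = exp (\<mu> * (real n * h)) * (1 + \<mu> * h) / \<mu>" using assms by (simp add: field_simps)
 also have "\<dots> <= exp (\<mu> * (real n * h)) * exp (\<mu> * h) / \<mu>"
  using assms by (intro divide_right_mono mult_left_mono) auto
 also have "\<dots> = exp (\<mu> * (real (Suc n) * h)) / \<mu>" by (simp add: algebra_simps flip: exp_add)
 finally show ?case .
qed (use assms in simp)

text \<open>An estimate in an exponentially weighted norm: integration gains
  \<open>1 / \<mu>\<close> from the drift and, since noise is controlled in mean square,
  \<open>1 / sqrt (2 * \<mu>)\<close> from the noise. A large weight thus yields a contraction on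
  the whole half-line.\<close>

lemma I_weight:
 assumes z: "adp z" "continuous_on {0..} z" and t: "0 <= t" and \<mu>: "0 < \<mu>" and a: "0 <= a"
  and bd: "!!s. 0 <= s ==> norm (fst (z s)) <= a * exp (\<mu> * s) \<and> norm (snd (z s)) <= a * exp (\<mu> * s)"
 shows "norm (I z t) <= (1 / \<mu> + 1 / sqrt (2 * \<mu>)) * (a * exp (\<mu> * t))"
proof (rule LIMSEQ_le_const2[OF tendsto_norm[OF R_tendsto[OF z t]]], intro exI allI impI)
 fix M
 let ?h = "1 / 2 ^ M :: real" and ?n = "idx M t"
 have "norm (R z M t) <= ?h * (\<Sum>i<?n. norm (fst (z (0 + real i * ?h)))) + sqrt (?h * (\<Sum>i<?n. (norm (snd (z (0 + real i * ?h))))\<^sup>2))"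
  by (rule gsum_norm) (use z in \<open>auto simp: adp_def\<close>)
 also have "?h * (\<Sum>i<?n. norm (fst (z (0 + real i * ?h)))) <= ?h * (\<Sum>i<?n. a * exp (\<mu> * (real i * ?h)))"
 proof (intro mult_left_mono sum_mono)
  show "norm (fst (z (0 + real i * ?h))) <= a * exp (\<mu> * (real i * ?h))" for i using bd[of "real i * ?h"] by simp
 qed simp
 also have "\<dots> = a * (?h * (\<Sum>i<?n. exp (\<mu> * (real i * ?h))))"
  unfolding sum_distrib_left[of a, symmetric] by (rule mult.left_commute)
 also have "\<dots> <= a * (exp (\<mu> * (real ?n * ?h)) / \<mu>)"
  by (rule mult_left_mono[OF exp_sum a]) (use \<mu> in auto)
 also have "\<dots> <= a * (exp (\<mu> * t) / \<mu>)"
  by (rule mult_left_mono[OF divide_right_mono[OF iffD2[OF exp_le_cancel_iff mult_left_mono[OF idx_time(1)[OF t, of M]]]]]) (use \<mu> a in auto)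
 also have "sqrt (?h * (\<Sum>i<?n. (norm (snd (z (0 + real i * ?h))))\<^sup>2)) <= sqrt (a\<^sup>2 * (exp (2 * \<mu> * t) / (2 * \<mu>)))"
 proof (rule real_sqrt_le_mono)
  have "(norm (snd (z (0 + real i * ?h))))\<^sup>2 <= a\<^sup>2 * exp (2 * \<mu> * (real i * ?h))" for i
  proof -
   have "(norm (snd (z (0 + real i * ?h))))\<^sup>2 <= (a * exp (\<mu> * (real i * ?h)))\<^sup>2"
    using bd[of "real i * ?h"] by (intro power_mono) auto
   then show ?thesis by (simp add: power_mult_distrib exp_double[symmetric] mult.assoc)
  qed
  then have "?h * (\<Sum>i<?n. (norm (snd (z (0 + real i * ?h))))\<^sup>2) <= ?h * (\<Sum>i<?n. a\<^sup>2 * exp (2 * \<mu> * (real i * ?h)))"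
   by (intro mult_left_mono sum_mono) auto
  also have "\<dots> = a\<^sup>2 * (?h * (\<Sum>i<?n. exp (2 * \<mu> * (real i * ?h))))"
   unfolding sum_distrib_left[of "a\<^sup>2", symmetric] by (rule mult.left_commute)
  also have "\<dots> <= a\<^sup>2 * (exp (2 * \<mu> * (real ?n * ?h)) / (2 * \<mu>))"
   by (rule mult_left_mono[OF exp_sum]) (use \<mu> in auto)
  also have "\<dots> <= a\<^sup>2 * (exp (2 * \<mu> * t) / (2 * \<mu>))"
   by (rule mult_left_mono[OF divide_right_mono[OF iffD2[OF exp_le_cancel_iff mult_left_mono[OF idx_time(1)[OF t, of M]]]]]) (use \<mu> in auto)
  finally show "?h * (\<Sum>i<?n. (norm (snd (z (0 + real i * ?h))))\<^sup>2) <= a\<^sup>2 * (exp (2 * \<mu> * t) / (2 * \<mu>))" .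
 qed
 also have "sqrt (a\<^sup>2 * (exp (2 * \<mu> * t) / (2 * \<mu>))) = a * (exp (\<mu> * t) / sqrt (2 * \<mu>))"
 proof -
  have "exp (2 * \<mu> * t) = (exp (\<mu> * t))\<^sup>2" by (simp add: exp_double[symmetric] mult.assoc)
  then show ?thesis using a by (simp add: real_sqrt_mult real_sqrt_divide)
 qed
 finally show "norm (R z M t) <= (1 / \<mu> + 1 / sqrt (2 * \<mu>)) * (a * exp (\<mu> * t))" by (simp add: algebra_simps)
qed

lemma idx_mono: "s <= t ==> idx M s <= idx M t"
 by (intro nat_mono floor_mono mult_right_mono) auto

lemma R_diff:
 assumes "s <= t"
 shows "R z M t - R z M s = rsum (real (idx M s) * (1 / 2 ^ M)) (1 / 2 ^ M) (idx M t - idx M s) z"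
 using gsum_append[of 0 "1 / 2 ^ M" "idx M s" "idx M t - idx M s" "%i. z (0 + real i * (1 / 2 ^ M))"] idx_mono[OF assms, of M]
 by (simp add: add_divide_distrib)

lemma I_increment:
 assumes z: "adp z" "continuous_on {0..} z" and s: "0 <= s" "s <= t" and B: "!!x. 0 <= x ==> x <= t ==> norm (z x) <= B"
 shows "norm (I z t - I z s) <= ((t - s) + sqrt (t - s)) * B"
proof -
 have t: "0 <= t" using s by simp
 have B0: "0 <= B" using order_trans[OF norm_ge_zero B[of 0]] t by simp
 have le: "norm (R z M t - R z M s) <= ((t - s + (1/2) ^ M) + sqrt (t - s + (1/2) ^ M)) * B" for M
 proof -
  let ?h = "1 / 2 ^ M :: real" and ?n = "idx M s" and ?k = "idx M t - idx M s"
  have "norm (R z M t - R z M s) <= (real ?k * ?h + sqrt (real ?k * ?h)) * B"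
   unfolding R_diff[OF s(2)]
  proof (rule gsum_norm_const[OF _ _ _ _ _ B0])
   fix i assume i: "i < ?k"
   show "snd (z (real ?n * ?h + real i * ?h)) \<in> Za (real ?n * ?h + real i * ?h)"
    using z by (auto simp: adp_def)
   have "?n + i <= idx M t" using i by linarith
   then have "real (?n + i) * ?h <= real (idx M t) * ?h" by (intro mult_right_mono of_nat_mono) auto
   also have "\<dots> <= t" by (rule idx_time(1)[OF t])
   finally have n: "norm (z (real ?n * ?h + real i * ?h)) <= B" by (intro B) (auto simp: add_divide_distrib)
   show "norm (fst (z (real ?n * ?h + real i * ?h))) <= B" "norm (snd (z (real ?n * ?h + real i * ?h))) <= B"
    using norm_components[OF n] by blast+
  qed auto
  also have "real ?k * ?h <= t - s + (1/2) ^ M"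
  proof -
   have "real ?k * ?h = real (idx M t) * ?h - real ?n * ?h" using idx_mono[OF s(2), of M] by (simp add: of_nat_diff diff_divide_distrib)
   then show ?thesis using idx_time[OF t, of M] idx_time[OF s(1), of M] by (simp add: power_one_over)
  qed
  finally show ?thesis using B0 by (simp add: mult_right_mono add_mono)
 qed
 have "(%M. ((t - s + (1/2) ^ M) + sqrt (t - s + (1/2) ^ M)) * B) \<longlonglongrightarrow> ((t - s + 0) + sqrt (t - s + 0)) * B"
  by (intro tendsto_intros LIMSEQ_power_zero) auto
 from LIMSEQ_le[OF tendsto_norm[OF tendsto_diff[OF R_tendsto[OF z t] R_tendsto[OF z s(1)]]] this] le show ?thesis by simp
qed

lemma I_continuous:
 assumes z: "adp z" "continuous_on {0..} z" shows "continuous_on {0..} (I z)"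
 unfolding continuous_on
proof
 fix x :: real assume x: "x \<in> {0..}"
 obtain B where B: "0 < B" "!!y. 0 <= y ==> y <= x + 1 ==> norm (z y) <= B" using bound_on[OF z(2), where T = "x + 1"] by blast
 have ev: "\<forall>\<^sub>F y in at x within {0..}. y \<in> {0..} \<and> \<bar>y - x\<bar> < 1"
  unfolding eventually_at by (intro exI[of _ 1]) (auto simp: dist_real_def)
 have "((%y. I z y - I z x) \<longlongrightarrow> 0) (at x within {0..})"
 proof (rule Lim_null_comparison)
  show "\<forall>\<^sub>F y in at x within {0..}. norm (I z y - I z x) <= (\<bar>y - x\<bar> + sqrt \<bar>y - x\<bar>) * B"
   using ev
  proof eventually_elim
   case (elim y)
   show ?case
   proof (cases "x <= y")
    case True
    then show ?thesis using I_increment[OF z, of x y B] B(2) x elim by auto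
   next
    case False
    then show ?thesis using I_increment[OF z, of y x B] B(2) x elim by (auto simp: norm_minus_commute abs_minus_commute)
   qed
  qed
  have "((%y. (\<bar>y - x\<bar> + sqrt \<bar>y - x\<bar>) * B) \<longlongrightarrow> (\<bar>x - x\<bar> + sqrt \<bar>x - x\<bar>) * B) (at x within {0..})"
   by (intro tendsto_intros)
  then show "((%y. (\<bar>y - x\<bar> + sqrt \<bar>y - x\<bar>) * B) \<longlongrightarrow> 0) (at x within {0..})" by simp
 qed
 then show "(I z \<longlongrightarrow> I z x) (at x within {0..})" by (rule LIM_zero_cancel)
qed

lemma real_power_diff: "m <= M ==> real (2 ^ (M - m)) = 2 ^ M / 2 ^ m"
 by (simp only: of_nat_power) (simp add: power_diff)

lemma idx_dyadic:
 assumes "m <= M" shows "idx M (real q / 2 ^ m) = q * 2 ^ (M - m)"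
proof -
 have "real q / 2 ^ m * 2 ^ M = real (q * 2 ^ (M - m))"
  using real_power_diff[OF assms] by (simp only: of_nat_mult) simp
 then show ?thesis by (simp only: floor_of_nat nat_int)
qed

text \<open>As \<open>s\<close> is dyadic, \<open>s\<close> and all partition points lie on every
  sufficiently fine grid; the integral is then compared with the sum without surplus cells.\<close>

lemma I_riemann:
 assumes z: "adp z" "continuous_on {0..} z" and s: "s = real q / 2 ^ m" and T: "s + real n * (1 / 2 ^ k) <= T" and \<epsilon>: "0 <= \<epsilon>"
  and osc: "!!x y. 0 <= x ==> x <= T ==> 0 <= y ==> y <= T ==> \<bar>x - y\<bar> <= 1 / 2 ^ k ==> norm (z x - z y) <= \<epsilon>"
 shows "norm (I z (s + real n * (1 / 2 ^ k)) - I z s - rsum s (1 / 2 ^ k) n z) <= (T + sqrt T) * \<epsilon>"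
proof -
 let ?t = "s + real n * (1 / 2 ^ k)"
 have s0: "0 <= s" "0 <= ?t" "s <= ?t" using s by auto
 have "norm (R z M ?t - R z M s - rsum s (1 / 2 ^ k) n z) <= (T + sqrt T) * \<epsilon>" if M: "m + k <= M" for M
 proof -
  define r :: nat where "r = 2 ^ (M - k)"
  have r: "0 < r" by (simp add: r_def)
  have h: "1 / 2 ^ M = 1 / 2 ^ k / (real r :: real)" using real_power_diff[of k M] M by (simp add: r_def)
  have i1: "idx M s = q * 2 ^ (M - m)" unfolding s by (rule idx_dyadic) (use M in simp)
  have "?t = real (q * 2 ^ k + n * 2 ^ m) / 2 ^ (m + k)" by (simp add: s power_add field_simps)
  then have "idx M ?t = (q * 2 ^ k + n * 2 ^ m) * 2 ^ (M - (m + k))" using idx_dyadic[OF M] by metis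
  also have "\<dots> = q * 2 ^ (k + (M - (m + k))) + n * 2 ^ (m + (M - (m + k)))" by (simp add: algebra_simps power_add)
  also have "k + (M - (m + k)) = M - m" using M by simp
  also have "m + (M - (m + k)) = M - k" using M by simp
  finally have i2: "idx M ?t = idx M s + n * r" unfolding i1 r_def .
  have "real (q * 2 ^ (M - m)) * (1 / 2 ^ M) = s"
   unfolding s of_nat_mult using real_power_diff[of m M] M by simp
  then have st: "real (idx M s) * (1 / 2 ^ M) = s" by (simp only: i1)
  have "idx M ?t - idx M s = n * r" using i2 by simp
  from R_diff[OF s0(3), where z = z and M = M, unfolded st this] have d: "R z M ?t - R z M s = rsum s (1 / 2 ^ M) (n * r) z" .
  have "norm (rsum s (1 / 2 ^ k) n z - rsum s (1 / 2 ^ M) (n * r) z) <= (T + sqrt T) * \<epsilon>"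
   unfolding h by (rule rsum_refine[OF s0(1) _ z(1) r \<epsilon> T osc]) simp_all
  then show ?thesis unfolding d by (simp only: norm_minus_commute)
 qed
 then show ?thesis
  by (intro LIMSEQ_le_const2[OF tendsto_norm[OF tendsto_diff[OF tendsto_diff[OF R_tendsto[OF z s0(2)] R_tendsto[OF z s0(1)]] tendsto_const]]]) blast
qed

definition \<Lambda> :: "(real => 'e) => real => 'e \<times> 'z" where
 "\<Lambda> x s = (K s (x s), L s (x s))"

lemma \<Lambda>_adp: "(!!s. 0 <= s ==> x s \<in> Ha s) ==> adp (\<Lambda> x)"
 by (simp add: adp_def \<Lambda>_def K L)

lemma strong_continuous_apply:
 fixes T :: "real => 'e => 'b::chilbert"
 assumes x: "continuous_on {0..} x" and T: "!!s. 0 <= s ==> T s \<in> bops" "!!s y. 0 <= s ==> norm (T s y) <= \<kappa> * norm y"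
  "!!y. continuous_on {0..} (%s. T s y)"
 shows "continuous_on {0..} (%s. T s (x s))"
 unfolding continuous_on
proof
 fix t :: real assume t: "t \<in> {0..}"
 have ev: "\<forall>\<^sub>F s in at t within {0..}. 0 <= s" unfolding eventually_at_filter by (rule always_eventually) auto
 show "((%s. T s (x s)) \<longlongrightarrow> T t (x t)) (at t within {0..})"
 proof (rule bounded_strong_tendsto[where T = T and x = x and c = \<kappa>])
  show "\<forall>\<^sub>F s in at t within {0..}. T s \<in> bops \<and> (\<forall>v. norm (T s v) <= \<kappa> * norm v)"
   using ev by eventually_elim (use T in blast)
 qed (use T(3)[of "x t"] x t in \<open>auto simp: continuous_on\<close>)
qed

lemma \<Lambda>_continuous: "continuous_on {0..} x ==> continuous_on {0..} (\<Lambda> x)"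
 unfolding \<Lambda>_def[abs_def]
 by (rule continuous_on_Pair[OF strong_continuous_apply[OF _ K(1) K(3) K(4)] strong_continuous_apply[OF _ L(1) L(3) L(4)]])

text \<open>Weight for which the gains in \<open>I_weight\<close>, multiplied by \<kappa>, are at
  most 1/2: it makes \<open>sqrt (2 * rate)\<close> equal to \<open>4 * (\<kappa> + 1)\<close>.
  Adding 1 to \<kappa> keeps it positive for vanishing coefficients.\<close>

definition rate :: real where "rate = 8 * (\<kappa> + 1)\<^sup>2"

lemma rate: "0 < rate" "\<kappa> * (1 / rate + 1 / sqrt (2 * rate)) <= 1 / 2"
proof -
 have p: "0 < \<kappa> + 1" using \<kappa> by simp
 then show "0 < rate" by (simp add: rate_def)
 have "2 * rate = (4 * (\<kappa> + 1))\<^sup>2" unfolding rate_def power_mult_distrib by simp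
 then have sq: "sqrt (2 * rate) = 4 * (\<kappa> + 1)" using \<kappa> by simp
 have "\<kappa> + 1 <= (\<kappa> + 1)\<^sup>2" using \<kappa> by (simp add: power2_eq_square)
 then have "1 / rate <= 1 / (8 * (\<kappa> + 1))" unfolding rate_def using p by (intro divide_left_mono) auto
 then have "\<kappa> * (1 / rate + 1 / sqrt (2 * rate)) <= \<kappa> * (1 / (8 * (\<kappa> + 1)) + 1 / (4 * (\<kappa> + 1)))"
  unfolding sq using \<kappa> by (intro mult_left_mono) auto
 also have "\<dots> = 3 / 8 * (\<kappa> / (\<kappa> + 1))"
 proof -
  have "1 / (8 * c) + 1 / (4 * c) = 3 / 8 * (1 / c)" if "0 < c" for c :: real using that by (simp add: field_simps)
  from this[OF p] show ?thesis by simp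
 qed
 also have "\<dots> <= 1 / 2" using \<kappa> p by (simp add: field_simps)
 finally show "\<kappa> * (1 / rate + 1 / sqrt (2 * rate)) <= 1 / 2" .
qed

lemma I_contraction:
 assumes x: "continuous_on {0..} x" "!!s. 0 <= s ==> x s \<in> Ha s" and y: "continuous_on {0..} y" "!!s. 0 <= s ==> y s \<in> Ha s"
  and t: "0 <= t" and a: "0 <= a" and bd: "!!s. 0 <= s ==> norm (x s - y s) <= a * exp (rate * s)"
 shows "norm (I (\<Lambda> x) t - I (\<Lambda> y) t) <= a / 2 * exp (rate * t)"
proof -
 let ?d = "%s. x s - y s"
 have d: "continuous_on {0..} ?d" "!!s. 0 <= s ==> ?d s \<in> Ha s"
  by (rule continuous_on_diff[OF x(1) y(1)]) (rule csubspace_diff[OF Ha(1) x(2) y(2)])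
 have "adp (%s. \<Lambda> x s - \<Lambda> y s)"
  by (simp add: adp_def \<Lambda>_def csubspace_diff[OF Ha(1)] csubspace_diff[OF Za(1)] K L x y)
 from I_diff[OF \<Lambda>_adp[OF x(2)] \<Lambda>_continuous[OF x(1)] \<Lambda>_adp[OF y(2)] \<Lambda>_continuous[OF y(1)] t this]
 have "I (\<Lambda> x) t - I (\<Lambda> y) t = I (%s. \<Lambda> x s - \<Lambda> y s) t" by simp
 also have "norm \<dots> <= (1 / rate + 1 / sqrt (2 * rate)) * (\<kappa> * a * exp (rate * t))"
 proof (rule I_weight[OF \<open>adp (%s. \<Lambda> x s - \<Lambda> y s)\<close> continuous_on_diff[OF \<Lambda>_continuous[OF x(1)] \<Lambda>_continuous[OF y(1)]] t rate(1)])
  fix s :: real assume s: "0 <= s"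
  have "\<kappa> * norm (x s - y s) <= \<kappa> * a * exp (rate * s)"
   using mult_left_mono[OF bd[OF s] \<kappa>] by (simp add: mult.assoc)
  then show "norm (fst (\<Lambda> x s - \<Lambda> y s)) <= \<kappa> * a * exp (rate * s) \<and> norm (snd (\<Lambda> x s - \<Lambda> y s)) <= \<kappa> * a * exp (rate * s)"
   using K(3)[OF s, of "x s - y s"] L(3)[OF s, of "x s - y s"] by (simp add: \<Lambda>_def bops_diff K(1) L(1) s)
 qed (use \<kappa> a in simp)
 also have "\<dots> = \<kappa> * (1 / rate + 1 / sqrt (2 * rate)) * (a * exp (rate * t))" by (simp add: algebra_simps)
 also have "\<dots> <= 1 / 2 * (a * exp (rate * t))" by (rule mult_right_mono[OF rate(2)]) (use a in simp)
 finally show ?thesis by simp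
qed

section \<open>Existence of the solution by Picard iteration\<close>

fun picard :: "'e => nat => real => 'e" where
 "picard u 0 = (%t. u)"
| "picard u (Suc m) = (%t. u + I (\<Lambda> (picard u m)) t)"

definition sol :: "'e => real => 'e" where
 "sol u t = lim (%m. picard u m t)"

lemma picard:
 assumes u: "u \<in> Ha 0"
 shows "continuous_on {0..} (picard u m) \<and> (\<forall>s\<ge>0. picard u m s \<in> Ha s)"
proof (induction m)
 case 0
 show ?case using Ha(3)[OF order_refl _ u] by simp
next
 case (Suc m)
 have z: "adp (\<Lambda> (picard u m))" "continuous_on {0..} (\<Lambda> (picard u m))"
  using Suc by (auto intro: \<Lambda>_adp \<Lambda>_continuous)
 have "u + I (\<Lambda> (picard u m)) s \<in> Ha s" if "0 <= s" for s
  by (rule csubspaceD(2)[OF Ha(1)[OF that] Ha(3)[OF order_refl that u] I_in[OF z that]])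
 then show ?case using I_continuous[OF z] by (simp add: continuous_on_add)
qed

lemma picard_step:
 assumes u: "u \<in> Ha 0" and t: "0 <= t"
 shows "norm (picard u (Suc m) t - picard u m t) <= norm u * exp (rate * t) * (1 / 2) ^ Suc m"
 using t
proof (induction m arbitrary: t)
 case 0
 have z: "adp (\<Lambda> (%_. u))" "continuous_on {0..} (\<Lambda> (%_. u))"
  by (rule \<Lambda>_adp, rule Ha(3)[OF order_refl _ u], simp, rule \<Lambda>_continuous, simp)
 have "norm (I (\<Lambda> (%_. u)) t) <= (1 / rate + 1 / sqrt (2 * rate)) * (\<kappa> * norm u * exp (rate * t))"
 proof (rule I_weight[OF z 0 rate(1)])
  fix s :: real assume s: "0 <= s"
  have "\<kappa> * norm u * 1 <= \<kappa> * norm u * exp (rate * s)" using \<kappa> rate(1) s by (intro mult_left_mono) auto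
  then show "norm (fst (\<Lambda> (%_. u) s)) <= \<kappa> * norm u * exp (rate * s) \<and> norm (snd (\<Lambda> (%_. u) s)) <= \<kappa> * norm u * exp (rate * s)"
   using K(3)[OF s, of u] L(3)[OF s, of u] by (simp add: \<Lambda>_def)
 qed (use \<kappa> in simp)
 also have "\<dots> <= 1 / 2 * (norm u * exp (rate * t))"
  using mult_right_mono[OF rate(2), of "norm u * exp (rate * t)"] by (simp add: algebra_simps)
 finally show ?case by simp
next
 case (Suc m)
 have "norm (I (\<Lambda> (picard u (Suc m))) t - I (\<Lambda> (picard u m)) t) <= norm u * (1 / 2) ^ Suc m / 2 * exp (rate * t)"
  by (rule I_contraction) (use picard[OF u, of m] picard[OF u, of "Suc m"] Suc in \<open>auto simp del: picard.simps simp: mult_ac\<close>)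
 then show ?case by (simp add: mult_ac)
qed

lemma geometric_limit:
 fixes x :: "nat => 'b::banach"
 assumes step: "!!m. norm (x (Suc m) - x m) <= c * (1 / 2) ^ Suc m"
 shows "x \<longlonglongrightarrow> lim x" "norm (lim x - x m) <= c * (1 / 2) ^ m"
proof -
 have c: "0 <= c" using order_trans[OF norm_ge_zero step[of 0]] by simp
 have bd: "norm (x (m + k) - x m) <= c * (1 / 2) ^ m" for m k
 proof -
  \<comment> \<open>The factor \<open>1 - (1 / 2) ^ k\<close> makes the induction on
    \<open>k\<close> close.\<close>
  have "norm (x (m + k) - x m) <= c * (1 / 2) ^ m * (1 - (1 / 2) ^ k)"
  proof (induction k)
   case (Suc k)
   have "norm (x (m + Suc k) - x m) <= norm (x (Suc (m + k)) - x (m + k)) + norm (x (m + k) - x m)"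
    using norm_triangle_ineq[of "x (Suc (m + k)) - x (m + k)" "x (m + k) - x m"] by simp
   also have "\<dots> <= c * (1 / 2) ^ Suc (m + k) + c * (1 / 2) ^ m * (1 - (1 / 2) ^ k)"
    using Suc step[of "m + k"] by (rule add_mono[rotated])
   also have "\<dots> = c * (1 / 2) ^ m * (1 - (1 / 2) ^ Suc k)" by (simp add: power_add field_simps)
   finally show ?case .
  qed simp
  also have "\<dots> <= c * (1 / 2) ^ m * 1" using c by (intro mult_left_mono) auto
  finally show ?thesis by simp
 qed
 have "summable (%m. c * (1 / 2) ^ Suc m)" using summable_mult[OF summable_geometric[of "1 / 2 :: real"], of "c / 2"] by simp
 from summable_comparison_test'[OF this step] have "convergent (%n. x n - x 0)"
  by (simp only: summable_iff_convergent sum_lessThan_telescope)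
 then show lim: "x \<longlonglongrightarrow> lim x" by (simp add: convergent_diff_const_right_iff convergent_LIMSEQ_iff)
 have "(%k. x (m + k)) \<longlonglongrightarrow> lim x" using LIMSEQ_ignore_initial_segment[OF lim, of m] by (simp add: add.commute)
 then have "(%k. norm (x (m + k) - x m)) \<longlonglongrightarrow> norm (lim x - x m)" by (intro tendsto_intros)
 then show "norm (lim x - x m) <= c * (1 / 2) ^ m" by (rule LIMSEQ_le_const2) (use bd in auto)
qed

lemma sol:
 assumes u: "u \<in> Ha 0" and t: "0 <= t"
 shows "(%m. picard u m t) \<longlonglongrightarrow> sol u t" "norm (sol u t - picard u m t) <= norm u * exp (rate * t) * (1 / 2) ^ m"
 unfolding sol_def using geometric_limit[of "%m. picard u m t", OF picard_step[OF u t]] by blast+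

lemma sol_in:
 assumes u: "u \<in> Ha 0" and t: "0 <= t" shows "sol u t \<in> Ha t"
 by (rule Lim_in_closed_set[OF Ha(2)[OF t] _ _ sol(1)[OF u t]]) (use picard[OF u] t in auto)

lemma sol_continuous:
 assumes u: "u \<in> Ha 0" shows "continuous_on {0..} (sol u)"
proof -
 have T: "continuous_on {0..T} (sol u)" for T
 proof (rule uniform_limit_theorem[of _ "picard u"])
  show "\<forall>\<^sub>F m in sequentially. continuous_on {0..T} (picard u m)"
   by (intro always_eventually allI continuous_on_subset[OF conjunct1[OF picard[OF u]]]) auto
  show "uniform_limit {0..T} (picard u) (sol u) sequentially"
  proof (rule uniform_limitI)
   fix e :: real assume e: "0 < e"
   have "(%m. norm u * exp (rate * T) * (1 / 2) ^ m) \<longlonglongrightarrow> norm u * exp (rate * T) * 0"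
    by (intro tendsto_intros LIMSEQ_power_zero) auto
   then have "\<forall>\<^sub>F m in sequentially. norm u * exp (rate * T) * (1 / 2) ^ m < e" using e by (intro order_tendstoD) auto
   then show "\<forall>\<^sub>F m in sequentially. \<forall>t\<in>{0..T}. dist (picard u m t) (sol u t) < e"
   proof eventually_elim
    case (elim m)
    have "norm u * exp (rate * t) * (1 / 2) ^ m <= norm u * exp (rate * T) * (1 / 2) ^ m" if "t <= T" for t
     using that rate(1) by (intro mult_right_mono mult_left_mono) auto
    then show ?case using sol(2)[OF u, of _ m] elim by (force simp: dist_norm norm_minus_commute)
   qed
  qed
 qed simp
 show ?thesis unfolding continuous_on_eq_continuous_within
 proof
  fix t :: real assume t: "t \<in> {0..}"
  \<comment> \<open>Continuity at \<open>t\<close> is local, so it can be taken from the interval up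
    to \<open>t + 1\<close>.\<close>
  have "at t within {0..t + 1} = at t within {0..}"
   by (rule at_within_nhd[of _ "{..<t + 1}"]) auto
  moreover have "(sol u \<longlongrightarrow> sol u t) (at t within {0..t + 1})"
   using T[of "t + 1"] t by (simp add: continuous_on)
  ultimately show "continuous (at t within {0..}) (sol u)"
   by (simp add: continuous_within)
 qed
qed

lemma sol_eq:
 assumes u: "u \<in> Ha 0" and t: "0 <= t" shows "sol u t = u + I (\<Lambda> (sol u)) t"
proof (rule LIMSEQ_unique)
 show "(%m. picard u (Suc m) t) \<longlonglongrightarrow> sol u t" by (rule LIMSEQ_Suc[OF sol(1)[OF u t]])
 have "(%m. I (\<Lambda> (picard u m)) t - I (\<Lambda> (sol u)) t) \<longlonglongrightarrow> 0"
 proof (rule Lim_null_comparison[OF always_eventually], rule allI)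
  fix m
  show "norm (I (\<Lambda> (picard u m)) t - I (\<Lambda> (sol u)) t) <= norm u * (1 / 2) ^ m / 2 * exp (rate * t)"
   by (rule I_contraction) (use picard[OF u, of m] sol_in[OF u] sol_continuous[OF u] sol(2)[OF u] t in \<open>auto simp: norm_minus_commute mult_ac\<close>)
  have "(%m. norm u * (1 / 2) ^ m / 2 * exp (rate * t)) \<longlonglongrightarrow> norm u * 0 / 2 * exp (rate * t)"
   by (intro tendsto_intros LIMSEQ_power_zero) auto
  then show "(%m. norm u * (1 / 2) ^ m / 2 * exp (rate * t)) \<longlonglongrightarrow> 0" by simp
 qed
 from tendsto_add[OF tendsto_const LIM_zero_cancel[OF this]] show "(%m. picard u (Suc m) t) \<longlonglongrightarrow> u + I (\<Lambda> (sol u)) t" by simp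
qed

section \<open>Convergence of Euler polygons\<close>

text \<open>The same \<open>N\<close> serves all dyadic starting points \<open>s\<close> below
  \<open>T\<close>, which the semigroup law and the generator require. The error of a polygon
  consists of the Riemann sum error of the exact solution and the propagated earlier errors;
  Gronwall is applied to squared norms, since the noise is only controlled in mean square.\<close>

lemma euler_convergence:
 assumes u: "u \<in> Ha 0" and T: "0 <= T" and e: "0 < e"
 shows "\<exists>N. \<forall>k\<ge>N. \<forall>q m n y s. s = real q / 2 ^ m \<longrightarrow> y 0 = sol u s \<longrightarrow>
  (\<forall>i<n. y (Suc i) = y i + inc (s + real i * (1 / 2 ^ k)) (1 / 2 ^ k) (K (s + real i * (1 / 2 ^ k)) (y i), L (s + real i * (1 / 2 ^ k)) (y i))) \<longrightarrow>
  s + real n * (1 / 2 ^ k) <= T \<longrightarrow> norm (y n - sol u (s + real n * (1 / 2 ^ k))) <= e"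
proof -
 let ?x = "sol u"
 have z: "adp (\<Lambda> ?x)" "continuous_on {0..} (\<Lambda> ?x)"
  by (auto intro: \<Lambda>_adp \<Lambda>_continuous sol_in[OF u] sol_continuous[OF u])
 \<comment> \<open>From \<open>(\<rho> + a + b)\<^sup>2 \<le> 3 * (\<rho>\<^sup>2 + a\<^sup>2 +
   b\<^sup>2)\<close>: the drift contributes \<open>\<kappa>\<^sup>2 * T\<close> by Cauchy-Schwarz,
   the noise \<open>\<kappa>\<^sup>2\<close>.\<close>
 define G where "G = 3 * \<kappa>\<^sup>2 * (T + 1)"
 \<comment> \<open>Gronwall factor times the factor \<open>T + sqrt T\<close> of the Riemann sum
   error; 1 is added for positivity.\<close>
 define D where "D = sqrt 3 * exp (G * T) * (T + sqrt T) + 1"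
 have G: "0 <= G" using T by (simp add: G_def)
 have D: "0 < D" using T by (auto simp: D_def intro!: add_nonneg_pos mult_nonneg_nonneg)
 define \<epsilon> where "\<epsilon> = e / D"
 have \<epsilon>: "0 < \<epsilon>" using e D by (simp add: \<epsilon>_def)
 obtain N where N: "!!M x y. N <= M ==> 0 <= x ==> x <= T ==> 0 <= y ==> y <= T ==> \<bar>x - y\<bar> <= 1 / 2 ^ M ==> norm (\<Lambda> ?x x - \<Lambda> ?x y) <= \<epsilon>"
  using modulus[OF z(2) \<epsilon>, where T = T] by blast
 define \<rho> where "\<rho> = (T + sqrt T) * \<epsilon>"
 have \<rho>: "0 <= \<rho>" using T \<epsilon> by (simp add: \<rho>_def)
 show ?thesis
 proof (intro exI[of _ N] allI impI)
  fix k q m n :: nat and y :: "nat => 'e" and s :: real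
  assume k: "N <= k" and s: "s = real q / 2 ^ m" and y0: "y 0 = ?x s"
   and y: "\<forall>i<n. y (Suc i) = y i + inc (s + real i * (1 / 2 ^ k)) (1 / 2 ^ k) (K (s + real i * (1 / 2 ^ k)) (y i), L (s + real i * (1 / 2 ^ k)) (y i))"
   and nT: "s + real n * (1 / 2 ^ k) <= T"
  define h where "h = 1 / (2::real) ^ k"
  have h: "0 < h" by (simp add: h_def)
  define p where "p i = s + real i * h" for i
  have s0: "0 <= s" using s by simp
  have p: "0 <= p i" "p (Suc i) = p i + h" for i using s0 h by (simp_all add: p_def algebra_simps)
  have y: "y (Suc i) = y i + inc (p i) h (K (p i) (y i), L (p i) (y i))" if "i < n" for i
   using y that by (simp add: p_def h_def)
  define d where "d i = y i - ?x (p i)" for i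
  have y_in: "y i \<in> Ha (p i)" if "i <= n" for i
   using that
  proof (induction i)
   case 0 show ?case using sol_in[OF u s0] by (simp add: y0 p_def)
  next
   case (Suc i)
   then have IH: "y i \<in> Ha (p i)" by simp
   have "inc (p i) h (K (p i) (y i), L (p i) (y i)) \<in> Ha (p (Suc i))"
    unfolding inc_def p(2) fst_conv snd_conv
    by (rule csubspaceD(2)[OF Ha(1)[OF _] csubspaceD(4)[OF Ha(1)] C_in])
      (use p(1)[of i] h IH in \<open>auto intro: Ha(3)[of "p i"] K(2) L(2)\<close>)
   moreover have "y i \<in> Ha (p (Suc i))" by (rule Ha(3)[OF p(1) _ IH]) (use p(2) h in simp)
   ultimately show ?case using y[of i] Suc.prems csubspaceD(2)[OF Ha(1)[OF p(1)[of "Suc i"]]] by simp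
  qed
  have d_in: "d i \<in> Ha (p i)" if "i <= n" for i
   unfolding d_def by (rule csubspace_diff[OF Ha(1)[OF p(1)] y_in[OF that] sol_in[OF u p(1)]])
  have rec: "norm (d i - gsum s h i (%l. (K (p l) (d l), L (p l) (d l)))) <= \<rho>" if i: "i <= n" for i
  proof -
   have yi: "y i = ?x s + gsum s h i (%l. (K (p l) (y l), L (p l) (y l)))"
    using i by (induction i) (auto simp: gsum_def y0 y p_def add.assoc)
   have "s + real i * h <= s + real n * h" using i h by (simp add: mult_right_mono)
   then have iT: "s + real i * (1 / 2 ^ k) <= T" using nT by (simp add: h_def)
   have xs: "?x (p i) - ?x s = I (\<Lambda> ?x) (p i) - I (\<Lambda> ?x) s"
    using sol_eq[OF u p(1)[of i]] sol_eq[OF u s0] by simp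
   have "norm (I (\<Lambda> ?x) (p i) - I (\<Lambda> ?x) s - rsum s h i (\<Lambda> ?x)) <= \<rho>"
    unfolding p_def h_def \<rho>_def by (rule I_riemann[OF z s iT less_imp_le[OF \<epsilon>] N[OF k]])
   moreover have "gsum s h i (%l. (K (p l) (d l), L (p l) (d l))) = gsum s h i (%l. (K (p l) (y l), L (p l) (y l))) - rsum s h i (\<Lambda> ?x)"
    using gsum_lin(1)[OF s0 less_imp_le[OF h], of i "%l. (K (p l) (y l), L (p l) (y l))" "%l. \<Lambda> ?x (s + real l * h)"]
    by (simp add: \<Lambda>_def d_def bops_diff K(1)[OF p(1)] L(1)[OF p(1)] p_def[symmetric])
   then have "d i - gsum s h i (%l. (K (p l) (d l), L (p l) (d l))) = - (?x (p i) - ?x s - rsum s h i (\<Lambda> ?x))"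
    unfolding d_def[of i] yi by (simp add: algebra_simps)
   ultimately show ?thesis unfolding xs by (simp only: norm_minus_cancel)
  qed
  have gron: "(norm (d i))\<^sup>2 <= 3 * \<rho>\<^sup>2 + (G * h) * (\<Sum>l<i. (norm (d l))\<^sup>2)" if i: "i <= n" for i
  proof -
   let ?S = "\<Sum>l<i. (norm (d l))\<^sup>2"
   have S: "0 <= ?S" by (simp add: sum_nonneg)
   have ih: "real i * h <= T"
   proof -
    have "real i * h <= real n * h" using i h by (simp add: mult_right_mono)
    then show ?thesis using nT s0 by (simp add: h_def)
   qed
   have "norm (gsum s h i (%l. (K (p l) (d l), L (p l) (d l)))) <= h * (\<Sum>l<i. norm (K (p l) (d l))) + sqrt (h * (\<Sum>l<i. (norm (L (p l) (d l)))\<^sup>2))"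
    using gsum_norm[OF s0 less_imp_le[OF h], of i "%l. (K (p l) (d l), L (p l) (d l))"] L(2)[OF p(1) d_in] i by (simp add: p_def)
   moreover have "(h * (\<Sum>l<i. norm (K (p l) (d l))))\<^sup>2 <= \<kappa>\<^sup>2 * T * h * ?S"
   proof -
    have "(\<Sum>l<i. norm (K (p l) (d l))) <= \<kappa> * (\<Sum>l<i. norm (d l))"
     unfolding sum_distrib_left by (intro sum_mono K(3)[OF p(1)])
    then have "(h * (\<Sum>l<i. norm (K (p l) (d l))))\<^sup>2 <= (h * (\<kappa> * (\<Sum>l<i. norm (d l))))\<^sup>2"
     using h by (intro power_mono mult_left_mono mult_nonneg_nonneg sum_nonneg) auto
    also have "\<dots> = h\<^sup>2 * \<kappa>\<^sup>2 * (\<Sum>l<i. norm (d l))\<^sup>2" by (simp add: power_mult_distrib)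
    also have "\<dots> <= h\<^sup>2 * \<kappa>\<^sup>2 * (?S * real i)"
     using sum_squared_le_sum_of_squares[of "%l. norm (d l)" "{..<i}"] by (intro mult_left_mono) auto
    also have "\<dots> = \<kappa>\<^sup>2 * (real i * h) * (h * ?S)" by (simp add: power2_eq_square)
    also have "\<dots> <= \<kappa>\<^sup>2 * T * (h * ?S)" using ih h S by (intro mult_right_mono mult_left_mono) auto
    finally show ?thesis by (simp add: mult.assoc)
   qed
   moreover have "(sqrt (h * (\<Sum>l<i. (norm (L (p l) (d l)))\<^sup>2)))\<^sup>2 <= \<kappa>\<^sup>2 * h * ?S"
   proof -
    have "(\<Sum>l<i. (norm (L (p l) (d l)))\<^sup>2) <= \<kappa>\<^sup>2 * ?S"
     unfolding sum_distrib_left power_mult_distrib[symmetric] by (intro sum_mono power_mono L(3)[OF p(1)]) auto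
    then have "h * (\<Sum>l<i. (norm (L (p l) (d l)))\<^sup>2) <= h * (\<kappa>\<^sup>2 * ?S)" using h by (intro mult_left_mono) auto
    moreover have "0 <= h * (\<Sum>l<i. (norm (L (p l) (d l)))\<^sup>2)" using h by (simp add: sum_nonneg)
    ultimately show ?thesis by (simp add: mult_ac)
   qed
   ultimately obtain a b where ab: "norm (gsum s h i (%l. (K (p l) (d l), L (p l) (d l)))) <= a + b" "a\<^sup>2 <= \<kappa>\<^sup>2 * T * h * ?S" "b\<^sup>2 <= \<kappa>\<^sup>2 * h * ?S"
    by blast
   have "norm (d i) <= \<rho> + (a + b)"
    using rec[OF i] ab(1) norm_triangle_ineq[of "d i - gsum s h i (%l. (K (p l) (d l), L (p l) (d l)))" "gsum s h i (%l. (K (p l) (d l), L (p l) (d l)))"] by simp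
   then have "(norm (d i))\<^sup>2 <= (\<rho> + (a + b))\<^sup>2" by (rule power_mono) simp
   also have "\<dots> <= 3 * (\<rho>\<^sup>2 + a\<^sup>2 + b\<^sup>2)"
    using sum_squares_bound[of \<rho> a] sum_squares_bound[of \<rho> b] sum_squares_bound[of a b] by (simp add: power2_eq_square algebra_simps)
   also have "\<dots> <= 3 * (\<rho>\<^sup>2 + \<kappa>\<^sup>2 * T * h * ?S + \<kappa>\<^sup>2 * h * ?S)" using ab by simp
   also have "\<dots> = 3 * \<rho>\<^sup>2 + (G * h) * ?S" by (simp add: G_def algebra_simps)
   finally show ?thesis .
  qed
  have "(norm (d n))\<^sup>2 <= 3 * \<rho>\<^sup>2 * (1 + G * h) ^ n"
   by (rule discrete_gronwall[OF gron _ order_refl]) (use G h in auto)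
  also have "\<dots> <= 3 * \<rho>\<^sup>2 * (exp (G * T))\<^sup>2"
  proof (rule mult_left_mono)
   have "(1 + G * h) ^ n <= exp (G * h) ^ n" using G h by (intro power_mono) auto
   also have "\<dots> = exp (G * (real n * h))" by (simp add: exp_of_nat_mult[symmetric] mult_ac)
   also have "\<dots> <= exp (G * T)"
   proof -
    have "real n * h <= T" using nT s0 by (simp add: h_def)
    then show ?thesis using G by (simp add: mult_left_mono)
   qed
   also have "\<dots> <= (exp (G * T))\<^sup>2" using G T by (intro self_le_power) auto
   finally show "(1 + G * h) ^ n <= (exp (G * T))\<^sup>2" .
  qed simp
  also have "\<dots> = (sqrt 3 * exp (G * T) * \<rho>)\<^sup>2" by (simp add: power_mult_distrib)
  finally have "norm (d n) <= sqrt 3 * exp (G * T) * \<rho>" by (rule power2_le_imp_le) (use \<rho> in simp)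
  also have "\<dots> = (sqrt 3 * exp (G * T) * (T + sqrt T)) * \<epsilon>" by (simp add: \<rho>_def)
  also have "\<dots> <= D * \<epsilon>" using \<epsilon> by (intro mult_right_mono) (auto simp: D_def)
  also have "\<dots> = e" using D by (simp add: \<epsilon>_def)
  finally show "norm (y n - ?x (s + real n * (1 / 2 ^ k))) <= e" by (simp add: d_def p_def h_def)
 qed
qed

end

lemma (in sde) sol_0:
 assumes u: "u \<in> Ha 0" shows "sol u 0 = u"
proof -
 have z: "adp (\<Lambda> (sol u))" "continuous_on {0..} (\<Lambda> (sol u))"
  by (auto intro: \<Lambda>_adp \<Lambda>_continuous sol_in[OF u] sol_continuous[OF u])
 have "R (\<Lambda> (sol u)) M 0 = 0" for M by (simp add: gsum_def)
 then have "I (\<Lambda> (sol u)) 0 = 0"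
  using LIMSEQ_unique[OF R_tendsto[OF z order_refl]] by (simp only: tendsto_const)
 then show ?thesis using sol_eq[OF u order_refl] by simp
qed

lemma norm_vacuum [simp]: "norm (vacuum :: 'k::chilbert L2 fock) = 1"
 using norm_of_cinner[of "vacuum :: 'k L2 fock" "1::complex"] by (simp add: cinner_complex_def)

lemma dyadic_floor_tendsto:
 assumes "0 <= t" shows "(%M. real (nat \<lfloor>t * 2 ^ M\<rfloor>) * (1 / 2 ^ M)) \<longlonglongrightarrow> t"
proof (rule real_tendsto_sandwich[OF always_eventually always_eventually])
 have b: "real (nat \<lfloor>t * 2 ^ M\<rfloor>) <= t * 2 ^ M" "t * 2 ^ M < real (nat \<lfloor>t * 2 ^ M\<rfloor>) + 1" for M
  using assms by (simp_all add: floor_correct)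
 have "t - (1 / 2) ^ M <= real (nat \<lfloor>t * 2 ^ M\<rfloor>) * (1 / 2 ^ M)" for M
 proof -
  have "t - (1 / 2) ^ M = (t * 2 ^ M - 1) * (1 / 2 ^ M)" by (simp add: power_one_over left_diff_distrib diff_divide_distrib)
  also have "\<dots> <= real (nat \<lfloor>t * 2 ^ M\<rfloor>) * (1 / 2 ^ M)" using b(2)[of M] by (intro mult_right_mono) auto
  finally show ?thesis .
 qed
 then show "\<forall>M. t - (1 / 2) ^ M <= real (nat \<lfloor>t * 2 ^ M\<rfloor>) * (1 / 2 ^ M)" by blast
 show "\<forall>M. real (nat \<lfloor>t * 2 ^ M\<rfloor>) * (1 / 2 ^ M) <= t" using b(1) by (simp add: pos_divide_le_eq)
 have "(%M. t - (1 / 2) ^ M) \<longlonglongrightarrow> t - 0" by (intro tendsto_intros LIMSEQ_power_zero) auto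
 then show "(%M. t - (1 / 2) ^ M) \<longlonglongrightarrow> t" by simp
qed simp

context flow
begin

lemma step_adapted:
 assumes s: "0 <= s" and h: "0 <= h" and k: "k \<in> A" and L: "column L" and y: "y \<in> adapted s"
 shows "step s (ecol k L h) y \<in> adapted (s + h)"
proof -
 have t: "0 <= s + h" using s h by simp
 have "y + h *\<^sub>R j s k y \<in> adapted s"
  by (intro csubspaceD[OF adapted_csubspace[OF s]] y j_preserves_adapted[OF s k y])
 then have "y + h *\<^sub>R j s k y \<in> adapted (s + h)" by (rule adapted_mono[OF s, rotated]) (use h in simp)
 then show ?thesis unfolding step_ecol[OF s h k L y]
  by (rule csubspaceD(2)[OF adapted_csubspace[OF t]]) (rule incr_adapted[OF s h jcol_adapted[OF s L y]])
qed

lemma j_tendsto: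
 assumes a: "a \<in> A" and t: "\<forall>\<^sub>F x in F. 0 <= \<tau> x" "(\<tau> \<longlongrightarrow> t) F" "0 <= t" and y: "(y \<longlongrightarrow> y0) F"
 shows "((%x. j (\<tau> x) a (y x)) \<longlongrightarrow> j t a y0) F"
proof -
 have 1: "((%x. j (\<tau> x) a y0) \<longlongrightarrow> j t a y0) F"
  by (rule continuous_on_tendsto_compose[OF j_strong_continuous[OF a] t(2)]) (use t in auto)
 show ?thesis
  by (rule bounded_strong_tendsto[where T = "%x. j (\<tau> x) a" and c = "onorm a", OF _ y 1]) (use t(1) j_bops[OF _ a] j_norm[OF _ a] in \<open>auto elim: eventually_mono\<close>)
qed

end

section \<open>The solution vectors of one pair of coefficients\<close>

locale driven = flow A j for A :: "('h::chilbert => 'h) set" and j :: "('h, 'k::chilbert) map_process" +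
 fixes k :: "'h => 'h" and l :: "'h => ('k, 'h) tensor"
 assumes k: "k \<in> A" and l: "l \<in> ket_uw_tensor A"
begin

text \<open>The flip passes from \<open>k \<otimes> h\<close>, the order of the block matrix form,
  to \<open>h \<otimes> k\<close>, the order used for columns.\<close>

definition L :: "'h => ('h, 'k) tensor" where "L u = flip (l u)"

lemma column_L: "column L" using column_ket[OF l] by (simp add: L_def[abs_def])

definition \<kappa> :: real where "\<kappa> = max (onorm k) (onorm L)"

lemma \<kappa>: "0 <= \<kappa>" "norm (k u) <= \<kappa> * norm u" "norm (L u) <= \<kappa> * norm u"
proof -
 show "0 <= \<kappa>" using onorm_ge0[OF A_bops[OF k]] by (simp add: \<kappa>_def)
 show "norm (k u) <= \<kappa> * norm u" "norm (L u) <= \<kappa> * norm u"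
  using order_trans[OF bops_onorm[OF A_bops[OF k], of u] mult_right_mono[of "onorm k" \<kappa> "norm u"]]
   order_trans[OF bops_onorm[OF column_bops[OF column_L], of u] mult_right_mono[of "onorm L" \<kappa> "norm u"]]
  by (auto simp: \<kappa>_def)
qed

sublocale S: sde adapted adapted_col incr "%s. j s k" "%s. jcol s L" \<kappa>
proof
 fix s t h h' :: real and y :: "('h, 'k L2 fock) tensor" and z :: "(('h, 'k L2 fock) tensor, 'k) tensor"
 show "0 <= s ==> csubspace (adapted s)" by (rule adapted_csubspace)
 show "0 <= s ==> closed (adapted s)" by (rule adapted_closed)
 show "0 <= s ==> s <= t ==> y \<in> adapted s ==> y \<in> adapted t" by (rule adapted_mono)
 show "0 <= s ==> csubspace (adapted_col s)" by (rule adapted_col_csubspace)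
 show "0 <= s ==> s <= t ==> z \<in> adapted_col s ==> z \<in> adapted_col t" by (rule adapted_col_mono)
 show "0 <= s ==> 0 <= h ==> incr s h \<in> bops" by (rule incr_bops)
 show "0 <= s ==> 0 <= h ==> (norm (incr s h z))\<^sup>2 <= h * (norm z)\<^sup>2" by (rule incr_norm)
 show "0 <= s ==> 0 <= h ==> z \<in> adapted_col s ==> incr s h z \<in> adapted (s + h)" by (rule incr_adapted)
 show "0 <= s ==> 0 <= h ==> y \<in> adapted s ==> \<langle>y, incr s h z\<rangle> = 0" by (rule incr_orth)
 show "0 <= s ==> 0 <= h ==> 0 <= h' ==> z \<in> adapted_col s ==> incr s (h + h') z = incr s h z + incr (s + h) h' z" by (rule incr_add)
 show "0 <= s ==> j s k \<in> bops" by (rule j_bops[OF _ k])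
 show "0 <= s ==> y \<in> adapted s ==> j s k y \<in> adapted s" by (rule j_preserves_adapted[OF _ k])
 show "0 <= s ==> norm (j s k y) <= \<kappa> * norm y"
  by (rule order_trans[OF j_norm[OF _ k]]) (simp_all add: \<kappa>_def mult_right_mono)
 show "continuous_on {0..} (%s. j s k y)" by (rule j_strong_continuous[OF k])
 show "0 <= s ==> jcol s L \<in> bops" by (rule jcol_bops[OF _ column_L])
 show "0 <= s ==> y \<in> adapted s ==> jcol s L y \<in> adapted_col s" by (rule jcol_adapted[OF _ column_L])
 show "0 <= s ==> norm (jcol s L y) <= \<kappa> * norm y"
  by (rule order_trans[OF jcol_norm[OF _ column_L]]) (simp_all add: \<kappa>_def mult_right_mono)
 show "continuous_on {0..} (%s. jcol s L y)" by (rule jcol_continuous[OF column_L])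
 show "0 <= \<kappa>" by (rule \<kappa>(1))
qed

definition W :: "real => 'h => ('h, 'k L2 fock) tensor" where "W = ecol k L"

lemma column_W: "0 <= h ==> column (W h)"
 unfolding W_def by (rule column_ecol[OF k column_L])

fun path :: "real => real => ('h, 'k L2 fock) tensor => nat => ('h, 'k L2 fock) tensor" where
 "path s h y 0 = y"
| "path s h y (Suc n) = step (s + real n * h) (W h) (path s h y n)"

lemma path_bops: "0 <= s ==> 0 <= h ==> (%y. path s h y n) \<in> bops"
 by (induction n) (simp_all add: bops_comp[OF step_bops[OF _ column_W]])

lemma path_adapted:
 assumes "0 <= s" "0 <= h" "y \<in> adapted s" shows "path s h y n \<in> adapted (s + real n * h)"
proof (induction n)
 case (Suc n)
 have e: "s + real (Suc n) * h = s + real n * h + h" by (simp add: algebra_simps)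
 show ?case unfolding e path.simps W_def
  by (rule step_adapted[OF _ assms(2) k column_L Suc]) (use assms in simp)
qed (use assms in simp)

lemma path_Suc:
 assumes "0 <= s" "0 <= h" "y \<in> adapted s"
 shows "path s h y (Suc n) = path s h y n + S.inc (s + real n * h) h (j (s + real n * h) k (path s h y n), jcol (s + real n * h) L (path s h y n))"
 using step_ecol[OF _ assms(2) k column_L path_adapted[OF assms]] assms by (simp add: W_def S.inc_def)

definition X :: "real => 'h => ('h, 'k L2 fock) tensor" where
 "X t u = S.sol (u \<otimes> vacuum) t"

lemma X_adapted: "0 <= t ==> X t u \<in> adapted t"
 unfolding X_def by (rule S.sol_in[OF adapted_vacuum])

lemma X_continuous: "continuous_on {0..} (%t. X t u)"
 unfolding X_def using S.sol_continuous[OF adapted_vacuum] .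

lemma X_0: "X 0 u = u \<otimes> vacuum"
 unfolding X_def by (rule S.sol_0[OF adapted_vacuum])

lemma path_convergence:
 assumes "0 <= T" "0 < e"
 shows "\<exists>N. \<forall>M\<ge>N. \<forall>q m n s. s = real q / 2 ^ m \<longrightarrow> s + real n * (1 / 2 ^ M) <= T \<longrightarrow>
  norm (path s (1 / 2 ^ M) (X s u) n - X (s + real n * (1 / 2 ^ M)) u) <= e"
proof -
 obtain N where N: "\<forall>M\<ge>N. \<forall>q m n y s. s = real q / 2 ^ m \<longrightarrow> y 0 = S.sol (u \<otimes> vacuum) s \<longrightarrow>
  (\<forall>i<n. y (Suc i) = y i + S.inc (s + real i * (1 / 2 ^ M)) (1 / 2 ^ M) (j (s + real i * (1 / 2 ^ M)) k (y i), jcol (s + real i * (1 / 2 ^ M)) L (y i))) \<longrightarrow>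
  s + real n * (1 / 2 ^ M) <= T \<longrightarrow> norm (y n - S.sol (u \<otimes> vacuum) (s + real n * (1 / 2 ^ M))) <= e"
  using S.euler_convergence[OF adapted_vacuum assms, of u] by blast
 show ?thesis
 proof (intro exI[of _ N] allI impI)
  fix M q m n s assume M: "N <= M" and s: "s = real q / 2 ^ m" and T: "s + real n * (1 / 2 ^ M) <= T"
  have s0: "0 <= s" using s by simp
  show "norm (path s (1 / 2 ^ M) (X s u) n - X (s + real n * (1 / 2 ^ M)) u) <= e"
   unfolding X_def
  proof (rule N[rule_format, OF M s _ _ T])
   show "path s (1 / 2 ^ M) (S.sol (u \<otimes> vacuum) s) (Suc i) = path s (1 / 2 ^ M) (S.sol (u \<otimes> vacuum) s) i +
     S.inc (s + real i * (1 / 2 ^ M)) (1 / 2 ^ M) (j (s + real i * (1 / 2 ^ M)) k (path s (1 / 2 ^ M) (S.sol (u \<otimes> vacuum) s) i), jcol (s + real i * (1 / 2 ^ M)) L (path s (1 / 2 ^ M) (S.sol (u \<otimes> vacuum) s) i))" for i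
    by (rule path_Suc[OF s0 _ S.sol_in[OF adapted_vacuum s0]]) simp
  qed simp
 qed
qed

abbreviation approx :: "nat => nat => 'h => ('h, 'k L2 fock) tensor" where
 "approx M n u \<equiv> path 0 (1 / 2 ^ M) (u \<otimes> vacuum) n"

text \<open>Polygons that start on the exact solution at a dyadic time; this is the form in which
  the semigroup law uses the convergence.\<close>

lemma path_tendsto:
 assumes s: "s = real q / 2 ^ m" and t: "0 <= t"
 shows "(%M. path s (1 / 2 ^ M) (X s u) (nat \<lfloor>t * 2 ^ M\<rfloor>)) \<longlonglongrightarrow> X (s + t) u"
proof -
 let ?\<tau> = "%M. s + real (nat \<lfloor>t * 2 ^ M\<rfloor>) * (1 / 2 ^ M)"
 have st: "0 <= s + t" using s t by simp
 have le: "?\<tau> M <= s + t" for M using S.idx_time(1)[OF t] by simp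
 have "(%M. path s (1 / 2 ^ M) (X s u) (nat \<lfloor>t * 2 ^ M\<rfloor>) - X (?\<tau> M) u) \<longlonglongrightarrow> 0"
 proof (rule LIMSEQ_I)
  fix e :: real assume "0 < e"
  then obtain N where N: "\<forall>M\<ge>N. \<forall>q m n s'. s' = real q / 2 ^ m \<longrightarrow> s' + real n * (1 / 2 ^ M) <= s + t \<longrightarrow>
   norm (path s' (1 / 2 ^ M) (X s' u) n - X (s' + real n * (1 / 2 ^ M)) u) <= e / 2"
   using path_convergence[OF st, of "e / 2" u] by auto
  show "\<exists>N. \<forall>M\<ge>N. norm (path s (1 / 2 ^ M) (X s u) (nat \<lfloor>t * 2 ^ M\<rfloor>) - X (?\<tau> M) u - 0) < e"
  proof (intro exI[of _ N] allI impI)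
   fix M assume "N <= M"
   from N[rule_format, OF this s le] \<open>0 < e\<close>
   show "norm (path s (1 / 2 ^ M) (X s u) (nat \<lfloor>t * 2 ^ M\<rfloor>) - X (?\<tau> M) u - 0) < e" by simp
  qed
 qed
 moreover have "(%M. X (?\<tau> M) u) \<longlonglongrightarrow> X (s + t) u"
  by (rule continuous_on_tendsto_compose[OF X_continuous tendsto_add[OF tendsto_const dyadic_floor_tendsto[OF t]]]) (use s t in auto)
 ultimately show ?thesis using tendsto_add by fastforce
qed

lemma approx_tendsto: "0 <= t ==> (%M. approx M (nat \<lfloor>t * 2 ^ M\<rfloor>) u) \<longlonglongrightarrow> X t u"
 using path_tendsto[of 0 0 0 t u] by (simp add: X_0)

text \<open>The form inequality \<open>k* + k + l* l \<le> \<beta>\<close>, whose case \<beta> = 0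
  is the contractivity hypothesis. Nonnegative \<beta> keeps the square roots and exponential bounds
  below monotone.\<close>

definition growth :: "real => bool" where
 "growth \<beta> \<longleftrightarrow> 0 <= \<beta> \<and> (\<forall>u. 2 * Re \<langle>u, k u\<rangle> + (norm (l u))\<^sup>2 <= \<beta> * (norm u)\<^sup>2)"

lemma norm_L: "norm (L u) = norm (l u)"
 by (simp add: L_def isometry_norm[OF flip_isometry])

lemma growth_exists: "growth (2 * \<kappa> + \<kappa>\<^sup>2)"
proof -
 have "2 * Re \<langle>u, k u\<rangle> + (norm (l u))\<^sup>2 <= (2 * \<kappa> + \<kappa>\<^sup>2) * (norm u)\<^sup>2" for u
 proof -
  have "Re \<langle>u, k u\<rangle> <= norm u * norm (k u)" using cinner_CS[of u "k u"] complex_Re_le_cmod order_trans by blast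
  also have "\<dots> <= norm u * (\<kappa> * norm u)" by (rule mult_left_mono[OF \<kappa>(2)]) simp
  finally have "Re \<langle>u, k u\<rangle> <= \<kappa> * (norm u)\<^sup>2" by (simp add: power2_eq_square mult_ac)
  moreover have "(norm (l u))\<^sup>2 <= (\<kappa> * norm u)\<^sup>2" unfolding norm_L[symmetric] by (rule power_mono[OF \<kappa>(3)]) simp
  ultimately show ?thesis by (simp add: power_mult_distrib algebra_simps)
 qed
 then show ?thesis using \<kappa>(1) by (simp add: growth_def)
qed

text \<open>Vacuum and one-particle part are orthogonal, so the squared norm is that of
  \<open>u + h k u\<close> plus \<open>h\<close> times that of \<open>l u\<close>. The terms of
  first order in \<open>h\<close> form exactly the growth inequality;
  \<open>\<kappa>\<^sup>2 * h\<^sup>2\<close> bounds the remaining square of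
  \<open>h k u\<close>.\<close>

lemma norm_W:
 assumes g: "growth \<beta>" and h: "0 <= h"
 shows "norm (W h u) <= sqrt (1 + \<beta> * h + \<kappa>\<^sup>2 * h\<^sup>2) * norm u"
proof -
 let ?y = "complex_of_real h *\<^sub>C k u + u" and ?n = "ampr (onepart h) (L u)"
 have b: "0 <= \<beta>" using g by (simp add: growth_def)
 have orth: "\<langle>E_ket vacuum ?y, ?n\<rangle> = 0"
  using cinner_E_bra[of ?y vacuum ?n] by (simp only: E_bra_vacuum_part[OF h] cinner_zero_right) (simp add: E_ket_def)
 have "(norm (W h u))\<^sup>2 = (norm ?y)\<^sup>2 + h * (norm (L u))\<^sup>2"
  unfolding W_def ecol_def norm_power2_add[of "E_ket vacuum ?y"] orth norm_op_tensor_part[OF h] by (simp add: E_ket_def norm_tensor)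
 also have "(norm ?y)\<^sup>2 = (norm u)\<^sup>2 + h\<^sup>2 * (norm (k u))\<^sup>2 + 2 * h * Re \<langle>u, k u\<rangle>"
  using norm_power2_add[of u "h *\<^sub>R k u"] by (simp add: scaleC_of_real add.commute cinner_scaleR_right power_mult_distrib)
 also have "(norm (k u))\<^sup>2 <= \<kappa>\<^sup>2 * (norm u)\<^sup>2" unfolding power_mult_distrib[symmetric] by (rule power_mono[OF \<kappa>(2)]) simp
 then have "(norm u)\<^sup>2 + h\<^sup>2 * (norm (k u))\<^sup>2 + 2 * h * Re \<langle>u, k u\<rangle> + h * (norm (L u))\<^sup>2 <=
  (norm u)\<^sup>2 + h\<^sup>2 * (\<kappa>\<^sup>2 * (norm u)\<^sup>2) + h * (2 * Re \<langle>u, k u\<rangle> + (norm (L u))\<^sup>2)"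
  using mult_left_mono[of "(norm (k u))\<^sup>2" "\<kappa>\<^sup>2 * (norm u)\<^sup>2" "h\<^sup>2"] by (simp add: algebra_simps)
 also have "h * (2 * Re \<langle>u, k u\<rangle> + (norm (L u))\<^sup>2) <= h * (\<beta> * (norm u)\<^sup>2)"
  using g h by (intro mult_left_mono) (simp_all add: growth_def norm_L)
 also have "(norm u)\<^sup>2 + h\<^sup>2 * (\<kappa>\<^sup>2 * (norm u)\<^sup>2) + h * (\<beta> * (norm u)\<^sup>2) = (1 + \<beta> * h + \<kappa>\<^sup>2 * h\<^sup>2) * (norm u)\<^sup>2"
  by (simp add: algebra_simps)
 finally have "(norm (W h u))\<^sup>2 <= (sqrt (1 + \<beta> * h + \<kappa>\<^sup>2 * h\<^sup>2) * norm u)\<^sup>2"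
  using b h by (simp add: power_mult_distrib add_nonneg_nonneg)
 then show ?thesis by (rule power2_le_imp_le) (use b h in simp)
qed

text \<open>The second-order remainder only adds \<open>\<kappa>\<^sup>2 * h\<close> to the
  exponential rate, which disappears as \<open>h\<close> tends to 0; this is how the limit obtains
  the sharp rate \<open>\<beta> / 2\<close>.\<close>

lemma norm_path:
 assumes g: "growth \<beta>" and s: "0 <= s" and h: "0 <= h"
 shows "norm (path s h y n) <= exp ((\<beta> + \<kappa>\<^sup>2 * h) / 2 * (real n * h)) * norm y"
proof -
 let ?c = "sqrt (1 + \<beta> * h + \<kappa>\<^sup>2 * h\<^sup>2)"
 have b: "0 <= \<beta>" using g by (simp add: growth_def)
 have on: "onorm (W h) <= ?c" by (rule onorm_bound[OF _ norm_W[OF g h]]) (use b h in simp)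
 have st: "norm (step t (W h) y) <= ?c * norm y" if "0 <= t" for t y
  by (rule order_trans[OF step_norm[OF that column_W[OF h]] mult_right_mono[OF on]]) simp
 have 1: "norm (path s h y n) <= ?c ^ n * norm y"
 proof (induction n)
  case (Suc n)
  have "norm (path s h y (Suc n)) <= ?c * norm (path s h y n)" using st[of "s + real n * h"] s h by simp
  also have "\<dots> <= ?c * (?c ^ n * norm y)" using Suc b h by (intro mult_left_mono) auto
  finally show ?case by simp
 qed simp
 have "1 + \<beta> * h + \<kappa>\<^sup>2 * h\<^sup>2 <= exp ((\<beta> + \<kappa>\<^sup>2 * h) * h)"
  using exp_ge_add_one_self[of "(\<beta> + \<kappa>\<^sup>2 * h) * h"] by (simp add: algebra_simps power2_eq_square)
 also have "\<dots> = (exp ((\<beta> + \<kappa>\<^sup>2 * h) / 2 * h))\<^sup>2" by (simp add: exp_double[symmetric])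
 finally have "?c <= exp ((\<beta> + \<kappa>\<^sup>2 * h) / 2 * h)" by (intro real_le_lsqrt) auto
 then have "?c ^ n <= exp ((\<beta> + \<kappa>\<^sup>2 * h) / 2 * h) ^ n" using b h by (intro power_mono) auto
 also have "\<dots> = exp ((\<beta> + \<kappa>\<^sup>2 * h) / 2 * (real n * h))" by (simp add: exp_of_nat_mult[symmetric] mult_ac)
 finally show ?thesis using 1 by (meson mult_right_mono norm_ge_zero order_trans)
qed

lemma norm_approx:
 assumes g: "growth \<beta>" and T: "real n * (1 / 2 ^ M) <= T"
 shows "norm (approx M n u) <= exp ((\<beta> + \<kappa>\<^sup>2) / 2 * T) * norm u"
proof -
 have b: "0 <= \<beta>" using g by (simp add: growth_def)
 have "norm (approx M n u) <= exp ((\<beta> + \<kappa>\<^sup>2 * (1 / 2 ^ M)) / 2 * (real n * (1 / 2 ^ M))) * norm (u \<otimes> (vacuum :: 'k L2 fock))"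
  by (rule norm_path[OF g]) simp_all
 also have "\<dots> <= exp ((\<beta> + \<kappa>\<^sup>2) / 2 * T) * norm (u \<otimes> (vacuum :: 'k L2 fock))"
 proof (intro mult_right_mono iffD2[OF exp_le_cancel_iff] mult_mono T)
  have "\<kappa>\<^sup>2 * (1 / 2 ^ M) <= \<kappa>\<^sup>2 * 1" by (rule mult_left_mono) simp_all
  then have "\<beta> + \<kappa>\<^sup>2 * (1 / 2 ^ M) <= \<beta> + \<kappa>\<^sup>2" by linarith
  then show "(\<beta> + \<kappa>\<^sup>2 * (1 / 2 ^ M)) / 2 <= (\<beta> + \<kappa>\<^sup>2) / 2" by (rule divide_right_mono) simp
 qed (use b in auto)
 finally show ?thesis by (simp add: norm_tensor)
qed

lemma
 assumes t: "0 <= t" shows X_bops: "X t \<in> bops"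
  and norm_X: "growth \<beta> ==> norm (X t u) <= exp (\<beta> / 2 * t) * norm u"
proof -
 let ?n = "%M. nat \<lfloor>t * 2 ^ M\<rfloor>"
 have le: "real (?n M) * (1 / 2 ^ M) <= t" for M
  using t of_nat_floor[of "t * 2 ^ M"] by (simp add: pos_divide_le_eq)
 show nX: "norm (X t u) <= exp (\<beta> / 2 * t) * norm u" if g: "growth \<beta>" for \<beta> u
 proof (rule LIMSEQ_le[OF tendsto_norm[OF approx_tendsto[OF t]]])
  have "(%M. exp ((\<beta> + \<kappa>\<^sup>2 * (1 / 2) ^ M) / 2 * t) * norm u) \<longlonglongrightarrow> exp ((\<beta> + \<kappa>\<^sup>2 * 0) / 2 * t) * norm u"
   by (intro tendsto_intros LIMSEQ_power_zero) auto
  then show "(%M. exp ((\<beta> + \<kappa>\<^sup>2 * (1 / 2) ^ M) / 2 * t) * norm u) \<longlonglongrightarrow> exp (\<beta> / 2 * t) * norm u" by simp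
  have b: "0 <= \<beta>" using g by (simp add: growth_def)
  have "norm (approx M (?n M) u) <= exp ((\<beta> + \<kappa>\<^sup>2 * (1 / 2) ^ M) / 2 * t) * norm u" for M
  proof -
   have "norm (approx M (?n M) u) <= exp ((\<beta> + \<kappa>\<^sup>2 * (1 / 2 ^ M)) / 2 * (real (?n M) * (1 / 2 ^ M))) * norm (u \<otimes> (vacuum :: 'k L2 fock))"
    by (rule norm_path[OF g]) simp_all
   also have "\<dots> <= exp ((\<beta> + \<kappa>\<^sup>2 * (1 / 2 ^ M)) / 2 * t) * norm (u \<otimes> (vacuum :: 'k L2 fock))"
    by (rule mult_right_mono[OF iffD2[OF exp_le_cancel_iff mult_left_mono[OF le]]]) (use b in auto)
   also have "norm (u \<otimes> (vacuum :: 'k L2 fock)) = norm u"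
    by (simp add: norm_tensor)
   finally show ?thesis by (simp add: power_one_over)
  qed
  then show "\<exists>N. \<forall>M\<ge>N. norm (approx M (?n M) u) <= exp ((\<beta> + \<kappa>\<^sup>2 * (1 / 2) ^ M) / 2 * t) * norm u" by blast
 qed
 have lin: "(%u. approx M n u) \<in> bops" for M n
  using bops_comp[OF path_bops[of 0 "1 / 2 ^ M"] E_ket_bops[of vacuum]] by (simp add: E_ket_def)
 show "X t \<in> bops"
 proof (rule bopsI[where K = "exp ((2 * \<kappa> + \<kappa>\<^sup>2) / 2 * t)"])
  show "X t (x + y) = X t x + X t y" for x y
   by (rule LIMSEQ_unique[OF approx_tendsto[OF t]])
     (use tendsto_add[OF approx_tendsto[OF t, of x] approx_tendsto[OF t, of y]] in \<open>simp add: bops_add[OF lin]\<close>)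
  show "X t (c *\<^sub>C x) = c *\<^sub>C X t x" for c x
   by (rule LIMSEQ_unique[OF approx_tendsto[OF t]])
     (use tendsto_scaleC[OF approx_tendsto[OF t, of x], of c] in \<open>simp add: bops_scaleC[OF lin]\<close>)
 qed (rule nX[OF growth_exists])
qed

end

text \<open>The vectors converge in norm, the operators only in one matrix element and with a common
  bound; the bound absorbs the error of replacing the vectors by their limits.\<close>

lemma bounded_weak_strong_tendsto:
 fixes x :: "'i => 'a::chilbert" and z :: "'i => 'b::chilbert" and T :: "'i => 'b => 'a"
 assumes x: "(x \<longlongrightarrow> x0) F" and z: "(z \<longlongrightarrow> z0) F"
  and T: "\<forall>\<^sub>F i in F. T i \<in> bops \<and> (\<forall>v. norm (T i v) <= c * norm v)"
  and lim: "((%i. \<langle>x0, T i z0\<rangle>) \<longlongrightarrow> p) F"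
 shows "((%i. \<langle>x i, T i (z i)\<rangle>) \<longlongrightarrow> p) F"
proof -
 let ?g = "%i. norm (x i - x0) * (c * norm (z i)) + norm x0 * (c * norm (z i - z0))"
 have "((%i. \<langle>x i, T i (z i)\<rangle> - \<langle>x0, T i z0\<rangle>) \<longlongrightarrow> 0) F"
 proof (rule Lim_null_comparison)
  show "\<forall>\<^sub>F i in F. norm (\<langle>x i, T i (z i)\<rangle> - \<langle>x0, T i z0\<rangle>) <= ?g i"
   using T
  proof eventually_elim
   case (elim i)
   have "\<langle>x i, T i (z i)\<rangle> - \<langle>x0, T i z0\<rangle> = \<langle>x i - x0, T i (z i)\<rangle> + \<langle>x0, T i (z i - z0)\<rangle>"
    using elim by (simp add: cinner_diff_left cinner_diff_right bops_diff)
   also have "norm \<dots> <= norm (x i - x0) * norm (T i (z i)) + norm x0 * norm (T i (z i - z0))"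
    by (rule norm_triangle_le[OF add_mono[OF cinner_CS cinner_CS]])
   also have "\<dots> <= ?g i" using elim by (intro add_mono mult_left_mono) auto
   finally show ?case .
  qed
  have "(?g \<longlongrightarrow> 0 * (c * norm z0) + norm x0 * (c * 0)) F"
   by (intro tendsto_add tendsto_mult tendsto_const tendsto_norm z tendsto_norm_zero[OF LIM_zero[OF x]] tendsto_norm_zero[OF LIM_zero[OF z]])
  then show "(?g \<longlongrightarrow> 0) F" by simp
 qed
 from tendsto_add[OF this lim] show ?thesis by simp
qed

context von_neumann
begin

lemma operator_bound_of_form:
 assumes "0 <= c" "!!u v. cmod \<langle>u, T v\<rangle> <= c * norm u * norm v" shows "norm (T v) <= c * norm v"
proof -
 have "(norm (T v))\<^sup>2 = cmod \<langle>T v, T v\<rangle>" by (simp add: cinner_self norm_power)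
 also have "\<dots> <= norm (T v) * (c * norm v)" using assms(2)[of "T v" v] by (simp add: mult_ac)
 finally show ?thesis by (rule power2_le_mult_imp_le) (use assms in auto)
qed

end

text \<open>Bounded weak convergence within \<open>A\<close> is ultraweak convergence, which
  \<open>j t\<close> preserves by normality.\<close>

lemma (in flow) j_weak_limit:
 assumes t: "0 <= t" and f: "\<forall>\<^sub>F i in F. f i \<in> A \<and> (\<forall>v. norm (f i v) <= c * norm v)" and L: "L \<in> A"
  and lim: "!!u v. ((%i. \<langle>u, f i v\<rangle>) \<longlongrightarrow> \<langle>u, L v\<rangle>) F"
 shows "((%i. \<langle>x, j t (f i) y\<rangle>) \<longlongrightarrow> \<langle>x, j t L y\<rangle>) F"
proof -
 have "limitin uw_topology f L F"
  by (rule limitin_uwI[OF _ A_bops[OF L] lim]) (use f A_bops in \<open>auto elim!: eventually_mono\<close>)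
 then have "limitin (subtopology uw_topology A) f L F"
  unfolding limitin_subtopology using f L by (auto elim!: eventually_mono)
 from continuous_map_limit[OF normal_rep.J_normal[OF j_rep[OF t]] this]
 show ?thesis by (auto dest: limitin_uw_cinner simp: o_def)
qed

section \<open>The perturbed semigroup\<close>

locale perturbation = flow A j + D1: driven A j k1 l1 + D2: driven A j k2 l2
 for A :: "('h::chilbert => 'h) set" and j :: "('h, 'k::chilbert) map_process"
  and k1 k2 :: "'h => 'h" and l1 l2 :: "'h => ('k, 'h) tensor"
begin

definition S :: "real => ('h => 'h) => 'h => 'h" where
 "S h a = (%u. adj (D1.W h) (j h a (D2.W h u)))"

definition P :: "real => ('h => 'h) => 'h => 'h" where
 "P t a = (%u. adj (D1.X t) (j t a (D2.X t u)))"

lemma S_in: "0 <= h ==> a \<in> A ==> S h a \<in> A"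
 unfolding S_def by (rule sandwich_in[OF D1.column_W D2.column_W j_in_uw_tensor])

lemma S_pow_in: "0 <= h ==> a \<in> A ==> (S h ^^ n) a \<in> A"
 by (induction n) (simp_all add: S_in)

lemma cinner_P: "0 <= t ==> \<langle>u, P t a v\<rangle> = \<langle>D1.X t u, j t a (D2.X t v)\<rangle>"
 by (simp add: P_def adj_cinner'[OF D1.X_bops])

text \<open>Peeling off the last step of both polygons replaces \<open>a\<close> by
  \<open>S h a\<close> at the earlier time. Arbitrary adapted starting vectors are allowed because
  the semigroup law starts the polygons from the solutions at time \<open>s\<close>.\<close>

lemma path_S:
 assumes s: "0 <= s" and h: "0 <= h" and y: "y1 \<in> adapted s" "y2 \<in> adapted s" and a: "a \<in> A"
 shows "\<langle>D1.path s h y1 n, j (s + real n * h) a (D2.path s h y2 n)\<rangle> = \<langle>y1, j s ((S h ^^ n) a) y2\<rangle>"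
 using a
proof (induction n arbitrary: a)
 case (Suc n)
 have t: "0 <= s + real n * h" using s h by simp
 have e: "s + real (Suc n) * h = s + real n * h + h" by (simp add: algebra_simps)
 have "\<langle>D1.path s h y1 (Suc n), j (s + real (Suc n) * h) a (D2.path s h y2 (Suc n))\<rangle> =
   \<langle>D1.path s h y1 n, j (s + real n * h) (S h a) (D2.path s h y2 n)\<rangle>"
  unfolding e S_def D1.path.simps D2.path.simps
  by (rule single_step[OF t h D1.path_adapted[OF s h y(1)] D2.path_adapted[OF s h y(2)] D1.column_W[OF h] D2.column_W[OF h] Suc.prems])
 also have "\<dots> = \<langle>y1, j s ((S h ^^ n) (S h a)) y2\<rangle>" by (rule Suc.IH[OF S_in[OF h Suc.prems]])
 finally show ?case by (simp add: funpow_swap1)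
qed simp

lemma approx_S:
 assumes a: "a \<in> A"
 shows "\<langle>D1.approx M n u, j (real n * (1 / 2 ^ M)) a (D2.approx M n v)\<rangle> = \<langle>u, (S (1 / 2 ^ M) ^^ n) a v\<rangle>"
proof -
 have b: "(S (1 / 2 ^ M) ^^ n) a \<in> A" by (rule S_pow_in[OF _ a]) simp
 show ?thesis
  using path_S[OF order_refl _ adapted_vacuum adapted_vacuum a, of "1 / 2 ^ M" u n v]
  by (simp add: j_0[OF b] amp_tensor[OF A_bops[OF b]] cinner_tensor)
qed

lemma P_limit:
 assumes t: "0 <= t" and a: "a \<in> A"
 shows "(%M. \<langle>u, (S (1 / 2 ^ M) ^^ nat \<lfloor>t * 2 ^ M\<rfloor>) a v\<rangle>) \<longlonglongrightarrow> \<langle>u, P t a v\<rangle>"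
 unfolding cinner_P[OF t] approx_S[OF a, symmetric]
 by (rule bounded_bilinear.tendsto[OF bounded_bilinear_cinner D1.approx_tendsto[OF t] j_tendsto[OF a _ dyadic_floor_tendsto[OF t] t D2.approx_tendsto[OF t]]]) simp

lemma P_bops:
 assumes t: "0 <= t" and a: "a \<in> A" shows "P t a \<in> bops"
 unfolding P_def by (rule bops_comp[OF adj_bops[OF D1.X_bops[OF t]] bops_comp[OF j_bops[OF t a] D2.X_bops[OF t]]])

text \<open>Membership is inherited from the powers of \<open>S\<close>, which stay in
  \<open>A\<close>, through weak limits.\<close>

lemma P_in:
 assumes t: "0 <= t" and a: "a \<in> A" shows "P t a \<in> A"
 by (rule A_weak_limit[OF P_bops[OF t a] always_eventually P_limit[OF t a]]) (use S_pow_in[OF _ a] in auto)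

definition rate :: real where
 "rate = max (2 * D1.\<kappa> + D1.\<kappa>\<^sup>2) (2 * D2.\<kappa> + D2.\<kappa>\<^sup>2)"

lemma rate: "0 <= rate" "D1.growth rate" "D2.growth rate"
proof -
 have m: "a <= rate * (norm u)\<^sup>2" if "a <= (2 * D1.\<kappa> + D1.\<kappa>\<^sup>2) * (norm u)\<^sup>2 \<or> a <= (2 * D2.\<kappa> + D2.\<kappa>\<^sup>2) * (norm u)\<^sup>2" for a and u :: 'h
  using that mult_right_mono[of "2 * D1.\<kappa> + D1.\<kappa>\<^sup>2" rate "(norm u)\<^sup>2"] mult_right_mono[of "2 * D2.\<kappa> + D2.\<kappa>\<^sup>2" rate "(norm u)\<^sup>2"]
  by (auto simp: rate_def)
 show r: "0 <= rate" using D1.\<kappa>(1) by (auto simp: rate_def le_max_iff_disj)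
 show "D1.growth rate" using D1.growth_exists m r by (auto simp: D1.growth_def)
 show "D2.growth rate" using D2.growth_exists m r by (auto simp: D2.growth_def)
qed

lemma norm_P:
 assumes g: "D1.growth \<beta>" "D2.growth \<beta>" and t: "0 <= t" and a: "a \<in> A"
 shows "norm (P t a v) <= exp (\<beta> * t) * onorm a * norm v"
proof -
 have "norm (P t a v) <= exp (\<beta> / 2 * t) * norm (j t a (D2.X t v))"
  unfolding P_def by (rule norm_adj_le[OF D1.X_bops[OF t] D1.norm_X[OF t g(1)]]) simp
 also have "norm (j t a (D2.X t v)) <= onorm a * norm (D2.X t v)" by (rule j_norm[OF t a])
 also have "norm (D2.X t v) <= exp (\<beta> / 2 * t) * norm v" by (rule D2.norm_X[OF t g(2)])
 finally have "norm (P t a v) <= exp (\<beta> / 2 * t) * (onorm a * (exp (\<beta> / 2 * t) * norm v))"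
  using onorm_ge0[OF A_bops[OF a]] by (simp add: mult_left_mono)
 also have "\<dots> = (exp (\<beta> / 2 * t) * exp (\<beta> / 2 * t)) * onorm a * norm v" by (simp only: mult_ac)
 also have "exp (\<beta> / 2 * t) * exp (\<beta> / 2 * t) = exp (\<beta> * t)" by (simp flip: exp_add)
 finally show ?thesis .
qed

lemma P_normal:
 assumes t: "0 <= t" shows "normal_map A A (P t)"
 unfolding normal_map_def clinear_on_def continuous_map_in_subtopology
proof (intro conjI ballI allI image_subsetI)
 interpret R: normal_rep A "j t" by (rule j_rep[OF t])
 note Xb = adj_bops[OF D1.X_bops[OF t]]
 show "P t (%u. c *\<^sub>C a u + b u) = (%v. c *\<^sub>C P t a v + P t b v)" if "a \<in> A" "b \<in> A" for a b c
  using that by (simp add: P_def R.J_lincomb bops_add[OF Xb] bops_scaleC[OF Xb])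
 show "continuous_map (subtopology uw_topology A) uw_topology (P t)"
  using continuous_map_compose[OF R.J_normal normal_conj[OF Xb D2.X_bops[OF t]]] by (simp add: o_def P_def[abs_def])
 have "P t ` topspace (subtopology uw_topology A) \<subseteq> A" by (auto intro: P_in[OF t])
 then show "P t \<in> topspace (subtopology uw_topology A) \<rightarrow> A" by blast
qed

lemma P_0: "a \<in> A ==> P 0 a = a"
proof (rule bops_ext)
 fix u v assume a: "a \<in> A"
 show "\<langle>u, P 0 a v\<rangle> = \<langle>u, a v\<rangle>"
  by (simp add: cinner_P D1.X_0 D2.X_0 j_0[OF a] amp_tensor[OF A_bops[OF a]] cinner_tensor)
qed

lemma P_tendsto:
 assumes a: "a \<in> A" and t: "\<forall>\<^sub>F x in F. 0 <= \<tau> x" "(\<tau> \<longlongrightarrow> t) F" "0 <= t"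
 shows "((%x. \<langle>u, P (\<tau> x) a v\<rangle>) \<longlongrightarrow> \<langle>u, P t a v\<rangle>) F"
proof -
 have c: "((%x. D1.X (\<tau> x) u) \<longlongrightarrow> D1.X t u) F" "((%x. D2.X (\<tau> x) v) \<longlongrightarrow> D2.X t v) F"
  by (rule continuous_on_tendsto_compose[OF D1.X_continuous t(2)] continuous_on_tendsto_compose[OF D2.X_continuous t(2)]; use t in simp)+
 have "((%x. \<langle>D1.X (\<tau> x) u, j (\<tau> x) a (D2.X (\<tau> x) v)\<rangle>) \<longlongrightarrow> \<langle>u, P t a v\<rangle>) F"
  unfolding cinner_P[OF t(3)]
  by (rule bounded_bilinear.tendsto[OF bounded_bilinear_cinner c(1) j_tendsto[OF a t c(2)]])
 moreover have "\<forall>\<^sub>F x in F. \<langle>D1.X (\<tau> x) u, j (\<tau> x) a (D2.X (\<tau> x) v)\<rangle> = \<langle>u, P (\<tau> x) a v\<rangle>"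
  using t(1) by eventually_elim (simp add: cinner_P)
 ultimately show ?thesis by (rule Lim_transform_eventually)
qed

lemma P_bound:
 assumes "0 <= t" "t <= T" "a \<in> A" shows "norm (P t a v) <= exp (rate * T) * onorm a * norm v"
proof -
 have "exp (rate * t) * onorm a * norm v <= exp (rate * T) * onorm a * norm v"
  using assms rate(1) onorm_ge0[OF A_bops[OF assms(3)]] by (intro mult_right_mono) (auto intro: mult_left_mono)
 then show ?thesis using norm_P[OF rate(2,3) assms(1,3), of v] by linarith
qed

lemma P_continuous: "pointwise_uw_continuous A P"
 unfolding pointwise_uw_continuous_def
proof (intro ballI continuous_map_into_uw)
 fix a assume a: "a \<in> A"
 show "P t a \<in> bops" if "t \<in> topspace (top_of_set {0..})" for t using that P_bops[OF _ a] by simp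
 fix \<xi> \<eta> :: "nat => 'h" assume ss: "square_summable \<xi>" "square_summable \<eta>"
 have "continuous_on {0..} (%t. uwf \<xi> \<eta> (P t a))"
  unfolding continuous_on
 proof
  fix t :: real assume t: "t \<in> {0..}"
  have ev: "\<forall>\<^sub>F s in at t within {0..}. 0 <= s \<and> s <= t + 1"
   unfolding eventually_at by (intro exI[of _ 1]) (auto simp: dist_real_def)
  then have ev0: "\<forall>\<^sub>F s in at t within {0..}. 0 <= s" by eventually_elim simp
  show "((%s. uwf \<xi> \<eta> (P s a)) \<longlongrightarrow> uwf \<xi> \<eta> (P t a)) (at t within {0..})"
  proof (rule uwf_tendsto[OF _ P_bops[OF _ a] _ ss])
   show "\<forall>\<^sub>F s in at t within {0..}. P s a \<in> bops \<and> (\<forall>v. norm (P s a v) <= exp (rate * (t + 1)) * onorm a * norm v)"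
    using ev by eventually_elim (use P_bops[OF _ a] P_bound[OF _ _ a] in auto)
   show "((%s. \<langle>u, P s a v\<rangle>) \<longlongrightarrow> \<langle>u, P t a v\<rangle>) (at t within {0..})" for u v
    by (rule P_tendsto[OF a ev0]) (use t in auto)
  qed (use t in simp)
 qed
 then show "continuous_map (top_of_set {0..}) euclidean (%t. uwf \<xi> \<eta> (P t a))" by simp
qed

definition bound :: "real => real" where
 "bound T = exp ((rate + D1.\<kappa>\<^sup>2) / 2 * T) * exp ((rate + D2.\<kappa>\<^sup>2) / 2 * T)"

lemma S_pow_bound:
 assumes a: "a \<in> A" and T: "real n * (1 / 2 ^ M) <= T"
 shows "norm ((S (1 / 2 ^ M) ^^ n) a v) <= bound T * onorm a * norm v"
proof (rule operator_bound_of_form)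
 let ?c1 = "exp ((rate + D1.\<kappa>\<^sup>2) / 2 * T)" and ?c2 = "exp ((rate + D2.\<kappa>\<^sup>2) / 2 * T)"
 have T0: "0 <= real n * (1 / 2 ^ M)" by simp
 note oa = onorm_ge0[OF A_bops[OF a]]
 show "0 <= bound T * onorm a" using oa by (simp add: bound_def)
 fix u v
 have "cmod \<langle>u, (S (1 / 2 ^ M) ^^ n) a v\<rangle> <= norm (D1.approx M n u) * norm (j (real n * (1 / 2 ^ M)) a (D2.approx M n v))"
  unfolding approx_S[OF a, symmetric] by (rule cinner_CS)
 also have "\<dots> <= (?c1 * norm u) * (onorm a * (?c2 * norm v))"
  by (intro mult_mono D1.norm_approx[OF rate(2) T] order_trans[OF j_norm[OF T0 a] mult_left_mono[OF D2.norm_approx[OF rate(3) T] oa]]) auto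
 finally show "cmod \<langle>u, (S (1 / 2 ^ M) ^^ n) a v\<rangle> <= bound T * onorm a * norm u * norm v" by (simp add: bound_def mult_ac)
qed

text \<open>The numbers \<open>\<langle>D1.X s u, j s (?c M) (D2.X s v)\<rangle>\<close> have two
  limits. As compressions of \<open>j\<close> at later times by polygons started from the solutions
  they tend to the form of \<open>P (s + t) a\<close>; by normality of \<open>j s\<close> they tend
  to that of \<open>P s (P t a)\<close>.\<close>

lemma P_semigroup_dyadic:
 assumes a: "a \<in> A" and s: "s = real q / 2 ^ m" and t: "0 <= t"
 shows "P (s + t) a = P s (P t a)"
proof (rule bops_ext)
 fix u v
 have s0: "0 <= s" and h: "0 <= 1 / (2::real) ^ M" for M using s by simp_all
 let ?n = "%M. nat \<lfloor>t * 2 ^ M\<rfloor>"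
 let ?c = "%M. (S (1 / 2 ^ M) ^^ ?n M) a"
 have cA: "?c M \<in> A" for M by (rule S_pow_in[OF _ a]) simp
 have cb: "norm (?c M w) <= bound t * onorm a * norm w" for M w by (rule S_pow_bound[OF a D1.S.idx_time(1)[OF t]])
 have "(%M. \<langle>D1.X s u, j s (?c M) (D2.X s v)\<rangle>) \<longlonglongrightarrow> \<langle>D1.X s u, j s (P t a) (D2.X s v)\<rangle>"
  by (rule j_weak_limit[OF s0 _ P_in[OF t a] P_limit[OF t a]]) (use cA cb in \<open>intro always_eventually allI conjI\<close>)
 moreover have "(%M. \<langle>D1.path s (1 / 2 ^ M) (D1.X s u) (?n M), j (s + real (?n M) * (1 / 2 ^ M)) a (D2.path s (1 / 2 ^ M) (D2.X s v) (?n M))\<rangle>)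
   \<longlonglongrightarrow> \<langle>D1.X (s + t) u, j (s + t) a (D2.X (s + t) v)\<rangle>"
  by (rule bounded_bilinear.tendsto[OF bounded_bilinear_cinner D1.path_tendsto[OF s t]
     j_tendsto[OF a _ tendsto_add[OF tendsto_const dyadic_floor_tendsto[OF t]] _ D2.path_tendsto[OF s t]]]) (use s0 t in auto)
 then have "(%M. \<langle>D1.X s u, j s (?c M) (D2.X s v)\<rangle>) \<longlonglongrightarrow> \<langle>D1.X (s + t) u, j (s + t) a (D2.X (s + t) v)\<rangle>"
  by (simp only: path_S[OF s0 h D1.X_adapted[OF s0] D2.X_adapted[OF s0] a])
 ultimately show "\<langle>u, P (s + t) a v\<rangle> = \<langle>u, P s (P t a) v\<rangle>"
  using LIMSEQ_unique s0 t by (simp add: cinner_P)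
qed

text \<open>Both sides are weakly continuous in \<open>s\<close>, so the dyadic case
  suffices.\<close>

lemma P_semigroup:
 assumes a: "a \<in> A" and s: "0 <= s" and t: "0 <= t"
 shows "P (s + t) a = P s (P t a)"
proof (rule bops_ext)
 fix u v
 let ?d = "%M. real (nat \<lfloor>s * 2 ^ M\<rfloor>) * (1 / 2 ^ M)"
 note lim = dyadic_floor_tendsto[OF s]
 have e: "P (?d M + t) a = P (?d M) (P t a)" for M
  by (rule P_semigroup_dyadic[OF a _ t, of _ "nat \<lfloor>s * 2 ^ M\<rfloor>" M]) simp
 show "\<langle>u, P (s + t) a v\<rangle> = \<langle>u, P s (P t a) v\<rangle>"
 proof (rule LIMSEQ_unique)
  show "(%M. \<langle>u, P (?d M + t) a v\<rangle>) \<longlonglongrightarrow> \<langle>u, P (s + t) a v\<rangle>"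
   by (rule P_tendsto[OF a _ tendsto_add[OF lim tendsto_const]]) (use s t in auto)
  show "(%M. \<langle>u, P (?d M + t) a v\<rangle>) \<longlonglongrightarrow> \<langle>u, P s (P t a) v\<rangle>"
   unfolding e by (rule P_tendsto[OF P_in[OF t a] _ lim s]) simp
 qed
qed

lemma P_normal_semigroup: "normal_semigroup A P"
 unfolding normal_semigroup_def using P_normal P_0 P_semigroup P_continuous by blast

lemma P_contractive:
 assumes "D1.growth 0" "D2.growth 0" shows "contractive_semigroup A P"
 unfolding contractive_semigroup_def
proof (intro allI impI ballI onorm_bound)
 fix t :: real and a v assume t: "0 <= t" and a: "a \<in> A"
 show "0 <= onorm a" by (rule onorm_ge0[OF A_bops[OF a]])
 show "norm (P t a v) <= onorm a * norm v" using norm_P[OF assms t a, of v] by simp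
qed

text \<open>The representation \<open>j t\<close> does not increase matrix norms, and each of the
  two outer factors, applied entrywise to columns, costs \<open>exp (rate / 2 * t)\<close>; together
  they cancel the damping factor.\<close>

lemma P_completely_quasicontractive: "completely_quasicontractive A P"
 unfolding completely_quasicontractive_def
proof (intro exI[of _ rate] allI impI)
 fix t :: real assume t: "0 <= t"
 let ?e = "exp (rate / 2 * t)"
 interpret R: amplified_rep A "j t" "iso t" by (rule rep[OF t])
 show "cb_norm A (%a u. exp (- rate * t) *\<^sub>R P t a u) <= 1"
  unfolding cb_norm_def
 proof (rule Sup_least, elim CollectE exE conjE, hypsubst)
  fix n a assume a: "a \<in> mats n A" and na: "mat_norm n a <= 1"
  have aA: "a i l \<in> A" if "i < n" "l < n" for i l using a that by (simp add: mats_def)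
  note Xb = adj_bops[OF D1.X_bops[OF t]]
  have "mat_norm n (%i l u. exp (- rate * t) *\<^sub>R P t (a i l) u) <= 1"
  proof (rule mat_norm_leI)
   fix \<xi> :: "nat => 'h" assume \<xi>: "L2_set (%l. norm (\<xi> l)) {..<n} <= 1"
   let ?w = "%i. \<Sum>l<n. j t (a i l) (D2.X t (\<xi> l))"
   have "(\<Sum>l<n. exp (- rate * t) *\<^sub>R P t (a i l) (\<xi> l)) = exp (- rate * t) *\<^sub>R adj (D1.X t) (?w i)" for i
    by (simp add: P_def scaleR_sum_right bops_sum[OF Xb])
   then have "norm (\<Sum>l<n. exp (- rate * t) *\<^sub>R P t (a i l) (\<xi> l)) <= exp (- rate * t) * (?e * norm (?w i))" for i
    using norm_adj_le[OF D1.X_bops[OF t] D1.norm_X[OF t rate(2)], of "?w i"] by simp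
   then have "L2_set (%i. norm (\<Sum>l<n. exp (- rate * t) *\<^sub>R P t (a i l) (\<xi> l))) {..<n} <= L2_set (%i. (exp (- rate * t) * ?e) * norm (?w i)) {..<n}"
    by (intro L2_set_mono) (simp_all add: mult.assoc)
   also have "\<dots> = (exp (- rate * t) * ?e) * L2_set (%i. norm (?w i)) {..<n}"
    by (rule L2_set_right_distrib[symmetric]) simp
   also have "L2_set (%i. norm (?w i)) {..<n} <= mat_norm n a * L2_set (%l. norm (D2.X t (\<xi> l))) {..<n}"
    by (rule R.J_mat_norm[OF a])
   also have "\<dots> <= 1 * (?e * 1)"
   proof (rule mult_mono[OF na])
    have "L2_set (%l. norm (D2.X t (\<xi> l))) {..<n} <= L2_set (%l. ?e * norm (\<xi> l)) {..<n}"
     by (rule L2_set_mono[OF D2.norm_X[OF t rate(3)]]) simp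
    also have "\<dots> = ?e * L2_set (%l. norm (\<xi> l)) {..<n}" by (rule L2_set_right_distrib[symmetric]) simp
    also have "\<dots> <= ?e * 1" by (rule mult_left_mono[OF \<xi>]) simp
    finally show "L2_set (%l. norm (D2.X t (\<xi> l))) {..<n} <= ?e * 1" .
   qed (simp_all add: L2_set_nonneg)
   finally have "L2_set (%i. norm (\<Sum>l<n. exp (- rate * t) *\<^sub>R P t (a i l) (\<xi> l))) {..<n} <= exp (- rate * t) * ?e * (1 * (?e * 1))"
    by (simp add: mult_left_mono)
   also have "\<dots> = 1" by (simp flip: exp_add)
   finally show "L2_set (%i. norm (\<Sum>l<n. exp (- rate * t) *\<^sub>R P t (a i l) (\<xi> l))) {..<n} <= 1" .
  qed
  then show "ereal (mat_norm n (%i l u. exp (- rate * t) *\<^sub>R P t (a i l) u)) <= 1" by simp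
 qed
qed

end

lemma (in perturbation) P_completely_positive:
 assumes "l1 = l2" "k1 = k2" shows "cp_semigroup A P"
 unfolding cp_semigroup_def completely_positive_def
proof (intro allI impI ballI)
 fix t :: real and n a assume t: "0 <= t" and a: "a \<in> mats n A" and pos: "mat_positive n a"
 interpret R: amplified_rep A "j t" "iso t" by (rule rep[OF t])
 have "mat_positive n (%i l. j t (a i l))" by (rule R.J_mat_positive[OF a pos])
 moreover have "D1.X = D2.X" by (simp only: assms)
 then have "\<langle>x, P t b y\<rangle> = \<langle>D2.X t x, j t b (D2.X t y)\<rangle>" for x y b
  by (simp only: cinner_P[OF t])
 ultimately show "mat_positive n (%i l. P t (a i l))" by (auto simp: mat_positive_def)
qed

section \<open>The generator\<close>

text \<open>The Banach-Steinhaus theorem: the closed sets \<open>F n\<close> cover the space, so one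
  of them contains a ball by Baire's theorem.\<close>

lemma uniform_boundedness:
 fixes T :: "'i => 'a::chilbert => 'b::chilbert"
 assumes T: "!!i. T i \<in> bops" and pt: "!!v. \<exists>c. \<forall>i. norm (T i v) <= c"
 obtains K where "0 <= K" "!!i v. norm (T i v) <= K * norm v"
proof -
 define F where "F n = {v. \<forall>i. norm (T i v) <= real n}" for n
 have cl: "closed (F n)" for n
 proof -
  have "F n = (\<Inter>i. {v. norm (T i v) <= real n})" by (auto simp: F_def)
  moreover have "closed {v. norm (T i v) <= real n}" for i
   by (intro closed_Collect_le continuous_on_norm bops_continuous_on[OF T] continuous_on_id continuous_on_const)
  ultimately show ?thesis by (simp add: closed_INT)
 qed
 have un: "\<Union>(range F) = UNIV"
 proof -
  have "\<exists>n. v \<in> F n" for v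
  proof -
   obtain c where c: "\<forall>i. norm (T i v) <= c" using pt by blast
   obtain n where "c <= real n" using real_arch_simple by blast
   with c have "v \<in> F n" unfolding F_def using order_trans by blast
   then show ?thesis ..
  qed
  then show ?thesis by blast
 qed
 have "\<exists>n. interior (F n) \<noteq> {}"
 proof (rule ccontr)
  assume no: "\<not> (\<exists>n. interior (F n) \<noteq> {})"
  have "euclidean interior_of \<Union>(range F) = {}"
   by (rule Baire_category_alt) (use no cl in \<open>auto simp: completely_metrizable_space_euclidean\<close>)
  then show False by (simp add: un)
 qed
 then obtain n x where "x \<in> interior (F n)" by blast
 then obtain e where e: "0 < e" "ball x e \<subseteq> F n" unfolding mem_interior by blast
 \<comment> \<open>A vector of length \<open>e / 2\<close> is the difference of two points of the
   ball, whose images have norm at most \<open>n\<close>; hence the bound \<open>2 * n\<close>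
   divided by \<open>e / 2\<close>.\<close>
 define K where "K = 4 * real n / e"
 show thesis
 proof (rule that[of K])
  show "0 <= K" using e by (simp add: K_def)
  fix i v
  show "norm (T i v) <= K * norm v"
  proof (cases "v = 0")
   case True then show ?thesis by (simp add: bops_0[OF T])
  next
   case False
   define r where "r = e / 2 / norm v"
   have r: "0 < r" using e False by (simp add: r_def)
   have "norm (r *\<^sub>R v) = e / 2" using e False by (simp add: r_def)
   then have "x + r *\<^sub>R v \<in> ball x e" "x \<in> ball x e" using e by (auto simp: dist_norm)
   then have "x + r *\<^sub>R v \<in> F n" "x \<in> F n" using e(2) by blast+
   then have "norm (T i (x + r *\<^sub>R v)) <= real n" "norm (T i x) <= real n" by (simp_all add: F_def)
   then have "norm (T i (x + r *\<^sub>R v) - T i x) <= 2 * real n"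
    using norm_triangle_ineq4[of "T i (x + r *\<^sub>R v)" "T i x"] by linarith
   moreover have "T i (x + r *\<^sub>R v) - T i x = r *\<^sub>R T i v" by (simp add: bops_add[OF T] bops_scaleR[OF T])
   ultimately have "r * norm (T i v) <= 2 * real n" using r by simp
   then have "norm (T i v) <= 2 * real n / r" using r by (simp add: pos_le_divide_eq mult.commute)
   also have "\<dots> = K * norm v" using e False by (simp add: r_def K_def)
   finally show ?thesis .
  qed
 qed
qed

text \<open>Uniform boundedness is applied twice: to the functionals given by \<open>T i v\<close>
  for fixed \<open>v\<close>, then to the operators. It supplies the bound that a weak limit along a
  sequence does not state.\<close>

lemma weakly_convergent_bounded:
 fixes T :: "nat => 'a::chilbert => 'b::chilbert"
 assumes T: "!!i. T i \<in> bops" and lim: "!!u v. (%i. \<langle>u, T i v\<rangle>) \<longlonglongrightarrow> \<langle>u, L v\<rangle>"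
 obtains K where "0 <= K" "!!i v. norm (T i v) <= K * norm v"
proof -
 have bdd: "\<exists>c. \<forall>i. cmod \<langle>u, T i v\<rangle> <= c" for u v
  using convergentI[OF lim[of u v], THEN convergent_imp_Bseq] unfolding Bseq_def by blast
 have "\<exists>c. \<forall>i. norm (T i v) <= c" for v
 proof -
  define R where "R i u = \<langle>T i v, u\<rangle>" for i u
  have R: "R i \<in> bops" for i
   by (rule bopsI[where K = "norm (T i v)"]) (simp_all add: R_def cinner_add_right cinner_scaleC_right scaleC_complex_def cinner_CS)
  have "\<exists>c. \<forall>i. norm (R i u) <= c" for u
  proof -
   have "norm (R i u) = cmod \<langle>u, T i v\<rangle>" for i
    unfolding R_def cnj_cinner[of u "T i v", symmetric] by (rule complex_mod_cnj)
   then show ?thesis using bdd[of u v] by simp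
  qed
  from uniform_boundedness[OF R this] obtain K where K: "0 <= K" "!!i u. norm (R i u) <= K * norm u" by blast
  have "norm (T i v) <= K" for i
  proof -
   have "(norm (T i v))\<^sup>2 = norm (R i (T i v))" by (simp add: R_def cinner_self norm_power)
   also have "\<dots> <= norm (T i v) * K" using K(2)[of i "T i v"] by (simp add: mult.commute)
   finally show ?thesis by (rule power2_le_mult_imp_le) (use K in auto)
  qed
  then show ?thesis by blast
 qed
 from uniform_boundedness[OF T this] show thesis using that by blast
qed

lemma uwf_adj:
 assumes T: "T \<in> bops" and ss: "square_summable \<xi>" "square_summable \<eta>"
 shows "uwf \<xi> \<eta> (adj T) = cnj (uwf \<eta> \<xi> T)"
proof (rule sums_unique2)
 show "(%n. \<langle>\<xi> n, adj T (\<eta> n)\<rangle>) sums uwf \<xi> \<eta> (adj T)" by (rule uwf_sums[OF ss adj_bops[OF T]])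
 have "(%n. cnj \<langle>\<eta> n, T (\<xi> n)\<rangle>) sums cnj (uwf \<eta> \<xi> T)" by (rule bounded_linear.sums[OF bounded_linear_cnj uwf_sums[OF ss(2,1) T]])
 then show "(%n. \<langle>\<xi> n, adj T (\<eta> n)\<rangle>) sums cnj (uwf \<eta> \<xi> T)" by (simp add: cnj_cinner adj_cinner'[OF T])
qed

lemma limitin_uw_adj:
 fixes f :: "'x => 'a::chilbert => 'b::chilbert"
 assumes "limitin uw_topology f L F" shows "limitin uw_topology (%x. adj (f x)) (adj L) F"
 unfolding limitin_uw_iff
proof (intro conjI allI impI)
 have f: "L \<in> bops" "\<forall>\<^sub>F x in F. f x \<in> bops" using assms by (simp_all add: limitin_uw_iff)
 show "adj L \<in> bops" by (rule adj_bops[OF f(1)])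
 show "\<forall>\<^sub>F x in F. adj (f x) \<in> bops" using f(2) by eventually_elim (rule adj_bops)
 fix \<xi> :: "nat => 'a" and \<eta> :: "nat => 'b" assume ss: "square_summable \<xi>" "square_summable \<eta>"
 have "((%x. cnj (uwf \<eta> \<xi> (f x))) \<longlongrightarrow> cnj (uwf \<eta> \<xi> L)) F"
  using assms ss by (intro tendsto_cnj) (simp add: limitin_uw_iff)
 moreover have "\<forall>\<^sub>F x in F. cnj (uwf \<eta> \<xi> (f x)) = uwf \<xi> \<eta> (adj (f x))"
  using f(2) by eventually_elim (simp add: uwf_adj ss)
 ultimately show "((%x. uwf \<xi> \<eta> (adj (f x))) \<longlongrightarrow> uwf \<xi> \<eta> (adj L)) F"
  unfolding uwf_adj[OF f(1) ss] by (rule Lim_transform_eventually)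
qed

section \<open>The stochastic derivative and its blocks\<close>

context flow
begin

text \<open>The operator on the right in \<open>theta_t\<close>; the one on the left is its
  adjoint.\<close>

definition frame :: "real => 'h \<times> ('k, 'h) tensor => ('h, 'k L2 fock) tensor" where
 "frame h p = h powr (-1/2) *\<^sub>R E_ket vacuum (fst p) + one_particle_iso h (snd p)"

lemma one_particle_iso:
 assumes h: "0 < h"
 shows "(one_particle_iso h :: ('k, 'h) tensor => _) = (%\<zeta>. h powr (-1/2) *\<^sub>R ampr (onepart h) (flip \<zeta>))"
proof -
 let ?V = "%\<zeta>::('k, 'h) tensor. h powr (-1/2) *\<^sub>R ampr (onepart h) (flip \<zeta>)"
 have pb: "(onepart h :: 'k => _) \<in> bops" by (rule part_bops) (use h in simp)
 have V: "?V \<in> bops" by (rule bops_rscale[OF bops_comp[OF op_tensor_bops[OF bops_id pb] isometry_bops[OF flip_isometry]]])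
 have e: "?V (c \<otimes> u) = u \<otimes> npart 1 (h powr (-1/2) *\<^sub>R L2_of (lo h (%_. c)))" for c u
  using npart_scale[of 1 "complex_of_real (h powr (-1/2))" "L2_of (lo h (%_. c))"]
  by (simp add: op_tensor_tensor[OF bops_id pb] onepart_def scaleC_of_real bops_scaleR[OF tensor_left_bops])
 show ?thesis unfolding one_particle_iso_def
 proof (rule the_equality)
  show "?V \<in> bops \<and> (\<forall>c u. ?V (c \<otimes> u) = u \<otimes> npart 1 (h powr (-1/2) *\<^sub>R L2_of (lo h (%_. c))))"
   using V e by blast
  show "V = ?V" if "V \<in> bops \<and> (\<forall>c u. V (c \<otimes> u) = u \<otimes> npart 1 (h powr (-1/2) *\<^sub>R L2_of (lo h (%_. c))))" for V
   by (rule tensor_bops_eq) (use that V e in auto)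
 qed
qed

lemma one_particle_bops: "0 < h ==> (one_particle_iso h :: ('k, 'h) tensor => _) \<in> bops"
 unfolding one_particle_iso
 by (rule bops_rscale[OF bops_comp[OF op_tensor_bops[OF bops_id part_bops] isometry_bops[OF flip_isometry]]]) simp

lemma fst_bops: "(fst :: 'a::chilbert \<times> 'b::chilbert => 'a) \<in> bops" and snd_bops: "(snd :: 'a::chilbert \<times> 'b::chilbert => 'b) \<in> bops"
 by (rule bopsI[where K = 1]; simp add: norm_components)+

lemma frame_bops: "0 < h ==> frame h \<in> bops"
 using bops_plus[OF bops_rscale[OF bops_comp[OF E_ket_bops fst_bops]] bops_comp[OF one_particle_bops snd_bops]]
 by (simp add: frame_def[abs_def])

lemma cinner_theta_t:
 assumes h: "0 < h"
 shows "\<langle>p, theta_t j h a q\<rangle> = \<langle>frame h p, j h a (frame h q) - amp a (frame h q)\<rangle>"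
 by (cases p; cases q)
   (simp add: theta_t_def frame_def cinner_prod_def cinner_add_left cinner_scaleR_left cinner_scaleR_right adj_cinner' E_ket_bops one_particle_bops[OF h])

lemma theta_t_adj:
 assumes h: "0 < h" and a: "a \<in> A"
 shows "theta_t j h a = (%p. adj (frame h) (j h a (frame h p) - amp a (frame h p)))" "theta_t j h a \<in> bops"
  "theta_t j h (adj a) = adj (theta_t j h a)"
proof -
 have h0: "0 <= h" using h by simp
 note jb = j_bops[OF h0 a] and fb = frame_bops[OF h] and ab = amp_bops[OF A_bops[OF a]]
 show e: "theta_t j h a = (%p. adj (frame h) (j h a (frame h p) - amp a (frame h p)))"
  by (rule bops_ext) (simp add: cinner_theta_t[OF h] adj_cinner'[OF fb])
 show b: "theta_t j h a \<in> bops" unfolding e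
  by (rule bops_comp[OF adj_bops[OF fb] bops_minus_op[OF bops_comp[OF jb fb] bops_comp[OF ab fb]]])
 have "j h (adj a) = adj (j h a)" by (rule normal_rep.J_adj[OF j_rep[OF h0] a])
 then show "theta_t j h (adj a) = adj (theta_t j h a)"
  by (intro bops_ext)
    (simp add: cinner_theta_t[OF h] adj_cinner'[OF b] amp_adj[OF A_bops[OF a], symmetric] cinner_diff_right adj_cinner'[OF jb] adj_cinner'[OF ab],
    metis cinner_theta_t[OF h] cnj_cinner cinner_diff_right complex_cnj_diff)
qed

lemma theta_limit:
 assumes "x \<in> theta_dom A j"
 shows "x \<in> A" "limitin uw_topology (%t. theta_t j t x) (theta j x) (at_right 0)"
proof -
 obtain L where L: "limitin uw_topology (%t. theta_t j t x) L (at_right 0)" and x: "x \<in> A"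
  using assms by (auto simp: theta_dom_def)
 show "x \<in> A" by (rule x)
 show "limitin uw_topology (%t. theta_t j t x) (theta j x) (at_right 0)"
  unfolding theta_def
  by (rule theI[where P = "%L. limitin uw_topology (%t. theta_t j t x) L (at_right 0)", OF L])
    (rule limitin_uw_unique[OF _ L], auto)
qed

lemma theta_bops: "x \<in> theta_dom A j ==> theta j x \<in> bops"
 by (rule limitin_uw_bops[OF theta_limit(2)])

lemma theta_adj:
 assumes x: "x \<in> theta_dom A j" shows "theta j (adj x) = adj (theta j x)"
proof -
 have "limitin uw_topology (%t. adj (theta_t j t x)) (adj (theta j x)) (at_right 0)"
  by (rule limitin_uw_adj[OF theta_limit(2)[OF x]])
 moreover have "\<forall>\<^sub>F t in at_right 0. adj (theta_t j t x) = theta_t j t (adj x)"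
  using eventually_at_right_less[of 0] by eventually_elim (simp add: theta_t_adj(3) theta_limit(1)[OF x])
 ultimately have L: "limitin uw_topology (%t. theta_t j t (adj x)) (adj (theta j x)) (at_right 0)"
  by (rule limitin_transform_eventually[rotated])
 show ?thesis unfolding theta_def[of j "adj x"]
  by (rule the_equality[where P = "%L. limitin uw_topology (%t. theta_t j t (adj x)) L (at_right 0)", OF L])
    (rule limitin_uw_unique[OF _ L], auto)
qed

text \<open>By definition this block is the adjoint of the lower left block at \<open>adj x\<close>.
  Since theta commutes with adjoints, it is the upper right block of theta at
  \<open>x\<close>.\<close>

lemma theta_delta_dag:
 assumes x: "x \<in> theta_dom A j"
 shows "\<langle>u, theta_delta_dag j x \<zeta>\<rangle> = \<langle>u, fst (theta j x (0, \<zeta>))\<rangle>" "theta_delta_dag j x \<in> bops"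
proof -
 note tb = theta_bops[OF x]
 have ub: "(%u. (u, 0)) \<in> bops" by (rule bopsI[where K = 1]) (simp_all add: scaleC_prod_def norm_Pair)
 have db: "theta_delta j (adj x) \<in> bops"
  unfolding theta_delta_def theta_adj[OF x] by (rule bops_comp[OF snd_bops bops_comp[OF adj_bops[OF tb] ub]])
 show "theta_delta_dag j x \<in> bops" unfolding theta_delta_dag_def by (rule adj_bops[OF db])
 have "\<langle>u, theta_delta_dag j x \<zeta>\<rangle> = \<langle>adj (theta j x) (u, 0), (0, \<zeta>)\<rangle>"
  unfolding theta_delta_dag_def adj_cinner'[OF db] by (simp add: theta_delta_def theta_adj[OF x] cinner_prod_def)
 also have "\<dots> = \<langle>u, fst (theta j x (0, \<zeta>))\<rangle>" unfolding adj_cinner[OF tb] by (simp add: cinner_prod_def)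
 finally show "\<langle>u, theta_delta_dag j x \<zeta>\<rangle> = \<langle>u, fst (theta j x (0, \<zeta>))\<rangle>" .
qed

lemma cinner_E_ket_part:
 assumes "0 <= h" shows "\<langle>E_ket vacuum u, ampr (onepart h) z\<rangle> = 0"
 using cinner_E_bra[of u vacuum "ampr (onepart h) z"]
 by (simp only: E_bra_vacuum_part[OF assms] cinner_zero_right) (simp add: E_ket_def)

lemma cinner_E_ket: "\<langle>E_ket \<psi> u, E_ket \<psi> v\<rangle> = \<langle>u, v\<rangle> * \<langle>\<psi>, \<psi>\<rangle>"
 by (simp add: E_ket_def cinner_tensor)

text \<open>The upper left block of \<open>theta_t\<close> is the difference quotient of the
  expectation semigroup, because both compress the flow to the vacuum.\<close>

lemma expectation_generator:
 assumes P0: "\<forall>t\<ge>0. \<forall>a\<in>A. P0 t a = vacuum_expectation (j t a)" and P0A: "\<forall>t\<ge>0. \<forall>a\<in>A. P0 t a \<in> A"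
  and x: "x \<in> theta_dom A j"
 shows "weak_generator A P0 x (theta_L j x)"
proof -
 note xA = theta_limit(1)[OF x]
 have ub: "(%u. (u, 0)) \<in> bops" by (rule bopsI[where K = 1]) (simp_all add: scaleC_prod_def norm_Pair)
 have "limitin uw_topology (%t u. fst (theta_t j t x (u, 0))) (theta_L j x) (at_right 0)"
  using continuous_map_limit[OF normal_conj[OF fst_bops ub] theta_limit(2)[OF x]] by (simp add: o_def theta_L_def)
 moreover have "\<forall>\<^sub>F t in at_right 0. (%u. fst (theta_t j t x (u, 0))) = (%u. (1 / t) *\<^sub>R (P0 t x u - x u))"
  using eventually_at_right_less[of 0]
 proof eventually_elim
  case (elim t)
  show ?case
  proof (rule bops_ext)
   fix u v
   have p: "complex_of_real (t powr - (1/2)) * complex_of_real (t powr - (1/2)) = complex_of_real (1 / t)"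
    using elim powr_add[of t "- (1/2)" "- (1/2)"] by (simp add: powr_minus_divide flip: of_real_mult)
   have "one_particle_iso t (0 :: ('k, 'h) tensor) = 0" by (rule bops_0[OF one_particle_bops[OF elim]])
   then have f: "frame t (w, 0) = t powr (-1/2) *\<^sub>R E_ket vacuum w" for w by (simp add: frame_def)
   have "\<langle>u, fst (theta_t j t x (v, 0))\<rangle> = \<langle>(u, 0), theta_t j t x (v, 0)\<rangle>" by (simp add: cinner_prod_def)
   also have "\<dots> = complex_of_real (1 / t) * (\<langle>E_ket vacuum u, j t x (E_ket vacuum v)\<rangle> - \<langle>E_ket vacuum u, amp x (E_ket (vacuum :: 'k L2 fock) v)\<rangle>)"
    unfolding cinner_theta_t[OF elim] f p[symmetric]
    using elim by (simp add: bops_scaleR[OF j_bops[OF _ xA]] bops_scaleR[OF amp_bops[OF A_bops[OF xA]]] cinner_scaleR_left cinner_scaleR_right cinner_diff_right algebra_simps)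
   also have "\<langle>E_ket vacuum u, j t x (E_ket vacuum v)\<rangle> = \<langle>u, P0 t x v\<rangle>"
    using P0 xA elim by (simp add: vacuum_expectation_def slice_def adj_cinner'[OF E_ket_bops])
   also have "\<langle>E_ket vacuum u, amp x (E_ket (vacuum :: 'k L2 fock) v)\<rangle> = \<langle>u, x v\<rangle>"
    by (simp add: op_tensor_E_ket A_bops xA cinner_E_ket)
   finally show "\<langle>u, fst (theta_t j t x (v, 0))\<rangle> = \<langle>u, (1 / t) *\<^sub>R (P0 t x v - x v)\<rangle>"
    by (simp add: cinner_scaleR_right cinner_diff_right)
  qed
 qed
 ultimately have lim: "limitin uw_topology (%t u. (1 / t) *\<^sub>R (P0 t x u - x u)) (theta_L j x) (at_right 0)"
  by (rule limitin_transform_eventually[rotated])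
 have "\<forall>\<^sub>F t in at_right 0. (%u. (1 / t) *\<^sub>R (P0 t x u - x u)) \<in> A"
  using eventually_at_right_less[of 0] by eventually_elim (use P0A xA in \<open>auto intro!: A_rscale A_diff\<close>)
 then have "theta_L j x \<in> A"
  by (rule A_weak_limit[OF limitin_uw_bops[OF lim] _ limitin_uw_cinner[OF lim]]) simp
 then show ?thesis using lim xA by (simp add: weak_generator_def)
qed

end

context driven
begin

text \<open>The factor \<open>sqrt h\<close> cancels the normalisation of both components of
  \<open>frame\<close>; a compression by two columns \<open>W\<close> is thus \<open>h\<close> times
  one by \<open>frame\<close>.\<close>

lemma W_frame:
 assumes h: "0 < h" shows "W h u = sqrt h *\<^sub>R frame h (complex_of_real h *\<^sub>C k u + u, l u)"
proof -
 have "sqrt h * h powr (-1/2) = 1" using h by (simp add: powr_half_sqrt[symmetric] flip: powr_add)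
 then show ?thesis
  by (simp add: W_def ecol_def frame_def one_particle_iso[OF h] L_def scaleR_add_right)
qed

end

section \<open>Difference quotients of the one-step map\<close>

context perturbation
begin

lemma cinner_W:
 assumes h: "0 <= h" and a: "a \<in> A"
 shows "\<langle>D1.W h u, amp a (D2.W h v)\<rangle> = \<langle>complex_of_real h *\<^sub>C k1 u + u, a (complex_of_real h *\<^sub>C k2 v + v)\<rangle>
  + complex_of_real h * \<langle>l1 u, ampr a (l2 v)\<rangle>"
proof -
 note ab = A_bops[OF a] and pb = part_bops[OF h]
 have "amp a (ampr (onepart h) z) = ampr (onepart h) (amp a z)" for z :: "('h, 'k) tensor"
  by (simp add: op_tensor_comp ab pb)
 moreover have "\<langle>ampr (onepart h) z, E_ket vacuum w\<rangle> = 0" for z :: "('h, 'k) tensor" and w :: 'h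
  using cnj_cinner[of "E_ket vacuum w" "ampr (onepart h) z"] by (simp add: cinner_E_ket_part[OF h])
 moreover have "\<langle>D1.L u, amp a (D2.L v)\<rangle> = \<langle>l1 u, ampr a (l2 v)\<rangle>"
  by (simp add: D1.L_def D2.L_def flip_op_tensor[OF ab, symmetric] isometry_cinner[OF flip_isometry])
 ultimately show ?thesis
  by (simp add: D1.W_def D2.W_def ecol_def bops_add[OF amp_bops[OF ab]] op_tensor_E_ket ab cinner_add_left cinner_add_right
    cinner_E_ket_part[OF h] cinner_op_tensor_part[OF h] cinner_E_ket)
qed

definition rateS :: "real => ('h => 'h) => 'h => 'h" where
 "rateS h a = (%u. (1 / h) *\<^sub>R (S h a u - a u))"

lemma rateS_in: "0 <= h ==> a \<in> A ==> rateS h a \<in> A"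
 unfolding rateS_def by (intro A_rscale A_diff S_in)

text \<open>Adding and subtracting \<open>a \<otimes> 1\<close> between the columns separates
  \<open>theta_t\<close> from an explicit remainder. The last term of the remainder restores
  \<open>\<iota>\<close> in the lower right block, so that in the limit \<pi> appears instead of
  \<open>\<pi> - \<iota>\<close>.\<close>

lemma cinner_rateS:
 assumes h: "0 < h" and a: "a \<in> A"
 shows "\<langle>u, rateS h a v\<rangle> = \<langle>(complex_of_real h *\<^sub>C k1 u + u, l1 u), theta_t j h a (complex_of_real h *\<^sub>C k2 v + v, l2 v)\<rangle>
  + \<langle>k1 u, a (complex_of_real h *\<^sub>C k2 v + v)\<rangle> + \<langle>u, a (k2 v)\<rangle> + \<langle>l1 u, ampr a (l2 v)\<rangle>"
proof -
 have h0: "0 <= h" using h by simp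
 note ab = A_bops[OF a]
 let ?p = "(complex_of_real h *\<^sub>C k1 u + u, l1 u)" and ?q = "(complex_of_real h *\<^sub>C k2 v + v, l2 v)"
 have "\<langle>u, S h a v\<rangle> = \<langle>D1.W h u, j h a (D2.W h v)\<rangle>"
  by (simp add: S_def adj_cinner'[OF column_bops[OF D1.column_W[OF h0]]])
 also have "\<dots> = \<langle>D1.W h u, j h a (D2.W h v) - amp a (D2.W h v)\<rangle> + \<langle>D1.W h u, amp a (D2.W h v)\<rangle>"
  by (simp add: cinner_diff_right)
 also have "\<langle>D1.W h u, j h a (D2.W h v) - amp a (D2.W h v)\<rangle> = complex_of_real h * \<langle>?p, theta_t j h a ?q\<rangle>"
 proof -
  have "complex_of_real (sqrt h) * complex_of_real (sqrt h) = complex_of_real h" using h by (simp flip: of_real_mult)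
  then show ?thesis
   unfolding D1.W_frame[OF h] D2.W_frame[OF h] cinner_theta_t[OF h] bops_scaleR[OF j_bops[OF h0 a]] bops_scaleR[OF amp_bops[OF ab]]
   by (simp add: cinner_scaleR_left cinner_scaleR_right scaleR_diff_right[symmetric] mult.assoc[symmetric])
 qed
 finally have "\<langle>u, S h a v - a v\<rangle> = complex_of_real h * (\<langle>?p, theta_t j h a ?q\<rangle> + \<langle>k1 u, a (complex_of_real h *\<^sub>C k2 v + v)\<rangle> + \<langle>u, a (k2 v)\<rangle> + \<langle>l1 u, ampr a (l2 v)\<rangle>)"
  unfolding cinner_W[OF h0 a]
  by (simp add: bops_add[OF ab] bops_scaleC[OF ab] cinner_diff_right cinner_add_left cinner_add_right cinner_scaleC_left cinner_scaleC_right algebra_simps)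
 then show ?thesis using h by (simp add: rateS_def cinner_scaleR_right)
qed

definition gen :: "('h => 'h) => 'h => 'h" where
 "gen x = (%u. theta_L j x u + adj l1 (theta_delta j x u) + adj l1 (theta_pi j x (l2 u))
      + theta_delta_dag j x (l2 u) + adj k1 (x u) + x (k2 u))"

lemma l_bops: "l1 \<in> bops" "l2 \<in> bops" "k1 \<in> bops" "k2 \<in> bops"
 using D1.l D2.l ket_uw_tensor_bops D1.k D2.k A_bops by blast+

lemma cinner_gen:
 assumes x: "x \<in> theta_dom A j"
 shows "\<langle>u, gen x v\<rangle> = \<langle>(u, l1 u), theta j x (v, l2 v)\<rangle> + \<langle>k1 u, x v\<rangle> + \<langle>u, x (k2 v)\<rangle> + \<langle>l1 u, ampr x (l2 v)\<rangle>"
proof -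
 have "theta j x (v, l2 v) = theta j x (v, 0) + theta j x (0, l2 v)"
  using bops_add[OF theta_bops[OF x], of "(v, 0)" "(0, l2 v)"] by simp
 then show ?thesis
  by (simp add: gen_def cinner_add_right adj_cinner' l_bops theta_delta_dag(1)[OF x] theta_L_def theta_delta_def theta_pi_def cinner_prod_def)
qed

lemma gen_bops:
 assumes x: "x \<in> theta_dom A j" shows "gen x \<in> bops"
proof -
 note tb = theta_bops[OF x] and xb = A_bops[OF theta_limit(1)[OF x]]
 have ub: "(%u. (u, 0)) \<in> bops" "(%\<zeta>. (0, \<zeta>)) \<in> bops"
  by (rule bopsI[where K = 1]; simp add: scaleC_prod_def norm_Pair)+
 have "theta_L j x \<in> bops" "theta_delta j x \<in> bops" "theta_pi j x \<in> bops"
  unfolding theta_L_def theta_delta_def theta_pi_def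
  by (rule bops_comp[OF fst_bops bops_comp[OF tb ub(1)]] bops_comp[OF snd_bops bops_comp[OF tb ub(1)]]
    bops_plus[OF bops_comp[OF snd_bops bops_comp[OF tb ub(2)]] op_tensor_bops[OF bops_id xb]])+
 note b = this
 show ?thesis unfolding gen_def
  by (rule bops_plus[OF bops_plus[OF bops_plus[OF bops_plus[OF bops_plus[OF b(1) bops_comp[OF adj_bops[OF l_bops(1)] b(2)]]
    bops_comp[OF adj_bops[OF l_bops(1)] bops_comp[OF b(3) l_bops(2)]]] bops_comp[OF theta_delta_dag(2)[OF x] l_bops(2)]]
    bops_comp[OF adj_bops[OF l_bops(3)] xb]] bops_comp[OF xb l_bops(4)]])
qed

text \<open>The vectors next to \<open>theta_t\<close> themselves depend on \<open>h\<close>, so its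
  weak convergence has to be supplemented by a uniform bound, which is available along the dyadic
  sequence.\<close>

lemma rateS_limit:
 assumes x: "x \<in> theta_dom A j"
 shows "(%M. \<langle>u, rateS (1 / 2 ^ M) x v\<rangle>) \<longlonglongrightarrow> \<langle>u, gen x v\<rangle>"
proof -
 note xA = theta_limit(1)[OF x]
 note xb = A_bops[OF xA]
 let ?h = "%M. 1 / 2 ^ M :: real"
 have h0: "0 < ?h M" for M by simp
 have hl: "?h \<longlonglongrightarrow> 0" using LIMSEQ_power_zero[of "1/2 :: real"] by (simp add: power_one_over)
 have fl: "filterlim ?h (at_right 0) sequentially"
  unfolding filterlim_at using hl by auto
 have th: "(%M. \<langle>p, theta_t j (?h M) x q\<rangle>) \<longlonglongrightarrow> \<langle>p, theta j x q\<rangle>" for p q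
  using filterlim_compose[OF limitin_uw_cinner[OF theta_limit(2)[OF x]] fl] .
 obtain K where K: "0 <= K" "!!M v. norm (theta_t j (?h M) x v) <= K * norm v"
  using weakly_convergent_bounded[OF theta_t_adj(2)[OF h0 xA] th] by blast
 have y: "(%M. complex_of_real (?h M) *\<^sub>C w + w') \<longlonglongrightarrow> w'" for w w' :: 'h
  using tendsto_add[OF tendsto_scaleR[OF hl tendsto_const[of w]] tendsto_const[of w']] by (simp only: scaleC_of_real scaleR_zero_left add_0_left)
 have "(%M. \<langle>(complex_of_real (?h M) *\<^sub>C k1 u + u, l1 u), theta_t j (?h M) x (complex_of_real (?h M) *\<^sub>C k2 v + v, l2 v)\<rangle>) \<longlonglongrightarrow> \<langle>(u, l1 u), theta j x (v, l2 v)\<rangle>"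
  by (rule bounded_weak_strong_tendsto[OF tendsto_Pair[OF y tendsto_const] tendsto_Pair[OF y tendsto_const] _ th])
    (use theta_t_adj(2)[OF h0 xA] K(2) in \<open>intro always_eventually allI conjI\<close>)
 moreover have "(%M. \<langle>k1 u, x (complex_of_real (?h M) *\<^sub>C k2 v + v)\<rangle>) \<longlonglongrightarrow> \<langle>k1 u, x v\<rangle>"
  by (rule bounded_bilinear.tendsto[OF bounded_bilinear_cinner tendsto_const bops_tendsto[OF xb y]])
 ultimately show ?thesis
  unfolding cinner_gen[OF x] cinner_rateS[OF h0 xA] by (intro tendsto_add tendsto_const)
qed

lemma gen_in:
 assumes x: "x \<in> theta_dom A j" shows "gen x \<in> A"
 by (rule A_weak_limit[OF gen_bops[OF x] always_eventually rateS_limit[OF x]]) (use rateS_in[OF _ theta_limit(1)[OF x]] in auto)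

end

text \<open>Averaging over the starting point \<open>s\<close> turns Riemann sums of \<open>P\<^sub>s(b\<^sub>h)\<close> into integrals, in which
 \<open>b\<^sub>h\<close> can tend to \<open>b\<close> for fixed \<open>s\<close>: \<open>P\<close> need not be jointly continuous in \<open>s\<close> and \<open>b\<close>.\<close>

lemma integral_average_bound:
 fixes f :: "real => complex"
 assumes h: "0 < h" and f: "continuous_on {0..} f"
  and e: "!!s. 0 <= s ==> s <= h ==> norm (C - complex_of_real h * (\<Sum>i<n. f (s + real i * h))) <= e"
 shows "norm (C - integral {0..real n * h} f) <= e"
proof -
 have fs: "continuous_on {0..h} (%s. f (s + real i * h))" for i
  by (rule continuous_on_compose2[OF f]) (use h in \<open>auto intro!: continuous_intros\<close>)
 \<comment> \<open>The translates of \<open>[0, h]\<close> by multiples of \<open>h\<close> tile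
   \<open>[0, n h]\<close>.\<close>
 have sum: "integral {0..h} (%s. \<Sum>i<n. f (s + real i * h)) = integral {0..real n * h} f" for n
 proof (induction n)
  case (Suc n)
  have fi: "continuous_on {a..b} f" if "0 <= a" for a b by (rule continuous_on_subset[OF f]) (use that in auto)
  have "integral {0..h} (%s. f (s + real n * h)) = integral {real n * h..real n * h + h} f"
   using integral_shift_Icc_real[of 0 h f "real n * h"] by (simp add: o_def add.commute)
  moreover have "integral {0..real n * h} f + integral {real n * h..real n * h + h} f = integral {0..real n * h + h} f"
   by (rule Henstock_Kurzweil_Integration.integral_combine) (use h in \<open>auto intro!: integrable_continuous_real fi\<close>)
  moreover have "integral {0..h} (%s. \<Sum>i<Suc n. f (s + real i * h)) =
    integral {0..h} (%s. \<Sum>i<n. f (s + real i * h)) + integral {0..h} (%s. f (s + real n * h))"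
   by (simp add: integral_add integrable_continuous_real continuous_on_sum fs)
  ultimately show ?case using Suc by (simp add: algebra_simps del: sum.lessThan_Suc)
 qed simp
 have c: "continuous_on {0..h} (%s. \<Sum>i<n. f (s + real i * h))" by (intro continuous_on_sum fs)
 have "integral {0..h} (%s. C - complex_of_real h * (\<Sum>i<n. f (s + real i * h))) =
   integral {0..h} (%s. C) - complex_of_real h * integral {0..h} (%s. \<Sum>i<n. f (s + real i * h))"
  by (subst Henstock_Kurzweil_Integration.integral_diff) (auto intro!: integrable_continuous_real continuous_on_mult_left c)
 also have "\<dots> = complex_of_real h * (C - integral {0..real n * h} f)"
  unfolding sum using h by (simp add: scaleR_conv_of_real algebra_simps)
 finally have "h * norm (C - integral {0..real n * h} f) = norm (integral {0..h} (%s. C - complex_of_real h * (\<Sum>i<n. f (s + real i * h))))"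
  using h by (simp add: norm_mult)
 also have "\<dots> <= e * (h - 0)"
  by (rule integral_bound) (use h e c in \<open>auto intro!: continuous_intros\<close>)
 finally show ?thesis using h by simp
qed

section \<open>The integral formula and the generator\<close>

context perturbation
begin

lemma rateS_bounded:
 assumes x: "x \<in> theta_dom A j"
 obtains K where "0 <= K" "!!M. onorm (rateS (1 / 2 ^ M) x) <= K"
proof -
 have b: "rateS (1 / 2 ^ M) x \<in> bops" for M
  by (rule A_bops[OF rateS_in[OF _ theta_limit(1)[OF x]]]) simp
 obtain K where "0 <= K" "!!M v. norm (rateS (1 / 2 ^ M) x v) <= K * norm v"
  using weakly_convergent_bounded[OF b rateS_limit[OF x]] by blast
 then show thesis using that onorm_bound by blast
qed

text \<open>A telescoping sum of single steps: for the polygons the discrete fundamental theorem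
  holds without error.\<close>

lemma path_increment:
 assumes s: "0 <= s" and h: "0 < h" and y: "y1 \<in> adapted s" "y2 \<in> adapted s" and a: "a \<in> A"
 shows "\<langle>D1.path s h y1 n, j (s + real n * h) a (D2.path s h y2 n)\<rangle> - \<langle>y1, j s a y2\<rangle> =
  complex_of_real h * (\<Sum>i<n. \<langle>D1.path s h y1 i, j (s + real i * h) (rateS h a) (D2.path s h y2 i)\<rangle>)"
proof (induction n)
 case (Suc n)
 let ?y1 = "D1.path s h y1 n" and ?y2 = "D2.path s h y2 n" and ?t = "s + real n * h"
 have t: "0 <= ?t" and h0: "0 <= h" using s h by simp_all
 have e: "s + real (Suc n) * h = ?t + h" by (simp add: algebra_simps)
 have S: "(%u. adj (D1.W h) (j h a (D2.W h u))) = (%u. complex_of_real h *\<^sub>C rateS h a u + a u)"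
  using h by (simp add: rateS_def S_def scaleC_of_real)
 have "\<langle>D1.path s h y1 (Suc n), j (?t + h) a (D2.path s h y2 (Suc n))\<rangle> = \<langle>?y1, j ?t (%u. complex_of_real h *\<^sub>C rateS h a u + a u) ?y2\<rangle>"
  unfolding D1.path.simps D2.path.simps S[symmetric]
  by (rule single_step[OF t h0 D1.path_adapted[OF s h0 y(1)] D2.path_adapted[OF s h0 y(2)] D1.column_W[OF h0] D2.column_W[OF h0] a])
 also have "\<dots> = complex_of_real h * \<langle>?y1, j ?t (rateS h a) ?y2\<rangle> + \<langle>?y1, j ?t a ?y2\<rangle>"
  by (simp add: normal_rep.J_lincomb[OF j_rep[OF t] rateS_in[OF h0 a] a] cinner_add_right cinner_scaleC_right)
 finally show ?case unfolding e using Suc by (simp add: algebra_simps)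
qed simp

text \<open>The error in the same summation formula once the polygons are replaced by the semigroup
  itself.\<close>

definition defect :: "('h => 'h) => 'h => 'h => nat => nat => real => complex" where
 "defect x u v M n s = \<langle>u, P (s + real n * (1 / 2 ^ M)) x v\<rangle> - \<langle>u, P s x v\<rangle>
  - complex_of_real (1 / 2 ^ M) * (\<Sum>i<n. \<langle>u, P (s + real i * (1 / 2 ^ M)) (rateS (1 / 2 ^ M) x) v\<rangle>)"

text \<open>By \<open>path_increment\<close> the defect is due only to replacing polygon points by
  solution vectors, in the end term and in each summand. The summands carry the factor
  \<open>h\<close> and a common operator bound \<open>K\<close>, so their total cost is proportional
  to \<open>T * K\<close>.\<close>

lemma defect_dyadic:
 assumes x: "x \<in> theta_dom A j" and T: "0 <= T" and e: "0 < e"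
 shows "\<exists>N. \<forall>M\<ge>N. \<forall>q m n s. s = real q / 2 ^ m \<longrightarrow> s + real n * (1 / 2 ^ M) <= T \<longrightarrow> cmod (defect x u v M n s) <= e"
proof -
 note xA = theta_limit(1)[OF x]
 obtain K where K: "0 <= K" "!!M. onorm (rateS (1 / 2 ^ M) x) <= K" using rateS_bounded[OF x] by blast
 \<comment> \<open>Bounds the solution vectors up to time \<open>T\<close> and, because of the
   summand 1 and \<open>d \<le> 1\<close>, also the polygon points.\<close>
 define B where "B = exp (rate / 2 * T) * (norm u + norm v) + 1"
 \<comment> \<open>Tolerance for the polygons such that all replacements together cost at most
   \<open>e\<close>.\<close>
 define d where "d = min 1 (e / (2 * B * (T * K + onorm x) + 1))"
 have ox: "0 <= onorm x" by (rule onorm_ge0[OF A_bops[OF xA]])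
 have B: "1 <= B" by (simp add: B_def)
 have den: "0 <= 2 * B * (T * K + onorm x)" using B T K ox by simp
 have d: "0 < d" "d <= 1" "2 * d * B * (T * K + onorm x) <= e"
 proof -
  show "0 < d" "d <= 1" using den e by (simp_all add: d_def)
  have "d * (2 * B * (T * K + onorm x)) <= d * (2 * B * (T * K + onorm x) + 1)" using \<open>0 < d\<close> by (intro mult_left_mono) auto
  also have "\<dots> <= e / (2 * B * (T * K + onorm x) + 1) * (2 * B * (T * K + onorm x) + 1)" using den by (intro mult_right_mono) (auto simp: d_def)
  also have "\<dots> = e" using den by simp
  finally show "2 * d * B * (T * K + onorm x) <= e" by (simp add: mult_ac)
 qed
 obtain N1 where N1: "\<forall>M\<ge>N1. \<forall>q m n s. s = real q / 2 ^ m \<longrightarrow> s + real n * (1 / 2 ^ M) <= T \<longrightarrow>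
  norm (D1.path s (1 / 2 ^ M) (D1.X s u) n - D1.X (s + real n * (1 / 2 ^ M)) u) <= d"
  using D1.path_convergence[OF T d(1)] by blast
 obtain N2 where N2: "\<forall>M\<ge>N2. \<forall>q m n s. s = real q / 2 ^ m \<longrightarrow> s + real n * (1 / 2 ^ M) <= T \<longrightarrow>
  norm (D2.path s (1 / 2 ^ M) (D2.X s v) n - D2.X (s + real n * (1 / 2 ^ M)) v) <= d"
  using D2.path_convergence[OF T d(1)] by blast
 show ?thesis
 proof (intro exI[of _ "max N1 N2"] allI impI)
  fix M q m n s assume M: "max N1 N2 <= M" and s: "s = real q / 2 ^ m" and sT: "s + real n * (1 / 2 ^ M) <= T"
  let ?h = "1 / 2 ^ M :: real"
  let ?y1 = "D1.path s ?h (D1.X s u)" and ?y2 = "D2.path s ?h (D2.X s v)" and ?t = "%i. s + real i * ?h"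
  have h: "0 < ?h" and s0: "0 <= s" using s by simp_all
  have close: "cmod (\<langle>?y1 i, j (?t i) c (?y2 i)\<rangle> - \<langle>u, P (?t i) c v\<rangle>) <= 2 * d * B * k"
   if i: "i <= n" and c: "c \<in> A" "onorm c <= k" for i c k
  proof -
   have t0: "0 <= ?t i" using s0 by simp
   have "real i * ?h <= real n * ?h" using i by (intro mult_right_mono) auto
   then have tT: "?t i <= T" using sT by linarith
   have n1: "norm (?y1 i - D1.X (?t i) u) <= d" and n2: "norm (?y2 i - D2.X (?t i) v) <= d"
    using N1 N2 M s tT by auto
   have E: "exp (rate / 2 * ?t i) <= exp (rate / 2 * T)" using tT rate(1) by (simp add: mult_left_mono)
   have "norm (D1.X (?t i) u) <= exp (rate / 2 * ?t i) * norm u" by (rule D1.norm_X[OF t0 rate(2)])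
   also have "\<dots> <= exp (rate / 2 * T) * (norm u + norm v)" using E by (intro mult_mono) auto
   finally have B1: "norm (D1.X (?t i) u) <= B" by (simp add: B_def)
   have "norm (D2.X (?t i) v) <= exp (rate / 2 * ?t i) * norm v" by (rule D2.norm_X[OF t0 rate(3)])
   also have "\<dots> <= exp (rate / 2 * T) * (norm u + norm v)" using E by (intro mult_mono) auto
   finally have B2: "norm (?y2 i) <= B"
    using norm_triangle_sub[of "?y2 i" "D2.X (?t i) v"] n2 d(2) by (simp add: B_def)
   have k0: "0 <= k" using onorm_ge0[OF A_bops[OF c(1)]] c(2) by linarith
   have jn: "norm (j (?t i) c z) <= k * norm z" for z
    by (rule order_trans[OF j_norm[OF t0 c(1)] mult_right_mono[OF c(2)]]) simp
   have e: "\<langle>?y1 i, j (?t i) c (?y2 i)\<rangle> - \<langle>u, P (?t i) c v\<rangle> =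
    \<langle>?y1 i - D1.X (?t i) u, j (?t i) c (?y2 i)\<rangle> + \<langle>D1.X (?t i) u, j (?t i) c (?y2 i - D2.X (?t i) v)\<rangle>"
    unfolding cinner_P[OF t0] by (simp only: cinner_diff_left cinner_diff_right bops_diff[OF j_bops[OF t0 c(1)]]) simp
   have F: "norm (j (?t i) c (?y2 i)) <= k * B" "norm (j (?t i) c (?y2 i - D2.X (?t i) v)) <= k * d"
    by (rule order_trans[OF jn mult_left_mono[OF B2 k0]] order_trans[OF jn mult_left_mono[OF n2 k0]])+
   have "norm (?y1 i - D1.X (?t i) u) * norm (j (?t i) c (?y2 i)) + norm (D1.X (?t i) u) * norm (j (?t i) c (?y2 i - D2.X (?t i) v)) <= d * (k * B) + B * (k * d)"
    by (rule add_mono[OF mult_mono[OF n1 F(1)] mult_mono[OF B1 F(2)]]) (use d(1) B in simp_all)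
   from order_trans[OF norm_triangle_ineq order_trans[OF add_mono[OF cinner_CS cinner_CS] this]]
   show ?thesis unfolding e by (simp add: algebra_simps)
  qed
  let ?g = "%i. \<langle>?y1 i, j (?t i) (rateS ?h x) (?y2 i)\<rangle>" and ?f = "%i. \<langle>u, P (?t i) (rateS ?h x) v\<rangle>"
  have rA: "rateS ?h x \<in> A" by (rule rateS_in[OF _ xA]) simp
  have e: "defect x u v M n s = (\<langle>u, P (?t n) x v\<rangle> - \<langle>?y1 n, j (?t n) x (?y2 n)\<rangle>) + complex_of_real ?h * (\<Sum>i<n. ?g i - ?f i)"
   using path_increment[OF s0 h D1.X_adapted[OF s0] D2.X_adapted[OF s0] xA, of u n v]
   by (simp add: defect_def cinner_P[OF s0] sum_subtractf algebra_simps)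
  have 1: "cmod (\<langle>u, P (?t n) x v\<rangle> - \<langle>?y1 n, j (?t n) x (?y2 n)\<rangle>) <= 2 * d * B * onorm x"
   using close[OF order_refl xA order_refl] by (simp only: norm_minus_commute)
  have "cmod (\<Sum>i<n. ?g i - ?f i) <= (\<Sum>i<n. 2 * d * B * K)"
   by (rule sum_norm_le) (use close[OF _ rA K(2)] in auto)
  then have "cmod (complex_of_real ?h * (\<Sum>i<n. ?g i - ?f i)) <= ?h * (\<Sum>i<n. 2 * d * B * K)"
   unfolding norm_mult norm_of_real by (intro mult_mono) auto
  also have "\<dots> = (real n * ?h) * (2 * d * B * K)" by simp
  also have "\<dots> <= T * (2 * d * B * K)" using sT s0 d(1) B K(1) by (intro mult_right_mono) auto
  finally have "cmod (defect x u v M n s) <= 2 * d * B * onorm x + T * (2 * d * B * K)"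
   unfolding e by (intro norm_triangle_le add_mono 1)
  also have "\<dots> = 2 * d * B * (T * K + onorm x)" by (simp add: algebra_simps)
  finally show "cmod (defect x u v M n s) <= e" using d(3) by linarith
 qed
qed

text \<open>For fixed \<open>M\<close> and \<open>n\<close> the defect is continuous in
  \<open>s\<close>. The dyadic approximations lie below \<open>s\<close>, so the constraint by
  \<open>T\<close> is preserved.\<close>

lemma defect_vanishes:
 assumes x: "x \<in> theta_dom A j" and T: "0 <= T" and e: "0 < e"
 shows "\<exists>N. \<forall>M\<ge>N. \<forall>n. \<forall>s\<ge>0. s + real n * (1 / 2 ^ M) <= T \<longrightarrow> cmod (defect x u v M n s) <= e"
proof -
 note xA = theta_limit(1)[OF x]
 obtain N where N: "\<forall>M\<ge>N. \<forall>q m n s. s = real q / 2 ^ m \<longrightarrow> s + real n * (1 / 2 ^ M) <= T \<longrightarrow> cmod (defect x u v M n s) <= e"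
  using defect_dyadic[OF assms] by blast
 show ?thesis
 proof (intro exI[of _ N] allI impI)
  fix M n and s :: real assume M: "N <= M" and s: "0 <= s" and sT: "s + real n * (1 / 2 ^ M) <= T"
  let ?h = "1 / 2 ^ M :: real" and ?\<sigma> = "%m. real (nat \<lfloor>s * 2 ^ m\<rfloor>) * (1 / 2 ^ m)"
  have rA: "rateS ?h x \<in> A" by (rule rateS_in[OF _ xA]) simp
  have P: "(%m. \<langle>u, P (?\<sigma> m + r) a v\<rangle>) \<longlonglongrightarrow> \<langle>u, P (s + r) a v\<rangle>" if "a \<in> A" "0 <= r" for a r
   by (rule P_tendsto[OF that(1) _ tendsto_add[OF dyadic_floor_tendsto[OF s] tendsto_const]]) (use that s in auto)
  have "(%m. cmod (defect x u v M n (?\<sigma> m))) \<longlonglongrightarrow> cmod (defect x u v M n s)"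
   unfolding defect_def using P[OF xA, of 0]
   by (intro tendsto_norm tendsto_diff tendsto_mult_left tendsto_sum P xA rA) auto
  then show "cmod (defect x u v M n s) <= e"
  proof (rule LIMSEQ_le_const2, intro exI[of _ 0] allI impI)
   fix m
   show "cmod (defect x u v M n (?\<sigma> m)) <= e"
    using sT D1.S.idx_time(1)[OF s, of m]
    by (intro N[rule_format, OF M, where q = "nat \<lfloor>s * 2 ^ m\<rfloor>" and m = m]) auto
  qed
 qed
qed

lemma P_form_continuous: "a \<in> A ==> continuous_on {0..} (%s. \<langle>u, P s a v\<rangle>)"
 unfolding continuous_on
proof
 fix t :: real assume a: "a \<in> A" and t: "t \<in> {0..}"
 show "((%s. \<langle>u, P s a v\<rangle>) \<longlongrightarrow> \<langle>u, P t a v\<rangle>) (at t within {0..})"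
  by (rule P_tendsto[OF a]) (use t in \<open>auto simp: eventually_at intro: exI[of _ 1]\<close>)
qed

text \<open>The integrals of the forms of \<open>P s\<close> at the difference quotients have two
  limits: dominated convergence inserts \<open>gen x\<close> for each fixed \<open>s\<close>, and
  the averaging lemma with small defect gives the left-hand side. As \<open>t\<close> is dyadic,
  fine steps divide it exactly.\<close>

lemma P_integral_dyadic:
 assumes x: "x \<in> theta_dom A j" and t: "t = real p / 2 ^ m"
 shows "\<langle>u, P t x v\<rangle> - \<langle>u, x v\<rangle> = integral {0..t} (%s. \<langle>u, P s (gen x) v\<rangle>)"
proof -
 note xA = theta_limit(1)[OF x]
 have t0: "0 <= t" using t by simp
 let ?b = "%M. rateS (1 / 2 ^ M) x" and ?C = "\<langle>u, P t x v\<rangle> - \<langle>u, x v\<rangle>"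
 have bA: "?b M \<in> A" for M by (rule rateS_in[OF _ xA]) simp
 obtain K where K: "0 <= K" "!!M. onorm (?b M) <= K" using rateS_bounded[OF x] by blast
 have bound: "cmod \<langle>u, P s (?b M) v\<rangle> <= norm u * (exp (rate * t) * K * norm v)" if "s \<in> {0..t}" for s M
 proof -
  have "norm (P s (?b M) v) <= exp (rate * t) * onorm (?b M) * norm v" by (rule P_bound[OF _ _ bA]) (use that in auto)
  also have "\<dots> <= exp (rate * t) * K * norm v" using K(2) by (intro mult_right_mono mult_left_mono) auto
  finally show ?thesis by (intro order_trans[OF cinner_CS mult_left_mono]) auto
 qed
 have "(%M. integral {0..t} (%s. \<langle>u, P s (?b M) v\<rangle>)) \<longlonglongrightarrow> integral {0..t} (%s. \<langle>u, P s (gen x) v\<rangle>)"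
 proof (rule dominated_convergence(2)[OF _ _ bound])
  show "(%s. \<langle>u, P s (?b M) v\<rangle>) integrable_on {0..t}" for M
   by (rule integrable_continuous_real[OF continuous_on_subset[OF P_form_continuous[OF bA]]]) auto
  fix s assume "s \<in> {0..t}"
  then have s: "0 <= s" by simp
  show "(%M. \<langle>u, P s (?b M) v\<rangle>) \<longlonglongrightarrow> \<langle>u, P s (gen x) v\<rangle>"
   unfolding cinner_P[OF s]
   by (rule j_weak_limit[OF s _ gen_in[OF x] rateS_limit[OF x]])
     (use bA order_trans[OF bops_onorm[OF A_bops[OF bA]] mult_right_mono[OF K(2)]] in \<open>auto intro!: always_eventually\<close>)
 qed auto
 moreover have "(%M. integral {0..t} (%s. \<langle>u, P s (?b M) v\<rangle>)) \<longlonglongrightarrow> ?C"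
 proof (rule LIMSEQ_I)
  fix e :: real assume e: "0 < e"
  \<comment> \<open>The increment over \<open>[s, s + t]\<close>; averaging uses starting points
    \<open>s\<close> up to one step, and by continuity it stays close to the increment from
    0.\<close>
  let ?D = "%s. \<langle>u, P (s + t) x v\<rangle> - \<langle>u, P s x v\<rangle>"
  have "((%s. ?D s) \<longlongrightarrow> \<langle>u, P (0 + t) x v\<rangle> - \<langle>u, P 0 x v\<rangle>) (at 0 within {0..})"
   by (intro tendsto_diff P_tendsto[OF xA] tendsto_add tendsto_ident_at tendsto_const) (use t0 in \<open>auto simp: eventually_at intro: exI[of _ 1]\<close>)
  then have "(?D \<longlongrightarrow> ?C) (at 0 within {0..})" by (simp add: P_0[OF xA])
  from tendstoD[OF this, of "e / 3"] e obtain d where d: "0 < d" "!!s. 0 < s ==> s < d ==> dist (?D s) ?C < e / 3"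
   by (auto simp: eventually_at)
  have dD: "cmod (?D s - ?C) <= e / 3" if "0 <= s" "s < d" for s
  proof (cases "s = 0")
   case False then show ?thesis using d(2)[of s] that by (simp add: dist_norm)
  qed (use e P_0[OF xA] in simp)
  obtain N where N: "\<forall>M\<ge>N. \<forall>n. \<forall>s\<ge>0. s + real n * (1 / 2 ^ M) <= t + 1 \<longrightarrow> cmod (defect x u v M n s) <= e / 3"
   using defect_vanishes[OF x add_nonneg_nonneg[OF t0 zero_le_one] divide_pos_pos[OF e zero_less_numeral]] by blast
  obtain N' where N': "(1 / 2) ^ N' < d" using real_arch_pow_inv[OF d(1), of "1 / 2"] by auto
  show "\<exists>N. \<forall>M\<ge>N. norm (integral {0..t} (%s. \<langle>u, P s (?b M) v\<rangle>) - ?C) < e"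
  proof (intro exI[of _ "max m (max N N')"] allI impI)
   fix M assume M: "max m (max N N') <= M"
   let ?h = "1 / 2 ^ M :: real" and ?n = "p * 2 ^ (M - m)"
   have "real (p * 2 ^ (M - m)) * ?h = t" unfolding t of_nat_mult using D1.S.real_power_diff[of m M] M by simp
   then have nh: "real ?n * ?h = t" .
   have hd: "?h < d"
   proof -
    have "(1 / 2 :: real) ^ M <= (1 / 2) ^ N'" by (rule power_decreasing) (use M in auto)
    then show ?thesis using N' by (simp add: power_one_over)
   qed
   have h1: "?h <= 1" by simp
   have "norm (?C - integral {0..real ?n * ?h} (%s. \<langle>u, P s (?b M) v\<rangle>)) <= 2 * e / 3"
   proof (rule integral_average_bound[OF _ P_form_continuous[OF bA]])
    fix s assume s: "0 <= s" "s <= ?h"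
    let ?\<Sigma> = "complex_of_real ?h * (\<Sum>i<?n. \<langle>u, P (s + real i * ?h) (?b M) v\<rangle>)"
    have "cmod (defect x u v M ?n s) <= e / 3"
     using N[rule_format, of M s ?n, unfolded nh] M s h1 by simp
    then have "cmod (?D s - ?\<Sigma>) <= e / 3" unfolding defect_def nh .
    moreover have "cmod (?D s - ?C) <= e / 3" by (rule dD) (use s hd in auto)
    moreover have "?C - ?\<Sigma> = (?D s - ?\<Sigma>) - (?D s - ?C)" by (simp add: algebra_simps)
    ultimately show "cmod (?C - ?\<Sigma>) <= 2 * e / 3"
     using norm_triangle_ineq4[of "?D s - ?\<Sigma>" "?D s - ?C"] by (simp only:)
   qed simp
   then show "norm (integral {0..t} (%s. \<langle>u, P s (?b M) v\<rangle>) - ?C) < e"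
    unfolding nh norm_minus_commute[of ?C] using e by linarith
  qed
 qed
 ultimately show ?thesis by (rule LIMSEQ_unique[symmetric, THEN sym, rotated])
qed

lemma P_integral:
 assumes x: "x \<in> theta_dom A j" and t: "0 <= t"
 shows "\<langle>u, P t x v\<rangle> - \<langle>u, x v\<rangle> = integral {0..t} (%s. \<langle>u, P s (gen x) v\<rangle>)"
proof (rule LIMSEQ_unique)
 note xA = theta_limit(1)[OF x]
 let ?\<tau> = "%M. real (nat \<lfloor>t * 2 ^ M\<rfloor>) * (1 / 2 ^ M)"
 have le: "?\<tau> M <= t" for M by (rule D1.S.idx_time(1)[OF t])
 show "(%M. \<langle>u, P (?\<tau> M) x v\<rangle> - \<langle>u, x v\<rangle>) \<longlonglongrightarrow> \<langle>u, P t x v\<rangle> - \<langle>u, x v\<rangle>"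
  by (intro tendsto_diff tendsto_const P_tendsto[OF xA _ dyadic_floor_tendsto[OF t] t]) simp
 have "\<langle>u, P (?\<tau> M) x v\<rangle> - \<langle>u, x v\<rangle> = integral {0..?\<tau> M} (%s. \<langle>u, P s (gen x) v\<rangle>)" for M
  by (rule P_integral_dyadic[OF x, of _ "nat \<lfloor>t * 2 ^ M\<rfloor>" M]) simp
 moreover have "continuous_on {0..t} (%r. integral {0..r} (%s. \<langle>u, P s (gen x) v\<rangle>))"
  by (rule indefinite_integral_continuous_1[OF integrable_continuous_real[OF continuous_on_subset[OF P_form_continuous[OF gen_in[OF x]]]]]) auto
 from continuous_on_tendsto_compose[OF this dyadic_floor_tendsto[OF t]] le t
 have "(%M. integral {0..?\<tau> M} (%s. \<langle>u, P s (gen x) v\<rangle>)) \<longlonglongrightarrow> integral {0..t} (%s. \<langle>u, P s (gen x) v\<rangle>)" by simp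
 ultimately show "(%M. \<langle>u, P (?\<tau> M) x v\<rangle> - \<langle>u, x v\<rangle>) \<longlonglongrightarrow> integral {0..t} (%s. \<langle>u, P s (gen x) v\<rangle>)" by simp
qed

text \<open>By the integral formula the difference quotient is the average of
  \<open>P s (gen x)\<close> over \<open>[0, t]\<close>: bounded uniformly and weakly convergent,
  hence ultraweakly convergent.\<close>

lemma P_generator:
 assumes x: "x \<in> theta_dom A j" shows "weak_generator A P x (gen x)"
 unfolding weak_generator_def
proof (intro conjI theta_limit(1)[OF x] gen_in[OF x])
 note xA = theta_limit(1)[OF x] and gA = gen_in[OF x]
 let ?q = "%t u. (1 / t) *\<^sub>R (P t x u - x u)"
 have form: "\<langle>u, ?q t v\<rangle> = complex_of_real (1 / t) * integral {0..t} (%s. \<langle>u, P s (gen x) v\<rangle>)" if "0 < t" for u v t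
  using P_integral[OF x, of t u v] that by (simp add: cinner_scaleR_right cinner_diff_right)
 have psi: "continuous_on {0..t} (%s. \<langle>u, P s (gen x) v\<rangle>)" for u v t
  by (rule continuous_on_subset[OF P_form_continuous[OF gA]]) auto
 have ev: "\<forall>\<^sub>F t in at_right (0::real). 0 < t \<and> t < d" if "0 < d" for d
  using that by (auto simp: eventually_at_right_field)
 show "limitin uw_topology ?q (gen x) (at_right 0)"
 proof (rule limitin_uwI[OF _ A_bops[OF gA]])
  have oK: "0 <= exp (rate * 1) * onorm (gen x)" using onorm_ge0[OF A_bops[OF gA]] by simp
  show "\<forall>\<^sub>F t in at_right 0. ?q t \<in> bops \<and> (\<forall>v. norm (?q t v) <= exp (rate * 1) * onorm (gen x) * norm v)"
   using ev[OF zero_less_one]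
  proof (eventually_elim, intro conjI allI operator_bound_of_form[OF oK])
   fix t :: real assume t: "0 < t \<and> t < 1"
   show "?q t \<in> bops" by (intro A_bops A_rscale A_diff P_in xA) (use t in simp)
   fix u v
   have "norm (integral {0..t} (%s. \<langle>u, P s (gen x) v\<rangle>)) <= (norm u * (exp (rate * 1) * onorm (gen x) * norm v)) * (t - 0)"
    by (rule integral_bound[OF _ psi]) (use t P_bound[where T = 1, OF _ _ gA] in \<open>auto intro!: order_trans[OF cinner_CS mult_left_mono]\<close>)
   then show "cmod \<langle>u, ?q t v\<rangle> <= exp (rate * 1) * onorm (gen x) * norm u * norm v"
    unfolding form[OF conjunct1[OF t]] using t by (simp add: norm_mult norm_divide field_simps)
  qed
  fix u v
  show "((%t. \<langle>u, ?q t v\<rangle>) \<longlongrightarrow> \<langle>u, gen x v\<rangle>) (at_right 0)"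
  proof (rule tendstoI)
   fix e :: real assume e: "0 < e"
   have "\<exists>d>0. \<forall>s\<in>{0..}. dist s 0 < d \<longrightarrow> dist \<langle>u, P s (gen x) v\<rangle> \<langle>u, P 0 (gen x) v\<rangle> < e / 2"
    using P_form_continuous[OF gA, of u v, unfolded continuous_on_iff, THEN bspec[of _ _ 0], THEN spec[of _ "e / 2"]] e by simp
   then obtain d where d: "0 < d" "!!s. 0 <= s ==> s < d ==> cmod (\<langle>u, P s (gen x) v\<rangle> - \<langle>u, gen x v\<rangle>) < e / 2"
    by (auto simp: dist_norm P_0[OF gA])
   show "\<forall>\<^sub>F t in at_right 0. dist \<langle>u, ?q t v\<rangle> \<langle>u, gen x v\<rangle> < e"
    using ev[OF d(1)]
   proof eventually_elim
    case (elim t)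
    have "norm (integral {0..t} (%s. \<langle>u, P s (gen x) v\<rangle> - \<langle>u, gen x v\<rangle>)) <= (e / 2) * (t - 0)"
     by (rule integral_bound) (use elim d(2) in \<open>auto intro!: continuous_on_diff psi continuous_on_const less_imp_le\<close>)
    also have "integral {0..t} (%s. \<langle>u, P s (gen x) v\<rangle> - \<langle>u, gen x v\<rangle>) = complex_of_real t * (\<langle>u, ?q t v\<rangle> - \<langle>u, gen x v\<rangle>)"
     using elim by (subst Henstock_Kurzweil_Integration.integral_diff)
      (auto intro!: integrable_continuous_real psi simp: form scaleR_conv_of_real right_diff_distrib)
    finally show ?case using elim e by (simp add: norm_mult dist_norm)
   qed
  qed
 qed
qed

text \<open>A unital flow gives theta the value 0 at the identity, so \<open>gen\<close> there
  reduces to the expression assumed to vanish, and the integral formula makes \<open>P t\<close>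
  constant on the identity.\<close>

lemma P_unital:
 assumes "(%u. adj k1 u + adj l1 (l2 u) + k2 u) = (%u. 0)"
 shows "unital_semigroup P"
proof -
 let ?I = "%u. u :: 'h"
 have "theta_t j h ?I = (%_. 0)" if "0 < h" for h
  using that by (intro bops_ext) (simp add: cinner_theta_t normal_rep.J_id[OF j_rep])
 then have lim: "limitin uw_topology (%t. theta_t j t ?I) (%_. 0) (at_right 0)"
  by (intro limitin_eventually) (auto intro: eventually_mono[OF eventually_at_right_less])
 then have x: "?I \<in> theta_dom A j" using A_id by (auto simp: theta_dom_def)
 have "theta j ?I = (%_. 0)" by (rule limitin_uw_unique[OF theta_limit(2)[OF x] lim]) simp
 have g: "gen ?I = (%_. 0)"
 proof (rule bops_ext)
  fix u v
  have "\<langle>u, gen ?I v\<rangle> = \<langle>u, adj k1 v + adj l1 (l2 v) + k2 v\<rangle>"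
   by (simp add: cinner_gen[OF x] \<open>theta j ?I = (%_. 0)\<close> cinner_add_right adj_cinner' l_bops)
  then show "\<langle>u, gen ?I v\<rangle> = \<langle>u, 0\<rangle>" using fun_cong[OF assms, of v] by simp
 qed
 have "P t ?I v = v" if "0 <= t" for t v
 proof (rule cinner_ext)
  fix u
  have "integral {0..t} (%s. \<langle>u, P s (%_. 0) v\<rangle>) = integral {0..t} (%s. 0)"
   by (intro Henstock_Kurzweil_Integration.integral_cong) (simp add: cinner_P normal_rep.J_zero[OF j_rep])
  then show "\<langle>u, P t ?I v\<rangle> = \<langle>u, v\<rangle>" using P_integral[OF x that, of u v] unfolding g by simp
 qed
 then show ?thesis by (auto simp: unital_semigroup_def)
qed

end

theorem theorem8p1:
  fixes A :: "('h::chilbert \<Rightarrow> 'h) set"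
    and P0 :: "real \<Rightarrow> ('h \<Rightarrow> 'h) \<Rightarrow> ('h \<Rightarrow> 'h)"
    and j :: "('h, 'k::chilbert) map_process"
    and l1 l2 :: "'h \<Rightarrow> ('k, 'h) tensor"
    and k1 k2 :: "'h \<Rightarrow> 'h"
  assumes "von_neumann_algebra A"
    and "markov_semigroup A P0"
    and "qs_flow A j"
    and "\<forall>t\<ge>0. \<forall>a\<in>A. P0 t a = vacuum_expectation (j t a)"
    and "l1 \<in> ket_uw_tensor A" and "l2 \<in> ket_uw_tensor A"
    and "k1 \<in> A" and "k2 \<in> A"
  shows "(\<forall>x\<in>theta_dom A j. weak_generator A P0 x (theta_L j x)) \<and>
    (\<exists>P. normal_semigroup A P \<and> completely_quasicontractive A P \<and>
      (\<forall>x\<in>theta_dom A j. weak_generator A P x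
         (\<lambda>u. theta_L j x u + adj l1 (theta_delta j x u) + adj l1 (theta_pi j x (l2 u))
            + theta_delta_dag j x (l2 u) + adj k1 (x u) + x (k2 u))) \<and>
      (positive_op (\<lambda>u. - (adj k1 u + k1 u + adj l1 (l1 u))) \<and>
       positive_op (\<lambda>u. - (adj k2 u + k2 u + adj l2 (l2 u))) \<longrightarrow> contractive_semigroup A P) \<and>
      ((\<lambda>u. adj k1 u + adj l1 (l2 u) + k2 u) = (\<lambda>u. 0) \<longrightarrow> unital_semigroup P) \<and>
      (l1 = l2 \<and> k1 = k2 \<longrightarrow> cp_semigroup A P))"
proof -
 interpret perturbation A j k1 k2 l1 l2
  by unfold_locales (use assms in auto)
 have P0A: "\<forall>t\<ge>0. \<forall>a\<in>A. P0 t a \<in> A"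
 proof (intro allI impI ballI)
  fix t :: real and a assume t: "0 <= t" and a: "a \<in> A"
  have "continuous_map (subtopology uw_topology A) (subtopology uw_topology A) (P0 t)"
   using assms(2) t by (auto simp: markov_semigroup_def normal_semigroup_def normal_map_def)
  then have "P0 t \<in> topspace (subtopology uw_topology A) \<rightarrow> topspace (subtopology uw_topology A)"
   by (rule continuous_map_funspace)
  then show "P0 t a \<in> A" using a A_bops[OF a] by auto
 qed
 \<comment> \<open>The operator inequality of (a), evaluated as a quadratic form, is the growth
   condition with constant 0.\<close>
 have dissipative: "2 * Re \<langle>u, k u\<rangle> + (norm (l u))\<^sup>2 <= 0 * (norm u)\<^sup>2"
  if "k \<in> bops" "l \<in> bops" "positive_op (%u. - (adj k u + k u + adj l (l u)))" for k and l :: "'h => ('k, 'h) tensor" and u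
 proof -
  have "\<langle>u, - (adj k u + k u + adj l (l u))\<rangle> \<in> \<real>\<^sub>\<ge>\<^sub>0" using that(3) unfolding positive_op_def by blast
  then have "0 <= Re \<langle>u, - (adj k u + k u + adj l (l u))\<rangle>" by (simp only: complex_nonneg_Reals_iff)
  moreover have "Re \<langle>k u, u\<rangle> = Re \<langle>u, k u\<rangle>" by (simp add: Re_cinner inner_commute)
  ultimately show ?thesis
   by (simp add: cinner_minus_right cinner_diff_right adj_cinner' that Re_cinner_self)
 qed
 show ?thesis
 proof (intro conjI exI[of _ P] ballI impI)
  show "weak_generator A P0 x (theta_L j x)" if "x \<in> theta_dom A j" for x
   by (rule expectation_generator[OF assms(4) P0A that])
  show "contractive_semigroup A P" if "positive_op (%u. - (adj k1 u + k1 u + adj l1 (l1 u))) \<and> positive_op (%u. - (adj k2 u + k2 u + adj l2 (l2 u)))"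
   by (rule P_contractive) (use dissipative l_bops that in \<open>auto simp: D1.growth_def D2.growth_def\<close>)
  show "weak_generator A P x (%u. theta_L j x u + adj l1 (theta_delta j x u) + adj l1 (theta_pi j x (l2 u))
      + theta_delta_dag j x (l2 u) + adj k1 (x u) + x (k2 u))" if "x \<in> theta_dom A j" for x
   using P_generator[OF that] unfolding gen_def .
 qed (use P_normal_semigroup P_completely_quasicontractive P_unital P_completely_positive in auto)
qed

end
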